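(* Let $\mu$ be a measure on $\mathbb{R}$ such that $\mathsf{p}(\mu)<\infty$ and set $\kappa:=\kappa(\mu)$. Let $p\in\mathbb{R}[z]$, $p(z)=c_{2\kappa+1}z^{2\kappa+1}+\ldots+c_0$, be such that $(\mu,p)\in\mathbb{E}_{\le\kappa}$ and $c_{2\kappa+1}=\int_{\mathbb{R}}(1+t^2)^{-(\kappa+1)}d\mu(t)$, and set $q:=\mathscr{C}_\kappa[\mu,p]$. Let $\beta\in2\mathbb{N}-1$. Then the following statements are true. (i) Assume that $\mu=\mu_0+\mu_1+\mu_2$ with measures $\mu_0,\mu_1,\mu_2$ on $\mathbb{R}$ such that the following conditions are satisfied: (a) $\mu_0$ is symmetric and $t\mapsto\mu_0((-t,t))$ is regularly varying with index $\beta$; (b) either $\mu_1([0,\infty))=0$ or $t\mapsto\mu_1([0,t))$ is regularly varying with index $\beta$; and either $\mu_1((-\infty,0))=0$ or $t\mapsto\mu_1((-t,0))$ is regularly varying with index $\beta$; (c) $\mu_2((-t,t))\lesssim t^\gamma$ as $t\to\infty$ with some $\gamma<\beta$; (d) if $\int_{\mathbb{R}}(1+|t|)^{-\beta}d\mu_1(t)<\infty$, then $c_{2\kappa}=\int_{\mathbb{R}}\frac{t}{(1+t^2)^{\kappa+1}}\,d(\mu_1+\mu_2)(t)$; (e) the following two limits (for $+$ and $-$) exist in $\mathbb{R}$: $$\eta_\pm:=\begin{cases}\displaystyle\lim_{t\to\infty}\biggl(\int_1^t\frac{\mu_1^\pm((-s,s))}{s^{\beta+1}}\,ds\bigg/\frac{\mu_0((-t,t))}{t^\beta}\biggr)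 & \text{if}\ \int_{\mathbb{R}}\frac{d\mu_1(t)}{(1+|t|)^\beta}=\infty,\\[3ex] \displaystyle-\lim_{t\to\infty}\biggl(\int_t^\infty\frac{\mu_1^\pm((-s,s))}{s^{\beta+1}}\,ds\bigg/\frac{\mu_0((-t,t))}{t^\beta}\biggr) & \text{if}\ \int_{\mathbb{R}}\frac{d\mu_1(t)}{(1+|t|)^\beta}<\infty.\end{cases}$$ Then $\mu((-t,t))\sim\mu_0((-t,t))$ as $t\to\infty$, $\beta=2\kappa+1$, and $$\lim_{r\to\infty}\frac{q(rz)}{f(r)}=i\omega\Bigl(\frac{z}{i}\Bigr)^{\beta-1}\qquad(\ast)$$ holds locally uniformly for $z\in\mathbb{C}^+$ with $$f(r)=\beta\,\frac{\mu((-r,r))}{r},\qquad \omega=(-1)^\kappa\Bigl(\frac{\pi}{2}+i(\eta_+-\eta_-)\Bigr).\qquad(\ast\ast)$$ (ii) Assume that there exist a regularly varying function $f:[x_0,\infty)\to(0,\infty)$ with $x_0>0$ and a constant $\omega\in\mathbb{C}\setminus i\mathbb{R}$ such that $(\ast)$ holds locally uniformly for $z\in\mathbb{C}^+$. Then $t\mapsto\mu((-t,t))$ is regularly varying with index $\beta$ and $$\lim_{t\to\infty}\frac{\mu((-t,0))}{\mu([0,t))}=1.$$ One can choose $f(r)=\beta\frac{\mu((-r,r))}{r}$ in $(\ast)$, in which case $\omega$ satisfies $\operatorname{Re}\omega=(-1)^\kappa\frac{\pi}{2}$.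
   Context: "Measure" means positive Borel measure; $\mathbb{N}=\{1,2,\ldots\}$, $\mathbb{N}_0=\mathbb{N}\cup\{0\}$; $\mathbb{C}^+=\{z\in\mathbb{C}:\operatorname{Im}z>0\}$. Complex powers are taken with the branch analytic on $\mathbb{C}\setminus(-\infty,0]$ with value $1$ at $1$. $f\sim g$ means $f/g\to1$; $f\lesssim g$ means $f\le cg$ for some constant $c>0$ (here for large $t$). For a measure $\mu$ on $\mathbb{R}$ set $$\mathsf{p}(\mu):=\inf\Bigl\{n\in\mathbb{N}:\int_{\mathbb{R}}\frac{d\mu(t)}{(1+|t|)^n}<\infty\Bigr\}\in\mathbb{N}\cup\{\infty\},\qquad \kappa(\mu):=\inf\Bigl\{n\in\mathbb{N}_0:\int_{\mathbb{R}}\frac{d\mu(t)}{(1+|t|)^{2n+2}}<\infty\Bigr\}.$$ For $\kappa\in\mathbb{N}_0$ let $\mathbb{E}_{\le\kappa}$ be the set of all pairs $(\mu,p)$ where $\mu$ is a measure on $\mathbb{R}$ with $\int_{\mathbb{R}}(1+t^2)^{-\kappa-1}d\mu(t)<\infty$, and $p$ is a polynomial with real coefficients of degree at most $2\kappa+1$ whose coefficient of $z^{2\kappa+1}$ satisfies $\frac{1}{(2\kappa+1)!}p^{(2\kappa+1)}(0)\ge\int_{\mathbb{R}}(1+t^2)^{-\kappa-1}d\mu(t)$. For $(\mu,p)\in\mathbb{E}_{\le\kappa}$ set $$\mathscr{C}_\kappa[\mu,p](z):=p(z)+(1+z^2)^{\kappa+1}\int_{\mathbb{R}}\frac{1}{t-z}\cdot\frac{d\mu(t)}{(1+t^2)^{\kappa+1}},\qquad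 z\in\mathbb{C}^+.$$ For a measure $\mu_1$ on $\mathbb{R}$ the measures $\mu_1^{\pm}$ are the restrictions $d\mu_1^+(t)=\mathbf{1}_{[0,\infty)}(t)\,d\mu_1(t)$ and $d\mu_1^-(t)=\mathbf{1}_{(-\infty,0)}(t)\,d\mu_1(t)$. A measurable function $f:[x_0,\infty)\to(0,\infty)$ with $x_0>0$ is regularly varying with index $\alpha\in\mathbb{R}$ if $\lim_{r\to\infty}f(\lambda r)/f(r)=\lambda^\alpha$ for all $\lambda>0$; a function that is positive only for large arguments is called regularly varying if its restriction to some $[x_0,\infty)$ is. *)

theory Defs
  imports "HOL-Analysis.Analysis" "HOL-Library.Landau_Symbols"
begin

definition borel_measure :: "real measure \<Rightarrow> bool" where
  "borel_measure \<mu> \<longleftrightarrow> sets \<mu> = sets borel"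

definition measure_sum :: "'a measure \<Rightarrow> 'a measure \<Rightarrow> 'a measure" where
  "measure_sum M N = measure_of (space M) (sets M) (\<lambda>A. emeasure M A + emeasure N A)"

lemma space_measure_sum [simp]: "space (measure_sum M N) = space M"
  by (simp add: measure_sum_def)

lemma sets_measure_sum [simp, measurable_cong]: "sets (measure_sum M N) = sets M"
  by (simp add: measure_sum_def)

lemma emeasure_measure_sum:
  assumes sets_eq: "sets M = sets N" and A: "A \<in> sets M"
  shows "emeasure (measure_sum M N) A = emeasure M A + emeasure N A"
proof (rule emeasure_measure_of[OF measure_sum_def])
  show "sets M \<subseteq> Pow (space M)"
    by (rule sets.space_closed)
  show "positive (sets (measure_sum M N)) (\<lambda>A. emeasure M A + emeasure N A)"
    by (simp add: positive_def)
  show "countably_additive (sets (measure_sum M N)) (\<lambda>A. emeasure M A + emeasure N A)"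
  proof (rule countably_additiveI)
    fix F :: "nat \<Rightarrow> 'a set"
    assume F: "range F \<subseteq> sets (measure_sum M N)" "disjoint_family F"
    then have "(\<Sum>i. emeasure M (F i) + emeasure N (F i))
        = (\<Sum>i. emeasure M (F i)) + (\<Sum>i. emeasure N (F i))"
      by (intro suminf_add[symmetric]) auto
    also have "\<dots> = emeasure M (\<Union>i. F i) + emeasure N (\<Union>i. F i)"
      using F sets_eq by (simp add: suminf_emeasure)
    finally show "(\<Sum>i. emeasure M (F i) + emeasure N (F i))
        = emeasure M (\<Union>i. F i) + emeasure N (\<Union>i. F i)" .
  qed
  show "A \<in> sets (measure_sum M N)"
    using A by simp
qed

definition symmetric_measure :: "real measure \<Rightarrow> bool" where
  "symmetric_measure \<mu> \<longleftrightarrow> (\<forall>A\<in>sets borel. emeasure \<mu> (uminus ` A) = emeasure \<mu> A)"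

definition pos_part :: "real measure \<Rightarrow> real measure" where
  "pos_part \<mu> = density \<mu> (indicator {0..})"

definition neg_part :: "real measure \<Rightarrow> real measure" where
  "neg_part \<mu> = density \<mu> (indicator {..<0})"

text \<open>The two growth indices are extended naturals; the infimum of the empty set is \<open>\<infinity>\<close>.\<close>

definition p_index :: "real measure \<Rightarrow> enat" where
  "p_index \<mu> = Inf {enat n | n. n \<ge> 1 \<and> (\<integral>\<^sup>+ t. ennreal (1 / (1 + \<bar>t\<bar>) ^ n) \<partial>\<mu>) < \<infinity>}"

definition kappa_index :: "real measure \<Rightarrow> enat" where
  "kappa_index \<mu> =
     Inf {enat n | n. (\<integral>\<^sup>+ t. ennreal (1 / (1 + \<bar>t\<bar>) ^ (2 * n + 2)) \<partial>\<mu>) < \<infinity>}"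

definition E_le :: "nat \<Rightarrow> (real measure \<times> real poly) set" where
  "E_le \<kappa> = {(\<mu>, p). borel_measure \<mu>
     \<and> (\<integral>\<^sup>+ t. ennreal (1 / (1 + t\<^sup>2) ^ (\<kappa> + 1)) \<partial>\<mu>) < \<infinity>
     \<and> degree p \<le> 2 * \<kappa> + 1
     \<and> coeff p (2 * \<kappa> + 1) \<ge> (\<integral>t. 1 / (1 + t\<^sup>2) ^ (\<kappa> + 1) \<partial>\<mu>)}"

definition upper_half_plane :: "complex set" where
  "upper_half_plane = {z. Im z > 0}"

text \<open>Only the values on the upper half-plane are meaningful; there the integrand is integrable
  whenever \<open>(\<mu>, p) \<in> E_le \<kappa>\<close>.\<close>

definition C_transform :: "nat \<Rightarrow> real measure \<Rightarrow> real poly \<Rightarrow> complex \<Rightarrow> complex" where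
  "C_transform \<kappa> \<mu> p z =
     poly (map_poly complex_of_real p) z
     + (1 + z\<^sup>2) ^ (\<kappa> + 1)
       * (\<integral>t. 1 / (complex_of_real t - z) * complex_of_real (1 / (1 + t\<^sup>2) ^ (\<kappa> + 1)) \<partial>\<mu>)"

text \<open>Only the restriction of \<open>f\<close> to some half-line \<open>[x\<^sub>0, \<infinity>)\<close> matters.\<close>

definition regularly_varying :: "(real \<Rightarrow> real) \<Rightarrow> real \<Rightarrow> bool" where
  "regularly_varying f \<alpha> \<longleftrightarrow>
     (\<exists>x\<^sub>0>0. f \<in> borel_measurable (restrict_space borel {x\<^sub>0..}) \<and> (\<forall>x\<ge>x\<^sub>0. f x > 0))
     \<and> (\<forall>c>0. ((\<lambda>r. f (c * r) / f r) \<longlongrightarrow> c powr \<alpha>) at_top)"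

definition locally_uniform_limit ::
    "complex set \<Rightarrow> (real \<Rightarrow> complex \<Rightarrow> complex) \<Rightarrow> (complex \<Rightarrow> complex) \<Rightarrow> real filter \<Rightarrow> bool" where
  "locally_uniform_limit S F l net \<longleftrightarrow>
     (\<forall>z\<in>S. \<exists>d>0. cball z d \<subseteq> S \<and> uniform_limit (cball z d) F l net)"

text \<open>The limit relation
  \<open>q (r z) / f r \<longrightarrow> \<i> \<omega> (z / \<i>)\<^bsup>\<beta> - 1\<^esup>\<close>, locally uniformly on the upper half-plane. The exponent is a
  natural number, so no branch of the power has to be chosen.\<close>

definition rescaling_limit ::
    "nat \<Rightarrow> (complex \<Rightarrow> complex) \<Rightarrow> (real \<Rightarrow> real) \<Rightarrow> complex \<Rightarrow> bool" where
  "rescaling_limit \<beta> q f \<omega> \<longleftrightarrow>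
     locally_uniform_limit upper_half_plane
       (\<lambda>r z. q (complex_of_real r * z) / complex_of_real (f r))
       (\<lambda>z. \<i> * \<omega> * (z / \<i>) ^ (\<beta> - 1)) at_top"

text \<open>The expression whose limit for \<open>t \<rightarrow> \<infinity>\<close> is \<open>\<eta>\<^sub>+\<close> (with \<open>\<nu> = pos_part \<mu>\<^sub>1\<close>) or \<open>\<eta>\<^sub>-\<close>
  (with \<open>\<nu> = neg_part \<mu>\<^sub>1\<close>). In both cases the case distinction is on the whole of \<open>\<mu>\<^sub>1\<close>.\<close>

definition eta_quotient ::
    "nat \<Rightarrow> real measure \<Rightarrow> real measure \<Rightarrow> real measure \<Rightarrow> real \<Rightarrow> real" where
  "eta_quotient \<beta> \<mu>\<^sub>0 \<mu>\<^sub>1 \<nu> t =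
     (if (\<integral>\<^sup>+ s. ennreal (1 / (1 + \<bar>s\<bar>) ^ \<beta>) \<partial>\<mu>\<^sub>1) = \<infinity>
      then (LINT s:{1..t}|lborel. measure \<nu> {-s<..<s} / s ^ (\<beta> + 1))
             / (measure \<mu>\<^sub>0 {-t<..<t} / t ^ \<beta>)
      else - ((LINT s:{t..}|lborel. measure \<nu> {-s<..<s} / s ^ (\<beta> + 1))
             / (measure \<mu>\<^sub>0 {-t<..<t} / t ^ \<beta>)))"

end

theory Submission
  imports Defs
begin

text \<open>
  Part (ii) is Tauberian. On the imaginary axis, the divided differences in \<open>v\<close> of
  \<open>Im (q (i \<surd>v)) / \<surd>v\<close> and of \<open>Re (q (i \<surd>v))\<close> do not see the polynomial part, and the integral part
  turns into \<open>\<integral> 1 / \<Prod>\<^sub>j (t\<^sup>2 + u\<^sub>j)\<close> and its odd analogue \<open>\<integral> t / \<Prod>\<^sub>j (t\<^sup>2 + u\<^sub>j)\<close>. So the limit of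
  \<open>q (r z) / f r\<close> determines these integrals in the limit for the rescaled measures \<open>\<mu> (r dt) / (r f r)\<close>. Letting
  the nodes coalesce gives all large powers of \<open>1 / (1 + t\<^sup>2)\<close>, and Weierstrass approximation in
  that variable, as in Karamata's proof, gives the mass of intervals and the balance of the two sides.

  Part (i) is Abelian. Integrating by parts expresses \<open>q\<close> through the truncated moments
  \<open>U u = \<integral>\<^bsub>|s|<u\<^esub> s\<^sup>2 w\<close> and \<open>F u = \<integral>\<^bsub>|s|<u\<^esub> s w - c\<^bsub>2\<kappa>\<^esub>\<close>, where \<open>w = (1 + s\<^sup>2)\<^sup>-\<^sup>\<kappa>\<^sup>-\<^sup>1\<close>; both integrals are
  better behaved than the Cauchy kernel, whose odd part only converges conditionally. By Karamata's
  theorem \<open>U u\<close> is comparable to \<open>u \<ell> u\<close> with \<open>\<ell> t = \<mu> (-t, t) / t\<^sup>\<beta>\<close> slowly varying, the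
  symmetric part cancels in \<open>F\<close>, and (e) says exactly that \<open>F / \<ell>\<close> converges. That \<open>\<mu>\<^sub>1\<close> is
  negligible follows from (e) as well: the increment of the integral over \<open>[t, 2t]\<close> dominates
  \<open>\<mu>\<^sub>1 (-t, t) / t\<^sup>\<beta>\<close>, whereas slow variation makes it \<open>o (\<ell> t)\<close>.
\<close>

section \<open>Divided differences of Stieltjes kernels\<close>

text \<open>Differencing lets (ii) start without any relation between \<beta> and \<kappa>: with
  enough nodes it removes two polynomials at once, the one inside \<open>q\<close> and the term with
  \<open>Im \<omega>\<close>, which on the axis is a multiple of \<open>v ^ n\<close> for \<beta> =
  2n + 1. Hence only \<open>Re \<omega>\<close> governs the measure, and only
  \<open>Re \<omega>\<close> gets normalised. The prefactor of the Cauchy integral, evaluated at the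
  pole, cancels the weight exactly, so that \<mu> itself remains. The equality \<beta> = 2\<kappa> +
  1 is a matter of growth: a mass function of index 2k + 1 forces \<open>kappa_index\<close> to be
  k.

  For (i) the kernel splits as
  \<open>1/(s - z) = - 1/z + (1/z) s^2/(s^2 - z^2) + s/(s^2 - z^2)\<close>. The prescribed leading
  coefficient of \<open>p\<close> cancels the first term to top order, the next coefficient is
  absorbed into \<open>F\<close>, and the rest of \<open>p\<close> is of lower order. The even
  layers produce pi/2, the odd ones the difference of the two \<eta>. Local uniformity is reached by
  letting z move along a sequence, so that sequential dominated convergence with a majorant uniform
  in z suffices.\<close>

text \<open>The opposite sign of the usual divided difference makes \<open>1 / (\<tau> + v)\<close> go to a positive product.\<close>

fun divdiff :: "real list \<Rightarrow> (real \<Rightarrow> real) \<Rightarrow> real \<Rightarrow> real" where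
  "divdiff [] G s = G s"
| "divdiff (u # us) G s = divdiff us (\<lambda>v. (G v - G u) / (u - v)) s"

lemma divdiff_cong:
  assumes "\<And>v. v \<in> insert s (set us) \<Longrightarrow> G v = H v"
  shows "divdiff us G s = divdiff us H s"
  using assms
proof (induction us arbitrary: G H)
  case (Cons u us)
  show ?case using Cons.prems by (auto intro!: Cons.IH)
qed simp

lemma divdiff_add: "divdiff us (\<lambda>v. G v + H v) s = divdiff us G s + divdiff us H s"
proof (induction us arbitrary: G H)
  case (Cons u us)
  have "(\<lambda>v. (G v + H v - (G u + H u)) / (u - v)) = (\<lambda>v. (G v - G u) / (u - v) + (H v - H u) / (u - v))"
    by (auto simp: add_divide_distrib diff_divide_distrib)
  then show ?case using Cons by simp
qed simp

lemma divdiff_cmult: "divdiff us (\<lambda>v. c * G v) s = c * divdiff us G s"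
proof (induction us arbitrary: G)
  case (Cons u us)
  have eq: "(\<lambda>v. (c * G v - c * G u) / (u - v)) = (\<lambda>v. c * ((G v - G u) / (u - v)))"
    by (auto simp: right_diff_distrib)
  show ?case by (simp only: divdiff.simps eq Cons.IH)
qed simp

lemma divdiff_tendsto:
  assumes "\<And>v. v \<in> insert s (set us) \<Longrightarrow> ((\<lambda>r. G r v) \<longlongrightarrow> L v) F"
  shows "((\<lambda>r. divdiff us (G r) s) \<longlongrightarrow> divdiff us L s) F"
  using assms
proof (induction us arbitrary: G L)
  case (Cons u us)
  show ?case
    \<comment> \<open>Read as multiplication by the constant \<open>inverse (u - v)\<close>, the
      step needs no distinct nodes: at \<open>v = u\<close> the factor is 0 by convention.\<close>
    using Cons.prems by (auto intro!: Cons.IH tendsto_mult tendsto_diff simp: divide_inverse)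
qed simp

text \<open>For fixed nodes a divided difference is a finite linear combination of values at the
  nodes, so integrability at each node is all that is required.\<close>

lemma divdiff_integral:
  assumes "\<And>v. v \<in> insert s (set us) \<Longrightarrow> integrable m (\<lambda>t. K t v)"
  shows "integrable m (\<lambda>t. divdiff us (K t) s)"
    and "divdiff us (\<lambda>v. \<integral>t. K t v \<partial>m) s = (\<integral>t. divdiff us (K t) s \<partial>m)"
proof -
  have "integrable m (\<lambda>t. divdiff us (K t) s) \<and>
        divdiff us (\<lambda>v. \<integral>t. K t v \<partial>m) s = (\<integral>t. divdiff us (K t) s \<partial>m)"
    using assms
  proof (induction us arbitrary: K)
    case (Cons u us)
    let ?K = "\<lambda>t v. (K t v - K t u) / (u - v)"
    have int: "integrable m (\<lambda>t. ?K t v)" if "v \<in> insert s (set us)" for v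
      using Cons.prems that by auto
    have "divdiff us (\<lambda>v. ((\<integral>t. K t v \<partial>m) - (\<integral>t. K t u \<partial>m)) / (u - v)) s
        = divdiff us (\<lambda>v. \<integral>t. ?K t v \<partial>m) s"
      using Cons.prems by (intro divdiff_cong) (auto simp: Bochner_Integration.integral_diff)
    then show ?case using Cons.IH[OF int] by simp
  qed simp
  then show "integrable m (\<lambda>t. divdiff us (K t) s)"
    and "divdiff us (\<lambda>v. \<integral>t. K t v \<partial>m) s = (\<integral>t. divdiff us (K t) s \<partial>m)" by auto
qed

text \<open>Every node splits off a linear factor and lowers the degree by one, so the nodes outlast
  the polynomial. The disjunct \<open>P = 0\<close> carries the induction past constants, whose
  quotient is zero although its degree is again 0.\<close>

lemma divdiff_poly:
  assumes "distinct (s # us)" "P = 0 \<or> degree P < length us"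
  shows "divdiff us (poly P) s = 0"
  using assms
proof (induction us arbitrary: P)
  case (Cons u us)
  \<comment> \<open>The minus sign matches the denominator \<open>u - v\<close> in
    \<open>divdiff\<close>.\<close>
  let ?Q = "- synthetic_div P u"
  have "(poly P v - poly P u) / (u - v) = poly ?Q v" if "v \<noteq> u" for v
  proof -
    have "poly P v = (v - u) * poly (synthetic_div P u) v + poly P u"
      by (subst synthetic_div_correct'[of u P, symmetric]) (simp add: algebra_simps)
    then show ?thesis using that by (simp add: field_simps)
  qed
  then have "divdiff (u # us) (poly P) s = divdiff us (poly ?Q) s"
    unfolding divdiff.simps using Cons.prems
    by (intro divdiff_cong) (metis distinct.simps(2) distinct_length_2_or_more insert_iff)
  moreover have "?Q = 0 \<or> degree ?Q < length us"
    using Cons.prems by (auto simp: synthetic_div_eq_0_iff degree_synthetic_div)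
  ultimately show ?case using Cons.IH[of ?Q] Cons.prems by (simp del: poly_minus divdiff.simps)
qed auto

text \<open>By the resolvent identity each difference reproduces the kernel
  \<open>1 / (\<tau> + v)\<close> with the constant factor \<open>1 / (\<tau> + u)\<close>; these
  factors accumulate to the product.\<close>

lemma divdiff_resolvent:
  assumes "distinct (s # us)" "\<And>v. v \<in> insert s (set us) \<Longrightarrow> \<tau> + v \<noteq> 0"
  shows "divdiff us (\<lambda>v. 1 / (\<tau> + v)) s = 1 / ((\<tau> + s) * (\<Prod>u\<leftarrow>us. \<tau> + u))"
  using assms
proof (induction us)
  case (Cons u us)
  have "divdiff (u # us) (\<lambda>v. 1 / (\<tau> + v)) s = divdiff us (\<lambda>v. 1 / (\<tau> + u) * (1 / (\<tau> + v))) s"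
    using Cons.prems
    by (auto intro!: divdiff_cong simp: divide_simps)
  also have "\<dots> = 1 / (\<tau> + u) * divdiff us (\<lambda>v. 1 / (\<tau> + v)) s"
    by (rule divdiff_cmult)
  also have "divdiff us (\<lambda>v. 1 / (\<tau> + v)) s = 1 / ((\<tau> + s) * (\<Prod>u\<leftarrow>us. \<tau> + u))"
    using Cons.prems by (intro Cons.IH) auto
  finally show ?case by (simp add: algebra_simps)
qed simp

text \<open>Division of \<open>P\<close> by \<open>v + \<tau>\<close> leaves a quotient of degree
  below the number of nodes, which is annihilated, and the value of \<open>P\<close> at the pole.
  With \<open>P\<close> the power of \<open>1 - r^2 v\<close> that comes from the prefactor of the
  transform, this value is \<open>(1 + t^2) ^ (\<kappa> + 1)\<close> and cancels the weight.\<close>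

lemma divdiff_poly_resolvent:
  assumes "distinct (s # us)" "\<And>v. v \<in> insert s (set us) \<Longrightarrow> \<tau> + v \<noteq> 0"
    and "degree P \<le> length us"
  shows "divdiff us (\<lambda>v. poly P v / (\<tau> + v)) s = poly P (-\<tau>) / ((\<tau> + s) * (\<Prod>u\<leftarrow>us. \<tau> + u))"
proof -
  let ?Q = "synthetic_div P (-\<tau>)"
  have "poly P v / (\<tau> + v) = poly ?Q v + poly P (-\<tau>) * (1 / (\<tau> + v))" if "\<tau> + v \<noteq> 0" for v
  proof -
    have "poly P v = (v + \<tau>) * poly ?Q v + poly P (-\<tau>)"
      by (subst synthetic_div_correct'[of "-\<tau>" P, symmetric]) (simp add: algebra_simps)
    then show ?thesis using that by (simp add: field_simps)
  qed
  then have "divdiff us (\<lambda>v. poly P v / (\<tau> + v)) s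
      = divdiff us (poly ?Q) s + poly P (-\<tau>) * divdiff us (\<lambda>v. 1 / (\<tau> + v)) s"
    using assms(2) by (subst divdiff_cmult[symmetric], subst divdiff_add[symmetric]) (intro divdiff_cong; simp)
  moreover have "divdiff us (poly ?Q) s = 0"
    using assms by (intro divdiff_poly) (auto simp: synthetic_div_eq_0_iff degree_synthetic_div)
  ultimately show ?thesis using divdiff_resolvent[OF assms(1,2)] by simp
qed

section \<open>Tauberian limits from inverse quadratic moments\<close>

lemma integrable_bounded_by:
  fixes f :: "'a \<Rightarrow> 'b::{banach, second_countable_topology}" and g :: "'a \<Rightarrow> real"
  assumes "integrable M g" "f \<in> borel_measurable M" "\<And>x. x \<in> space M \<Longrightarrow> norm (f x) \<le> g x"
  shows "integrable M f"
proof (rule Bochner_Integration.integrable_bound[OF assms(1,2)])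
  show "AE x in M. norm (f x) \<le> norm (g x)"
    using assms(3) by (intro AE_I2) (smt (verit) real_norm_def)
qed

text \<open>In the variable \<open>x = 1 / (1 + t^2)\<close>, which stays in [0, 1], the hypotheses
  cover all polynomials times \<open>x ^ K\<close>; the convergent mass of \<open>x ^ K\<close> pays
  for the uniform approximation of \<open>h\<close>. The bounded factors \<open>a\<close> and
  \<open>b\<close> may differ, so that the statement serves the even case \<open>a = b = 1\<close>
  as well as the odd case \<open>a = t / (1 + t^2)\<close>, \<open>b = 0\<close>.\<close>

lemma weierstrass_moment_limit:
  fixes m :: "'i \<Rightarrow> real measure" and h a b :: "real \<Rightarrow> real"
  assumes sets: "\<And>r. sets (m r) = sets borel" "sets \<sigma> = sets borel"
    and ab: "a \<in> borel_measurable borel" "b \<in> borel_measurable borel" "\<And>t. \<bar>a t\<bar> \<le> 1" "\<And>t. \<bar>b t\<bar> \<le> 1"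
    and int: "\<forall>\<^sub>F r in F. integrable (m r) (\<lambda>t. 1 / (1 + t\<^sup>2) ^ K)" "integrable \<sigma> (\<lambda>t. 1 / (1 + t\<^sup>2) ^ K)"
    and mass: "((\<lambda>r. \<integral>t. 1 / (1 + t\<^sup>2) ^ K \<partial>m r) \<longlongrightarrow> (\<integral>t. 1 / (1 + t\<^sup>2) ^ K \<partial>\<sigma>)) F"
    and lim: "\<And>k. k \<ge> K \<Longrightarrow> ((\<lambda>r. \<integral>t. a t * (1 / (1 + t\<^sup>2) ^ k) \<partial>m r) \<longlongrightarrow> (\<integral>t. b t * (1 / (1 + t\<^sup>2) ^ k) \<partial>\<sigma>)) F"
    and h: "continuous_on UNIV h"
  shows "((\<lambda>r. \<integral>t. a t * (h (1 / (1 + t\<^sup>2)) * (1 / (1 + t\<^sup>2) ^ K)) \<partial>m r)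
            \<longlongrightarrow> (\<integral>t. b t * (h (1 / (1 + t\<^sup>2)) * (1 / (1 + t\<^sup>2) ^ K)) \<partial>\<sigma>)) F"
proof (rule tendstoI)
  fix e :: real assume e: "e > 0"
  define x where "x t = 1 / (1 + t\<^sup>2)" for t :: real
  have x01: "x t \<in> {0..1}" for t by (auto simp: x_def divide_simps add_pos_nonneg)
  have xp: "1 / (1 + t\<^sup>2) ^ k = x t ^ k" for t k by (simp add: x_def power_divide)
  have xm [measurable]: "x \<in> borel_measurable borel" unfolding x_def by measurable
  have hm [measurable]: "h \<in> borel_measurable borel" using h by (rule borel_measurable_continuous_onI)
  note ab(1,2) [measurable]
  \<comment> \<open>Adding 1 makes \<open>B\<close> positive and an eventual strict bound for the
    masses under \<open>m r\<close>. With \<open>d = e / (4 * B)\<close> each of the two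
    approximation errors is at most \<open>e / 4\<close>, which leaves room for another
    \<open>e / 4\<close> from the polynomial.\<close>
  define B where "B = (\<integral>t. x t ^ K \<partial>\<sigma>) + 1"
  have B: "B > 0" unfolding B_def using x01 by (intro add_nonneg_pos integral_nonneg) auto
  define d where "d = e / (4 * B)"
  have d: "d > 0" using e B by (simp add: d_def)
  obtain g where g: "real_polynomial_function g" "\<And>y. y \<in> {0..1} \<Longrightarrow> \<bar>h y - g y\<bar> < d"
    using Stone_Weierstrass_real_polynomial_function[of "{0..1}" h d] d h
    by (auto intro: continuous_on_subset)
  then obtain c n where gc: "g = (\<lambda>y. \<Sum>i\<le>n. c i * y ^ i)"
    by (auto simp: real_polynomial_function_iff_sum)
  have gm [measurable]: "g \<in> borel_measurable borel" unfolding gc by measurable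
  have close: "norm ((\<integral>t. \<alpha> t * (h (x t) * x t ^ K) \<partial>M) - (\<integral>t. \<alpha> t * (g (x t) * x t ^ K) \<partial>M)) \<le> d * (\<integral>t. x t ^ K \<partial>M)"
    and gsum: "(\<integral>t. \<alpha> t * (g (x t) * x t ^ K) \<partial>M) = (\<Sum>i\<le>n. c i * (\<integral>t. \<alpha> t * x t ^ (K + i) \<partial>M))"
    if M [measurable_cong]: "sets M = sets borel" and IM: "integrable M (\<lambda>t. x t ^ K)"
      and \<alpha> [measurable]: "\<alpha> \<in> borel_measurable borel" and \<alpha>1: "\<And>t. \<bar>\<alpha> t\<bar> \<le> 1" for M \<alpha>
  proof -
    have I: "integrable M (\<lambda>t. \<alpha> t * (u t * x t ^ K))"
      if [measurable]: "u \<in> borel_measurable borel" and ub: "\<And>t. \<bar>u t\<bar> \<le> C" for u C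
    proof (rule integrable_bounded_by[of M "\<lambda>t. C * x t ^ K"])
      show "norm (\<alpha> t * (u t * x t ^ K)) \<le> C * x t ^ K" for t
        using mult_mono[OF \<alpha>1[of t] ub[of t]] x01[of t]
        by (auto simp: abs_mult mult.assoc[symmetric] intro!: mult_right_mono)
    qed (use IM in auto)
    have "compact (h ` {0..1})" using h by (intro compact_continuous_image) (auto intro: continuous_on_subset)
    then obtain C where C: "\<And>y. y \<in> {0..1} \<Longrightarrow> \<bar>h y\<bar> \<le> C"
      by (meson compact_imp_bounded bounded_real imageI)
    have Ch: "\<bar>h (x t)\<bar> \<le> C" for t using C x01 by auto
    have Cg: "\<bar>g (x t)\<bar> \<le> C + d" for t using Ch[of t] g(2)[OF x01[of t]] by linarith
    have I1: "integrable M (\<lambda>t. \<alpha> t * (h (x t) * x t ^ K))" using Ch by (intro I) auto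
    have I2: "integrable M (\<lambda>t. \<alpha> t * (g (x t) * x t ^ K))" using Cg by (intro I) auto
    have "norm ((\<integral>t. \<alpha> t * (h (x t) * x t ^ K) \<partial>M) - (\<integral>t. \<alpha> t * (g (x t) * x t ^ K) \<partial>M))
        = norm (\<integral>t. \<alpha> t * ((h (x t) - g (x t)) * x t ^ K) \<partial>M)"
      using I1 I2 by (subst Bochner_Integration.integral_diff[symmetric]) (auto simp: algebra_simps)
    also have "\<dots> \<le> (\<integral>t. d * x t ^ K \<partial>M)"
    proof (rule Bochner_Integration.integral_norm_bound_integral)
      show "integrable M (\<lambda>t. \<alpha> t * ((h (x t) - g (x t)) * x t ^ K))"
        using g(2)[OF x01] by (intro I[of _ d]) (auto intro: less_imp_le)
      show "norm (\<alpha> t * ((h (x t) - g (x t)) * x t ^ K)) \<le> d * x t ^ K" for t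
        using mult_mono[OF \<alpha>1[of t] less_imp_le[OF g(2)[OF x01[of t]]]] x01[of t]
        by (auto simp: abs_mult mult.assoc[symmetric] intro!: mult_right_mono)
    qed (use IM in auto)
    finally show "norm ((\<integral>t. \<alpha> t * (h (x t) * x t ^ K) \<partial>M) - (\<integral>t. \<alpha> t * (g (x t) * x t ^ K) \<partial>M)) \<le> d * (\<integral>t. x t ^ K \<partial>M)"
      by simp
    have I3: "integrable M (\<lambda>t. \<alpha> t * x t ^ (K + i))" for i
      using I[of "\<lambda>t. x t ^ i" 1] x01 by (auto simp: power_add mult.commute power_le_one)
    have "(\<integral>t. \<alpha> t * (g (x t) * x t ^ K) \<partial>M) = (\<integral>t. (\<Sum>i\<le>n. c i * (\<alpha> t * x t ^ (K + i))) \<partial>M)"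
      by (intro Bochner_Integration.integral_cong refl)
         (auto simp: gc sum_distrib_left sum_distrib_right power_add algebra_simps)
    also have "\<dots> = (\<Sum>i\<le>n. c i * (\<integral>t. \<alpha> t * x t ^ (K + i) \<partial>M))"
      using I3 by (subst Bochner_Integration.integral_sum) auto
    finally show "(\<integral>t. \<alpha> t * (g (x t) * x t ^ K) \<partial>M) = (\<Sum>i\<le>n. c i * (\<integral>t. \<alpha> t * x t ^ (K + i) \<partial>M))" .
  qed
  have lim': "((\<lambda>r. \<integral>t. a t * x t ^ (K + i) \<partial>m r) \<longlongrightarrow> (\<integral>t. b t * x t ^ (K + i) \<partial>\<sigma>)) F" for i
    using lim[of "K + i"] by (simp only: xp le_add1)
  have L: "((\<lambda>r. \<Sum>i\<le>n. c i * (\<integral>t. a t * x t ^ (K + i) \<partial>m r)) \<longlongrightarrow> (\<Sum>i\<le>n. c i * (\<integral>t. b t * x t ^ (K + i) \<partial>\<sigma>))) F"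
    by (intro tendsto_sum tendsto_mult tendsto_const lim')
  have ev1: "\<forall>\<^sub>F r in F. dist (\<Sum>i\<le>n. c i * (\<integral>t. a t * x t ^ (K + i) \<partial>m r)) (\<Sum>i\<le>n. c i * (\<integral>t. b t * x t ^ (K + i) \<partial>\<sigma>)) < e / 4"
    using tendstoD[OF L, of "e/4"] e by simp
  have ev2: "\<forall>\<^sub>F r in F. (\<integral>t. x t ^ K \<partial>m r) < B"
    using order_tendstoD(2)[OF mass, of B] unfolding xp B_def by simp
  have "\<forall>\<^sub>F r in F. dist (\<integral>t. a t * (h (x t) * x t ^ K) \<partial>m r) (\<integral>t. b t * (h (x t) * x t ^ K) \<partial>\<sigma>) < e"
    using ev1 ev2 int(1)
  proof eventually_elim
    case (elim r)
    have c1: "norm ((\<integral>t. a t * (h (x t) * x t ^ K) \<partial>m r) - (\<integral>t. a t * (g (x t) * x t ^ K) \<partial>m r)) \<le> d * (\<integral>t. x t ^ K \<partial>m r)"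
      using close[OF sets(1) _ ab(1,3)] elim(3) by (simp add: xp)
    have c2: "norm ((\<integral>t. b t * (h (x t) * x t ^ K) \<partial>\<sigma>) - (\<integral>t. b t * (g (x t) * x t ^ K) \<partial>\<sigma>)) \<le> d * (\<integral>t. x t ^ K \<partial>\<sigma>)"
      using close[OF sets(2) _ ab(2,4)] int(2) by (simp add: xp)
    have "d * (\<integral>t. x t ^ K \<partial>m r) \<le> e / 4"
      using mult_left_mono[OF less_imp_le[OF elim(2)], of d] d B by (simp add: d_def)
    moreover have "d * (\<integral>t. x t ^ K \<partial>\<sigma>) \<le> d * B" using d by (intro mult_left_mono) (auto simp: B_def)
    then have "d * (\<integral>t. x t ^ K \<partial>\<sigma>) \<le> e / 4" using B by (simp add: d_def)
    moreover have "(\<integral>t. a t * (g (x t) * x t ^ K) \<partial>m r) = (\<Sum>i\<le>n. c i * (\<integral>t. a t * x t ^ (K + i) \<partial>m r))"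
      using gsum[OF sets(1) _ ab(1,3)] elim(3) by (simp add: xp)
    moreover have "(\<integral>t. b t * (g (x t) * x t ^ K) \<partial>\<sigma>) = (\<Sum>i\<le>n. c i * (\<integral>t. b t * x t ^ (K + i) \<partial>\<sigma>))"
      using gsum[OF sets(2) _ ab(2,4)] int(2) by (simp add: xp)
    ultimately show ?case using elim(1) c1 c2 e unfolding dist_norm real_norm_def by argo
  qed
  then show "\<forall>\<^sub>F r in F. dist (\<integral>t. a t * (h (1 / (1 + t\<^sup>2)) * (1 / (1 + t\<^sup>2) ^ K)) \<partial>m r)
     (\<integral>t. b t * (h (1 / (1 + t\<^sup>2)) * (1 / (1 + t\<^sup>2) ^ K)) \<partial>\<sigma>) < e"
    by (simp only: xp x_def[symmetric])
qed

text \<open>Functions of \<open>x = 1 / (1 + t^2)\<close> see exactly the symmetric intervals. The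
  indicator of such an interval is not continuous in x but lies between continuous functions whose
  integrals converge; continuity of the limiting mass \<open>S\<close> at \<delta> closes the
  gap.\<close>

lemma tauber_interval:
  fixes m :: "'i \<Rightarrow> real measure"
  assumes sets: "\<And>r. sets (m r) = sets borel" "sets \<sigma> = sets borel"
    and int: "\<forall>\<^sub>F r in F. integrable (m r) (\<lambda>t. 1 / (1 + t\<^sup>2) ^ K)" "integrable \<sigma> (\<lambda>t. 1 / (1 + t\<^sup>2) ^ K)"
    and lim: "\<And>k. k \<ge> K \<Longrightarrow> ((\<lambda>r. \<integral>t. 1 / (1 + t\<^sup>2) ^ k \<partial>m r) \<longlongrightarrow> (\<integral>t. 1 / (1 + t\<^sup>2) ^ k \<partial>\<sigma>)) F"
    and S: "isCont S \<delta>" "\<And>a. a > 0 \<Longrightarrow> measure \<sigma> {-a<..<a} = S a" and \<delta>: "\<delta> > 0"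
  shows "((\<lambda>r. measure (m r) {-\<delta><..<\<delta>}) \<longlongrightarrow> S \<delta>) F"
proof -
  define x where "x t = 1 / (1 + t\<^sup>2)" for t :: real
  have x01: "0 < x t" "x t \<le> 1" for t by (auto simp: x_def divide_simps add_pos_nonneg)
  have xm [measurable]: "x \<in> borel_measurable borel" unfolding x_def by measurable
  have xp: "1 / (1 + t\<^sup>2) ^ k = x t ^ k" for t k by (simp add: x_def power_divide)
  have xmono: "x s < x t \<longleftrightarrow> t\<^sup>2 < s\<^sup>2" for s t
    by (auto simp: x_def divide_simps add_pos_nonneg add_strict_increasing2)
  have intl: "integrable M (\<lambda>t. indicator {-a<..<a} t :: real)"
    if M [measurable_cong]: "sets M = sets borel" and IM: "integrable M (\<lambda>t. 1 / (1 + t\<^sup>2) ^ K)" for M and a :: real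
  proof (rule integrable_bounded_by[of M "\<lambda>t. (1 + a\<^sup>2) ^ K * (1 / (1 + t\<^sup>2) ^ K)"])
    show "norm (indicator {-a<..<a} t :: real) \<le> (1 + a\<^sup>2) ^ K * (1 / (1 + t\<^sup>2) ^ K)" for t
    proof (cases "t \<in> {-a<..<a}")
      case True
      then have "t\<^sup>2 \<le> a\<^sup>2" by (auto simp: abs_le_square_iff[symmetric])
      then have "(1 + t\<^sup>2) ^ K \<le> (1 + a\<^sup>2) ^ K" by (intro power_mono) auto
      then show ?thesis using True by (auto simp: divide_simps add_pos_nonneg indicator_def)
    qed auto
    show "integrable M (\<lambda>t. (1 + a\<^sup>2) ^ K * (1 / (1 + t\<^sup>2) ^ K))" by (rule integrable_mult_right, rule IM)
  qed auto
  have sandwich: "\<exists>g. ((\<lambda>r. \<integral>t. g t \<partial>m r) \<longlongrightarrow> (\<integral>t. g t \<partial>\<sigma>)) F \<and>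
      (\<forall>M. sets M = sets borel \<longrightarrow> integrable M (\<lambda>t. 1 / (1 + t\<^sup>2) ^ K) \<longrightarrow>
        measure M {-a<..<a} \<le> (\<integral>t. g t \<partial>M) \<and> (\<integral>t. g t \<partial>M) \<le> measure M {-b<..<b})"
    if "0 < a" "a < b" for a b :: real
  proof -
    \<comment> \<open>A ramp in x from 0 at \<open>x b\<close> to 1 at \<open>x a\<close>. Dividing
      by \<open>x ^ K\<close> in \<open>h\<close> makes \<open>h (x t) * x t ^ K\<close> the ramp
      itself; the maximum with \<open>x b\<close> matters only where the ramp vanishes and keeps
      \<open>h\<close> continuous at 0.\<close>
    define \<phi> where "\<phi> y = min 1 (max 0 ((y - x b) / (x a - x b)))" for y
    define h where "h y = \<phi> y / (max (x b) y) ^ K" for y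
    have h: "continuous_on UNIV h"
      unfolding h_def \<phi>_def using x01(1)[of b] that xmono[of b a]
      by (intro continuous_intros) (auto simp: max_def power2_eq_square mult_strict_mono)
    define g where "g t = h (x t) * x t ^ K" for t
    have hm [measurable]: "h \<in> borel_measurable borel" using h by (rule borel_measurable_continuous_onI)
    have ab: "x b < x a" using that by (auto simp: xmono intro!: power_strict_mono)
    have gm [measurable]: "g \<in> borel_measurable borel" unfolding g_def[abs_def] by measurable
    have gle: "g t \<le> indicator {-b<..<b} t" for t
    proof (cases "\<bar>t\<bar> < b")
      case True
      then have "t\<^sup>2 < b\<^sup>2" using power_strict_mono[of "\<bar>t\<bar>" b 2] by simp
      then have "max (x b) (x t) = x t" using xmono[of b t] by simp
      then have "g t = \<phi> (x t)" using x01(1)[of t] by (simp add: g_def h_def)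
      then show ?thesis using True by (auto simp: \<phi>_def indicator_def)
    next
      case False
      then have "b\<^sup>2 \<le> t\<^sup>2" using power_mono[of b "\<bar>t\<bar>" 2] that by simp
      then have "x t \<le> x b" using xmono[of b t] by simp
      then have "(x t - x b) / (x a - x b) \<le> 0" using ab by (intro divide_nonpos_pos) auto
      then have "\<phi> (x t) = 0" by (simp add: \<phi>_def)
      then show ?thesis by (simp add: g_def h_def)
    qed
    have g0: "0 \<le> g t" for t 
      unfolding g_def h_def \<phi>_def using x01(1)[of t] x01(1)[of b]
      by (intro mult_nonneg_nonneg divide_nonneg_nonneg zero_le_power) (auto simp: le_max_iff_disj less_imp_le)
    have leg: "indicator {-a<..<a} t \<le> g t" for t
    proof (cases "\<bar>t\<bar> < a")
      case True
      then have "t\<^sup>2 < a\<^sup>2" using power_strict_mono[of "\<bar>t\<bar>" a 2] by simp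
      then have "x a < x t" using xmono[of a t] by simp
      then have "max (x b) (x t) = x t" "\<phi> (x t) = 1" using ab
        by (auto simp: \<phi>_def max_def min_def divide_simps)
      then show ?thesis using x01(1)[of t] by (simp add: g_def h_def indicator_def)
    next
      case False
      then show ?thesis using g0[of t] by (auto simp: indicator_def)
    qed
    have "((\<lambda>r. \<integral>t. 1 * (h (1 / (1 + t\<^sup>2)) * (1 / (1 + t\<^sup>2) ^ K)) \<partial>m r) \<longlongrightarrow> (\<integral>t. 1 * (h (1 / (1 + t\<^sup>2)) * (1 / (1 + t\<^sup>2) ^ K)) \<partial>\<sigma>)) F"
      by (rule weierstrass_moment_limit) (use sets int lim h in auto)
    then have l: "((\<lambda>r. \<integral>t. g t \<partial>m r) \<longlongrightarrow> (\<integral>t. g t \<partial>\<sigma>)) F"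
      unfolding g_def by (simp only: xp x_def[symmetric] mult_1)
    have "measure M {-a<..<a} \<le> (\<integral>t. g t \<partial>M) \<and> (\<integral>t. g t \<partial>M) \<le> measure M {-b<..<b}"
      if M [measurable_cong]: "sets M = sets borel" and IM: "integrable M (\<lambda>t. 1 / (1 + t\<^sup>2) ^ K)" for M
    proof -
      have ig: "integrable M g"
      proof (rule integrable_bounded_by)
        show "integrable M (\<lambda>t. indicator {-b<..<b} t :: real)" by (rule intl[OF M IM])
        show "norm (g t) \<le> indicator {-b<..<b} t" for t using gle[of t] g0[of t] by simp
      qed simp
      have sp: "space M = UNIV" using sets_eq_imp_space_eq[OF M] by simp
      have "measure M {-a<..<a} = (\<integral>t. indicator {-a<..<a} t \<partial>M)" by (simp add: sp)
      also have "\<dots> \<le> (\<integral>t. g t \<partial>M)" by (intro integral_mono intl M IM ig leg)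
      finally have 1: "measure M {-a<..<a} \<le> (\<integral>t. g t \<partial>M)" .
      have "(\<integral>t. g t \<partial>M) \<le> (\<integral>t. indicator {-b<..<b} t \<partial>M)" by (intro integral_mono intl M IM ig gle)
      then show ?thesis using 1 by (simp add: sp)
    qed
    then show ?thesis using l by blast
  qed
  show ?thesis
  proof (rule order_tendstoI)
    fix y assume y: "y < S \<delta>"
    have "\<forall>\<^sub>F a in at_left \<delta>. y < S a"
      using S(1) y by (intro order_tendstoD(1)[of S "S \<delta>"]) (auto simp: isCont_def filterlim_at_split)
    moreover have "\<forall>\<^sub>F a in at_left \<delta>. a \<in> {0<..<\<delta>}"
      using \<delta> by (rule eventually_at_left_real)
    ultimately have "\<forall>\<^sub>F a in at_left \<delta>. y < S a \<and> 0 < a \<and> a < \<delta>" by eventually_elim auto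
    then obtain a where a: "0 < a" "a < \<delta>" "y < S a"
      using eventually_happens'[of "at_left \<delta>"] trivial_limit_at_left_real by blast
    obtain g where g: "((\<lambda>r. \<integral>t. g t \<partial>m r) \<longlongrightarrow> (\<integral>t. g t \<partial>\<sigma>)) F"
      "\<And>M. sets M = sets borel \<Longrightarrow> integrable M (\<lambda>t. 1 / (1 + t\<^sup>2) ^ K) \<Longrightarrow>
        measure M {-a<..<a} \<le> (\<integral>t. g t \<partial>M) \<and> (\<integral>t. g t \<partial>M) \<le> measure M {-\<delta><..<\<delta>}"
      using sandwich[OF a(1,2)] by blast
    have "y < (\<integral>t. g t \<partial>\<sigma>)" using g(2)[OF sets(2) int(2)] S(2)[OF a(1)] a by linarith
    from order_tendstoD(1)[OF g(1) this] int(1)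
    show "\<forall>\<^sub>F r in F. y < measure (m r) {-\<delta><..<\<delta>}"
    proof eventually_elim
      case (elim r)
      with g(2)[OF sets(1)[of r]] show ?case by force
    qed
  next
    fix y assume y: "y > S \<delta>"
    have "\<forall>\<^sub>F a in at_right \<delta>. y > S a"
      using S(1) y by (intro order_tendstoD(2)[of S "S \<delta>"]) (auto simp: isCont_def filterlim_at_split)
    moreover have "\<forall>\<^sub>F a in at_right \<delta>. a \<in> {\<delta><..<\<delta>+1}"
      by (rule eventually_at_right_real) simp
    ultimately have "\<forall>\<^sub>F a in at_right \<delta>. y > S a \<and> a > \<delta>" by eventually_elim auto
    then obtain a where a: "a > \<delta>" "y > S a"
      using eventually_happens'[of "at_right \<delta>"] trivial_limit_at_right_real by blast
    obtain g where g: "((\<lambda>r. \<integral>t. g t \<partial>m r) \<longlongrightarrow> (\<integral>t. g t \<partial>\<sigma>)) F"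
      "\<And>M. sets M = sets borel \<Longrightarrow> integrable M (\<lambda>t. 1 / (1 + t\<^sup>2) ^ K) \<Longrightarrow>
        measure M {-\<delta><..<\<delta>} \<le> (\<integral>t. g t \<partial>M) \<and> (\<integral>t. g t \<partial>M) \<le> measure M {-a<..<a}"
      using sandwich[OF \<delta> a(1)] by blast
    have "y > (\<integral>t. g t \<partial>\<sigma>)" using g(2)[OF sets(2) int(2)] S(2)[of a] a \<delta> by force
    from order_tendstoD(2)[OF g(1) this] int(1)
    show "\<forall>\<^sub>F r in F. y > measure (m r) {-\<delta><..<\<delta>}"
    proof eventually_elim
      case (elim r)
      with g(2)[OF sets(1)[of r]] show ?case by force
    qed
  qed
qed

text \<open>The odd integrals test against \<open>t / (1 + t^2)\<close> times functions of x. Since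
  \<open>|t| / (1 + t^2) = sqrt (x (1 - x))\<close>, division by this root turns the test function
  into \<open>sgn t\<close> times a plateau. The root vanishes at t = 0, so a small neighbourhood of
  0 has to be cut out; the hypothesis that \<open>S\<close> tends to 0 pays for it.\<close>

lemma tauber_balance:
  fixes m :: "'i \<Rightarrow> real measure"
  assumes sets: "\<And>r. sets (m r) = sets borel" "sets \<sigma> = sets borel"
    and int: "\<forall>\<^sub>F r in F. integrable (m r) (\<lambda>t. 1 / (1 + t\<^sup>2) ^ K)" "integrable \<sigma> (\<lambda>t. 1 / (1 + t\<^sup>2) ^ K)"
    and lim: "\<And>k. k \<ge> K \<Longrightarrow> ((\<lambda>r. \<integral>t. 1 / (1 + t\<^sup>2) ^ k \<partial>m r) \<longlongrightarrow> (\<integral>t. 1 / (1 + t\<^sup>2) ^ k \<partial>\<sigma>)) F"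
    and odd: "\<And>k. k \<ge> K \<Longrightarrow> ((\<lambda>r. \<integral>t. t / (1 + t\<^sup>2) * (1 / (1 + t\<^sup>2) ^ k) \<partial>m r) \<longlongrightarrow> 0) F"
    and S: "\<And>a. a > 0 \<Longrightarrow> isCont S a" "\<And>a. a > 0 \<Longrightarrow> measure \<sigma> {-a<..<a} = S a" "(S \<longlongrightarrow> 0) (at_right 0)"
    and \<delta>: "\<delta> > 0"
  shows "((\<lambda>r. measure (m r) {0..<\<delta>} - measure (m r) {-\<delta><..<0}) \<longlongrightarrow> 0) F"
proof (rule tendstoI)
  fix e :: real assume e: "e > 0"
  note interval = tauber_interval[OF sets int lim S(1) S(2)]
  define x where "x t = 1 / (1 + t\<^sup>2)" for t :: real
  have x01: "0 < x t" "x t \<le> 1" for t by (auto simp: x_def divide_simps add_pos_nonneg)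
  have xm [measurable]: "x \<in> borel_measurable borel" unfolding x_def by measurable
  have xp: "1 / (1 + t\<^sup>2) ^ k = x t ^ k" for t k by (simp add: x_def power_divide)
  have xmono: "x s < x t \<longleftrightarrow> \<bar>t\<bar> < \<bar>s\<bar>" for s t
  proof -
    have "x s < x t \<longleftrightarrow> t\<^sup>2 < s\<^sup>2"
      by (auto simp: x_def divide_simps add_pos_nonneg add_strict_increasing2)
    then show ?thesis by (simp add: abs_le_square_iff flip: linorder_not_le)
  qed
  have "\<forall>\<^sub>F b in at_left \<delta>. S \<delta> - e / 4 < S b"
    using S(1)[OF \<delta>] e by (intro order_tendstoD(1)[of S "S \<delta>"]) (auto simp: isCont_def filterlim_at_split)
  moreover have "\<forall>\<^sub>F b in at_left \<delta>. b \<in> {0<..<\<delta>}" using \<delta> by (rule eventually_at_left_real)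
  ultimately have "\<forall>\<^sub>F b in at_left \<delta>. S \<delta> - e / 4 < S b \<and> 0 < b \<and> b < \<delta>" by eventually_elim auto
  then obtain b where b: "0 < b" "b < \<delta>" "S \<delta> - e / 4 < S b"
    using eventually_happens'[of "at_left \<delta>"] trivial_limit_at_left_real by blast
  have "\<forall>\<^sub>F a in at_right 0. S a < e / 4" using S(3) e by (intro order_tendstoD(2)[of S 0]) auto
  moreover have "\<forall>\<^sub>F a in at_right 0. a \<in> {0<..<b}" using b by (intro eventually_at_right_real) auto
  ultimately have "\<forall>\<^sub>F a in at_right 0. S a < e / 4 \<and> 0 < a \<and> a < b" by eventually_elim auto
  then obtain a where a: "0 < a" "a < b" "S a < e / 4"
    using eventually_happens'[of "at_right (0::real)"] trivial_limit_at_right_real by blast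
  \<comment> \<open>A trapezoid in x, equal to 1 from \<open>x b\<close> to \<open>x a\<close>, that
    is for |t| between a and b, and 0 for |t| \<ge> \<delta> and for |t| \<le> a/2. The constant
    \<open>c\<close> below bounds \<open>x (1 - x)\<close> from below on its support, so both maxima
    in \<open>h\<close> are inactive there.\<close>
  define \<psi> where "\<psi> y = min 1 (max 0 ((y - x \<delta>) / (x b - x \<delta>))) * min 1 (max 0 ((x (a/2) - y) / (x (a/2) - x a)))" for y
  define c where "c = x \<delta> * (1 - x (a/2))"
  define h where "h y = \<psi> y / (sqrt (max c (y * (1 - y))) * (max (x \<delta>) y) ^ K)" for y
  have ord: "x \<delta> < x b" "x b < x a" "x a < x (a/2)" "x (a/2) < 1"
  proof -
    have "x (a/2) < x 0" using a by (subst xmono) auto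
    then show "x (a/2) < 1" by (simp add: x_def)
  qed (use a b in \<open>auto simp: xmono\<close>)
  have c: "c > 0" using ord x01(1)[of \<delta>] by (simp add: c_def)
  have h: "continuous_on UNIV h"
  proof -
    have "sqrt (max c (y * (1 - y))) * max (x \<delta>) y ^ K \<noteq> 0" for y
      using c x01(1)[of \<delta>] by (auto simp: max_def)
    then show ?thesis unfolding h_def \<psi>_def using ord by (intro continuous_intros) auto
  qed
  have hm [measurable]: "h \<in> borel_measurable borel" using h by (rule borel_measurable_continuous_onI)
  define G where "G t = t / (1 + t\<^sup>2) * (h (x t) * x t ^ K)" for t
  have Gm [measurable]: "G \<in> borel_measurable borel" unfolding G_def[abs_def] by measurable

  have \<psi>01: "0 \<le> \<psi> y" "\<psi> y \<le> 1" for y by (auto simp: \<psi>_def mult_le_one)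
  have G: "G t = sgn t * \<psi> (x t)" for t
  proof (cases "\<psi> (x t) = 0")
    case False
    then have 1: "x \<delta> < x t" "x t < x (a/2)" using ord
      by (auto simp: \<psi>_def max_def min_def divide_simps split: if_splits)
    then have "c \<le> x t * (1 - x t)" unfolding c_def using ord x01[of \<delta>] by (intro mult_mono) auto
    moreover have "x t * (1 - x t) = (t / (1 + t\<^sup>2))\<^sup>2"
    proof -
      have nz: "1 + t\<^sup>2 \<noteq> 0" using zero_le_power2[of t] by linarith
      then have "1 - x t = t\<^sup>2 / (1 + t\<^sup>2)" by (simp add: x_def field_simps)
      then show ?thesis by (simp add: x_def power2_eq_square)
    qed
    ultimately have "sqrt (max c (x t * (1 - x t))) = \<bar>t\<bar> / (1 + t\<^sup>2)"
      by (simp add: max_absorb2 abs_divide abs_of_nonneg)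
    moreover have "\<bar>t\<bar> > 0" using 1 xmono[of t "a/2"] a by linarith
    ultimately have "h (x t) * x t ^ K = \<psi> (x t) / (\<bar>t\<bar> / (1 + t\<^sup>2))"
      using 1 x01(1)[of t] by (simp add: h_def max_absorb2)
    moreover have "t / (1 + t\<^sup>2) / (\<bar>t\<bar> / (1 + t\<^sup>2)) = sgn t"
    proof -
      have "1 + t\<^sup>2 \<noteq> 0" using zero_le_power2[of t] by linarith
      then show ?thesis using \<open>\<bar>t\<bar> > 0\<close> by (auto simp: sgn_if)
    qed
    ultimately show ?thesis by (metis G_def times_divide_eq_left times_divide_eq_right)
  qed (auto simp: G_def h_def)
  define D where "D t = (indicator {0..<\<delta>} t - indicator {-\<delta><..<0} t :: real)" for t
  have Dm [measurable]: "D \<in> borel_measurable borel" unfolding D_def[abs_def] by measurable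
  \<comment> \<open>Off the plateau the two functions differ by at most 1, which costs the mass of
    (-a, a) and of the two strips where b \<le> |t| < \<delta>.\<close>
  have le: "\<bar>D t - G t\<bar> \<le> indicator {-a<..<a} t + (indicator {-\<delta><..<\<delta>} t - indicator {-b<..<b} t)" for t
  proof -
    consider "\<bar>t\<bar> < a" | "a \<le> \<bar>t\<bar>" "\<bar>t\<bar> < b" | "b \<le> \<bar>t\<bar>" "\<bar>t\<bar> < \<delta>" | "\<delta> \<le> \<bar>t\<bar>" by linarith
    then show ?thesis
    proof cases
      case 2
      have "x b < x t" "x t \<le> x a" using 2 a xmono[of b t] xmono[of a t] by auto
      then have "\<psi> (x t) = 1" using ord by (auto simp: \<psi>_def max_def min_def divide_simps)
      then show ?thesis using 2 a b by (auto simp: G D_def indicator_def sgn_if)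
    next
      case 4
      have "x t \<le> x \<delta>" using 4 \<delta> xmono[of \<delta> t] by auto
      then have "(x t - x \<delta>) / (x b - x \<delta>) \<le> 0" using ord by (intro divide_nonpos_pos) auto
      then have "\<psi> (x t) = 0" by (simp add: \<psi>_def)
      then show ?thesis using 4 a b by (auto simp: G D_def indicator_def)
    qed (use \<psi>01[of "x t"] a b in \<open>auto simp: G D_def indicator_def sgn_if\<close>)
  qed
  have bnd: "\<bar>measure M {0..<\<delta>} - measure M {-\<delta><..<0}\<bar> \<le>
      \<bar>\<integral>t. G t \<partial>M\<bar> + (measure M {-a<..<a} + (measure M {-\<delta><..<\<delta>} - measure M {-b<..<b}))"
    if M [measurable_cong]: "sets M = sets borel" and IM: "integrable M (\<lambda>t. 1 / (1 + t\<^sup>2) ^ K)" for M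
  proof -
    have intl: "integrable M (\<lambda>t. indicator A t :: real)" if A: "A \<in> sets borel" "A \<subseteq> {-\<delta><..<\<delta>}" for A
    proof (rule integrable_bounded_by[of M "\<lambda>t. (1 + \<delta>\<^sup>2) ^ K * (1 / (1 + t\<^sup>2) ^ K)"])
      show "norm (indicator A t :: real) \<le> (1 + \<delta>\<^sup>2) ^ K * (1 / (1 + t\<^sup>2) ^ K)" for t
      proof (cases "t \<in> A")
        case True
        then have "\<bar>t\<bar> \<le> \<bar>\<delta>\<bar>" using A by fastforce
        then have "t\<^sup>2 \<le> \<delta>\<^sup>2" by (simp add: abs_le_square_iff)
        then have "(1 + t\<^sup>2) ^ K \<le> (1 + \<delta>\<^sup>2) ^ K" by (intro power_mono) auto
        then show ?thesis using True by (auto simp: divide_simps add_pos_nonneg indicator_def)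
      qed auto
      show "integrable M (\<lambda>t. (1 + \<delta>\<^sup>2) ^ K * (1 / (1 + t\<^sup>2) ^ K))" by (rule integrable_mult_right, rule IM)
    qed (use A in auto)
    have sp: "space M = UNIV" using sets_eq_imp_space_eq[OF M] by simp
    have I: "integrable M D" unfolding D_def using \<delta> by (intro Bochner_Integration.integrable_diff intl) auto
    have I2: "integrable M (\<lambda>t. indicator {-a<..<a} t + (indicator {-\<delta><..<\<delta>} t - indicator {-b<..<b} t) :: real)"
      using a b by (intro Bochner_Integration.integrable_diff Bochner_Integration.integrable_add intl) auto
    have I3: "integrable M (\<lambda>t. D t - G t)"
      using I2 by (rule integrable_bounded_by) (use le in auto)
    have IG: "integrable M G" using Bochner_Integration.integrable_diff[OF I I3] by simp
    have "measure M {0..<\<delta>} - measure M {-\<delta><..<0} = (\<integral>t. D t \<partial>M)"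
      unfolding D_def using \<delta> by (subst Bochner_Integration.integral_diff) (auto intro!: intl simp: sp)
    also have "\<dots> = (\<integral>t. G t \<partial>M) + (\<integral>t. D t - G t \<partial>M)"
      using I IG by (simp add: Bochner_Integration.integral_diff)
    finally have 1: "measure M {0..<\<delta>} - measure M {-\<delta><..<0} = (\<integral>t. G t \<partial>M) + (\<integral>t. D t - G t \<partial>M)" .
    have "\<bar>\<integral>t. D t - G t \<partial>M\<bar> \<le> (\<integral>t. indicator {-a<..<a} t + (indicator {-\<delta><..<\<delta>} t - indicator {-b<..<b} t) \<partial>M)"
      using Bochner_Integration.integral_norm_bound_integral[OF I3 I2] le by auto
    also have "\<dots> = measure M {-a<..<a} + (measure M {-\<delta><..<\<delta>} - measure M {-b<..<b})"
    proof -
      have i: "integrable M (indicator {-a<..<a} :: real \<Rightarrow> real)" "integrable M (indicator {-\<delta><..<\<delta>} :: real \<Rightarrow> real)"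
        "integrable M (indicator {-b<..<b} :: real \<Rightarrow> real)"
        using a b by (auto intro!: intl)
      show ?thesis
        unfolding Bochner_Integration.integral_add[OF i(1) Bochner_Integration.integrable_diff[OF i(2,3)]]
          Bochner_Integration.integral_diff[OF i(2,3)] by (simp add: sp)
    qed
    finally show ?thesis using 1 by linarith
  qed
  have "((\<lambda>r. \<integral>t. t / (1 + t\<^sup>2) * (h (1 / (1 + t\<^sup>2)) * (1 / (1 + t\<^sup>2) ^ K)) \<partial>m r)
         \<longlongrightarrow> (\<integral>t. 0 * (h (1 / (1 + t\<^sup>2)) * (1 / (1 + t\<^sup>2) ^ K)) \<partial>\<sigma>)) F"
  proof (rule weierstrass_moment_limit)
    show "\<bar>t / (1 + t\<^sup>2)\<bar> \<le> 1" for t :: real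
    proof -
      have "0 \<le> (\<bar>t\<bar> - 1)\<^sup>2" by simp
      then have "\<bar>t\<bar> \<le> 1 + t\<^sup>2" by (simp add: power2_diff)
      moreover have "1 + t\<^sup>2 > 0" using zero_le_power2[of t] by linarith
      ultimately show ?thesis by (simp add: abs_divide divide_le_eq)
    qed
  qed (use sets int lim odd h in auto)
  then have "((\<lambda>r. \<integral>t. G t \<partial>m r) \<longlongrightarrow> 0) F"
    unfolding G_def by (simp only: xp x_def[symmetric] mult_zero_left Bochner_Integration.integral_zero)
  then have e1: "\<forall>\<^sub>F r in F. \<bar>\<integral>t. G t \<partial>m r\<bar> < e / 4" using e by (auto dest!: tendstoD[of _ _ _ "e/4"])
  have "((\<lambda>r. measure (m r) {-a<..<a} + (measure (m r) {-\<delta><..<\<delta>} - measure (m r) {-b<..<b}))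
      \<longlongrightarrow> S a + (S \<delta> - S b)) F"
    using a b by (intro tendsto_intros interval) auto
  then have e2: "\<forall>\<^sub>F r in F. measure (m r) {-a<..<a} + (measure (m r) {-\<delta><..<\<delta>} - measure (m r) {-b<..<b}) < e / 2"
    using a b by (intro order_tendstoD(2)) auto
  show "\<forall>\<^sub>F r in F. dist (measure (m r) {0..<\<delta>} - measure (m r) {-\<delta><..<0}) 0 < e"
    using e1 e2 int(1)
  proof eventually_elim
    case (elim r)
    show ?case using bnd[OF sets(1) elim(3)] elim(1,2) e by (simp add: dist_norm)
  qed
qed

section \<open>The transform on the imaginary axis\<close>

text \<open>Since \<open>(i y)^2 = - y^2\<close>, removing two coefficients at a time alternates the
  sign. With \<open>n = \<kappa> + 1\<close> both resulting polynomials in \<open>v = y^2\<close>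
  have degree at most \<kappa>, low enough for differencing to kill them.\<close>

lemma poly_imaginary_axis:
  assumes "p = 0 \<or> degree p < 2 * n"
  shows "\<exists>P Q. (P = 0 \<or> degree P < n) \<and> (Q = 0 \<or> degree Q < n) \<and>
    (\<forall>y. poly (map_poly complex_of_real p) (\<i> * of_real y) = Complex (poly P (y\<^sup>2)) (y * poly Q (y\<^sup>2)))"
  using assms
proof (induction n arbitrary: p)
  case 0
  then show ?case by (intro exI[of _ 0]) (auto simp: complex_eq_iff)
next
  case (Suc n)
  obtain a p1 where p1: "p = pCons a p1" by (cases p)
  obtain b p2 where p2: "p1 = pCons b p2" by (cases p1)
  have "p2 = 0 \<or> degree p2 < 2 * n" using Suc.prems by (auto simp: p1 p2 split: if_splits)
  then obtain P Q where PQ: "P = 0 \<or> degree P < n" "Q = 0 \<or> degree Q < n"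
    "\<And>y. poly (map_poly complex_of_real p2) (\<i> * of_real y) = Complex (poly P (y\<^sup>2)) (y * poly Q (y\<^sup>2))"
    using Suc.IH by blast
  have "poly (map_poly complex_of_real p) (\<i> * of_real y)
      = Complex (poly (pCons a (- P)) (y\<^sup>2)) (y * poly (pCons b (- Q)) (y\<^sup>2))" for y
    by (simp add: p1 p2 map_poly_pCons PQ(3) complex_eq_iff power2_eq_square algebra_simps)
  moreover have "pCons a (- P) = 0 \<or> degree (pCons a (- P)) < Suc n"
    "pCons b (- Q) = 0 \<or> degree (pCons b (- Q)) < Suc n" using PQ by auto
  ultimately show ?case by blast
qed

lemma Re_mult_of_real: "Re (a * complex_of_real b) = Re a * b"
  and Im_mult_of_real: "Im (a * complex_of_real b) = Im a * b"
  by simp_all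

text \<open>On the axis the prefactor is real and
  \<open>1 / (t - i y) = (t + i y) / (t^2 + y^2)\<close>, so the odd moment lands in the real part
  and the even one in the imaginary part. Apart from one factor y, both depend on y only through
  \<open>y^2\<close>, the variable of differencing.\<close>

lemma C_transform_imaginary_axis:
  fixes y :: real
  assumes [measurable_cong]: "sets \<mu> = sets borel" and int: "integrable \<mu> (\<lambda>t. 1 / (1 + t\<^sup>2) ^ (\<kappa> + 1))" and y: "y > 0"
  shows "integrable \<mu> (\<lambda>t. 1 / (1 + t\<^sup>2) ^ (\<kappa> + 1) / (t\<^sup>2 + y\<^sup>2))"
    and "integrable \<mu> (\<lambda>t. t / (1 + t\<^sup>2) ^ (\<kappa> + 1) / (t\<^sup>2 + y\<^sup>2))"
    and "C_transform \<kappa> \<mu> p (\<i> * of_real y) = poly (map_poly complex_of_real p) (\<i> * of_real y) +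
      Complex ((1 - y\<^sup>2) ^ (\<kappa> + 1) * (\<integral>t. t / (1 + t\<^sup>2) ^ (\<kappa> + 1) / (t\<^sup>2 + y\<^sup>2) \<partial>\<mu>))
        (y * ((1 - y\<^sup>2) ^ (\<kappa> + 1) * (\<integral>t. 1 / (1 + t\<^sup>2) ^ (\<kappa> + 1) / (t\<^sup>2 + y\<^sup>2) \<partial>\<mu>)))"
proof -
  define w where "w t = 1 / (1 + t\<^sup>2) ^ (\<kappa> + 1)" for t :: real
  have wpos: "w t > 0" for t by (simp add: w_def add_pos_nonneg)
  have wm [measurable]: "w \<in> borel_measurable borel" unfolding w_def[abs_def] by measurable
  let ?g = "\<lambda>t. 1 / (complex_of_real t - \<i> * of_real y) * complex_of_real (w t)"
  have re: "Re (?g t) = t / (1 + t\<^sup>2) ^ (\<kappa> + 1) / (t\<^sup>2 + y\<^sup>2)" and im: "Im (?g t) = y * (1 / (1 + t\<^sup>2) ^ (\<kappa> + 1) / (t\<^sup>2 + y\<^sup>2))" for t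
  proof -
    have "Re (1 / (complex_of_real t - \<i> * of_real y)) = t / (t\<^sup>2 + y\<^sup>2)"
      "Im (1 / (complex_of_real t - \<i> * of_real y)) = y / (t\<^sup>2 + y\<^sup>2)"
      by (auto simp: Re_divide Im_divide)
    then show "Re (?g t) = t / (1 + t\<^sup>2) ^ (\<kappa> + 1) / (t\<^sup>2 + y\<^sup>2)" "Im (?g t) = y * (1 / (1 + t\<^sup>2) ^ (\<kappa> + 1) / (t\<^sup>2 + y\<^sup>2))"
      unfolding Re_mult_of_real Im_mult_of_real by (simp_all add: w_def)
  qed
  have I: "integrable \<mu> ?g"
  proof (rule Bochner_Integration.integrable_bound)
    show "integrable \<mu> (\<lambda>t. 1 / y * w t)" unfolding w_def by (rule integrable_mult_right, rule int)
    have "norm (?g t) \<le> 1 / y * w t" for t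
    proof -
      have "y \<le> norm (complex_of_real t - \<i> * of_real y)"
        using abs_Im_le_cmod[of "complex_of_real t - \<i> * of_real y"] y by simp
      then show ?thesis using y wpos[of t] by (simp add: norm_mult norm_divide divide_simps mult_mono)
    qed
    then show "AE t in \<mu>. norm (?g t) \<le> norm (1 / y * w t)"
      using y wpos by (auto intro!: AE_I2 simp: abs_mult abs_of_pos)
  qed measurable
  have Ire: "integrable \<mu> (\<lambda>t. Re (?g t))" and Iim: "integrable \<mu> (\<lambda>t. Im (?g t))"
    using I by auto
  show "integrable \<mu> (\<lambda>t. t / (1 + t\<^sup>2) ^ (\<kappa> + 1) / (t\<^sup>2 + y\<^sup>2))" using Ire unfolding re .
  show "integrable \<mu> (\<lambda>t. 1 / (1 + t\<^sup>2) ^ (\<kappa> + 1) / (t\<^sup>2 + y\<^sup>2))"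
    using Bochner_Integration.integrable_mult_right[of "1/y", OF Iim] y unfolding im by simp
  have "(\<integral>t. ?g t \<partial>\<mu>) = Complex (\<integral>t. t / (1 + t\<^sup>2) ^ (\<kappa> + 1) / (t\<^sup>2 + y\<^sup>2) \<partial>\<mu>)
        (y * (\<integral>t. 1 / (1 + t\<^sup>2) ^ (\<kappa> + 1) / (t\<^sup>2 + y\<^sup>2) \<partial>\<mu>))"
  proof (rule complex_eqI)
    have "Re (\<integral>t. ?g t \<partial>\<mu>) = (\<integral>t. Re (?g t) \<partial>\<mu>)" by (rule integral_Re[symmetric, OF I])
    then show "Re (\<integral>t. ?g t \<partial>\<mu>) = Re (Complex (\<integral>t. t / (1 + t\<^sup>2) ^ (\<kappa> + 1) / (t\<^sup>2 + y\<^sup>2) \<partial>\<mu>)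
        (y * (\<integral>t. 1 / (1 + t\<^sup>2) ^ (\<kappa> + 1) / (t\<^sup>2 + y\<^sup>2) \<partial>\<mu>)))" unfolding re complex.sel .
    have "Im (\<integral>t. ?g t \<partial>\<mu>) = (\<integral>t. Im (?g t) \<partial>\<mu>)" by (rule integral_Im[symmetric, OF I])
    then show "Im (\<integral>t. ?g t \<partial>\<mu>) = Im (Complex (\<integral>t. t / (1 + t\<^sup>2) ^ (\<kappa> + 1) / (t\<^sup>2 + y\<^sup>2) \<partial>\<mu>)
        (y * (\<integral>t. 1 / (1 + t\<^sup>2) ^ (\<kappa> + 1) / (t\<^sup>2 + y\<^sup>2) \<partial>\<mu>)))"
      unfolding im complex.sel Bochner_Integration.integral_mult_right_zero .
  qed
  moreover have "(1 + (\<i> * complex_of_real y)\<^sup>2) ^ (\<kappa> + 1) = of_real ((1 - y\<^sup>2) ^ (\<kappa> + 1))"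
    by (simp add: power_mult_distrib)
  ultimately show "C_transform \<kappa> \<mu> p (\<i> * of_real y) = poly (map_poly complex_of_real p) (\<i> * of_real y) +
      Complex ((1 - y\<^sup>2) ^ (\<kappa> + 1) * (\<integral>t. t / (1 + t\<^sup>2) ^ (\<kappa> + 1) / (t\<^sup>2 + y\<^sup>2) \<partial>\<mu>))
        (y * ((1 - y\<^sup>2) ^ (\<kappa> + 1) * (\<integral>t. 1 / (1 + t\<^sup>2) ^ (\<kappa> + 1) / (t\<^sup>2 + y\<^sup>2) \<partial>\<mu>)))"
    unfolding C_transform_def w_def by (simp add: complex_eq_iff)
qed

text \<open>Differencing acts under the integral sign, so a polynomial in front of a Stieltjes
  transform ends up inside, evaluated at the pole \<open>- \<tau> t\<close>. It is applied to the
  weighted measure \<mu> and to Lebesgue measure.\<close>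

lemma divdiff_stieltjes:
  fixes a \<tau> :: "'a \<Rightarrow> real"
  assumes "distinct (s # us)" "\<And>v. v \<in> insert s (set us) \<Longrightarrow> v > 0" "\<And>t. \<tau> t \<ge> 0"
    and "degree P \<le> length us"
    and int: "\<And>v. v > 0 \<Longrightarrow> integrable m (\<lambda>t. a t / (\<tau> t + v))"
  shows "integrable m (\<lambda>t. a t * poly P (- \<tau> t) * (1 / ((\<tau> t + s) * (\<Prod>u\<leftarrow>us. \<tau> t + u))))"
    and "divdiff us (\<lambda>v. poly P v * (\<integral>t. a t / (\<tau> t + v) \<partial>m)) s
        = (\<integral>t. a t * poly P (- \<tau> t) * (1 / ((\<tau> t + s) * (\<Prod>u\<leftarrow>us. \<tau> t + u))) \<partial>m)"
proof -
  let ?K = "\<lambda>t v. a t * (poly P v / (\<tau> t + v))"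
  have I: "integrable m (\<lambda>t. ?K t v)" if "v \<in> insert s (set us)" for v
    using integrable_mult_right[of "poly P v", OF int[OF assms(2)[OF that]]] by (simp add: mult_ac)
  have eq: "divdiff us (?K t) s = a t * poly P (- \<tau> t) * (1 / ((\<tau> t + s) * (\<Prod>u\<leftarrow>us. \<tau> t + u)))" for t
  proof -
    have "\<tau> t + v \<noteq> 0" if "v \<in> insert s (set us)" for v
      using assms(2)[OF that] assms(3)[of t] by linarith
    then show ?thesis
      by (subst divdiff_cmult, subst divdiff_poly_resolvent[OF assms(1) _ assms(4)]) auto
  qed
  have *: "divdiff us (\<lambda>v. poly P v * (\<integral>t. a t / (\<tau> t + v) \<partial>m)) s = divdiff us (\<lambda>v. \<integral>t. ?K t v \<partial>m) s"
    by (intro divdiff_cong) (simp add: mult_ac flip: Bochner_Integration.integral_mult_right_zero)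
  show "integrable m (\<lambda>t. a t * poly P (- \<tau> t) * (1 / ((\<tau> t + s) * (\<Prod>u\<leftarrow>us. \<tau> t + u))))"
    using divdiff_integral(1)[where K = ?K and s = s and us = us, OF I] unfolding eq .
  show "divdiff us (\<lambda>v. poly P v * (\<integral>t. a t / (\<tau> t + v) \<partial>m)) s
        = (\<integral>t. a t * poly P (- \<tau> t) * (1 / ((\<tau> t + s) * (\<Prod>u\<leftarrow>us. \<tau> t + u))) \<partial>m)"
    using divdiff_integral(2)[where K = ?K and s = s and us = us, OF I] unfolding eq * .
qed

text \<open>What \<open>divdiff\<close> makes of \<open>1 / (t^2 + v)\<close>. The node
  \<open>s\<close> is kept apart from \<open>us\<close> because it is the point of evaluation
  there.\<close>

definition pole_kernel :: "real \<Rightarrow> real list \<Rightarrow> real \<Rightarrow> real" where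
  "pole_kernel s us t = 1 / ((t\<^sup>2 + s) * (\<Prod>u\<leftarrow>us. t\<^sup>2 + u))"

lemma measurable_pole_kernel [measurable]: "pole_kernel s us \<in> borel_measurable borel"
proof -
  have [measurable]: "(\<lambda>t. \<Prod>u\<leftarrow>us. t\<^sup>2 + u) \<in> borel_measurable (borel :: real measure)"
    by (induction us) auto
  show ?thesis unfolding pole_kernel_def[abs_def] by measurable
qed

text \<open>Presents \<open>1 / sqrt v\<close>, up to the factor pi, as the Stieltjes transform of
  Lebesgue measure; this is how the limiting measure is identified.\<close>

lemma integral_inverse_quadratic:
  fixes s :: real
  assumes "s > 0"
  shows "integrable lborel (\<lambda>t. 1 / (t\<^sup>2 + s))" "(\<integral>t. 1 / (t\<^sup>2 + s) \<partial>lborel) = pi / sqrt s"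
proof -
  have s: "sqrt s > 0" "sqrt s * sqrt s = s" using assms by auto
  define F where "F t = arctan (t / sqrt s) / sqrt s" for t
  have D: "DERIV F t :> 1 / (t\<^sup>2 + s)" for t
  proof -
    have "DERIV F t :> (1 / (1 + (t / sqrt s)\<^sup>2)) * (1 / sqrt s) / sqrt s"
      unfolding F_def using s by (auto intro!: derivative_eq_intros simp: divide_simps)
    moreover have "(1 / (1 + (t / sqrt s)\<^sup>2)) * (1 / sqrt s) / sqrt s = 1 / (t\<^sup>2 + s)"
    proof -
      have "(1 / (1 + (t / sqrt s)\<^sup>2)) * (1 / sqrt s) / sqrt s = 1 / ((1 + t\<^sup>2 / s) * (sqrt s * sqrt s))"
        using assms by (simp add: power_divide mult_ac)
      also have "(1 + t\<^sup>2 / s) * (sqrt s * sqrt s) = t\<^sup>2 + s" using assms s(2) by (simp add: distrib_right)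
      finally show ?thesis .
    qed
    ultimately show ?thesis by simp
  qed
  have ti: "filterlim (\<lambda>t. t / sqrt s) at_top at_top" "filterlim (\<lambda>t. t / sqrt s) at_bot at_bot"
    using s by (auto intro!: filterlim_tendsto_pos_mult_at_top filterlim_tendsto_pos_mult_at_bot filterlim_ident
      simp: divide_inverse mult.commute[of _ "inverse _"])
  have top: "(F \<longlongrightarrow> (pi / 2) / sqrt s) at_top" unfolding F_def
    by (intro tendsto_divide tendsto_const filterlim_compose[OF tendsto_arctan_at_top ti(1)]) (use s in auto)
  have bot: "(F \<longlongrightarrow> (- (pi / 2)) / sqrt s) at_bot" unfolding F_def
    by (intro tendsto_divide tendsto_const filterlim_compose[OF tendsto_arctan_at_bot ti(2)]) (use s in auto)
  have pos: "t\<^sup>2 + s > 0" for t using assms by (simp add: add_nonneg_pos)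
  have c: "isCont (\<lambda>t. 1 / (t\<^sup>2 + s)) t" for t using pos[of t] by (auto intro!: continuous_intros)
  have b: "((F \<circ> real_of_ereal) \<longlongrightarrow> (- (pi / 2)) / sqrt s) (at_right (-\<infinity>))"
    "((F \<circ> real_of_ereal) \<longlongrightarrow> (pi / 2) / sqrt s) (at_left \<infinity>)"
    using top bot by (simp_all add: ereal_tendsto_simps)
  have n: "AE t in lborel. -\<infinity> < ereal t \<longrightarrow> ereal t < \<infinity> \<longrightarrow> 0 \<le> 1 / (t\<^sup>2 + s)"
    using pos by (auto simp: less_imp_le)
  have "set_integrable lborel (einterval (-\<infinity>) \<infinity>) (\<lambda>t. 1 / (t\<^sup>2 + s))"
    and "(LBINT t=-\<infinity>..\<infinity>. 1 / (t\<^sup>2 + s)) = (pi / 2) / sqrt s - (- (pi / 2)) / sqrt s"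
    using interval_integral_FTC_nonneg[OF _ D c n b] by auto
  then show "integrable lborel (\<lambda>t. 1 / (t\<^sup>2 + s))" "(\<integral>t. 1 / (t\<^sup>2 + s) \<partial>lborel) = pi / sqrt s"
    by (auto simp: set_integrable_def interval_lebesgue_integral_def set_lebesgue_integral_def)
qed

section \<open>Differenced transforms as integrals against rescaled measures\<close>

definition scaled_measure :: "real measure \<Rightarrow> real \<Rightarrow> real \<Rightarrow> real measure" where
  "scaled_measure \<mu> r c = density (distr \<mu> borel (\<lambda>t. t / r)) (\<lambda>_. ennreal c)"

lemma sets_scaled_measure [simp, measurable_cong]: "sets (scaled_measure \<mu> r c) = sets borel"
  by (simp add: scaled_measure_def)

lemma
  fixes g :: "real \<Rightarrow> real"
  assumes [measurable_cong]: "sets \<mu> = sets borel" and c: "c \<ge> 0" and [measurable]: "g \<in> borel_measurable borel"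
  shows integrable_scaled_measure: "integrable \<mu> (\<lambda>t. g (t / r)) \<Longrightarrow> integrable (scaled_measure \<mu> r c) g"
    and integral_scaled_measure: "(\<integral>t. g t \<partial>scaled_measure \<mu> r c) = c * (\<integral>t. g (t / r) \<partial>\<mu>)"
  using c by (auto simp: scaled_measure_def integrable_density integrable_distr_eq integral_density integral_distr)

lemma measure_scaled_measure:
  assumes [measurable_cong]: "sets \<mu> = sets borel" and c: "c \<ge> 0" and A [measurable]: "A \<in> sets borel"
  shows "measure (scaled_measure \<mu> r c) A = c * measure \<mu> ((\<lambda>t. t / r) -` A)"
proof -
  have sp: "space \<mu> = UNIV" using sets_eq_imp_space_eq[OF assms(1)] by simp
  have "emeasure (scaled_measure \<mu> r c) A = ennreal c * emeasure \<mu> ((\<lambda>t. t / r) -` A)"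
    by (simp add: scaled_measure_def emeasure_density nn_integral_cmult emeasure_distr sp)
  then show ?thesis using c by (simp add: measure_def enn2real_mult)
qed

text \<open>The substitution is \<open>z = i r sqrt v\<close> together with scaling t by r. The
  bound \<open>\<kappa> + 1 \<le> length us\<close> serves two ends: it annihilates the two
  polynomials of degree at most \<kappa> coming from \<open>p\<close>, and it admits the prefactor,
  of degree \<kappa> + 1 in v.\<close>

lemma
  fixes us :: "real list"
  assumes sets [measurable_cong]: "sets \<mu> = sets borel"
    and int: "integrable \<mu> (\<lambda>t. 1 / (1 + t\<^sup>2) ^ (\<kappa> + 1))"
    and p: "degree p \<le> 2 * \<kappa> + 1" and r: "r > 0" and c: "c > 0"
    and us: "distinct (s # us)" "\<And>v. v \<in> insert s (set us) \<Longrightarrow> v > 0" "\<kappa> + 1 \<le> length us"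
  defines "k \<equiv> pole_kernel s us"
  shows integrable_scaled_kernel: "integrable (scaled_measure \<mu> r (1 / (r * c))) k"
    and integrable_scaled_kernel_odd: "integrable (scaled_measure \<mu> r (1 / (r * c))) (\<lambda>t. t * k t)"
    and divdiff_Im_C_transform:
      "divdiff us (\<lambda>v. Im (C_transform \<kappa> \<mu> p (\<i> * of_real (r * sqrt v))) / (sqrt v * c)) s
        = (\<integral>t. k t \<partial>scaled_measure \<mu> r (1 / (r * c)))"
    and divdiff_Re_C_transform:
      "divdiff us (\<lambda>v. Re (C_transform \<kappa> \<mu> p (\<i> * of_real (r * sqrt v))) / c) s
        = (\<integral>t. t * k t \<partial>scaled_measure \<mu> r (1 / (r * c)))"
proof -
  let ?m = "scaled_measure \<mu> r (1 / (r * c))"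
  define w where "w t = 1 / (1 + t\<^sup>2) ^ (\<kappa> + 1)" for t :: real
  have km [measurable]: "k \<in> borel_measurable borel" unfolding k_def by measurable
  obtain P Q where P: "P = 0 \<or> degree P < \<kappa> + 1" and Q: "Q = 0 \<or> degree Q < \<kappa> + 1"
    and PQ: "\<And>y. poly (map_poly complex_of_real p) (\<i> * of_real y) = Complex (poly P (y\<^sup>2)) (y * poly Q (y\<^sup>2))"
    using poly_imaginary_axis[of p "\<kappa> + 1"] p by auto
  \<comment> \<open>The prefactor \<open>(1 + z^2) ^ (\<kappa> + 1)\<close> as a polynomial in v. At
    the pole \<open>v = - ((t / r)^2)\<close> it is the reciprocal of the weight
    \<open>w t\<close>.\<close>
  define R where "R = [:1, - (r\<^sup>2):] ^ (\<kappa> + 1)"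
  have degR: "degree R \<le> length us"
  proof -
    have "degree R \<le> degree [:1, - (r\<^sup>2):] * (\<kappa> + 1)" unfolding R_def by (rule degree_power_le)
    also have "\<dots> \<le> 1 * (\<kappa> + 1)" by (intro mult_right_mono) auto
    finally show ?thesis using us(3) by simp
  qed
  have Rw: "poly R (- ((t / r)\<^sup>2)) * w t = 1" for t
  proof -
    have "1 + t\<^sup>2 \<noteq> 0" using zero_le_power2[of t] by linarith
    moreover have "poly R (- ((t / r)\<^sup>2)) = (1 + t\<^sup>2) ^ (\<kappa> + 1)"
      unfolding R_def poly_power using r by (simp add: power_divide)
    ultimately show ?thesis by (simp only: w_def) simp
  qed
  have kill: "divdiff us (\<lambda>v. poly S (r\<^sup>2 * v)) s = 0" if "S = 0 \<or> degree S < \<kappa> + 1" for S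
  proof -
    have "divdiff us (poly (pcompose S [:0, r\<^sup>2:])) s = 0"
      using that us by (intro divdiff_poly) (auto simp: degree_pcompose)
    moreover have "poly (pcompose S [:0, r\<^sup>2:]) = (\<lambda>v. poly S (r\<^sup>2 * v))"
      by (auto simp: poly_pcompose mult.commute)
    ultimately show ?thesis by simp
  qed
  \<comment> \<open>One computation for both parts: \<open>b t = 1\<close> yields the imaginary
    part, \<open>b t = t\<close> the real part.\<close>
  have gen: "integrable \<mu> (\<lambda>t. b t / r\<^sup>2 * k (t / r))"
     "divdiff us (\<lambda>v. poly R v * (\<integral>t. b t * w t / (t\<^sup>2 + r\<^sup>2 * v) \<partial>\<mu>)) s = (\<integral>t. b t / r\<^sup>2 * k (t / r) \<partial>\<mu>)"
    if b: "\<And>v. v > 0 \<Longrightarrow> integrable \<mu> (\<lambda>t. b t * w t / (t\<^sup>2 + r\<^sup>2 * v))" for b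
  proof -
    have e: "b t * w t / r\<^sup>2 / ((t / r)\<^sup>2 + v) = b t * w t / (t\<^sup>2 + r\<^sup>2 * v)" for t v
      using r by (simp add: field_simps)
    have e2: "b t * w t / r\<^sup>2 * poly R (- ((t / r)\<^sup>2)) * (1 / (((t / r)\<^sup>2 + s) * (\<Prod>u\<leftarrow>us. (t / r)\<^sup>2 + u))) = b t / r\<^sup>2 * k (t / r)" for t
      using Rw[of t] by (simp add: k_def pole_kernel_def mult_ac)
    note * = divdiff_stieltjes[OF us(1,2), of "\<lambda>t. (t / r)\<^sup>2" R \<mu> "\<lambda>t. b t * w t / r\<^sup>2", unfolded e e2, OF _ _ degR b]
    show "integrable \<mu> (\<lambda>t. b t / r\<^sup>2 * k (t / r))" by (rule *(1)) auto
    show "divdiff us (\<lambda>v. poly R v * (\<integral>t. b t * w t / (t\<^sup>2 + r\<^sup>2 * v) \<partial>\<mu>)) s = (\<integral>t. b t / r\<^sup>2 * k (t / r) \<partial>\<mu>)"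
      by (rule *(2)) auto
  qed
  have sq: "(r * sqrt v)\<^sup>2 = r\<^sup>2 * v" "r * sqrt v > 0" if "v > 0" for v
    using that r by (auto simp: power_mult_distrib)
  have I1: "integrable \<mu> (\<lambda>t. 1 * w t / (t\<^sup>2 + r\<^sup>2 * v))" and I2: "integrable \<mu> (\<lambda>t. t * w t / (t\<^sup>2 + r\<^sup>2 * v))" if "v > 0" for v
    using C_transform_imaginary_axis(1,2)[OF sets int sq(2)[OF that]] by (simp_all add: w_def sq(1)[OF that])
  have CT: "C_transform \<kappa> \<mu> p (\<i> * of_real (r * sqrt v)) =
      Complex (poly P (r\<^sup>2 * v) + poly R v * (\<integral>t. t * w t / (t\<^sup>2 + r\<^sup>2 * v) \<partial>\<mu>))
        (r * sqrt v * (poly Q (r\<^sup>2 * v) + poly R v * (\<integral>t. 1 * w t / (t\<^sup>2 + r\<^sup>2 * v) \<partial>\<mu>)))" if "v > 0" for v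
    unfolding C_transform_imaginary_axis(3)[OF sets int sq(2)[OF that]] PQ sq(1)[OF that]
    by (simp add: complex_eq_iff w_def R_def poly_power algebra_simps)
  have i: "integrable \<mu> (\<lambda>t. k (t / r))" "integrable \<mu> (\<lambda>t. t / r * k (t / r))"
    using integrable_mult_right[of "r\<^sup>2", OF gen(1)[OF I1]] integrable_mult_right[of r, OF gen(1)[OF I2]] r
    by (simp_all add: power2_eq_square)
  show "integrable ?m k" by (rule integrable_scaled_measure) (use sets r c i in auto)
  show "integrable ?m (\<lambda>t. t * k t)" by (rule integrable_scaled_measure) (use sets r c i in auto)
  have "divdiff us (\<lambda>v. Im (C_transform \<kappa> \<mu> p (\<i> * of_real (r * sqrt v))) / (sqrt v * c)) s
     = divdiff us (\<lambda>v. r / c * (poly Q (r\<^sup>2 * v) + poly R v * (\<integral>t. 1 * w t / (t\<^sup>2 + r\<^sup>2 * v) \<partial>\<mu>))) s"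
    using us(2) by (intro divdiff_cong, subst CT) (auto simp: divide_simps)
  also have "\<dots> = r / c * (\<integral>t. 1 / r\<^sup>2 * k (t / r) \<partial>\<mu>)"
    by (simp only: divdiff_cmult divdiff_add kill[OF Q] gen(2)[OF I1] add_0)
  also have "\<dots> = (\<integral>t. k t \<partial>?m)"
    using r c by (subst integral_scaled_measure[OF sets]) (auto simp: power2_eq_square)
  finally show "divdiff us (\<lambda>v. Im (C_transform \<kappa> \<mu> p (\<i> * of_real (r * sqrt v))) / (sqrt v * c)) s = (\<integral>t. k t \<partial>?m)" .
  have "divdiff us (\<lambda>v. Re (C_transform \<kappa> \<mu> p (\<i> * of_real (r * sqrt v))) / c) s
     = divdiff us (\<lambda>v. 1 / c * (poly P (r\<^sup>2 * v) + poly R v * (\<integral>t. t * w t / (t\<^sup>2 + r\<^sup>2 * v) \<partial>\<mu>))) s"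
    using us(2) by (intro divdiff_cong, subst CT) auto
  also have "\<dots> = 1 / c * (\<integral>t. t / r\<^sup>2 * k (t / r) \<partial>\<mu>)"
    by (simp only: divdiff_cmult divdiff_add kill[OF P] gen(2)[OF I2] add_0)
  also have "\<dots> = 1 / c * (1 / r * (\<integral>t. t / r * k (t / r) \<partial>\<mu>))"
    by (subst Bochner_Integration.integral_mult_right_zero[symmetric]) (simp add: power2_eq_square)
  also have "\<dots> = (\<integral>t. t * k t \<partial>?m)"
    using r c by (subst integral_scaled_measure[OF sets]) (auto simp: mult_ac)
  finally show "divdiff us (\<lambda>v. Re (C_transform \<kappa> \<mu> p (\<i> * of_real (r * sqrt v))) / c) s = (\<integral>t. t * k t \<partial>?m)" .
qed

section \<open>From simple poles to a multiple pole\<close>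

text \<open>Each factor satisfies
  \<open>1 + \<tau> \<le> \<tau> + u \<le> (1 + \<eta>) (1 + \<tau>)\<close>. The comparison is
  multiplicative and hence uniform in \<tau>, so it survives integration over unbounded t.\<close>

lemma prod_list_shift_bounds:
  fixes \<tau> :: real
  assumes "\<tau> \<ge> 0" "\<eta> \<ge> 0" "\<And>u. u \<in> set us \<Longrightarrow> 1 \<le> u \<and> u \<le> 1 + \<eta>"
  shows "(1 + \<tau>) ^ length us \<le> (\<Prod>u\<leftarrow>us. \<tau> + u)" "(\<Prod>u\<leftarrow>us. \<tau> + u) \<le> (1 + \<eta>) ^ length us * (1 + \<tau>) ^ length us"
proof -
  have "(1 + \<tau>) ^ length us \<le> (\<Prod>u\<leftarrow>us. \<tau> + u) \<and> (\<Prod>u\<leftarrow>us. \<tau> + u) \<le> ((1 + \<eta>) * (1 + \<tau>)) ^ length us"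
    using assms(3)
  proof (induction us)
    case (Cons u us)
    have u: "1 \<le> u" "u \<le> 1 + \<eta>" using Cons.prems[of u] by auto
    have IH: "(1 + \<tau>) ^ length us \<le> (\<Prod>u\<leftarrow>us. \<tau> + u)" "(\<Prod>u\<leftarrow>us. \<tau> + u) \<le> ((1 + \<eta>) * (1 + \<tau>)) ^ length us"
      using Cons by auto
    have "0 \<le> (1 + \<tau>) ^ length us" using assms by simp
    then have p0: "0 \<le> (\<Prod>u\<leftarrow>us. \<tau> + u)" using IH(1) by linarith
    have "\<tau> + u \<le> (1 + \<eta>) * (1 + \<tau>)" 
    proof -
      have "(1 + \<eta>) * (1 + \<tau>) = 1 + \<tau> + \<eta> + \<eta> * \<tau>" by (simp add: algebra_simps)
      then show ?thesis using u mult_nonneg_nonneg[OF assms(2,1)] by linarith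
    qed
    then have "(\<tau> + u) * (\<Prod>u\<leftarrow>us. \<tau> + u) \<le> ((1 + \<eta>) * (1 + \<tau>)) * ((1 + \<eta>) * (1 + \<tau>)) ^ length us"
      using u assms IH(2) p0 by (intro mult_mono) auto
    moreover have "(1 + \<tau>) * (1 + \<tau>) ^ length us \<le> (\<tau> + u) * (\<Prod>u\<leftarrow>us. \<tau> + u)"
      using u assms IH(1) p0 by (intro mult_mono) auto
    ultimately show ?case by simp
  qed simp
  then show "(1 + \<tau>) ^ length us \<le> (\<Prod>u\<leftarrow>us. \<tau> + u)" "(\<Prod>u\<leftarrow>us. \<tau> + u) \<le> (1 + \<eta>) ^ length us * (1 + \<tau>) ^ length us"
    by (auto simp: power_mult_distrib)
qed

text \<open>Letting the nodes collapse to \<open>1\<close> turns the distinct simple poles into one multiple pole.\<close>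

lemma coalescing_nodes:
  fixes m :: "'i \<Rightarrow> real measure"
  assumes sets [measurable_cong]: "\<And>r. sets (m r) = sets borel" "sets \<sigma> = sets borel"
    and int: "\<forall>s us. distinct (s # us) \<and> (\<forall>v\<in>insert s (set us). v > 0) \<and> K \<le> length us
        \<longrightarrow> (\<forall>\<^sub>F r in F. integrable (m r) (pole_kernel s us)) \<and> integrable \<sigma> (pole_kernel s us)
          \<and> ((\<lambda>r. \<integral>t. pole_kernel s us t \<partial>m r) \<longlongrightarrow> (\<integral>t. pole_kernel s us t \<partial>\<sigma>)) F"
    and n: "n \<ge> K + 1"
  shows "\<forall>\<^sub>F r in F. integrable (m r) (\<lambda>t. 1 / (1 + t\<^sup>2) ^ n)"
    and "integrable \<sigma> (\<lambda>t. 1 / (1 + t\<^sup>2) ^ n)"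
    and "((\<lambda>r. \<integral>t. 1 / (1 + t\<^sup>2) ^ n \<partial>m r) \<longlongrightarrow> (\<integral>t. 1 / (1 + t\<^sup>2) ^ n \<partial>\<sigma>)) F"
    and "\<And>\<eta>. \<eta> > 0 \<Longrightarrow> \<exists>s us. distinct (s # us) \<and> (\<forall>v\<in>insert s (set us). v > 0) \<and> length us = n - 1 \<and>
       (\<forall>t. 0 \<le> pole_kernel s us t \<and> pole_kernel s us t \<le> 1 / (1 + t\<^sup>2) ^ n \<and> 1 / (1 + t\<^sup>2) ^ n \<le> (1 + \<eta>) ^ n * pole_kernel s us t)"
proof -
  let ?x = "\<lambda>t::real. 1 / (1 + t\<^sup>2) ^ n"
  have nodes: "\<exists>s us. distinct (s # us) \<and> (\<forall>v\<in>insert s (set us). v > 0) \<and> length us = n - 1 \<and>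
       (\<forall>t. 0 \<le> pole_kernel s us t \<and> pole_kernel s us t \<le> ?x t \<and> ?x t \<le> (1 + \<eta>) ^ n * pole_kernel s us t)" if \<eta>: "\<eta> > 0" for \<eta> :: real
  proof -
    \<comment> \<open>Equally spaced distinct nodes that start at 1 and stay below
      \<open>1 + \<eta>\<close>.\<close>
    define l where "l = map (\<lambda>j. 1 + \<eta> * real j / real n) [0..<n]"
    have len: "length l = n" by (simp add: l_def)
    obtain s us where l: "l = s # us" using len n by (cases l) auto
    have d: "distinct (s # us)" unfolding l[symmetric] l_def using \<eta> n by (auto simp: distinct_map inj_on_def)
    have b: "1 \<le> u \<and> u \<le> 1 + \<eta>" if "u \<in> set (s # us)" for u
    proof -
      obtain j where j: "j < n" "u = 1 + \<eta> * real j / real n" using \<open>u \<in> set (s # us)\<close> unfolding l[symmetric] l_def by auto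
      have "\<eta> * (real j / real n) \<le> \<eta> * 1" using \<eta> j by (intro mult_left_mono) auto
      then show ?thesis using j \<eta> by simp
    qed
    have pos: "\<forall>v\<in>insert s (set us). v > 0" using b by force
    have keq: "pole_kernel s us t = 1 / (\<Prod>u\<leftarrow>l. t\<^sup>2 + u)" for t by (simp add: pole_kernel_def l)
    have "0 \<le> pole_kernel s us t \<and> pole_kernel s us t \<le> ?x t \<and> ?x t \<le> (1 + \<eta>) ^ n * pole_kernel s us t" for t
    proof -
      have p: "(1 + t\<^sup>2) ^ n > 0" by (simp add: add_pos_nonneg)
      have B: "(1 + t\<^sup>2) ^ n \<le> (\<Prod>u\<leftarrow>l. t\<^sup>2 + u)" "(\<Prod>u\<leftarrow>l. t\<^sup>2 + u) \<le> (1 + \<eta>) ^ n * (1 + t\<^sup>2) ^ n"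
        using prod_list_shift_bounds[of "t\<^sup>2" \<eta> l] b \<eta> len by (auto simp: l)
      then have "0 < (\<Prod>u\<leftarrow>l. t\<^sup>2 + u)" using p by linarith
      then show ?thesis unfolding keq using p B by (auto simp: divide_simps mult.commute)
    qed
    moreover have "length us = n - 1" using len l by auto
    ultimately show ?thesis using d pos by blast
  qed
  show "\<And>\<eta>. \<eta> > 0 \<Longrightarrow> \<exists>s us. distinct (s # us) \<and> (\<forall>v\<in>insert s (set us). v > 0) \<and> length us = n - 1 \<and>
       (\<forall>t. 0 \<le> pole_kernel s us t \<and> pole_kernel s us t \<le> ?x t \<and> ?x t \<le> (1 + \<eta>) ^ n * pole_kernel s us t)" by (rule nodes)
  have intx: "integrable M ?x" if [measurable_cong]: "sets M = sets borel" and i: "integrable M (pole_kernel s us)"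
    and b: "\<And>t. ?x t \<le> C * pole_kernel s us t" for M s us C
  proof (rule integrable_bounded_by)
    show "integrable M (\<lambda>t. C * pole_kernel s us t)" by (rule integrable_mult_right, rule i)
    show "norm (?x t) \<le> C * pole_kernel s us t" for t using b[of t] zero_le_power2[of t] by simp
  qed measurable
  \<comment> \<open>For integrability a fixed \<eta> is enough; here it is 1.\<close>
  obtain s us where su: "distinct (s # us)" "\<forall>v\<in>insert s (set us). v > 0" "length us = n - 1"
    "\<And>t. ?x t \<le> (1 + 1) ^ n * pole_kernel s us t" using nodes[of 1] by auto
  have len: "K \<le> length us" using su(3) n by simp
  show ix: "\<forall>\<^sub>F r in F. integrable (m r) ?x"
  proof -
    have "\<forall>\<^sub>F r in F. integrable (m r) (pole_kernel s us)" using int su(1,2) len by blast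
    then show ?thesis by eventually_elim (rule intx[OF sets(1) _ su(4)])
  qed
  show ix2: "integrable \<sigma> ?x"
    using int su(1,2) len by (intro intx[OF sets(2) _ su(4)]) blast
  show "((\<lambda>r. \<integral>t. ?x t \<partial>m r) \<longlongrightarrow> (\<integral>t. ?x t \<partial>\<sigma>)) F"
  proof (rule order_tendstoI)
    fix y assume y: "y < (\<integral>t. ?x t \<partial>\<sigma>)"
    \<comment> \<open>The multiple pole and the kernel with nearby nodes differ by a factor between
      1 and \<open>(1 + \<eta>) ^ n\<close>. A small \<eta> fits into the strict inequality, and
      convergence at distinct nodes carries the inequality over to \<open>m r\<close>.\<close>
    have "((\<lambda>\<eta>. (\<integral>t. ?x t \<partial>\<sigma>) / (1 + \<eta>) ^ n) \<longlongrightarrow> (\<integral>t. ?x t \<partial>\<sigma>) / (1 + 0) ^ n) (at_right 0)"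
      by (intro tendsto_intros) auto
    then have "\<forall>\<^sub>F \<eta> in at_right 0. y < (\<integral>t. ?x t \<partial>\<sigma>) / (1 + \<eta>) ^ n" using y by (intro order_tendstoD) auto
    then have "\<forall>\<^sub>F \<eta> in at_right 0. y < (\<integral>t. ?x t \<partial>\<sigma>) / (1 + \<eta>) ^ n \<and> \<eta> > 0"
      using eventually_at_right_less[of 0] by eventually_elim auto
    then obtain \<eta> where \<eta>: "y < (\<integral>t. ?x t \<partial>\<sigma>) / (1 + \<eta>) ^ n" "\<eta> > 0"
      using eventually_happens'[of "at_right (0::real)"] trivial_limit_at_right_real by blast
    obtain s us where su: "distinct (s # us)" "\<forall>v\<in>insert s (set us). v > 0" "length us = n - 1"
      "\<And>t. pole_kernel s us t \<le> ?x t" "\<And>t. ?x t \<le> (1 + \<eta>) ^ n * pole_kernel s us t" using nodes[OF \<eta>(2)] by blast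
    have len: "K \<le> length us" using su(3) n by simp
    have I: "\<forall>\<^sub>F r in F. integrable (m r) (pole_kernel s us)" "integrable \<sigma> (pole_kernel s us)" "((\<lambda>r. \<integral>t. pole_kernel s us t \<partial>m r) \<longlongrightarrow> (\<integral>t. pole_kernel s us t \<partial>\<sigma>)) F"
      using int su(1,2) len by blast+
    have "(\<integral>t. ?x t \<partial>\<sigma>) \<le> (\<integral>t. (1 + \<eta>) ^ n * pole_kernel s us t \<partial>\<sigma>)"
      by (intro integral_mono ix2 su(5) integrable_mult_right, rule I(2))
    then have "(\<integral>t. ?x t \<partial>\<sigma>) / (1 + \<eta>) ^ n \<le> (\<integral>t. pole_kernel s us t \<partial>\<sigma>)"
      using \<eta>(2) by (subst pos_divide_le_eq) (auto simp: mult.commute)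
    then have "y < (\<integral>t. pole_kernel s us t \<partial>\<sigma>)" using \<eta> by linarith
    from order_tendstoD(1)[OF I(3) this] I(1) ix
    show "\<forall>\<^sub>F r in F. y < (\<integral>t. ?x t \<partial>m r)"
    proof eventually_elim
      case (elim r)
      have "(\<integral>t. pole_kernel s us t \<partial>m r) \<le> (\<integral>t. ?x t \<partial>m r)" by (intro integral_mono elim su(4))
      then show ?case using elim(1) by linarith
    qed
  next
    fix y assume y: "y > (\<integral>t. ?x t \<partial>\<sigma>)"
    have "((\<lambda>\<eta>. (1 + \<eta>) ^ n * (\<integral>t. ?x t \<partial>\<sigma>)) \<longlongrightarrow> (1 + 0) ^ n * (\<integral>t. ?x t \<partial>\<sigma>)) (at_right 0)"
      by (intro tendsto_intros)
    then have "\<forall>\<^sub>F \<eta> in at_right 0. y > (1 + \<eta>) ^ n * (\<integral>t. ?x t \<partial>\<sigma>)" using y by (intro order_tendstoD) auto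
    then have "\<forall>\<^sub>F \<eta> in at_right 0. y > (1 + \<eta>) ^ n * (\<integral>t. ?x t \<partial>\<sigma>) \<and> \<eta> > 0"
      using eventually_at_right_less[of 0] by eventually_elim auto
    then obtain \<eta> where \<eta>: "y > (1 + \<eta>) ^ n * (\<integral>t. ?x t \<partial>\<sigma>)" "\<eta> > 0"
      using eventually_happens'[of "at_right (0::real)"] trivial_limit_at_right_real by blast
    obtain s us where su: "distinct (s # us)" "\<forall>v\<in>insert s (set us). v > 0" "length us = n - 1"
      "\<And>t. pole_kernel s us t \<le> ?x t" "\<And>t. ?x t \<le> (1 + \<eta>) ^ n * pole_kernel s us t" using nodes[OF \<eta>(2)] by blast
    have len: "K \<le> length us" using su(3) n by simp
    have I: "\<forall>\<^sub>F r in F. integrable (m r) (pole_kernel s us)" "integrable \<sigma> (pole_kernel s us)" "((\<lambda>r. \<integral>t. pole_kernel s us t \<partial>m r) \<longlongrightarrow> (\<integral>t. pole_kernel s us t \<partial>\<sigma>)) F"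
      using int su(1,2) len by blast+
    have "(1 + \<eta>) ^ n * (\<integral>t. pole_kernel s us t \<partial>\<sigma>) \<le> (1 + \<eta>) ^ n * (\<integral>t. ?x t \<partial>\<sigma>)"
      using \<eta> by (intro mult_left_mono integral_mono ix2 su(4) I(2)) auto
    then have "(1 + \<eta>) ^ n * (\<integral>t. pole_kernel s us t \<partial>\<sigma>) < y" using \<eta> by linarith
    from order_tendstoD(2)[OF tendsto_mult[OF tendsto_const I(3)] this] I(1) ix
    show "\<forall>\<^sub>F r in F. y > (\<integral>t. ?x t \<partial>m r)"
    proof eventually_elim
      case (elim r)
      have "(\<integral>t. ?x t \<partial>m r) \<le> (\<integral>t. (1 + \<eta>) ^ n * pole_kernel s us t \<partial>m r)"
        by (rule integral_mono[OF elim(3) integrable_mult_right[OF elim(2)] su(5)])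
      then show ?case using elim(1) by simp
    qed
  qed
qed

text \<open>The odd integrand changes sign, so a sandwich is impossible and the error is estimated
  absolutely: \<open>|t| \<le> 1 + t^2\<close> trades one power of \<open>1 / (1 + t^2)\<close> for
  the factor t and leaves a small multiple of an even integral, whose values are eventually
  bounded.\<close>

lemma coalescing_nodes_odd:
  fixes m :: "'i \<Rightarrow> real measure"
  assumes sets [measurable_cong]: "\<And>r. sets (m r) = sets borel" "sets \<sigma> = sets borel"
    and int: "\<forall>s us. distinct (s # us) \<and> (\<forall>v\<in>insert s (set us). v > 0) \<and> K \<le> length us
        \<longrightarrow> (\<forall>\<^sub>F r in F. integrable (m r) (pole_kernel s us)) \<and> integrable \<sigma> (pole_kernel s us)
          \<and> ((\<lambda>r. \<integral>t. pole_kernel s us t \<partial>m r) \<longlongrightarrow> (\<integral>t. pole_kernel s us t \<partial>\<sigma>)) F"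
    and odd: "\<forall>s us. distinct (s # us) \<and> (\<forall>v\<in>insert s (set us). v > 0) \<and> K \<le> length us
        \<longrightarrow> (\<forall>\<^sub>F r in F. integrable (m r) (\<lambda>t. t * pole_kernel s us t)) \<and> ((\<lambda>r. \<integral>t. t * pole_kernel s us t \<partial>m r) \<longlongrightarrow> 0) F"
    and n: "n \<ge> K + 1"
  shows "((\<lambda>r. \<integral>t. t / (1 + t\<^sup>2) * (1 / (1 + t\<^sup>2) ^ n) \<partial>m r) \<longlongrightarrow> 0) F"
proof (rule tendstoI)
  fix e :: real assume e: "e > 0"
  let ?x = "\<lambda>n t. 1 / (1 + t\<^sup>2) ^ n :: real"
  note cn = coalescing_nodes[where m = m and F = F and \<sigma> = \<sigma> and K = K, OF sets int]
  have n1: "Suc n \<ge> K + 1" using n by simp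
  define B where "B = (\<integral>t. ?x n t \<partial>\<sigma>) + 1"
  have B: "B > 0" unfolding B_def by (intro add_nonneg_pos integral_nonneg) auto
  \<comment> \<open>\<open>1 - 1 / (1 + \<eta>) ^ Suc n\<close> bounds the relative error of the
    kernel with nodes in [1, 1 + \<eta>] and tends to 0 with \<eta>.\<close>
  have "((\<lambda>\<eta>. (1 - 1 / (1 + \<eta>) ^ Suc n) * B) \<longlongrightarrow> (1 - 1 / (1 + 0) ^ Suc n) * B) (at_right 0)"
    by (intro tendsto_intros) auto
  then have "\<forall>\<^sub>F \<eta> in at_right 0. (1 - 1 / (1 + \<eta>) ^ Suc n) * B < e / 2" using e by (intro order_tendstoD(2)) auto
  then have "\<forall>\<^sub>F \<eta> in at_right 0. (1 - 1 / (1 + \<eta>) ^ Suc n) * B < e / 2 \<and> \<eta> > 0"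
    using eventually_at_right_less[of 0] by eventually_elim auto
  then obtain \<eta> where \<eta>: "(1 - 1 / (1 + \<eta>) ^ Suc n) * B < e / 2" "\<eta> > 0"
    using eventually_happens'[of "at_right (0::real)"] trivial_limit_at_right_real by blast
  obtain s us where su: "distinct (s # us)" "\<forall>v\<in>insert s (set us). v > 0" "length us = Suc n - 1"
    "\<And>t. 0 \<le> pole_kernel s us t" "\<And>t. pole_kernel s us t \<le> ?x (Suc n) t" "\<And>t. ?x (Suc n) t \<le> (1 + \<eta>) ^ Suc n * pole_kernel s us t"
    using cn(4)[OF n1 \<eta>(2)] by blast
  have len: "K \<le> length us" using su(3) n by simp
  have O: "\<forall>\<^sub>F r in F. integrable (m r) (\<lambda>t. t * pole_kernel s us t)" "((\<lambda>r. \<integral>t. t * pole_kernel s us t \<partial>m r) \<longlongrightarrow> 0) F"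
    using odd su(1,2) len by blast+
  have ev: "\<forall>\<^sub>F r in F. (\<integral>t. ?x n t \<partial>m r) < B"
    by (rule order_tendstoD(2)[OF cn(3)[OF n]]) (auto simp: B_def)
  have ev2: "\<forall>\<^sub>F r in F. \<bar>\<integral>t. t * pole_kernel s us t \<partial>m r\<bar> < e / 2"
    using tendstoD[OF O(2), of "e/2"] e by simp
  show "\<forall>\<^sub>F r in F. dist (\<integral>t. t / (1 + t\<^sup>2) * (1 / (1 + t\<^sup>2) ^ n) \<partial>m r) 0 < e"
    using ev ev2 O(1) cn(1)[OF n]
  proof eventually_elim
    case (elim r)
    define c where "c = 1 - 1 / (1 + \<eta>) ^ Suc n"
    have c: "c \<ge> 0" using \<eta> by (simp add: c_def divide_le_eq_1 one_le_power del: power_Suc)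
    have tk: "norm (t * ?x (Suc n) t - t * pole_kernel s us t) \<le> c * ?x n t" for t
    proof -
      have p: "1 + t\<^sup>2 > 0" using zero_le_power2[of t] by linarith
      have "0 \<le> (\<bar>t\<bar> - 1)\<^sup>2" by simp
      then have t: "\<bar>t\<bar> \<le> 1 + t\<^sup>2" by (simp add: power2_diff)
      have "?x (Suc n) t / (1 + \<eta>) ^ Suc n \<le> pole_kernel s us t" using su(6)[of t] \<eta>(2)
        by (subst pos_divide_le_eq) (auto simp: mult.commute simp del: power_Suc)
      moreover have "(1 - 1 / (1 + \<eta>) ^ Suc n) * ?x (Suc n) t = ?x (Suc n) t - ?x (Suc n) t / (1 + \<eta>) ^ Suc n"
        by (simp only: left_diff_distrib mult_1 times_divide_eq_left)
      ultimately have "?x (Suc n) t - pole_kernel s us t \<le> c * ?x (Suc n) t" unfolding c_def by linarith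
      then have "\<bar>t\<bar> * (?x (Suc n) t - pole_kernel s us t) \<le> (1 + t\<^sup>2) * (c * ?x (Suc n) t)"
        using su(5)[of t] t p by (intro mult_mono) auto
      also have "\<dots> = c * ?x n t" using p by simp
      finally show ?thesis
        unfolding right_diff_distrib[symmetric] real_norm_def abs_mult using su(5)[of t] by simp
    qed
    have I1: "integrable (m r) (\<lambda>t. t * ?x (Suc n) t - t * pole_kernel s us t)"
    proof (rule integrable_bounded_by[OF _ _ tk])
      show "integrable (m r) (\<lambda>t. c * ?x n t)" by (rule integrable_mult_right, rule elim(4))
    qed measurable
    have I2: "integrable (m r) (\<lambda>t. t * ?x (Suc n) t)"
      using Bochner_Integration.integrable_add[OF I1 elim(3)] by simp
    have "norm (\<integral>t. t * ?x (Suc n) t - t * pole_kernel s us t \<partial>m r) \<le> (\<integral>t. c * ?x n t \<partial>m r)"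
      using I1 tk by (intro Bochner_Integration.integral_norm_bound_integral integrable_mult_right elim(4)) auto
    also have "\<dots> = c * (\<integral>t. ?x n t \<partial>m r)" by (rule Bochner_Integration.integral_mult_right_zero)
    also have "\<dots> \<le> c * B" using c elim(1) by (intro mult_left_mono) auto
    also have "\<dots> < e / 2" using \<eta>(1) by (simp add: c_def)
    finally have "norm ((\<integral>t. t * ?x (Suc n) t \<partial>m r) - (\<integral>t. t * pole_kernel s us t \<partial>m r)) < e / 2"
      using I2 elim(3) by (simp add: Bochner_Integration.integral_diff)
    moreover have "(\<integral>t. t / (1 + t\<^sup>2) * (1 / (1 + t\<^sup>2) ^ n) \<partial>m r) = (\<integral>t. t * ?x (Suc n) t \<partial>m r)"
      by simp
    ultimately show ?case using elim(2) unfolding dist_norm real_norm_def diff_0_right by linarith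
  qed
qed

section \<open>The limiting measure and the Tauberian theorem\<close>

lemma measure_power_density:
  assumes "C \<ge> 0" "a > 0"
  shows "measure (density lborel (\<lambda>t. ennreal (C * t ^ (2 * n)))) {-a<..<a} = 2 * C * a ^ (2 * n + 1) / (2 * n + 1)"
proof -
  define F where "F t = C / (2 * n + 1) * t ^ Suc (2 * n)" for t :: real
  have nz: "(2 * real n + 1) \<noteq> 0" by (simp add: add_nonneg_eq_0_iff)
  have D: "DERIV F t :> C * t ^ (2 * n)" for t
    using DERIV_cmult[OF DERIV_pow[of "Suc (2 * n)" t], of "C / (2 * n + 1)"] nz
    unfolding F_def[abs_def] by (simp add: add.commute)
  have "emeasure (density lborel (\<lambda>t. ennreal (C * t ^ (2 * n)))) {-a<..<a}
     = (\<integral>\<^sup>+ t. ennreal (C * t ^ (2 * n)) * indicator {-a<..<a} t \<partial>lborel)"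
    by (subst emeasure_density) auto
  also have "\<dots> = (\<integral>\<^sup>+ t. ennreal (C * t ^ (2 * n)) * indicator {-a..a} t \<partial>lborel)"
    by (intro nn_integral_cong_AE) (use AE_lborel_singleton[of a] AE_lborel_singleton[of "-a"] in eventually_elim, auto simp: indicator_def)
  also have "\<dots> = ennreal (F a - F (-a))"
    by (rule nn_integral_FTC_Icc) (use D assms in auto)
  also have "F a - F (-a) = 2 * C * a ^ (2 * n + 1) / (2 * n + 1)"
  proof -
    have "F (-a) = - F a" by (simp add: F_def)
    then show ?thesis by (simp add: F_def)
  qed
  finally show ?thesis using assms by (simp add: measure_def)
qed

text \<open>Up to a constant, \<open>v ^ n / sqrt v\<close> is \<open>v ^ n\<close> times the
  Stieltjes transform of Lebesgue measure. At the pole \<open>v = - (t^2)\<close> the polynomial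
  becomes \<open>(-1) ^ n * t ^ (2 * n)\<close>: the origin of both the sign in \<omega> and the
  limiting density.\<close>

lemma
  fixes us :: "real list"
  assumes "distinct (s # us)" "\<forall>v\<in>insert s (set us). v > 0" "n \<le> length us"
  shows integrable_power_pole_kernel: "integrable lborel (\<lambda>t. t ^ (2 * n) * pole_kernel s us t)"
    and divdiff_power_sqrt: "divdiff us (\<lambda>v. W * v ^ n / sqrt v) s =
      (-1) ^ n * W / pi * (\<integral>t. t ^ (2 * n) * pole_kernel s us t \<partial>lborel)"
proof -
  let ?P = "monom (1::real) n"
  have P: "degree ?P \<le> length us" using assms(3) degree_monom_le[of "1::real" n] by linarith
  have eq: "1 * poly ?P (- (t\<^sup>2)) * (1 / ((t\<^sup>2 + s) * (\<Prod>u\<leftarrow>us. t\<^sup>2 + u))) = (-1) ^ n * (t ^ (2 * n) * pole_kernel s us t)" for t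
    by (simp add: poly_monom pole_kernel_def power_minus[of "t\<^sup>2"] power_mult)
  note * = divdiff_stieltjes[of s us "\<lambda>t::real. t\<^sup>2" ?P lborel "\<lambda>t. 1", OF assms(1) _ _ P integral_inverse_quadratic(1), unfolded eq]
  have i: "integrable lborel (\<lambda>t. (-1) ^ n * (t ^ (2 * n) * pole_kernel s us t))"
    using assms(2) by (intro *(1)) auto
  show "integrable lborel (\<lambda>t. t ^ (2 * n) * pole_kernel s us t)"
    using integrable_mult_right[of "(-1) ^ n", OF i] by (simp flip: mult.assoc power_mult_distrib)
  have "divdiff us (\<lambda>v. W * v ^ n / sqrt v) s = divdiff us (\<lambda>v. W / pi * (poly ?P v * (\<integral>t. 1 / (t\<^sup>2 + v) \<partial>lborel))) s"
  proof (rule divdiff_cong)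
    fix v assume "v \<in> insert s (set us)"
    then have "v > 0" using assms(2) by blast
    then show "W * v ^ n / sqrt v = W / pi * (poly ?P v * (\<integral>t. 1 / (t\<^sup>2 + v) \<partial>lborel))"
      by (simp add: integral_inverse_quadratic(2) poly_monom)
  qed
  also have "\<dots> = W / pi * (\<integral>t. (-1) ^ n * (t ^ (2 * n) * pole_kernel s us t) \<partial>lborel)"
    using assms(2) by (subst divdiff_cmult, subst *(2)) auto
  also have "\<dots> = (-1) ^ n * W / pi * (\<integral>t. t ^ (2 * n) * pole_kernel s us t \<partial>lborel)" by simp
  finally show "divdiff us (\<lambda>v. W * v ^ n / sqrt v) s =
      (-1) ^ n * W / pi * (\<integral>t. t ^ (2 * n) * pole_kernel s us t \<partial>lborel)" .
qed

lemma pole_kernel_pos: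
  assumes "\<forall>v\<in>insert s (set us). v > 0"
  shows "pole_kernel s us t > 0"
proof -
  have "\<forall>x\<in>set us. t\<^sup>2 + x > 0" using assms by (simp add: add_nonneg_pos)
  then have "(\<Prod>u\<leftarrow>us. t\<^sup>2 + u) > 0" by (induction us) auto
  then show ?thesis using assms by (simp add: pole_kernel_def add_nonneg_pos)
qed

text \<open>Strict positivity is what allows the sign of the limiting density to be read off from
  the nonnegativity of the rescaled integrals.\<close>

lemma integral_power_pole_kernel_pos:
  assumes "distinct (s # us)" "\<forall>v\<in>insert s (set us). v > 0" "n \<le> length us"
  shows "(\<integral>t. t ^ (2 * n) * pole_kernel s us t \<partial>lborel) > 0"
proof -
  note pos = pole_kernel_pos[OF assms(2)]
  have nn: "0 \<le> t ^ (2 * n) * pole_kernel s us t" for t using pos[of t] by (simp add: power_mult less_imp_le)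
  have "(\<integral>t. t ^ (2 * n) * pole_kernel s us t \<partial>lborel) \<noteq> 0"
  proof
    assume "(\<integral>t. t ^ (2 * n) * pole_kernel s us t \<partial>lborel) = 0"
    then have "AE t in lborel. t ^ (2 * n) * pole_kernel s us t = 0"
      using integral_nonneg_eq_0_iff_AE[OF integrable_power_pole_kernel[OF assms]] nn by simp
    with AE_lborel_singleton[of 0] have "AE t in (lborel :: real measure). False"
    proof eventually_elim
      case (elim t)
      then show ?case using pos[of t] by simp
    qed
    then show False by (simp add: eventually_False ae_filter_eq_bot_iff)
  qed
  moreover have "(\<integral>t. t ^ (2 * n) * pole_kernel s us t \<partial>lborel) \<ge> 0" using nn by (intro Bochner_Integration.integral_nonneg) auto
  ultimately show ?thesis by linarith
qed

text \<open>Convergence on the imaginary axis is the only input from the rescaling limit. That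
  \<open>C\<close> is positive is a conclusion: a limit of integrals of positive kernels cannot be
  negative, and \<open>Re \<omega> \<noteq> 0\<close> excludes zero.\<close>

lemma tauberian_rescaling:
  fixes f :: "real \<Rightarrow> real" and \<omega> :: complex
  assumes sets [measurable_cong]: "sets \<mu> = sets borel"
    and int: "integrable \<mu> (\<lambda>t. 1 / (1 + t\<^sup>2) ^ (\<kappa> + 1))"
    and p: "degree p \<le> 2 * \<kappa> + 1" and f: "\<forall>\<^sub>F r in at_top. f r > 0" and \<omega>: "Re \<omega> \<noteq> 0"
    and lim: "\<And>v. v > 0 \<Longrightarrow> ((\<lambda>r. C_transform \<kappa> \<mu> p (\<i> * of_real (r * sqrt v)) / of_real (f r))
        \<longlongrightarrow> \<i> * \<omega> * of_real (sqrt v) ^ (2 * n)) at_top"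
  defines "C \<equiv> (-1) ^ n * Re \<omega> / pi"
  shows "C > 0"
    and "\<And>\<delta>. \<delta> > 0 \<Longrightarrow> ((\<lambda>r. measure \<mu> {-(\<delta> * r)<..<\<delta> * r} / (r * f r)) \<longlongrightarrow> 2 * C * \<delta> ^ (2 * n + 1) / (2 * n + 1)) at_top"
    and "((\<lambda>r. (measure \<mu> {0..<r} - measure \<mu> {-r<..<0}) / (r * f r)) \<longlongrightarrow> 0) at_top"
proof -
  define m where "m r = scaled_measure \<mu> r (1 / (r * f r))" for r
  define \<sigma> where "\<sigma> = density lborel (\<lambda>t. ennreal (C * t ^ (2 * n)))"
  \<comment> \<open>Enough nodes for the transform, which takes \<kappa> + 1 of them, and for the
    annihilation of \<open>v ^ n\<close>.\<close>
  define K where "K = max (\<kappa> + 1) (n + 1)"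
  have pf: "\<forall>\<^sub>F r in at_top. r > 0 \<and> f r > 0" using f eventually_gt_at_top[of 0] by eventually_elim auto
  have sm: "sets (m r) = sets borel" for r by (simp add: m_def)
  have s\<sigma>: "sets \<sigma> = sets borel" by (simp add: \<sigma>_def)
  let ?q = "C_transform \<kappa> \<mu> p"
  have iv: "complex_of_real (sqrt v) ^ (2 * n) = of_real (v ^ n)" if "v > 0" for v
    using that by (simp add: power_mult flip: of_real_power)
  have limIm: "((\<lambda>r. Im (?q (\<i> * of_real (r * sqrt v))) / (sqrt v * f r)) \<longlongrightarrow> Re \<omega> * v ^ n / sqrt v) at_top" if "v > 0" for v
  proof -
    have "((\<lambda>r. Im (?q (\<i> * of_real (r * sqrt v)) / of_real (f r)) / sqrt v) \<longlongrightarrow> Im (\<i> * \<omega> * of_real (v ^ n)) / sqrt v) at_top"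
      using lim[OF that] that unfolding iv[OF that] by (intro tendsto_intros) auto
    then show ?thesis by (simp add: Im_divide_of_real mult.commute)
  qed
  \<comment> \<open>In the limit the real part is a polynomial in v, so \<open>Im \<omega>\<close>
    leaves no trace after differencing and the odd moments tend to 0.\<close>
  have limRe: "((\<lambda>r. Re (?q (\<i> * of_real (r * sqrt v))) / f r) \<longlongrightarrow> poly (monom (- Im \<omega>) n) v) at_top" if "v > 0" for v
  proof -
    have "((\<lambda>r. Re (?q (\<i> * of_real (r * sqrt v)) / of_real (f r))) \<longlongrightarrow> Re (\<i> * \<omega> * of_real (v ^ n))) at_top"
      using lim[OF that] that unfolding iv[OF that] by (intro tendsto_intros) auto
    then show ?thesis by (simp add: Re_divide_of_real poly_monom)
  qed
  have ker: "\<forall>\<^sub>F r in at_top. integrable (m r) (pole_kernel s us)" "\<forall>\<^sub>F r in at_top. integrable (m r) (\<lambda>t. t * pole_kernel s us t)"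
    "((\<lambda>r. \<integral>t. pole_kernel s us t \<partial>m r) \<longlongrightarrow> C * (\<integral>t. t ^ (2 * n) * pole_kernel s us t \<partial>lborel)) at_top"
    "((\<lambda>r. \<integral>t. t * pole_kernel s us t \<partial>m r) \<longlongrightarrow> 0) at_top"
    if su: "distinct (s # us)" "\<forall>v\<in>insert s (set us). v > 0" "K \<le> length us" for s us
  proof -
    have l: "\<kappa> + 1 \<le> length us" "n + 1 \<le> length us" using su(3) by (auto simp: K_def)
    have su2: "\<And>v. v \<in> insert s (set us) \<Longrightarrow> v > 0" using su(2) by blast
    note * = sets int p _ _ su(1) su2 l(1)
    show "\<forall>\<^sub>F r in at_top. integrable (m r) (pole_kernel s us)"
      using pf by eventually_elim (auto simp: m_def intro!: integrable_scaled_kernel[OF *])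
    show "\<forall>\<^sub>F r in at_top. integrable (m r) (\<lambda>t. t * pole_kernel s us t)"
      using pf by eventually_elim (auto simp: m_def intro!: integrable_scaled_kernel_odd[OF *])
    have "((\<lambda>r. divdiff us (\<lambda>v. Im (?q (\<i> * of_real (r * sqrt v))) / (sqrt v * f r)) s) \<longlongrightarrow> divdiff us (\<lambda>v. Re \<omega> * v ^ n / sqrt v) s) at_top"
      by (intro divdiff_tendsto limIm su2)
    moreover have "\<forall>\<^sub>F r in at_top. divdiff us (\<lambda>v. Im (?q (\<i> * of_real (r * sqrt v))) / (sqrt v * f r)) s = (\<integral>t. pole_kernel s us t \<partial>m r)"
      using pf by eventually_elim (unfold m_def, rule divdiff_Im_C_transform[OF *], auto)
    ultimately show "((\<lambda>r. \<integral>t. pole_kernel s us t \<partial>m r) \<longlongrightarrow> C * (\<integral>t. t ^ (2 * n) * pole_kernel s us t \<partial>lborel)) at_top"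
      using l divdiff_power_sqrt[OF su(1,2), of n "Re \<omega>"] unfolding C_def by (subst (asm) tendsto_cong) auto
    have "((\<lambda>r. divdiff us (\<lambda>v. Re (?q (\<i> * of_real (r * sqrt v))) / f r) s) \<longlongrightarrow> divdiff us (poly (monom (- Im \<omega>) n)) s) at_top"
      by (intro divdiff_tendsto limRe su2)
    moreover have "divdiff us (poly (monom (- Im \<omega>) n)) s = 0"
      using degree_monom_le[of "- Im \<omega>" n] l by (intro divdiff_poly su(1)) auto
    moreover have "\<forall>\<^sub>F r in at_top. divdiff us (\<lambda>v. Re (?q (\<i> * of_real (r * sqrt v))) / f r) s = (\<integral>t. t * pole_kernel s us t \<partial>m r)"
      using pf by eventually_elim (unfold m_def, rule divdiff_Re_C_transform[OF *], auto)
    ultimately show "((\<lambda>r. \<integral>t. t * pole_kernel s us t \<partial>m r) \<longlongrightarrow> 0) at_top" by (simp add: tendsto_cong)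
  qed
  show C: "C > 0"
  proof -
    \<comment> \<open>Any admissible nodes would do; together with \<open>s = 1\<close> these are 1,
      2, ..., K + 1.\<close>
    define us where "us = map (\<lambda>j. real j + 2) [0..<K]"
    have su: "distinct (1 # us)" "\<forall>v\<in>insert 1 (set us). v > 0" "K \<le> length us"
      by (auto simp: us_def distinct_map inj_on_def)
    have nn: "pole_kernel 1 us t \<ge> 0" for t using pole_kernel_pos[OF su(2), of t] by simp
    have "0 \<le> C * (\<integral>t. t ^ (2 * n) * pole_kernel 1 us t \<partial>lborel)"
      by (rule tendsto_lowerbound[OF ker(3)[OF su]]) (simp_all add: nn Bochner_Integration.integral_nonneg)
    moreover have "(\<integral>t. t ^ (2 * n) * pole_kernel 1 us t \<partial>lborel) > 0"
      using su by (intro integral_power_pole_kernel_pos) (auto simp: K_def)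
    moreover have "C \<noteq> 0" using \<omega> by (simp add: C_def)
    ultimately show ?thesis by (simp add: zero_le_mult_iff)
  qed
  have \<sigma>int: "integrable \<sigma> (pole_kernel s us)" "(\<integral>t. pole_kernel s us t \<partial>\<sigma>) = C * (\<integral>t. t ^ (2 * n) * pole_kernel s us t \<partial>lborel)"
    if su: "distinct (s # us)" "\<forall>v\<in>insert s (set us). v > 0" "K \<le> length us" for s us
  proof -
    have *: "integrable lborel (\<lambda>t. t ^ (2 * n) * pole_kernel s us t)"
      using su by (intro integrable_power_pole_kernel) (auto simp: K_def)
    have nn: "AE t in lborel. 0 \<le> C * t ^ (2 * n)" using C by (auto simp: power_mult)
    show "integrable \<sigma> (pole_kernel s us)" unfolding \<sigma>_def
      using nn integrable_mult_right[of C, OF *] by (subst integrable_density) (auto simp: mult_ac)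
    show "(\<integral>t. pole_kernel s us t \<partial>\<sigma>) = C * (\<integral>t. t ^ (2 * n) * pole_kernel s us t \<partial>lborel)"
      unfolding \<sigma>_def using nn by (subst integral_density) (auto simp: mult_ac)
  qed
  have hyp: "\<forall>s us. distinct (s # us) \<and> (\<forall>v\<in>insert s (set us). v > 0) \<and> K \<le> length us \<longrightarrow>
     (\<forall>\<^sub>F r in at_top. integrable (m r) (pole_kernel s us)) \<and> integrable \<sigma> (pole_kernel s us)
      \<and> ((\<lambda>r. \<integral>t. pole_kernel s us t \<partial>m r) \<longlongrightarrow> (\<integral>t. pole_kernel s us t \<partial>\<sigma>)) at_top"
  proof (intro allI impI)
    fix s :: real and us assume "distinct (s # us) \<and> (\<forall>v\<in>insert s (set us). v > 0) \<and> K \<le> length us"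
    then have su: "distinct (s # us)" "\<forall>v\<in>insert s (set us). v > 0" "K \<le> length us" by blast+
    show "(\<forall>\<^sub>F r in at_top. integrable (m r) (pole_kernel s us)) \<and> integrable \<sigma> (pole_kernel s us)
      \<and> ((\<lambda>r. \<integral>t. pole_kernel s us t \<partial>m r) \<longlongrightarrow> (\<integral>t. pole_kernel s us t \<partial>\<sigma>)) at_top"
      unfolding \<sigma>int(2)[OF su] by (intro conjI ker(1,3)[OF su] \<sigma>int(1)[OF su])
  qed
  have hypo: "\<forall>s us. distinct (s # us) \<and> (\<forall>v\<in>insert s (set us). v > 0) \<and> K \<le> length us \<longrightarrow>
     (\<forall>\<^sub>F r in at_top. integrable (m r) (\<lambda>t. t * pole_kernel s us t)) \<and> ((\<lambda>r. \<integral>t. t * pole_kernel s us t \<partial>m r) \<longlongrightarrow> 0) at_top"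
    using ker(2,4) by blast
  note cn = coalescing_nodes[where m = m, OF sm s\<sigma> hyp]
  note cno = coalescing_nodes_odd[where m = m, OF sm s\<sigma> hyp hypo]
  define S where "S a = 2 * C * a ^ (2 * n + 1) / (2 * n + 1)" for a
  have S: "isCont S a" "(S \<longlongrightarrow> 0) (at_right 0)" for a
  proof -
    show cont: "isCont S a" for a unfolding S_def by (auto intro!: continuous_intros simp: add_nonneg_eq_0_iff)
    show "(S \<longlongrightarrow> 0) (at_right 0)"
      using cont[of 0] by (simp add: isCont_def filterlim_at_split) (simp add: S_def)
  qed
  have S2: "measure \<sigma> {-a<..<a} = S a" if "a > 0" for a
    unfolding \<sigma>_def S_def using C that by (intro measure_power_density) auto
  have mm: "measure (m r) {a<..<b} = measure \<mu> {a * r<..<b * r} / (r * f r)"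
      "measure (m r) {a..<b} = measure \<mu> {a * r..<b * r} / (r * f r)" if "r > 0" "f r > 0" for r a b
  proof -
    have e: "(\<lambda>t. t / r) -` {a<..<b} = {a * r<..<b * r}" "(\<lambda>t. t / r) -` {a..<b} = {a * r..<b * r}"
      using that by (auto simp: field_simps)
    show "measure (m r) {a<..<b} = measure \<mu> {a * r<..<b * r} / (r * f r)"
      "measure (m r) {a..<b} = measure \<mu> {a * r..<b * r} / (r * f r)"
      unfolding m_def e[symmetric] using that by (simp_all add: measure_scaled_measure[OF sets])
  qed
  show "((\<lambda>r. measure \<mu> {-(\<delta> * r)<..<\<delta> * r} / (r * f r)) \<longlongrightarrow> 2 * C * \<delta> ^ (2 * n + 1) / (2 * n + 1)) at_top" if "\<delta> > 0" for \<delta>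
  proof -
    have "((\<lambda>r. measure (m r) {-\<delta><..<\<delta>}) \<longlongrightarrow> S \<delta>) at_top"
    \<comment> \<open>K differences produce K + 1 poles, hence the exponent
      \<open>K + 1\<close>.\<close>
    proof (rule tauber_interval[where K = "K + 1" and \<sigma> = \<sigma>])
      show "\<forall>\<^sub>F r in at_top. integrable (m r) (\<lambda>t. 1 / (1 + t\<^sup>2) ^ (K + 1))" by (rule cn(1)) simp
      show "integrable \<sigma> (\<lambda>t. 1 / (1 + t\<^sup>2) ^ (K + 1))" by (rule cn(2)) simp
      show "sets (m r) = sets borel" for r by (rule sm)
      show "sets \<sigma> = sets borel" by (rule s\<sigma>)
      show "((\<lambda>r. \<integral>t. 1 / (1 + t\<^sup>2) ^ k \<partial>m r) \<longlongrightarrow> (\<integral>t. 1 / (1 + t\<^sup>2) ^ k \<partial>\<sigma>)) at_top" if "K + 1 \<le> k" for k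
        by (rule cn(3)[OF that])
      show "measure \<sigma> {-a<..<a} = S a" if "a > 0" for a by (rule S2[OF that])
    qed (rule S that)+
    moreover have "\<forall>\<^sub>F r in at_top. measure (m r) {-\<delta><..<\<delta>} = measure \<mu> {-(\<delta> * r)<..<\<delta> * r} / (r * f r)"
      using pf by eventually_elim (simp add: mm(1))
    ultimately show ?thesis unfolding S_def by (simp add: tendsto_cong)
  qed
  have "((\<lambda>r. measure (m r) {0..<1} - measure (m r) {-1<..<0}) \<longlongrightarrow> 0) at_top"
  proof (rule tauber_balance[where K = "K + 1" and \<sigma> = \<sigma> and S = S])
    show "\<forall>\<^sub>F r in at_top. integrable (m r) (\<lambda>t. 1 / (1 + t\<^sup>2) ^ (K + 1))" by (rule cn(1)) simp
    show "integrable \<sigma> (\<lambda>t. 1 / (1 + t\<^sup>2) ^ (K + 1))" by (rule cn(2)) simp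
    show "(0::real) < 1" by simp
    show "sets (m r) = sets borel" for r by (rule sm)
    show "sets \<sigma> = sets borel" by (rule s\<sigma>)
    show "((\<lambda>r. \<integral>t. 1 / (1 + t\<^sup>2) ^ k \<partial>m r) \<longlongrightarrow> (\<integral>t. 1 / (1 + t\<^sup>2) ^ k \<partial>\<sigma>)) at_top" if "K + 1 \<le> k" for k
      by (rule cn(3)[OF that])
    show "measure \<sigma> {-a<..<a} = S a" if "a > 0" for a by (rule S2[OF that])
    show "((\<lambda>r. \<integral>t. t / (1 + t\<^sup>2) * (1 / (1 + t\<^sup>2) ^ k) \<partial>m r) \<longlongrightarrow> 0) at_top" if "K + 1 \<le> k" for k
      by (rule cno[OF that])
  qed (rule S)+
  moreover have "\<forall>\<^sub>F r in at_top. measure (m r) {0..<1} - measure (m r) {-1<..<0} = (measure \<mu> {0..<r} - measure \<mu> {-r<..<0}) / (r * f r)"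
    using pf by eventually_elim (simp add: mm diff_divide_distrib)
  ultimately show "((\<lambda>r. (measure \<mu> {0..<r} - measure \<mu> {-r<..<0}) / (r * f r)) \<longlongrightarrow> 0) at_top"
    by (simp add: tendsto_cong)
qed

section \<open>Slowly varying quotients\<close>

definition sv :: "(real \<Rightarrow> real) \<Rightarrow> nat \<Rightarrow> real \<Rightarrow> real" where
  "sv M \<beta> t = M t / t ^ \<beta>"

lemma regularly_varying_eventually_pos: "regularly_varying f \<alpha> \<Longrightarrow> \<forall>\<^sub>F r in at_top. f r > 0"
  unfolding regularly_varying_def eventually_at_top_linorder by blast

lemma regularly_varying_sv:
  assumes "regularly_varying M (real \<beta>)" "c > 0"
  shows "((\<lambda>r. sv M \<beta> (c * r) / sv M \<beta> r) \<longlongrightarrow> 1) at_top"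
proof -
  have "((\<lambda>r. M (c * r) / M r / c ^ \<beta>) \<longlongrightarrow> c powr real \<beta> / c ^ \<beta>) at_top"
    using assms by (intro tendsto_divide) (auto simp: regularly_varying_def)
  moreover have "\<forall>\<^sub>F r in at_top. M (c * r) / M r / c ^ \<beta> = sv M \<beta> (c * r) / sv M \<beta> r"
    using eventually_gt_at_top[of 0] by eventually_elim (use assms in \<open>auto simp: sv_def power_mult_distrib\<close>)
  ultimately show ?thesis using assms by (simp add: powr_realpow tendsto_cong)
qed

lemma ex_dyadic_bracket:
  fixes z :: real
  assumes "z \<ge> 1"
  shows "\<exists>n. 2 ^ n \<le> z \<and> z < 2 ^ (n + 1)"
proof -
  define k where "k = nat \<lfloor>z\<rfloor>"
  have k: "k \<ge> 1" "real k \<le> z" "z < real k + 1" using assms unfolding k_def by linarith+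
  obtain n where n: "2 ^ n \<le> k" "k < 2 ^ (n + 1)" using ex_power_ivl1[of 2 k] k by auto
  have "real (2 ^ n) \<le> real k" "real (k + 1) \<le> real (2 ^ (n + 1))" using n by (intro of_nat_mono; simp)+
  then have "real (2 ^ n) \<le> z" "z < real (2 ^ (n + 1))" using k by linarith+
  then show ?thesis by (intro exI[of _ n]) simp
qed

text \<open>Potter bounds with a crude constant, obtained without uniform convergence. The limit
  relation is used for the ratio 2 only: each doubling costs at most \<open>a = 2 powr e\<close>,
  and monotonicity of \<open>M\<close> bridges the gap between dyadic points at the price
  \<open>2 ^ \<beta>\<close>.\<close>

lemma potter_bounds:
  fixes M :: "real \<Rightarrow> real"
  assumes mono: "\<And>x y. 0 < x \<Longrightarrow> x \<le> y \<Longrightarrow> M x \<le> M y" and rv: "regularly_varying M (real \<beta>)" and e: "e > 0"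
  shows "\<exists>C X. C > 0 \<and> X \<ge> 1 \<and> (\<forall>x\<ge>X. sv M \<beta> x > 0) \<and>
    (\<forall>x y. X \<le> y \<longrightarrow> y \<le> x \<longrightarrow> sv M \<beta> x \<le> C * (x / y) powr e * sv M \<beta> y \<and> sv M \<beta> y \<le> C * (x / y) powr e * sv M \<beta> x)"
proof -
  let ?l = "sv M \<beta>"
  define a where "a = (2::real) powr e"
  have a: "a > 1" using e by (simp add: a_def)
  have "\<forall>\<^sub>F r in at_top. ?l (2 * r) / ?l r < a" "\<forall>\<^sub>F r in at_top. ?l (2 * r) / ?l r > 1 / a"
    using regularly_varying_sv[OF rv, of 2] a by (auto intro!: order_tendstoD)
  then have "\<forall>\<^sub>F r in at_top. ?l (2 * r) \<le> a * ?l r \<and> ?l r \<le> a * ?l (2 * r) \<and> ?l r > 0"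
    using regularly_varying_eventually_pos[OF rv] eventually_gt_at_top[of 0]
  proof eventually_elim
    case (elim r)
    have "?l r > 0" using elim by (simp add: sv_def)
    then show ?case using elim a by (auto simp: divide_simps mult.commute)
  qed
  then obtain X0 where X0: "\<And>r. r \<ge> X0 \<Longrightarrow> ?l (2 * r) \<le> a * ?l r \<and> ?l r \<le> a * ?l (2 * r) \<and> ?l r > 0"
    by (auto simp: eventually_at_top_linorder)
  define X where "X = max 1 X0"
  have X: "?l (2 * r) \<le> a * ?l r" "?l r \<le> a * ?l (2 * r)" "?l r > 0" if "r \<ge> X" for r
    using X0[of r] that by (auto simp: X_def)
  have X1: "X \<ge> 1" by (simp add: X_def)
  have iter: "?l (2 ^ n * y) \<le> a ^ n * ?l y \<and> ?l y \<le> a ^ n * ?l (2 ^ n * y)" if "y \<ge> X" for n y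
  proof (induction n)
    case (Suc n)
    have "1 * y \<le> 2 ^ n * y" using that X1 by (intro mult_right_mono) auto
    then have ge: "2 ^ n * y \<ge> X" using that by simp
    have "?l (2 ^ Suc n * y) \<le> a * ?l (2 ^ n * y)" using X(1)[OF ge] by (simp add: mult.assoc)
    also have "\<dots> \<le> a * (a ^ n * ?l y)" using Suc a by (intro mult_left_mono) auto
    finally have 1: "?l (2 ^ Suc n * y) \<le> a ^ Suc n * ?l y" by (simp add: mult.assoc)
    have "?l y \<le> a ^ n * ?l (2 ^ n * y)" using Suc by blast
    also have "\<dots> \<le> a ^ n * (a * ?l (2 * (2 ^ n * y)))" using X(2)[OF ge] a by (intro mult_left_mono) auto
    finally show ?case using 1 by (simp add: mult_ac)
  qed simp
  \<comment> \<open>Only \<open>M\<close> is monotone, not the quotient; between x and 2x the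
    denominator grows by at most \<open>2 ^ \<beta>\<close>.\<close>
  have mono_l: "?l x \<le> 2 ^ \<beta> * ?l y" if "0 < x" "x \<le> y" "y \<le> 2 * x" "M y \<ge> 0" for x y
  proof -
    have "y ^ \<beta> \<le> (2 * x) ^ \<beta>" using that by (intro power_mono) auto
    then have "M x * y ^ \<beta> \<le> M y * (2 ^ \<beta> * x ^ \<beta>)"
      using mono[of x y] that by (intro mult_mono) (auto simp: power_mult_distrib)
    then show ?thesis using that by (simp add: sv_def field_simps)
  qed
  define C where "C = 2 ^ \<beta> * a"
  have main: "?l x \<le> C * (x / y) powr e * ?l y \<and> ?l y \<le> C * (x / y) powr e * ?l x" if "X \<le> y" "y \<le> x" for x y
  proof -
    have y: "y > 0" "x > 0" using that X1 by auto
    have "x / y \<ge> 1" using that y by simp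
    then obtain n where n: "2 ^ n \<le> x / y" "x / y < 2 ^ (n + 1)"
      using ex_dyadic_bracket by blast
    have n': "2 ^ n * y \<le> x" "x < 2 * (2 ^ n * y)" using n y by (auto simp: field_simps)
    have n2: "2 ^ Suc n * y = 2 * (2 ^ n * y)" by simp
    have an: "a ^ n \<le> (x / y) powr e"
    proof -
      have "a ^ n = (2 ^ n) powr e" by (simp add: a_def powr_power mult.commute powr_powr flip: powr_realpow)
      also have "\<dots> \<le> (x / y) powr e" using n e by (intro powr_mono2) auto
      finally show ?thesis .
    qed
    have pos: "?l y > 0" "?l x > 0" using X(3) that by auto
    have ge: "2 ^ n * y \<ge> X"
    proof -
      have "1 * y \<le> 2 ^ n * y" using y by (intro mult_right_mono) auto
      then show ?thesis using that by simp
    qed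
    have Mp: "M t \<ge> 0" if "t \<ge> X" for t
      using X(3)[OF that] that X1 by (auto simp: sv_def zero_less_divide_iff)
    \<comment> \<open>The upper estimate passes through the dyadic point above x, the lower one
      through the dyadic point below, since \<open>mono_l\<close> bounds a value only by values
      further right.\<close>
    have "?l x \<le> 2 ^ \<beta> * ?l (2 ^ Suc n * y)" unfolding n2
      using n' y that ge Mp[of "2 * (2 ^ n * y)"] by (intro mono_l) auto
    also have "\<dots> \<le> 2 ^ \<beta> * (a ^ Suc n * ?l y)" using iter[OF that(1), of "Suc n"] by (intro mult_left_mono) auto
    also have "\<dots> = C * a ^ n * ?l y" by (simp add: C_def)
    also have "\<dots> \<le> C * (x / y) powr e * ?l y" using an pos a by (intro mult_right_mono mult_left_mono) (auto simp: C_def)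
    finally have 1: "?l x \<le> C * (x / y) powr e * ?l y" .
    have "?l y \<le> a ^ n * ?l (2 ^ n * y)" using iter[OF that(1), of n] by blast
    also have "\<dots> \<le> a ^ n * (2 ^ \<beta> * ?l x)"
      using n' y that Mp[of x] a by (intro mult_left_mono mono_l) auto
    also have "\<dots> \<le> (x / y) powr e * (2 ^ \<beta> * ?l x)" using an pos by (intro mult_right_mono) auto
    also have "\<dots> \<le> (x / y) powr e * (C * ?l x)" using a pos by (intro mult_left_mono mult_right_mono) (auto simp: C_def)
    finally show ?thesis using 1 by (simp add: mult_ac)
  qed
  show ?thesis using main X X1 a by (intro exI[of _ C] exI[of _ X]) (auto simp: C_def)
qed

text \<open>The Potter bounds with the smaller of the two points frozen at \<open>X\<close>.\<close>

lemma sv_lower_bound: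
  fixes M :: "real \<Rightarrow> real"
  assumes mono: "\<And>x y. 0 < x \<Longrightarrow> x \<le> y \<Longrightarrow> M x \<le> M y" and rv: "regularly_varying M (real \<beta>)" and e: "e > 0"
  shows "\<exists>c>0. \<forall>\<^sub>F t in at_top. c * t powr (-e) \<le> sv M \<beta> t"
    and "\<exists>c>0. \<forall>\<^sub>F t in at_top. sv M \<beta> t \<le> c * t powr e"
proof -
  obtain C X where CX: "C > 0" "X \<ge> 1" "\<And>x. x \<ge> X \<Longrightarrow> sv M \<beta> x > 0"
    "\<And>x y. X \<le> y \<Longrightarrow> y \<le> x \<Longrightarrow> sv M \<beta> x \<le> C * (x / y) powr e * sv M \<beta> y \<and> sv M \<beta> y \<le> C * (x / y) powr e * sv M \<beta> x"
    using potter_bounds[OF mono rv e] by blast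
  have "sv M \<beta> X / C * X powr e * t powr (-e) \<le> sv M \<beta> t" "sv M \<beta> t \<le> C / X powr e * sv M \<beta> X * t powr e" if "t \<ge> X" for t
    using CX(4)[of X t] that CX(1,2) by (auto simp: powr_divide powr_minus field_simps)
  then have 1: "\<forall>\<^sub>F t in at_top. sv M \<beta> X / C * X powr e * t powr (-e) \<le> sv M \<beta> t"
    and 2: "\<forall>\<^sub>F t in at_top. sv M \<beta> t \<le> C / X powr e * sv M \<beta> X * t powr e"
    unfolding eventually_at_top_linorder by blast+
  have "sv M \<beta> X / C * X powr e > 0" "C / X powr e * sv M \<beta> X > 0" using CX by auto
  then show "\<exists>c>0. \<forall>\<^sub>F t in at_top. c * t powr (-e) \<le> sv M \<beta> t" "\<exists>c>0. \<forall>\<^sub>F t in at_top. sv M \<beta> t \<le> c * t powr e"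
    using 1 2 by blast+
qed

lemma powr_over_sv_tendsto_0:
  fixes M :: "real \<Rightarrow> real"
  assumes mono: "\<And>x y. 0 < x \<Longrightarrow> x \<le> y \<Longrightarrow> M x \<le> M y" and rv: "regularly_varying M (real \<beta>)" and e: "e > 0"
  shows "((\<lambda>t. t powr (-e) / sv M \<beta> t) \<longlongrightarrow> 0) at_top"
proof -
  \<comment> \<open>Half of the exponent is spent on the lower bound of the quotient, the other half
    produces the decay.\<close>
  obtain c where c: "c > 0" "\<forall>\<^sub>F t in at_top. c * t powr (-(e/2)) \<le> sv M \<beta> t"
    using sv_lower_bound(1)[OF mono rv, of "e/2"] e by auto
  show ?thesis
  proof (rule tendsto_sandwich)
    show "\<forall>\<^sub>F t in at_top. 0 \<le> t powr (-e) / sv M \<beta> t"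
      using c(2) eventually_gt_at_top[of 0]
    proof eventually_elim
      case (elim t)
      have "0 < c * t powr (-(e/2))" using c elim by simp
      then show ?case using elim by simp
    qed
    show "\<forall>\<^sub>F t in at_top. t powr (-e) / sv M \<beta> t \<le> t powr (-(e/2)) / c"
      using c(2) eventually_gt_at_top[of 0]
    proof eventually_elim
      case (elim t)
      have p: "0 < c * t powr (-(e/2))" using c elim by simp
      have "t powr (-e) / sv M \<beta> t \<le> t powr (-e) / (c * t powr (-(e/2)))"
        using p elim by (intro divide_left_mono) (auto intro!: mult_pos_pos)
      also have "\<dots> = t powr (-(e/2)) * t powr (-(e/2)) / (c * t powr (-(e/2)))" by (simp flip: powr_add)
      also have "\<dots> = t powr (-(e/2)) / c" using p by simp
      finally show ?case .
    qed
    show "((\<lambda>t. t powr (-(e/2)) / c) \<longlongrightarrow> 0) at_top"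
      using tendsto_divide[OF tendsto_neg_powr[OF _ filterlim_ident] tendsto_const, of "-(e/2)" c] e c by simp
  qed simp
qed

text \<open>Supplies the pointwise limit and the majorant for dominated convergence in v. The
  exponent 1/2 is a choice: any number strictly between 0 and 1 keeps the envelope integrable
  against \<open>1 / (1 + v^2)\<close> both at 0 and at infinity.\<close>

lemma slowly_varying_comparison:
  fixes M \<Psi> :: "real \<Rightarrow> real"
  assumes mono: "\<And>x y. 0 < x \<Longrightarrow> x \<le> y \<Longrightarrow> M x \<le> M y" and rv: "regularly_varying M (real \<beta>)"
    and lim: "((\<lambda>t. \<Psi> t / sv M \<beta> t) \<longlongrightarrow> A) at_top"
    and bdd: "\<And>x. \<exists>B. \<forall>t. 0 < t \<longrightarrow> t \<le> x \<longrightarrow> \<bar>\<Psi> t\<bar> \<le> B"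
  shows "\<And>v. v > 0 \<Longrightarrow> ((\<lambda>r. \<Psi> (r * v) / sv M \<beta> r) \<longlongrightarrow> A) at_top"
    and "\<exists>C X. \<forall>r\<ge>X. sv M \<beta> r > 0 \<and> (\<forall>v>0. \<bar>\<Psi> (r * v) / sv M \<beta> r\<bar> \<le> C * (v powr (1/2) + v powr (-1/2)))"
proof -
  let ?l = "sv M \<beta>"
  have lpos: "\<forall>\<^sub>F r in at_top. ?l r > 0"
    using regularly_varying_eventually_pos[OF rv] eventually_gt_at_top[of 0] by eventually_elim (auto simp: sv_def)
  show "((\<lambda>r. \<Psi> (r * v) / ?l r) \<longlongrightarrow> A) at_top" if v: "v > 0" for v
  proof -
    have fl: "filterlim (\<lambda>r. v * r) at_top at_top"
      using v by (intro filterlim_tendsto_pos_mult_at_top[OF tendsto_const] filterlim_ident)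
    have "((\<lambda>r. \<Psi> (v * r) / ?l (v * r) * (?l (v * r) / ?l r)) \<longlongrightarrow> A * 1) at_top"
      by (intro tendsto_mult filterlim_compose[OF lim fl] regularly_varying_sv[OF rv v])
    moreover have "\<forall>\<^sub>F r in at_top. \<Psi> (v * r) / ?l (v * r) * (?l (v * r) / ?l r) = \<Psi> (r * v) / ?l r"
      using eventually_compose_filterlim[OF lpos fl] by eventually_elim (auto simp: mult.commute)
    ultimately show ?thesis using Lim_transform_eventually by force
  qed
  obtain C X where CX: "C > 0" "X \<ge> 1" "\<And>x. x \<ge> X \<Longrightarrow> ?l x > 0"
    "\<And>x y. X \<le> y \<Longrightarrow> y \<le> x \<Longrightarrow> ?l x \<le> C * (x / y) powr (1/2) * ?l y \<and> ?l y \<le> C * (x / y) powr (1/2) * ?l x"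
    using potter_bounds[OF mono rv, of "1/2"] by auto
  have "\<forall>\<^sub>F t in at_top. dist (\<Psi> t / ?l t) A < 1" using tendstoD[OF lim, of 1] by simp
  then obtain X1 where X1: "\<And>t. t \<ge> X1 \<Longrightarrow> dist (\<Psi> t / ?l t) A < 1" by (auto simp: eventually_at_top_linorder)
  define Y where "Y = max X X1"
  have Y: "Y \<ge> X" "Y \<ge> 1" using CX(2) by (auto simp: Y_def)
  have P1: "\<bar>\<Psi> t\<bar> \<le> (\<bar>A\<bar> + 1) * ?l t" if "t \<ge> Y" for t
  proof -
    have "\<bar>\<Psi> t / ?l t\<bar> \<le> \<bar>A\<bar> + 1" using X1[of t] that by (auto simp: Y_def dist_real_def)
    then show ?thesis using CX(3)[of t] that by (auto simp: Y_def abs_divide divide_simps split: if_splits)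
  qed
  obtain B where B: "\<And>t. 0 < t \<Longrightarrow> t \<le> Y \<Longrightarrow> \<bar>\<Psi> t\<bar> \<le> B" using bdd[of Y] by blast
  have B0: "B \<ge> 0" using B[of Y] Y by force
  define D where "D = (\<bar>A\<bar> + 1) * C + B * C / ?l Y"
  have lY: "?l Y > 0" using CX(3) Y by auto
  have D: "D \<ge> (\<bar>A\<bar> + 1) * C" "D \<ge> B * C / ?l Y" "D \<ge> 0" using CX(1) B0 lY by (auto simp: D_def)
  have "\<bar>\<Psi> (r * v) / ?l r\<bar> \<le> D * (v powr (1/2) + v powr (-1/2))" if r: "r \<ge> Y" and v: "v > 0" for r v
  proof -
    have lr: "?l r > 0" "r > 0" using CX(3) r Y by auto
    have vp: "v powr (1/2) > 0" "v powr (-1/2) > 0" using v by auto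
    consider "r * v \<ge> Y" "v \<ge> 1" | "r * v \<ge> Y" "v < 1" | "r * v < Y" by linarith
    then show ?thesis
    proof cases
      case 1
      have "?l (r * v) \<le> C * (r * v / r) powr (1/2) * ?l r"
        using CX(4)[of r "r * v"] r Y 1 lr by auto
      then have "\<bar>\<Psi> (r * v)\<bar> \<le> (\<bar>A\<bar> + 1) * (C * v powr (1/2) * ?l r)"
        using P1[OF 1(1)] lr by (intro order_trans[OF P1[OF 1(1)]] mult_left_mono) auto
      then have "\<bar>\<Psi> (r * v) / ?l r\<bar> \<le> (\<bar>A\<bar> + 1) * C * v powr (1/2)"
        using lr by (simp add: abs_divide pos_divide_le_eq mult_ac)
      also have "\<dots> \<le> D * (v powr (1/2) + v powr (-1/2))" using D vp CX(1) by (intro mult_mono) auto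
      finally show ?thesis .
    next
      case 2
      have "?l (r * v) \<le> C * (r / (r * v)) powr (1/2) * ?l r"
        using CX(4)[of "r * v" r] r Y 2 lr by auto
      then have "?l (r * v) \<le> C * v powr (-1/2) * ?l r" using lr v
        by (simp add: powr_divide powr_minus_divide)
      then have "\<bar>\<Psi> (r * v)\<bar> \<le> (\<bar>A\<bar> + 1) * (C * v powr (-1/2) * ?l r)"
        by (intro order_trans[OF P1[OF 2(1)]] mult_left_mono) auto
      then have "\<bar>\<Psi> (r * v) / ?l r\<bar> \<le> (\<bar>A\<bar> + 1) * C * v powr (-1/2)"
        using lr by (simp add: abs_divide pos_divide_le_eq mult_ac)
      also have "\<dots> \<le> D * (v powr (1/2) + v powr (-1/2))" using D vp CX(1) by (intro mult_mono) auto
      finally show ?thesis .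
    next
      case 3
      \<comment> \<open>Here nothing is known about \<Psi> except the bound \<open>B\<close>. Potter
        from \<open>Y\<close> to r together with \<open>r / Y < 1 / v\<close> shows that the
        reciprocal of the quotient at r is itself dominated by a multiple of
        \<open>v powr (-1/2)\<close>.\<close>
      have "?l Y \<le> C * (r / Y) powr (1/2) * ?l r" using CX(4)[of Y r] Y r by auto
      also have "\<dots> \<le> C * (1 / v) powr (1/2) * ?l r"
      proof -
        have "(r / Y) powr (1/2) \<le> (1 / v) powr (1/2)" using 3 v Y lr by (intro powr_mono2) (auto simp: field_simps)
        then show ?thesis using CX(1) lr by (intro mult_right_mono mult_left_mono) auto
      qed
      also have "(1 / v) powr (1/2) = v powr (-1/2)" using v by (simp add: powr_divide powr_minus_divide)
      finally have "1 / ?l r \<le> C / ?l Y * v powr (-1/2)" using lr lY by (simp add: field_simps)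
      then have "B * (1 / ?l r) \<le> B * (C / ?l Y * v powr (-1/2))" using B0 by (rule mult_left_mono)
      moreover have "\<bar>\<Psi> (r * v) / ?l r\<bar> \<le> B * (1 / ?l r)"
        using B[of "r * v"] 3 v lr by (simp add: abs_divide divide_right_mono)
      ultimately have "\<bar>\<Psi> (r * v) / ?l r\<bar> \<le> B * C / ?l Y * v powr (-1/2)" by simp
      also have "\<dots> \<le> D * (v powr (1/2) + v powr (-1/2))" using D vp CX(1) by (intro mult_mono) auto
      finally show ?thesis .
    qed
  qed
  then show "\<exists>C X. \<forall>r\<ge>X. ?l r > 0 \<and> (\<forall>v>0. \<bar>\<Psi> (r * v) / ?l r\<bar> \<le> C * (v powr (1/2) + v powr (-1/2)))"
    using CX(3) Y by (intro exI[of _ D] exI[of _ Y]) auto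
qed

section \<open>Layer-cake integration\<close>

text \<open>Makes Fubini available: the intervals (-n, n) exhaust the line and have finite
  measure.\<close>

lemma sigma_finite_locally_finite:
  fixes m :: "real measure"
  assumes "sets m = sets borel" "\<And>a. emeasure m {-a<..<a} < \<infinity>"
  shows "sigma_finite_measure m"
proof
  have sp: "space m = UNIV" using sets_eq_imp_space_eq[OF assms(1)] by simp
  have "(\<Union>n::nat. {- real n<..<real n}) = UNIV"
  proof -
    have "\<exists>n::nat. - real n < x \<and> x < real n" for x
      using reals_Archimedean2[of "\<bar>x\<bar>"] by (metis abs_less_iff minus_less_iff)
    then show ?thesis by auto
  qed
  then show "\<exists>A. countable A \<and> A \<subseteq> sets m \<and> \<Union>A = space m \<and> (\<forall>a\<in>A. emeasure m a \<noteq> \<infinity>)"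
    using assms sp by (intro exI[of _ "range (\<lambda>n::nat. {- real n<..<real n})"]) (auto simp: less_top)
qed

text \<open>Tonelli on the region |s| < u. Afterwards the measure enters only through its masses of
  symmetric intervals.\<close>

lemma nn_layer:
  fixes m :: "real measure" and k :: "real \<Rightarrow> ennreal"
  assumes sets [measurable_cong]: "sets m = sets borel" and fin: "\<And>a. emeasure m {-a<..<a} < \<infinity>"
    and [measurable]: "k \<in> borel_measurable borel"
  shows "(\<integral>\<^sup>+ s. (\<integral>\<^sup>+ u. k u * indicator {\<bar>s\<bar><..} u \<partial>lborel) \<partial>m) = (\<integral>\<^sup>+ u. k u * emeasure m {-u<..<u} \<partial>lborel)"
proof -
  interpret m: sigma_finite_measure m by (rule sigma_finite_locally_finite[OF sets fin])
  interpret P: pair_sigma_finite m lborel ..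
  have sp: "space m = UNIV" using sets_eq_imp_space_eq[OF sets] by simp
  have "(\<integral>\<^sup>+ s. (\<integral>\<^sup>+ u. k u * indicator {\<bar>s\<bar><..} u \<partial>lborel) \<partial>m)
     = (\<integral>\<^sup>+ s. (\<integral>\<^sup>+ u. k u * indicator {p. \<bar>fst p\<bar> < snd p} (s, u) \<partial>lborel) \<partial>m)"
    by (intro nn_integral_cong) (auto simp: indicator_def)
  also have "\<dots> = (\<integral>\<^sup>+ u. (\<integral>\<^sup>+ s. k u * indicator {p. \<bar>fst p\<bar> < snd p} (s, u) \<partial>m) \<partial>lborel)"
  proof (rule P.Fubini'[symmetric])
    have "{p. \<bar>fst p\<bar> < snd p} \<in> sets (borel \<Otimes>\<^sub>M (borel :: real measure))"
    proof -
      have "{p \<in> space (borel \<Otimes>\<^sub>M borel). \<bar>fst p\<bar> < (snd p :: real)} \<in> sets (borel \<Otimes>\<^sub>M borel)" by measurable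
      then show ?thesis by (simp add: space_pair_measure)
    qed
    moreover have "sets (m \<Otimes>\<^sub>M lborel) = sets (borel \<Otimes>\<^sub>M (borel :: real measure))"
      by (intro sets_pair_measure_cong sets) simp
    ultimately have [measurable]: "{p. \<bar>fst p\<bar> < snd p} \<in> sets (m \<Otimes>\<^sub>M lborel)" by simp
    show "(\<lambda>(s, u). k u * indicator {p. \<bar>fst p\<bar> < snd p} (s, u)) \<in> borel_measurable (m \<Otimes>\<^sub>M lborel)"
      by measurable
  qed
  also have "\<dots> = (\<integral>\<^sup>+ u. (\<integral>\<^sup>+ s. k u * indicator {-u<..<u} s \<partial>m) \<partial>lborel)"
    by (intro nn_integral_cong) (auto simp: indicator_def abs_less_iff)
  also have "\<dots> = (\<integral>\<^sup>+ u. k u * emeasure m {-u<..<u} \<partial>lborel)"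
    by (intro nn_integral_cong) (simp add: nn_integral_cmult)
  finally show ?thesis .
qed

text \<open>The signed counterpart: \<open>h\<close> may change sign and \<open>k\<close> is
  complex, so Fubini rests on the absolute majorant in \<open>kB\<close> and \<open>hB\<close>. The
  gain is a Lebesgue integral over truncated moments, to which the asymptotics of those moments can
  be applied.\<close>

lemma layer_integral:
  fixes m :: "real measure" and k :: "real \<Rightarrow> complex" and h :: "real \<Rightarrow> real"
  assumes sets [measurable_cong]: "sets m = sets borel" and fin: "\<And>a. emeasure m {-a<..<a} < \<infinity>"
    and [measurable]: "k \<in> borel_measurable borel" "h \<in> borel_measurable borel"
    and kint: "\<And>s. set_integrable lborel {\<bar>s\<bar><..} k"
    and kB: "\<And>s. (LBINT u:{\<bar>s\<bar><..}. norm (k u)) \<le> B s"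
    and hB: "integrable m (\<lambda>s. \<bar>h s\<bar> * B s)"
  shows "integrable m (\<lambda>s. of_real (h s) * (LBINT u:{\<bar>s\<bar><..}. k u))"
    and "integrable lborel (\<lambda>u. k u * of_real (LINT s:{-u<..<u}|m. h s))"
    and "(\<integral>s. of_real (h s) * (LBINT u:{\<bar>s\<bar><..}. k u) \<partial>m) = (\<integral>u. k u * of_real (LINT s:{-u<..<u}|m. h s) \<partial>lborel)"
proof -
  interpret m: sigma_finite_measure m by (rule sigma_finite_locally_finite[OF sets fin])
  interpret P: pair_sigma_finite m lborel ..
  let ?S = "{p :: real \<times> real. \<bar>fst p\<bar> < snd p}"
  have Sm: "?S \<in> sets (borel \<Otimes>\<^sub>M (borel :: real measure))"
  proof -
    have "{p \<in> space (borel \<Otimes>\<^sub>M borel). \<bar>fst p\<bar> < (snd p :: real)} \<in> sets (borel \<Otimes>\<^sub>M borel)" by measurable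
    then show ?thesis by (simp add: space_pair_measure)
  qed
  have seq: "sets (m \<Otimes>\<^sub>M lborel) = sets (borel \<Otimes>\<^sub>M (borel :: real measure))"
    by (intro sets_pair_measure_cong sets) simp
  have [measurable]: "?S \<in> sets (m \<Otimes>\<^sub>M lborel)" using Sm seq by simp
  define F where "F s u = indicator ?S (s, u) *\<^sub>R (of_real (h s) * k u)" for s u
  have Fm: "case_prod F \<in> borel_measurable (m \<Otimes>\<^sub>M lborel)"
    unfolding F_def[abs_def] by measurable
  have F1: "F s u = of_real (h s) * (indicator {\<bar>s\<bar><..} u *\<^sub>R k u)" for s u
    by (auto simp: F_def indicator_def)
  have F2: "F s u = k u * of_real (indicator {-u<..<u} s *\<^sub>R h s)" for s u
    by (auto simp: F_def indicator_def abs_less_iff)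
  have I1: "(\<integral>u. F s u \<partial>lborel) = of_real (h s) * (LBINT u:{\<bar>s\<bar><..}. k u)" for s
    unfolding F1 set_lebesgue_integral_def by (rule Bochner_Integration.integral_mult_right_zero)
  have kn: "set_integrable lborel {\<bar>s\<bar><..} (\<lambda>u. norm (k u))" for s
    using set_integrable_norm[OF kint] .
  have "integrable (m \<Otimes>\<^sub>M lborel) (case_prod F)"
  proof (rule P.Fubini_integrable[OF Fm])
    have n: "(\<integral>u. norm (case_prod F (s, u)) \<partial>lborel) = \<bar>h s\<bar> * (LBINT u:{\<bar>s\<bar><..}. norm (k u))" for s
    proof -
      have "(\<lambda>u. norm (case_prod F (s, u))) = (\<lambda>u. \<bar>h s\<bar> * (indicator {\<bar>s\<bar><..} u *\<^sub>R norm (k u)))"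
        by (auto simp: F1 norm_mult indicator_def)
      then show ?thesis by (simp add: set_lebesgue_integral_def)
    qed
    show "integrable m (\<lambda>s. \<integral>u. norm (case_prod F (s, u)) \<partial>lborel)"
    proof (rule integrable_bounded_by[OF hB])
      show "(\<lambda>s. \<integral>u. norm (case_prod F (s, u)) \<partial>lborel) \<in> borel_measurable m"
        using Fm by measurable
      show "norm (\<integral>u. norm (case_prod F (s, u)) \<partial>lborel) \<le> \<bar>h s\<bar> * B s" for s
      proof -
        have "0 \<le> (LBINT u:{\<bar>s\<bar><..}. norm (k u))" unfolding set_lebesgue_integral_def by (intro Bochner_Integration.integral_nonneg) auto
        then show ?thesis unfolding n using kB[of s] by (simp add: abs_mult mult_left_mono)
      qed
    qed
    show "AE s in m. integrable lborel (\<lambda>u. case_prod F (s, u))"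
      unfolding case_prod_conv F1
      by (intro AE_I2 integrable_mult_right) (rule kint[unfolded set_integrable_def])
  qed
  note I = this
  show "integrable m (\<lambda>s. of_real (h s) * (LBINT u:{\<bar>s\<bar><..}. k u))"
    using P.integrable_fst[OF I] unfolding I1 .
  have "integrable lborel (\<lambda>u. \<integral>s. F s u \<partial>m)" using P.integrable_snd[OF I] .
  moreover have I2: "(\<integral>s. F s u \<partial>m) = k u * of_real (LINT s:{-u<..<u}|m. h s)" for u
    unfolding F2 set_lebesgue_integral_def by (simp only: Bochner_Integration.integral_mult_right_zero integral_complex_of_real)
  ultimately show "integrable lborel (\<lambda>u. k u * of_real (LINT s:{-u<..<u}|m. h s))" by simp
  show "(\<integral>s. of_real (h s) * (LBINT u:{\<bar>s\<bar><..}. k u) \<partial>m) = (\<integral>u. k u * of_real (LINT s:{-u<..<u}|m. h s) \<partial>lborel)"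
    using P.Fubini_integral[OF I] unfolding I1 I2 by simp
qed

lemma einterval_infinity: "einterval (ereal a) \<infinity> = {a<..}"
  by (auto simp: einterval_def)

text \<open>From \<open>sqrt v + 1 / sqrt v = (1 + v) / sqrt v\<close> and
  \<open>(1 + v) / (1 + v^2) \<le> 2 / (1 + v)\<close> the integrand is at most four times the
  derivative of \<open>arctan (sqrt v)\<close>.\<close>

lemma integrable_sqrt_envelope:
  "set_integrable lborel {0<..} (\<lambda>v::real. (v powr (1/2) + v powr (-1/2)) / (1 + v\<^sup>2))"
proof -
  let ?g = "\<lambda>v. 1 / (2 * (sqrt v * (1 + v)))"
  have D: "DERIV (\<lambda>v. arctan (sqrt v)) v :> ?g v" if "v > 0" for v
    using that by (auto intro!: derivative_eq_intros simp: field_simps)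
  have c: "isCont ?g v" if "v > 0" for v using that by (auto intro!: continuous_intros)
  have t: "((\<lambda>v. arctan (sqrt v)) \<longlongrightarrow> pi / 2) at_top"
    by (rule filterlim_compose[OF tendsto_arctan_at_top sqrt_at_top])
  have b: "((\<lambda>v. arctan (sqrt v)) \<longlongrightarrow> arctan (sqrt 0)) (at_right 0)" by (intro tendsto_intros)
  have n: "AE v in lborel. ereal 0 < ereal v \<longrightarrow> ereal v < \<infinity> \<longrightarrow> 0 \<le> ?g v" by auto
  have A: "(((\<lambda>v. arctan (sqrt v)) \<circ> real_of_ereal) \<longlongrightarrow> arctan (sqrt 0)) (at_right (ereal 0))"
    "(((\<lambda>v. arctan (sqrt v)) \<circ> real_of_ereal) \<longlongrightarrow> pi / 2) (at_left \<infinity>)"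
    using b t by (simp_all only: ereal_tendsto_simps)
  have "set_integrable lborel (einterval (ereal 0) \<infinity>) ?g"
    by (rule interval_integral_FTC_nonneg(1)[OF _ _ _ n A]) (use D c in auto)
  then have I: "integrable lborel (\<lambda>v. indicator {0<..} v *\<^sub>R ?g v)"
    by (simp only: einterval_infinity set_integrable_def)
  show ?thesis unfolding set_integrable_def
  proof (rule integrable_bounded_by[OF integrable_mult_right[OF I, of 4]])
    show "norm (indicator {0<..} v *\<^sub>R ((v powr (1/2) + v powr (-1/2)) / (1 + v\<^sup>2))) \<le> 4 * (indicator {0<..} v *\<^sub>R ?g v)" for v
    proof (cases "v > 0")
      case True
      have s: "v powr (1/2) = sqrt v" "v powr (-1/2) = 1 / sqrt v" using True by (auto simp: powr_half_sqrt powr_minus_divide)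
      have "sqrt v + 1 / sqrt v = (1 + v) / sqrt v" using True by (simp add: field_simps)
      moreover have "(1 + v) / (1 + v\<^sup>2) \<le> 2 / (1 + v)"
      proof -
        have "0 \<le> (v - 1)\<^sup>2" by simp
        then have "(1 + v) * (1 + v) \<le> 2 * (1 + v\<^sup>2)" by (simp add: power2_eq_square algebra_simps)
        then show ?thesis using True by (simp add: divide_simps add_pos_pos)
      qed
      then have "(1 + v) / (1 + v\<^sup>2) / sqrt v \<le> 2 / (1 + v) / sqrt v" using True by (intro divide_right_mono) auto
      moreover have "(1 + v) / sqrt v / (1 + v\<^sup>2) \<ge> 0" using True by simp
      moreover have "4 * (1 / (2 * X)) = 2 / X" for X :: real by simp
      ultimately show ?thesis using True unfolding s by (simp only: indicator_simps greaterThan_iff scaleR_one real_norm_def abs_of_nonneg) (simp add: mult_ac)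
    qed simp
  qed measurable
qed

text \<open>Stated for sequences and for kernels depending on n: this suits dominated convergence
  and lets the point z inside the kernel move with n.\<close>

lemma abel_limit:
  fixes k :: "nat \<Rightarrow> real \<Rightarrow> complex" and r :: "nat \<Rightarrow> real"
  assumes mono: "\<And>x y. 0 < x \<Longrightarrow> x \<le> y \<Longrightarrow> M x \<le> M y" and rv: "regularly_varying M (real \<beta>)"
    and lim: "((\<lambda>t. \<Psi> t / sv M \<beta> t) \<longlongrightarrow> A) at_top"
    and bdd: "\<And>x. \<exists>B. \<forall>t. 0 < t \<longrightarrow> t \<le> x \<longrightarrow> \<bar>\<Psi> t\<bar> \<le> B"
    and [measurable]: "\<Psi> \<in> borel_measurable borel" "\<And>n. k n \<in> borel_measurable borel" "k' \<in> borel_measurable borel"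
    and kC: "\<And>n v. v > 0 \<Longrightarrow> norm (k n v) \<le> C / (1 + v\<^sup>2)"
    and kl: "\<And>v. v > 0 \<Longrightarrow> (\<lambda>n. k n v) \<longlonglongrightarrow> k' v"
    and r: "filterlim r at_top sequentially"
  shows "(\<lambda>n. LBINT v:{0<..}. k n v * of_real (\<Psi> (r n * v) / sv M \<beta> (r n))) \<longlonglongrightarrow> (LBINT v:{0<..}. k' v) * of_real A"
proof -
  obtain D X where DX: "\<And>r v. r \<ge> X \<Longrightarrow> v > 0 \<Longrightarrow> \<bar>\<Psi> (r * v) / sv M \<beta> r\<bar> \<le> D * (v powr (1/2) + v powr (-1/2))"
    using slowly_varying_comparison(2)[OF mono rv lim bdd] by metis
  \<comment> \<open>The majorant holds for large r only, hence a shift of the sequence, which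
    \<open>LIMSEQ_offset\<close> undoes at the end.\<close>
  obtain n0 where n0: "\<And>n. n \<ge> n0 \<Longrightarrow> r n \<ge> X"
    using r by (auto simp: filterlim_at_top eventually_sequentially)
  have "(\<lambda>n. LBINT v:{0<..}. k (n + n0) v * of_real (\<Psi> (r (n + n0) * v) / sv M \<beta> (r (n + n0)))) \<longlonglongrightarrow> (LBINT v:{0<..}. k' v * of_real A)"
    unfolding set_lebesgue_integral_def
  proof (rule integral_dominated_convergence)
    let ?w = "\<lambda>v. \<bar>C\<bar> * \<bar>D\<bar> * (indicator {0<..} v *\<^sub>R ((v powr (1/2) + v powr (-1/2)) / (1 + v\<^sup>2)))"
    show "integrable lborel ?w"
      using integrable_sqrt_envelope unfolding set_integrable_def by (rule integrable_mult_right)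
    show "AE v in lborel. (\<lambda>n. indicat_real {0<..} v *\<^sub>R (k (n + n0) v * of_real (\<Psi> (r (n + n0) * v) / sv M \<beta> (r (n + n0)))))
        \<longlonglongrightarrow> indicat_real {0<..} v *\<^sub>R (k' v * of_real A)"
    proof (rule AE_I2)
      fix v :: real
      show "(\<lambda>n. indicat_real {0<..} v *\<^sub>R (k (n + n0) v * of_real (\<Psi> (r (n + n0) * v) / sv M \<beta> (r (n + n0)))))
        \<longlonglongrightarrow> indicat_real {0<..} v *\<^sub>R (k' v * of_real A)"
      proof (cases "v > 0")
        case True
        have "(\<lambda>n. \<Psi> (r n * v) / sv M \<beta> (r n)) \<longlonglongrightarrow> A"
          using filterlim_compose[OF slowly_varying_comparison(1)[OF mono rv lim bdd True] r] .
        then have "(\<lambda>n. indicat_real {0<..} v *\<^sub>R (k n v * of_real (\<Psi> (r n * v) / sv M \<beta> (r n))))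
          \<longlonglongrightarrow> indicat_real {0<..} v *\<^sub>R (k' v * of_real A)"
          by (intro tendsto_intros kl True)
        then show ?thesis by (rule LIMSEQ_ignore_initial_segment)
      qed simp
    qed
    show "AE v in lborel. norm (indicat_real {0<..} v *\<^sub>R (k (n + n0) v * of_real (\<Psi> (r (n + n0) * v) / sv M \<beta> (r (n + n0))))) \<le> ?w v" for n
    proof (rule AE_I2)
      fix v :: real
      show "norm (indicat_real {0<..} v *\<^sub>R (k (n + n0) v * of_real (\<Psi> (r (n + n0) * v) / sv M \<beta> (r (n + n0))))) \<le> ?w v"
      proof (cases "v > 0")
        case True
        have "\<bar>\<Psi> (r (n + n0) * v) / sv M \<beta> (r (n + n0))\<bar> \<le> \<bar>D\<bar> * (v powr (1/2) + v powr (-1/2))"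
          using DX[OF n0[of "n + n0"] True] by (rule order_trans) (auto intro!: mult_right_mono)
        moreover have "norm (k (n + n0) v) \<le> \<bar>C\<bar> / (1 + v\<^sup>2)"
          using kC[OF True] by (rule order_trans) (auto intro!: divide_right_mono)
        ultimately have "norm (k (n + n0) v) * \<bar>\<Psi> (r (n + n0) * v) / sv M \<beta> (r (n + n0))\<bar>
           \<le> \<bar>C\<bar> / (1 + v\<^sup>2) * (\<bar>D\<bar> * (v powr (1/2) + v powr (-1/2)))" by (intro mult_mono) auto
        then show ?thesis using True by (simp add: norm_mult norm_divide abs_divide mult_ac)
      qed simp
    qed
  qed measurable
  then have "(\<lambda>n. LBINT v:{0<..}. k n v * of_real (\<Psi> (r n * v) / sv M \<beta> (r n))) \<longlonglongrightarrow> (LBINT v:{0<..}. k' v * of_real A)"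
    by (rule LIMSEQ_offset)
  then show ?thesis by simp
qed

text \<open>The negative derivative of \<open>1 / (u\<^sup>2 - z\<^sup>2)\<close> in \<open>u\<close>.\<close>

definition layer_kernel :: "complex \<Rightarrow> real \<Rightarrow> complex" where
  "layer_kernel z u = 2 * of_real u / ((of_real u)\<^sup>2 - z\<^sup>2)\<^sup>2"

lemma measurable_layer_kernel [measurable]: "layer_kernel z \<in> borel_measurable borel"
  unfolding layer_kernel_def[abs_def] by measurable

text \<open>Factor into \<open>(u - z) (u + z)\<close>. Each factor is at least \<delta> because of
  its imaginary part and at least \<open>u - R\<close> by the triangle inequality, and one of the
  two bounds always beats \<open>c (1 + u)\<close>. Uniformity in z makes later majorants
  independent of the moving point.\<close>

lemma square_diff_lower_bound:
  assumes "\<delta> > 0" "R \<ge> 0"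
  shows "\<exists>c>0. \<forall>z u. Im z \<ge> \<delta> \<longrightarrow> norm z \<le> R \<longrightarrow> u \<ge> 0 \<longrightarrow> norm ((complex_of_real u)\<^sup>2 - z\<^sup>2) \<ge> c * (1 + u\<^sup>2)"
proof -
  \<comment> \<open>Chosen so that the line \<open>c * (1 + u)\<close> reaches \<delta> exactly at
    \<open>u = R + \<delta>\<close>, where the two lower bounds agree.\<close>
  define c where "c = \<delta> / (1 + R + \<delta>)"
  have c: "c > 0" "c * (1 + R + \<delta>) = \<delta>" "c \<le> 1" using assms by (auto simp: c_def)
  have b: "c * (1 + u) \<le> norm w" if "\<bar>Im w\<bar> \<ge> \<delta>" "u - R \<le> norm w" "u \<ge> 0" for w :: complex and u
  proof (cases "u \<le> R + \<delta>")
    case True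
    then have "c * (1 + u) \<le> c * (1 + R + \<delta>)" using c by (intro mult_left_mono) auto
    then show ?thesis using c that(1) abs_Im_le_cmod[of w] by linarith
  next
    case False
    have "c * (1 + u) = c * (1 + R + \<delta>) + c * (u - R - \<delta>)" by (simp add: algebra_simps)
    also have "\<dots> \<le> \<delta> + 1 * (u - R - \<delta>)" using c False by (intro add_mono mult_right_mono) auto
    also have "\<delta> + 1 * (u - R - \<delta>) = u - R" by simp
    also have "\<dots> \<le> norm w" by (rule that(2))
    finally show ?thesis .
  qed
  have "norm ((complex_of_real u)\<^sup>2 - z\<^sup>2) \<ge> c\<^sup>2 * (1 + u\<^sup>2)" if z: "Im z \<ge> \<delta>" "norm z \<le> R" "u \<ge> 0" for z u
  proof -
    have "u - R \<le> norm (complex_of_real u - z)" "u - R \<le> norm (complex_of_real u + z)"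
      using norm_triangle_ineq2[of "complex_of_real u" z] norm_diff_ineq[of "complex_of_real u" z] z by auto
    then have "c * (1 + u) \<le> norm (complex_of_real u - z)" "c * (1 + u) \<le> norm (complex_of_real u + z)"
      using z assms by (auto intro!: b)
    then have "(c * (1 + u)) * (c * (1 + u)) \<le> norm (complex_of_real u - z) * norm (complex_of_real u + z)"
      using c z by (intro mult_mono) auto
    also have "\<dots> = norm ((complex_of_real u)\<^sup>2 - z\<^sup>2)"
      by (simp add: power2_eq_square algebra_simps flip: norm_mult)
    finally have "c\<^sup>2 * (1 + u)\<^sup>2 \<le> norm ((complex_of_real u)\<^sup>2 - z\<^sup>2)" by (simp add: power2_eq_square mult_ac)
    moreover have "c\<^sup>2 * (1 + u\<^sup>2) \<le> c\<^sup>2 * (1 + u)\<^sup>2" using z by (intro mult_left_mono) (auto simp: power2_sum)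
    ultimately show ?thesis by linarith
  qed
  then show ?thesis using c(1) by (intro exI[of _ "c\<^sup>2"]) auto
qed

lemma norm_layer_kernel_le:
  assumes "c > 0" "u \<ge> 0" "norm ((complex_of_real u)\<^sup>2 - z\<^sup>2) \<ge> c * (1 + u\<^sup>2)"
  shows "norm (layer_kernel z u) \<le> 2 / c\<^sup>2 * (u / (1 + u\<^sup>2)\<^sup>2)"
proof -
  have p: "c * (1 + u\<^sup>2) > 0" using assms by (simp add: add_pos_nonneg)
  have "norm (layer_kernel z u) = 2 * u / (norm ((complex_of_real u)\<^sup>2 - z\<^sup>2))\<^sup>2"
    using assms(2) by (simp add: layer_kernel_def norm_divide norm_mult norm_power)
  also have "\<dots> \<le> 2 * u / (c * (1 + u\<^sup>2))\<^sup>2"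
    using assms p by (intro divide_left_mono power_mono mult_pos_pos) (auto intro!: zero_less_power)
  finally show ?thesis by (simp add: power_mult_distrib)
qed

lemma tendsto_inverse_quadratic_at_top:
  "((\<lambda>u::real. 1 / (1 + u\<^sup>2)) \<longlongrightarrow> 0) at_top" "((\<lambda>u::real. u / (1 + u\<^sup>2)) \<longlongrightarrow> 0) at_top"
proof -
  have i: "((\<lambda>u::real. 1 / u) \<longlongrightarrow> 0) at_top"
    using tendsto_inverse_0_at_top[OF filterlim_ident] by (simp add: inverse_eq_divide)
  have p: "1 + u\<^sup>2 > 0" for u :: real using zero_le_power2[of u] by linarith
  show 2: "((\<lambda>u::real. u / (1 + u\<^sup>2)) \<longlongrightarrow> 0) at_top"
  proof (rule tendsto_0_le[OF i, where K = 1])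
    show "\<forall>\<^sub>F u::real in at_top. norm (u / (1 + u\<^sup>2)) \<le> norm (1 / u) * 1"
      using eventually_ge_at_top[of 1]
    proof eventually_elim
      case (elim u)
      then have "u * u \<le> 1 * (1 + u\<^sup>2)" by (simp add: power2_eq_square)
      then have "u / (1 + u\<^sup>2) \<le> 1 / u" using p[of u] elim by (subst frac_le_eq; simp add: divide_le_0_iff mult_ac)
      then show ?case using elim p[of u] by simp
    qed
  qed
  show "((\<lambda>u::real. 1 / (1 + u\<^sup>2)) \<longlongrightarrow> 0) at_top"
  proof (rule tendsto_0_le[OF 2, where K = 1])
    show "\<forall>\<^sub>F u::real in at_top. norm (1 / (1 + u\<^sup>2)) \<le> norm (u / (1 + u\<^sup>2)) * 1"
      using eventually_ge_at_top[of 1]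
    proof eventually_elim
      case (elim u)
      then show ?case using p[of u] by (simp add: divide_right_mono)
    qed
  qed
qed

lemma tail_rational:
  fixes a :: real
  assumes "a \<ge> 0"
  shows "set_integrable lborel {a<..} (\<lambda>u. u / (1 + u\<^sup>2)\<^sup>2)" "(LBINT u:{a<..}. u / (1 + u\<^sup>2)\<^sup>2) = 1 / (2 * (1 + a\<^sup>2))"
proof -
  let ?F = "\<lambda>u::real. - 1 / 2 * (1 / (1 + u\<^sup>2))"
  have nz: "1 + u\<^sup>2 \<noteq> 0" for u :: real using zero_le_power2[of u] by linarith
  have D: "DERIV ?F u :> u / (1 + u\<^sup>2)\<^sup>2" for u
  proof -
    have "DERIV (\<lambda>u. 1 / (1 + u\<^sup>2)) u :> - (2 * u) / (1 + u\<^sup>2)\<^sup>2"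
      using nz[of u] by (auto intro!: derivative_eq_intros simp: power2_eq_square)
    from DERIV_cmult[OF this, of "- 1 / 2"] show ?thesis by simp
  qed
  have c: "isCont (\<lambda>u. u / (1 + u\<^sup>2)\<^sup>2) u" for u :: real using nz[of u] by (auto intro!: continuous_intros)
  have t: "(?F \<longlongrightarrow> 0) at_top"
    using tendsto_mult[OF tendsto_const[of "- 1 / 2"] tendsto_inverse_quadratic_at_top(1)] by (simp only: mult_zero_right)
  have b: "(?F \<longlongrightarrow> ?F a) (at_right a)" using nz by (intro tendsto_intros) auto
  have *: "AE u in lborel. ereal a < ereal u \<longrightarrow> ereal u < \<infinity> \<longrightarrow> 0 \<le> u / (1 + u\<^sup>2)\<^sup>2" using assms by auto
  have A: "((?F \<circ> real_of_ereal) \<longlongrightarrow> ?F a) (at_right (ereal a))" "((?F \<circ> real_of_ereal) \<longlongrightarrow> 0) (at_left \<infinity>)"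
    using b t by (simp_all add: ereal_tendsto_simps)
  show "set_integrable lborel {a<..} (\<lambda>u. u / (1 + u\<^sup>2)\<^sup>2)"
    using interval_integral_FTC_nonneg(1)[OF _ D c * A] by (simp add: einterval_infinity)
  show "(LBINT u:{a<..}. u / (1 + u\<^sup>2)\<^sup>2) = 1 / (2 * (1 + a\<^sup>2))"
    using interval_integral_FTC_nonneg(2)[OF _ D c * A] by (simp add: einterval_infinity interval_lebesgue_integral_def)
qed

lemma square_diff_nonzero:
  assumes "Im z > 0"
  shows "(complex_of_real u)\<^sup>2 - z\<^sup>2 \<noteq> 0"
proof -
  have "(complex_of_real u)\<^sup>2 - z\<^sup>2 = (of_real u - z) * (of_real u + z)" by (simp add: power2_eq_square algebra_simps)
  moreover have "complex_of_real u - z \<noteq> 0" "complex_of_real u + z \<noteq> 0" using assms by (auto simp: complex_eq_iff)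
  ultimately show ?thesis by simp
qed

text \<open>The norm bound is the majorant that \<open>layer_integral\<close> asks for. At a = 0 the
  total integral is \<open>- 1 / z^2\<close>, the factor with which \<eta> enters the limit.\<close>

lemma layer_kernel_tail:
  assumes z: "Im z > 0" and a: "a \<ge> 0" and c: "c > 0" "\<And>u. u \<ge> 0 \<Longrightarrow> norm ((complex_of_real u)\<^sup>2 - z\<^sup>2) \<ge> c * (1 + u\<^sup>2)"
  shows "set_integrable lborel {a<..} (layer_kernel z)"
    and "(LBINT u:{a<..}. norm (layer_kernel z u)) \<le> 1 / c\<^sup>2 * (1 / (1 + a\<^sup>2))"
    and "(LBINT u:{a<..}. layer_kernel z u) = 1 / ((of_real a)\<^sup>2 - z\<^sup>2)"
proof -
  have bd: "norm (indicator {a<..} u *\<^sub>R layer_kernel z u) \<le> 2 / c\<^sup>2 * (indicator {a<..} u *\<^sub>R (u / (1 + u\<^sup>2)\<^sup>2))" for u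
    using norm_layer_kernel_le[OF c(1) _ c(2), of u] a by (auto simp: indicator_def)
  have I: "integrable lborel (\<lambda>u. 2 / c\<^sup>2 * (indicator {a<..} u *\<^sub>R (u / (1 + u\<^sup>2)\<^sup>2)))"
    using tail_rational(1)[OF a] unfolding set_integrable_def by (rule integrable_mult_right)
  show int: "set_integrable lborel {a<..} (layer_kernel z)" unfolding set_integrable_def
    by (rule integrable_bounded_by[OF I _ bd]) measurable
  have "(LBINT u:{a<..}. norm (layer_kernel z u)) \<le> (LBINT u. 2 / c\<^sup>2 * (indicator {a<..} u *\<^sub>R (u / (1 + u\<^sup>2)\<^sup>2)))"
    unfolding set_lebesgue_integral_def
  proof (rule integral_mono[OF _ I])
    show "integrable lborel (\<lambda>u. indicat_real {a<..} u *\<^sub>R norm (layer_kernel z u))"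
      using set_integrable_norm[OF int] by (simp add: set_integrable_def)
    show "indicat_real {a<..} u *\<^sub>R norm (layer_kernel z u) \<le> 2 / c\<^sup>2 * (indicat_real {a<..} u *\<^sub>R (u / (1 + u\<^sup>2)\<^sup>2))" for u
      using bd[of u] by (simp add: abs_of_nonneg)
  qed
  also have "\<dots> = 2 / c\<^sup>2 * (LBINT u:{a<..}. u / (1 + u\<^sup>2)\<^sup>2)"
    unfolding set_lebesgue_integral_def by (rule Bochner_Integration.integral_mult_right_zero)
  also have "\<dots> = 1 / c\<^sup>2 * (1 / (1 + a\<^sup>2))" 
  proof -
    have "2 / X * (1 / (2 * Y)) = 1 / X * (1 / Y)" for X Y :: real by simp
    then show ?thesis unfolding tail_rational(2)[OF a] .
  qed
  finally show "(LBINT u:{a<..}. norm (layer_kernel z u)) \<le> 1 / c\<^sup>2 * (1 / (1 + a\<^sup>2))" .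
  let ?F = "\<lambda>w. - 1 / (w\<^sup>2 - z\<^sup>2)"
  have nz: "(complex_of_real u)\<^sup>2 - z\<^sup>2 \<noteq> 0" for u by (rule square_diff_nonzero[OF z])
  have D: "((\<lambda>u. ?F (of_real u)) has_vector_derivative layer_kernel z u) (at u)" for u
    unfolding layer_kernel_def
    by (rule has_vector_derivative_real_field) (use nz[of u] in \<open>auto intro!: derivative_eq_intros simp: power2_eq_square\<close>)
  have cont: "isCont (layer_kernel z) u" for u
    unfolding layer_kernel_def using nz[of u] by (auto intro!: continuous_intros)
  have t: "((\<lambda>u. ?F (of_real u)) \<longlongrightarrow> 0) at_top"
  proof (rule tendsto_0_le)
    show "((\<lambda>u::real. 1 / (c * (1 + u\<^sup>2))) \<longlongrightarrow> 0) at_top"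
      using tendsto_mult[OF tendsto_const[of "1 / c"] tendsto_inverse_quadratic_at_top(1)] by simp
    show "\<forall>\<^sub>F u in at_top. norm (?F (complex_of_real u)) \<le> norm (1 / (c * (1 + u\<^sup>2))) * 1"
      using eventually_ge_at_top[of 0]
    proof eventually_elim
      case (elim u)
      have p: "c * (1 + u\<^sup>2) > 0" using c(1) by (simp add: add_pos_nonneg)
      then show ?case using c(2)[OF elim] by (auto simp: norm_divide intro!: divide_left_mono mult_pos_pos)
    qed
  qed
  have b: "((\<lambda>u. ?F (of_real u)) \<longlongrightarrow> ?F (of_real a)) (at_right a)"
    using nz by (intro tendsto_intros) auto
  have A: "(((\<lambda>u. ?F (of_real u)) \<circ> real_of_ereal) \<longlongrightarrow> ?F (of_real a)) (at_right (ereal a))" "(((\<lambda>u. ?F (of_real u)) \<circ> real_of_ereal) \<longlongrightarrow> 0) (at_left \<infinity>)"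
    using b t by (simp_all add: ereal_tendsto_simps)
  have "set_integrable lborel (einterval (ereal a) \<infinity>) (layer_kernel z)" using int by (simp add: einterval_infinity)
  from interval_integral_FTC_integrable[OF _ D cont this A]
  show "(LBINT u:{a<..}. layer_kernel z u) = 1 / ((of_real a)\<^sup>2 - z\<^sup>2)"
    by (simp add: einterval_infinity interval_lebesgue_integral_def)
qed

text \<open>The origin of the constant pi/2 in \<omega>: the two logarithms in the antiderivative
  cancel at infinity, while at 0 they differ by the half turn from -z to z.\<close>

lemma layer_kernel_first_moment:
  assumes z: "Im z > 0"
  shows "(LBINT u:{0<..}. of_real u * layer_kernel z u) = \<i> * pi / (2 * z)"
proof -
  obtain c where c: "c > 0" "\<And>u. u \<ge> 0 \<Longrightarrow> norm ((complex_of_real u)\<^sup>2 - z\<^sup>2) \<ge> c * (1 + u\<^sup>2)"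
    using square_diff_lower_bound[of "Im z" "norm z"] z by auto
  have z0: "z \<noteq> 0" using z by auto
  \<comment> \<open>Integration by parts followed by partial fractions of
    \<open>1 / (w^2 - z^2)\<close>. For real w the arguments \<open>w - z\<close> and
    \<open>w + z\<close> stay in opposite open half-planes, off the branch cut.\<close>
  let ?F = "\<lambda>w. - w / (w\<^sup>2 - z\<^sup>2) + (Ln (w - z) - Ln (w + z)) / (2 * z)"
  have nz: "(complex_of_real u)\<^sup>2 - z\<^sup>2 \<noteq> 0" for u by (rule square_diff_nonzero[OF z])
  have nn: "complex_of_real u - z \<notin> \<real>\<^sub>\<le>\<^sub>0" "complex_of_real u + z \<notin> \<real>\<^sub>\<le>\<^sub>0" for u
    using z by (auto simp: complex_nonpos_Reals_iff)
  have nz2: "complex_of_real u - z \<noteq> 0" "complex_of_real u + z \<noteq> 0" for u using z by (auto simp: complex_eq_iff)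
  have D: "((\<lambda>u. ?F (of_real u)) has_vector_derivative (of_real u * layer_kernel z u)) (at u)" for u
  proof (rule has_vector_derivative_real_field)
    let ?w = "complex_of_real u"
    have "(?F has_field_derivative
        (- 1 * (?w\<^sup>2 - z\<^sup>2) - (- ?w) * (2 * ?w)) / ((?w\<^sup>2 - z\<^sup>2) * (?w\<^sup>2 - z\<^sup>2)) + (1 / (?w - z) - 1 / (?w + z)) / (2 * z)) (at ?w)"
    proof (intro DERIV_add DERIV_divide DERIV_cdivide DERIV_diff)
      show "((\<lambda>w. Ln (w - z)) has_field_derivative 1 / (?w - z)) (at ?w)"
        using DERIV_chain2[OF has_field_derivative_Ln[OF nn(1)[of u]] DERIV_diff[OF DERIV_ident DERIV_const]]
        by (simp add: inverse_eq_divide)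
      show "((\<lambda>w. Ln (w + z)) has_field_derivative 1 / (?w + z)) (at ?w)"
        using DERIV_chain2[OF has_field_derivative_Ln[OF nn(2)[of u]] DERIV_add[OF DERIV_ident DERIV_const]]
        by (simp add: inverse_eq_divide)
      show "((\<lambda>w. w\<^sup>2 - z\<^sup>2) has_field_derivative 2 * ?w) (at ?w)"
        by (auto intro!: derivative_eq_intros)
      show "(uminus has_field_derivative - 1) (at ?w)"
        by (auto intro!: derivative_eq_intros)
    qed (rule nz)
    moreover have "(1 / (?w - z) - 1 / (?w + z)) / (2 * z) = 1 / (?w\<^sup>2 - z\<^sup>2)"
    proof -
      have "1 / (?w - z) - 1 / (?w + z) = 2 * z / (?w\<^sup>2 - z\<^sup>2)"
        using nz2[of u] nz[of u] by (simp add: divide_simps) (simp add: power2_eq_square algebra_simps)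
      then show ?thesis using z0 by simp
    qed
    moreover have "(- 1 * (?w\<^sup>2 - z\<^sup>2) - (- ?w) * (2 * ?w)) / ((?w\<^sup>2 - z\<^sup>2) * (?w\<^sup>2 - z\<^sup>2)) + 1 / (?w\<^sup>2 - z\<^sup>2) = ?w * layer_kernel z u"
      using nz[of u] unfolding layer_kernel_def by (simp add: divide_simps) (simp add: power2_eq_square algebra_simps)
    ultimately show "(?F has_field_derivative (?w * layer_kernel z u)) (at ?w)" by simp
  qed
  have cont: "isCont (\<lambda>u. of_real u * layer_kernel z u) u" for u
    unfolding layer_kernel_def using nz[of u] by (auto intro!: continuous_intros)
  have int: "set_integrable lborel {0<..} (\<lambda>u. of_real u * layer_kernel z u)" unfolding set_integrable_def
  proof (rule integrable_bounded_by)
    let ?g = "\<lambda>u. 2 / c\<^sup>2 * (1 / (u\<^sup>2 + 1)) :: real"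
    show "integrable lborel ?g" using integral_inverse_quadratic(1)[of 1] by (intro integrable_mult_right) auto
    show "norm (indicator {0<..} u *\<^sub>R (of_real u * layer_kernel z u)) \<le> ?g u" for u
    proof (cases "u > 0")
      case True
      have "norm (of_real u * layer_kernel z u) \<le> u * (2 / c\<^sup>2 * (u / (1 + u\<^sup>2)\<^sup>2))"
        unfolding norm_mult using norm_layer_kernel_le[OF c(1) _ c(2), of u] True by (intro mult_mono) auto
      also have "\<dots> = 2 / c\<^sup>2 * (u\<^sup>2 / (1 + u\<^sup>2)\<^sup>2)" by (simp add: power2_eq_square)
      also have "\<dots> \<le> 2 / c\<^sup>2 * ((1 + u\<^sup>2) / (1 + u\<^sup>2)\<^sup>2)" by (intro mult_left_mono divide_right_mono) auto
      also have "(1 + u\<^sup>2) / (1 + u\<^sup>2)\<^sup>2 = 1 / (u\<^sup>2 + 1)" by (simp add: power2_eq_square add.commute)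
      finally show ?thesis using True by simp
    qed simp
  qed measurable
  have t: "((\<lambda>u. ?F (of_real u)) \<longlongrightarrow> 0) at_top"
  proof -
    have fr: "filterlim (\<lambda>u. complex_of_real u) at_infinity at_top" by (rule filterlim_of_real_at_infinity) 
    have 1: "((\<lambda>u. - complex_of_real u / ((of_real u)\<^sup>2 - z\<^sup>2)) \<longlongrightarrow> 0) at_top"
    proof (rule tendsto_0_le)
      show "((\<lambda>u::real. u / (c * (1 + u\<^sup>2))) \<longlongrightarrow> 0) at_top"
        using tendsto_mult[OF tendsto_const[of "1 / c"] tendsto_inverse_quadratic_at_top(2)] by simp
      show "\<forall>\<^sub>F u in at_top. norm (- complex_of_real u / ((of_real u)\<^sup>2 - z\<^sup>2)) \<le> norm (u / (c * (1 + u\<^sup>2))) * 1"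
        using eventually_ge_at_top[of 0]
      proof eventually_elim
        case (elim u)
        have p: "c * (1 + u\<^sup>2) > 0" using c(1) by (simp add: add_pos_nonneg)
        then show ?case using c(2)[OF elim] elim by (auto simp: norm_divide intro!: divide_left_mono mult_pos_pos)
      qed
    qed
    have zu: "((\<lambda>u. z / complex_of_real u) \<longlongrightarrow> 0) at_top"
      by (rule tendsto_divide_0[OF tendsto_const fr])
    \<comment> \<open>Taking the positive factor u out of both logarithms leaves arguments that tend
      to 1.\<close>
    have 2: "((\<lambda>u. Ln (1 - z / of_real u) - Ln (1 + z / of_real u)) \<longlongrightarrow> Ln (1 - 0) - Ln (1 + 0)) at_top"
      by (intro tendsto_intros zu) auto
    have "\<forall>\<^sub>F u in at_top. Ln (1 - z / of_real u) - Ln (1 + z / of_real u) = Ln (of_real u - z) - Ln (of_real u + z)"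
      using eventually_gt_at_top[of 0]
    proof eventually_elim
      case (elim u)
      have "complex_of_real u - z = of_real u * (1 - z / of_real u)" "complex_of_real u + z = of_real u * (1 + z / of_real u)"
        using elim by (auto simp: algebra_simps)
      moreover have "1 - z / of_real u \<noteq> 0" "1 + z / of_real u \<noteq> 0"
        using nz2[of u] elim by (auto simp: field_simps add_eq_0_iff)
      ultimately show ?case using elim by (simp add: Ln_times_of_real)
    qed
    then have "((\<lambda>u. Ln (complex_of_real u - z) - Ln (of_real u + z)) \<longlongrightarrow> 0) at_top"
      using 2 by (simp add: tendsto_cong)
    then have "((\<lambda>u. ?F (of_real u)) \<longlongrightarrow> 0 + 0 / (2 * z)) at_top" using z0 by (intro tendsto_intros 1) auto
    then show ?thesis by simp
  qed
  have b: "((\<lambda>u. ?F (of_real u)) \<longlongrightarrow> ?F (of_real 0)) (at_right 0)"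
    using nz[of 0] nn[of 0] z0 by (intro tendsto_intros) auto
  have A: "(((\<lambda>u. ?F (of_real u)) \<circ> real_of_ereal) \<longlongrightarrow> ?F (of_real 0)) (at_right (ereal 0))" "(((\<lambda>u. ?F (of_real u)) \<circ> real_of_ereal) \<longlongrightarrow> 0) (at_left \<infinity>)"
    using b t by (simp_all only: ereal_tendsto_simps)
  have "set_integrable lborel (einterval (ereal 0) \<infinity>) (\<lambda>u. of_real u * layer_kernel z u)" using int by (simp add: einterval_infinity)
  from interval_integral_FTC_integrable[OF _ D cont this A]
  have "(LBINT u:{0<..}. of_real u * layer_kernel z u) = - ?F 0"
    by (simp add: einterval_infinity interval_lebesgue_integral_def)
  also have "- ?F 0 = (Ln z - Ln (-z)) / (2 * z)" by (simp add: minus_divide_left)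
  also have "Ln (- z) = Ln z - \<i> * pi" using z z0 by (subst Ln_minus) auto
  finally show ?thesis by simp
qed

section \<open>Mass functions and their power moments\<close>

abbreviation (input) mass :: "real measure \<Rightarrow> real \<Rightarrow> real" where
  "mass m \<equiv> \<lambda>t. measure m {-t<..<t}"

text \<open>\<open>measure\<close> is 0 on sets of infinite measure; finiteness on bounded intervals
  excludes this and makes \<open>mass\<close> monotone. The Borel sigma-algebra is bundled in
  because nearly every use needs both.\<close>

definition locally_finite :: "real measure \<Rightarrow> bool" where
  "locally_finite m \<longleftrightarrow> sets m = sets borel \<and> (\<forall>a. emeasure m {-a<..<a} < \<infinity>)"

lemma locally_finiteD:
  assumes "locally_finite m"
  shows "sets m = sets borel" "\<And>a. emeasure m {-a<..<a} < \<infinity>" "space m = UNIV"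
    "\<And>a. emeasure m {-a<..<a} = ennreal (mass m a)"
  using assms sets_eq_imp_space_eq[of m borel]
  by (auto simp: locally_finite_def emeasure_eq_ennreal_measure less_top)

lemma mass_mono:
  assumes "locally_finite m" "x \<le> y"
  shows "mass m x \<le> mass m y"
  using assms locally_finiteD(1,2)[OF assms(1)]
  by (intro measure_mono_fmeasurable) (auto simp: fmeasurable_def)

lemma measurable_mass [measurable]:
  assumes "locally_finite m"
  shows "mass m \<in> borel_measurable borel"
  using mass_mono[OF assms] by (intro borel_measurable_mono monoI)

lemma weight_bounds:
  fixes s :: real
  shows "0 < 1 / (1 + s\<^sup>2) ^ n" "1 / (1 + s\<^sup>2) ^ n \<le> 1"
proof -
  have p: "1 + s\<^sup>2 > 0" using zero_le_power2[of s] by linarith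
  then show "0 < 1 / (1 + s\<^sup>2) ^ n" by simp
  have "1 \<le> (1 + s\<^sup>2) ^ n" by (rule one_le_power) simp
  then show "1 / (1 + s\<^sup>2) ^ n \<le> 1" using p by (subst divide_le_eq_1_pos) auto
qed

lemma DERIV_neg_inverse_power:
  fixes u :: real
  assumes "u \<noteq> 0"
  shows "DERIV (\<lambda>u. - (1 / u ^ n)) u :> n / u ^ (n + 1)"
proof (cases n)
  case (Suc k)
  have "DERIV (\<lambda>u. - (1 / u ^ n)) u :> - (- (real n * u ^ (n - Suc 0)) / (u ^ n)\<^sup>2)"
    using assms by (auto intro!: derivative_eq_intros simp: power2_eq_square)
  moreover have "- (- (real n * u ^ (n - Suc 0)) / (u ^ n)\<^sup>2) = n / u ^ (n + 1)"
    using assms Suc by (simp add: power2_eq_square)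
  ultimately show ?thesis by simp
qed simp

text \<open>This is \<open>nn_layer\<close> with the kernel \<open>n / u ^ (n + 1)\<close> on
  [1, b], the derivative of \<open>- (1 / u ^ n)\<close>. The inner integral starts at the larger of
  |s| and 1, hence the maximum, and is empty for |s| \<ge> b.\<close>

lemma nn_layer_bounded:
  assumes m: "locally_finite m" and b: "b \<ge> 1"
  shows "(\<integral>\<^sup>+ u. ennreal (n / u ^ (n + 1) * mass m u) * indicator {1..b} u \<partial>lborel)
    = (\<integral>\<^sup>+ s. ennreal (1 / max \<bar>s\<bar> 1 ^ n - 1 / b ^ n) * indicator {-b<..<b} s \<partial>m)"
proof -
  note mD = locally_finiteD[OF m]
  let ?k = "\<lambda>u. ennreal (n / u ^ (n + 1)) * indicator {1..b} u"
  have inner: "(\<integral>\<^sup>+ u. ?k u * indicator {\<bar>s\<bar><..} u \<partial>lborel) = ennreal (1 / max \<bar>s\<bar> 1 ^ n - 1 / b ^ n) * indicator {-b<..<b} s" for s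
  proof (cases "\<bar>s\<bar> < b")
    case True
    let ?a = "max \<bar>s\<bar> 1"
    have "(\<integral>\<^sup>+ u. ?k u * indicator {\<bar>s\<bar><..} u \<partial>lborel) = (\<integral>\<^sup>+ u. ennreal (n / u ^ (n + 1)) * indicator {?a..b} u \<partial>lborel)"
    proof (rule nn_integral_cong_AE)
      show "AE u in lborel. ?k u * indicator {\<bar>s\<bar><..} u = ennreal (n / u ^ (n + 1)) * indicator {?a..b} u"
        using AE_lborel_singleton[of "\<bar>s\<bar>"] AE_lborel_singleton[of 1]
        by eventually_elim (auto simp: indicator_def)
    qed
    also have "\<dots> = ennreal (- (1 / b ^ n) - - (1 / ?a ^ n))"
      using True b by (intro nn_integral_FTC_Icc DERIV_neg_inverse_power) auto
    finally show ?thesis using True by (simp add: indicator_def abs_less_iff)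
  next
    case False
    then have z: "?k u * indicator {\<bar>s\<bar><..} u = 0" for u by (auto simp: indicator_def)
    show ?thesis unfolding z using False by (auto simp: indicator_def abs_less_iff)
  qed
  have "(\<integral>\<^sup>+ u. ennreal (n / u ^ (n + 1) * mass m u) * indicator {1..b} u \<partial>lborel) = (\<integral>\<^sup>+ u. ?k u * emeasure m {-u<..<u} \<partial>lborel)"
  proof (rule nn_integral_cong)
    fix u :: real
    have "ennreal (n / u ^ (n + 1) * mass m u) = ennreal (n / u ^ (n + 1)) * ennreal (mass m u)" if "u \<ge> 0"
      using that by (intro ennreal_mult) auto
    then show "ennreal (n / u ^ (n + 1) * mass m u) * indicator {1..b} u = ?k u * emeasure m {-u<..<u}"
      unfolding mD(4) by (cases "u \<in> {1..b}") auto
  qed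
  also have "\<dots> = (\<integral>\<^sup>+ s. (\<integral>\<^sup>+ u. ?k u * indicator {\<bar>s\<bar><..} u \<partial>lborel) \<partial>m)"
    by (rule nn_layer[symmetric, OF mD(1,2)]) measurable
  finally show ?thesis unfolding inner .
qed

text \<open>The same kernel on an unbounded interval. No boundary term survives because
  \<open>1 / u ^ n\<close> tends to 0, which is where \<open>n \<ge> 1\<close> enters.\<close>

lemma nn_layer_tail:
  assumes m: "locally_finite m" and t: "t > 0" and n: "n \<ge> 1"
  shows "(\<integral>\<^sup>+ u. ennreal (n / u ^ (n + 1) * mass m u) * indicator {t..} u \<partial>lborel)
    = (\<integral>\<^sup>+ s. ennreal (1 / max \<bar>s\<bar> t ^ n) \<partial>m)"
proof -
  note mD = locally_finiteD[OF m]
  let ?k = "\<lambda>u. ennreal (n / u ^ (n + 1)) * indicator {t..} u"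
  have lim: "((\<lambda>u::real. - (1 / u ^ n)) \<longlongrightarrow> 0) at_top"
    using tendsto_minus[OF tendsto_inverse_0_at_top[OF filterlim_pow_at_top[OF _ filterlim_ident]]] n by (simp add: inverse_eq_divide)
  have inner: "(\<integral>\<^sup>+ u. ?k u * indicator {\<bar>s\<bar><..} u \<partial>lborel) = ennreal (1 / max \<bar>s\<bar> t ^ n)" for s
  proof -
    let ?a = "max \<bar>s\<bar> t"
    have "(\<integral>\<^sup>+ u. ?k u * indicator {\<bar>s\<bar><..} u \<partial>lborel) = (\<integral>\<^sup>+ u. ennreal (n / u ^ (n + 1)) * indicator {?a..} u \<partial>lborel)"
    proof (rule nn_integral_cong_AE)
      show "AE u in lborel. ?k u * indicator {\<bar>s\<bar><..} u = ennreal (n / u ^ (n + 1)) * indicator {?a..} u"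
        using AE_lborel_singleton[of "\<bar>s\<bar>"] AE_lborel_singleton[of t]
        by eventually_elim (auto simp: indicator_def)
    qed
    also have "\<dots> = ennreal (0 - - (1 / ?a ^ n))"
      using t by (intro nn_integral_FTC_atLeast DERIV_neg_inverse_power lim) auto
    finally show ?thesis by simp
  qed
  have "(\<integral>\<^sup>+ u. ennreal (n / u ^ (n + 1) * mass m u) * indicator {t..} u \<partial>lborel) = (\<integral>\<^sup>+ u. ?k u * emeasure m {-u<..<u} \<partial>lborel)"
  proof (rule nn_integral_cong)
    fix u :: real
    have "ennreal (n / u ^ (n + 1) * mass m u) = ennreal (n / u ^ (n + 1)) * ennreal (mass m u)" if "u \<ge> 0"
      using that by (intro ennreal_mult) auto
    then show "ennreal (n / u ^ (n + 1) * mass m u) * indicator {t..} u = ?k u * emeasure m {-u<..<u}"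
      unfolding mD(4) using t by (cases "u \<in> {t..}") auto
  qed
  also have "\<dots> = (\<integral>\<^sup>+ s. (\<integral>\<^sup>+ u. ?k u * indicator {\<bar>s\<bar><..} u \<partial>lborel) \<partial>m)"
    by (rule nn_layer[symmetric, OF mD(1,2)]) measurable
  finally show ?thesis unfolding inner .
qed

lemma locally_finite_integrable:
  fixes h :: "real \<Rightarrow> real"
  assumes m: "locally_finite m" and [measurable]: "h \<in> borel_measurable borel" and B: "\<And>s. \<bar>s\<bar> < b \<Longrightarrow> \<bar>h s\<bar> \<le> B"
  shows "set_integrable m {-b<..<b} h"
  unfolding set_integrable_def
proof (rule integrable_bounded_by)
  note mD = locally_finiteD[OF m]
  note [measurable_cong] = mD(1)
  show "integrable m (\<lambda>s. B * indicator {-b<..<b} s)"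
    using mD(1) mD(2)[of b] by (intro integrable_mult_right) auto
  show "norm (indicator {-b<..<b} s *\<^sub>R h s) \<le> B * indicator {-b<..<b} s" for s
    using B[of s] by (auto simp: indicator_def abs_less_iff)
  show "(\<lambda>s. indicat_real {-b<..<b} s *\<^sub>R h s) \<in> borel_measurable m" by measurable
qed

text \<open>Integration by parts through layers: the boundary term is what the constant
  \<open>1 / b ^ n\<close> in \<open>nn_layer_bounded\<close> integrates to.\<close>

lemma layer_bounded:
  assumes m: "locally_finite m" and b: "b \<ge> 1"
  shows "set_integrable lborel {1..b} (\<lambda>u. mass m u / u ^ (n + 1))"
    and "n * (LINT u:{1..b}|lborel. mass m u / u ^ (n + 1)) = (LINT s:{-b<..<b}|m. 1 / max \<bar>s\<bar> 1 ^ n) - mass m b / b ^ n"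
proof -
  note mD = locally_finiteD[OF m]
  note [measurable_cong] = mD(1)
  note measurable_mass[OF m, measurable]
  have bd: "mass m u / u ^ (n + 1) \<le> mass m b" if "u \<in> {1..b}" for u
  proof -
    have "mass m u / u ^ (n + 1) \<le> mass m u / 1"
      using that by (intro divide_left_mono one_le_power mult_pos_pos zero_less_power) auto
    also have "\<dots> \<le> mass m b" using mass_mono[OF m, of u b] that by simp
    finally show ?thesis .
  qed
  show "set_integrable lborel {1..b} (\<lambda>u. mass m u / u ^ (n + 1))" unfolding set_integrable_def
  proof (rule integrable_bounded_by)
    show "integrable lborel (\<lambda>u. mass m b * indicator {1..b} u)" by (intro integrable_mult_right integrable_real_indicator) (auto simp: emeasure_lborel_Icc_eq)
    show "norm (indicator {1..b} u *\<^sub>R (mass m u / u ^ (n + 1))) \<le> mass m b * indicator {1..b} u" for u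
      using bd[of u] by (cases "u \<in> {1..b}") (auto simp: abs_of_nonneg)
  qed measurable
  have i: "set_integrable m {-b<..<b} (\<lambda>s. 1 / max \<bar>s\<bar> 1 ^ n)" "set_integrable m {-b<..<b} (\<lambda>s. 1 / b ^ n)"
    using m b by (auto intro!: locally_finite_integrable[where B = 1] simp: divide_le_eq_1 one_le_power)
  have "n * (LINT u:{1..b}|lborel. mass m u / u ^ (n + 1)) = (\<integral>u. n / u ^ (n + 1) * mass m u * indicator {1..b} u \<partial>lborel)"
    unfolding set_lebesgue_integral_def
    by (subst Bochner_Integration.integral_mult_right_zero[symmetric]) (auto intro!: Bochner_Integration.integral_cong)
  also have "\<dots> = enn2real (\<integral>\<^sup>+ u. ennreal (n / u ^ (n + 1) * mass m u) * indicator {1..b} u \<partial>lborel)"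
    by (subst integral_eq_nn_integral) (auto simp: indicator_def intro!: arg_cong[where f = enn2real] nn_integral_cong)
  also have "\<dots> = enn2real (\<integral>\<^sup>+ s. ennreal (indicator {-b<..<b} s * (1 / max \<bar>s\<bar> 1 ^ n - 1 / b ^ n)) \<partial>m)"
    unfolding nn_layer_bounded[OF m b] by (intro arg_cong[where f = enn2real] nn_integral_cong) (auto simp: indicator_def)
  also have "\<dots> = (\<integral>s. indicator {-b<..<b} s * (1 / max \<bar>s\<bar> 1 ^ n - 1 / b ^ n) \<partial>m)"
  proof (subst integral_eq_nn_integral)
    have "1 / max \<bar>s\<bar> 1 ^ n - 1 / b ^ n \<ge> 0" if "s \<in> {-b<..<b}" for s
    proof -
      have "max \<bar>s\<bar> 1 ^ n \<le> b ^ n" using that b by (intro power_mono) auto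
      then show ?thesis using b by (auto intro!: divide_left_mono mult_pos_pos zero_less_power)
    qed
    then show "AE s in m. 0 \<le> indicator {-b<..<b} s * (1 / max \<bar>s\<bar> 1 ^ n - 1 / b ^ n)"
      by (intro AE_I2) (auto simp: indicator_def)
  qed simp_all
  also have "\<dots> = (LINT s:{-b<..<b}|m. 1 / max \<bar>s\<bar> 1 ^ n) - (LINT s:{-b<..<b}|m. 1 / b ^ n)"
    using set_integral_diff(2)[OF i] by (simp add: set_lebesgue_integral_def)
  also have "(LINT s:{-b<..<b}|m. 1 / b ^ n) = mass m b / b ^ n"
    unfolding set_lebesgue_integral_def using mD(3) by simp
  finally show "n * (LINT u:{1..b}|lborel. mass m u / u ^ (n + 1)) = (LINT s:{-b<..<b}|m. 1 / max \<bar>s\<bar> 1 ^ n) - mass m b / b ^ n" .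
qed

text \<open>Bernoulli's inequality for
  \<open>(s^2 / (1 + s^2)) ^ N = (1 - 1 / (1 + s^2)) ^ N\<close>. The factor \<open>2 ^ N\<close>
  comes from \<open>1 + s^2 \<le> 2 s^2\<close>.\<close>

lemma inverse_power_shift_bounds:
  fixes s :: real
  assumes "\<bar>s\<bar> \<ge> 1"
  shows "0 \<le> 1 / (s\<^sup>2) ^ N - 1 / (1 + s\<^sup>2) ^ N" "1 / (s\<^sup>2) ^ N - 1 / (1 + s\<^sup>2) ^ N \<le> real N * 2 ^ N * (1 / (1 + s\<^sup>2) ^ N) / s\<^sup>2"
proof -
  have s: "s\<^sup>2 \<ge> 1" using assms power_mono[of 1 "\<bar>s\<bar>" 2] by simp
  then have p: "s\<^sup>2 > 0" "1 + s\<^sup>2 > 0" by linarith+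
  have "(s\<^sup>2) ^ N \<le> (1 + s\<^sup>2) ^ N" using s by (intro power_mono) auto
  then show "0 \<le> 1 / (s\<^sup>2) ^ N - 1 / (1 + s\<^sup>2) ^ N" using p by (auto intro!: divide_left_mono mult_pos_pos)
  have "1 - real N * (1 / (1 + s\<^sup>2)) \<le> (1 - 1 / (1 + s\<^sup>2)) ^ N"
    using Bernoulli_inequality[of "- (1 / (1 + s\<^sup>2))" N] p s by simp
  also have "1 - 1 / (1 + s\<^sup>2) = s\<^sup>2 / (1 + s\<^sup>2)" using p by (simp add: field_simps)
  finally have 1: "1 - (s\<^sup>2) ^ N / (1 + s\<^sup>2) ^ N \<le> N / (1 + s\<^sup>2)" by (simp add: power_divide)
  have "1 / (s\<^sup>2) ^ N - 1 / (1 + s\<^sup>2) ^ N = 1 / (s\<^sup>2) ^ N * (1 - (s\<^sup>2) ^ N / (1 + s\<^sup>2) ^ N)"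
    using p by (simp add: right_diff_distrib)
  also have "\<dots> \<le> 1 / (s\<^sup>2) ^ N * (N / (1 + s\<^sup>2))" using 1 p by (intro mult_left_mono) auto
  also have "\<dots> \<le> 2 ^ N * (1 / (1 + s\<^sup>2) ^ N) * (N / s\<^sup>2)"
  proof (rule mult_mono)
    have "(1 + s\<^sup>2) ^ N \<le> (2 * s\<^sup>2) ^ N" using s by (intro power_mono) auto
    then show "1 / (s\<^sup>2) ^ N \<le> 2 ^ N * (1 / (1 + s\<^sup>2) ^ N)" using p by (simp add: divide_simps power_mult_distrib)
    show "real N / (1 + s\<^sup>2) \<le> N / s\<^sup>2" using p by (intro divide_left_mono) auto
  qed (use p in auto)
  finally show "1 / (s\<^sup>2) ^ N - 1 / (1 + s\<^sup>2) ^ N \<le> real N * 2 ^ N * (1 / (1 + s\<^sup>2) ^ N) / s\<^sup>2" by (simp add: mult_ac)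
qed

text \<open>Exchanges the weight for truncated powers, whose moments the layer formulas compute. The
  error is again a multiple of the integrable weight, in the first estimate even divided by |s| for
  |s| \<ge> 1; the tail estimates depend on this extra decay.\<close>

lemma weight_comparison:
  fixes s :: real and \<kappa> :: nat
  defines "w \<equiv> 1 / (1 + s\<^sup>2) ^ (\<kappa> + 1)" and "C \<equiv> (real \<kappa> + 2) * 2 ^ (\<kappa> + 1)"
  shows "\<bar>\<bar>s\<bar> * w - 1 / max \<bar>s\<bar> 1 ^ (2 * \<kappa> + 1)\<bar> \<le> C * w / max \<bar>s\<bar> 1"
    and "\<bar>s\<^sup>2 * w - 1 / max \<bar>s\<bar> 1 ^ (2 * \<kappa>)\<bar> \<le> C * w"
proof -
  let ?N = "\<kappa> + 1"
  have p: "1 + s\<^sup>2 > 0" using zero_le_power2[of s] by linarith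
  have w: "w > 0" "w \<le> 1" unfolding w_def by (rule weight_bounds)+
  \<comment> \<open>The first bound covers |s| < 1, where \<open>1 \<le> 2 ^ ?N * w\<close>; the
    second is the Bernoulli constant for |s| \<ge> 1.\<close>
  have C: "C \<ge> 2 ^ ?N" "C \<ge> real ?N * 2 ^ ?N" by (auto simp: C_def algebra_simps)
  consider "\<bar>s\<bar> < 1" | "\<bar>s\<bar> \<ge> 1" by linarith
  then have "\<bar>\<bar>s\<bar> * w - 1 / max \<bar>s\<bar> 1 ^ (2 * \<kappa> + 1)\<bar> \<le> C * w / max \<bar>s\<bar> 1 \<and> \<bar>s\<^sup>2 * w - 1 / max \<bar>s\<bar> 1 ^ (2 * \<kappa>)\<bar> \<le> C * w"
  proof cases
    case 1
    then have s2: "s\<^sup>2 \<le> 1" by (simp add: abs_square_le_1)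
    then have "(1 + s\<^sup>2) ^ ?N \<le> 2 ^ ?N" by (intro power_mono) auto
    then have "1 \<le> 2 ^ ?N * w" using p by (simp add: w_def divide_simps)
    also have "\<dots> \<le> C * w" using C w by (intro mult_right_mono) auto
    finally have "1 \<le> C * w" .
    moreover have "0 \<le> \<bar>s\<bar> * w" "\<bar>s\<bar> * w \<le> 1" "0 \<le> s\<^sup>2 * w" "s\<^sup>2 * w \<le> 1"
      using w 1 s2 by (auto intro!: mult_le_one)
    ultimately show ?thesis using 1 by (auto simp: max_absorb2 abs_le_iff)
  next
    case 2
    let ?e = "1 / (s\<^sup>2) ^ ?N - w"
    have e: "0 \<le> ?e" "?e \<le> real ?N * 2 ^ ?N * w / s\<^sup>2"
      using inverse_power_shift_bounds[OF 2, of ?N] by (simp_all only: w_def)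
    have s0: "\<bar>s\<bar> > 0" "s \<noteq> 0" using 2 by auto
    have s2: "s\<^sup>2 = \<bar>s\<bar> * \<bar>s\<bar>" by (simp add: power2_eq_square)
    have "real ?N * 2 ^ ?N * w / s\<^sup>2 \<le> C * w / s\<^sup>2" using C w by (intro divide_right_mono mult_right_mono) auto
    then have e2: "?e \<le> C * w / s\<^sup>2" using e(2) by linarith
    have A: "1 / \<bar>s\<bar> ^ (2 * \<kappa> + 1) = \<bar>s\<bar> * (1 / (s\<^sup>2) ^ ?N)" "1 / \<bar>s\<bar> ^ (2 * \<kappa>) = s\<^sup>2 * (1 / (s\<^sup>2) ^ ?N)"
    proof -
      have "(s\<^sup>2) ^ ?N = \<bar>s\<bar> ^ (2 * ?N)" unfolding power_mult by simp
      then have e1: "(s\<^sup>2) ^ ?N = \<bar>s\<bar> * \<bar>s\<bar> ^ (2 * \<kappa> + 1)" and e2: "(s\<^sup>2) ^ ?N = s\<^sup>2 * \<bar>s\<bar> ^ (2 * \<kappa>)"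
        by (simp_all add: s2)
      show "1 / \<bar>s\<bar> ^ (2 * \<kappa> + 1) = \<bar>s\<bar> * (1 / (s\<^sup>2) ^ ?N)" unfolding e1 using s0 by simp
      show "1 / \<bar>s\<bar> ^ (2 * \<kappa>) = s\<^sup>2 * (1 / (s\<^sup>2) ^ ?N)" unfolding e2 using s0 by simp
    qed
    have "\<bar>\<bar>s\<bar> * w - 1 / \<bar>s\<bar> ^ (2 * \<kappa> + 1)\<bar> = \<bar>s\<bar> * ?e" unfolding A
      using e(1) s0 by (subst right_diff_distrib[symmetric]) (simp add: abs_mult)
    also have "\<dots> \<le> \<bar>s\<bar> * (C * w / s\<^sup>2)" using e2 by (intro mult_left_mono) auto
    also have "\<dots> = C * w / \<bar>s\<bar>"
    proof -
      have "x * (y / (x * x)) = y / x" if "x \<noteq> 0" for x y :: real using that by simp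
      then show ?thesis unfolding s2 using s0 by (metis less_irrefl)
    qed
    finally have 1: "\<bar>\<bar>s\<bar> * w - 1 / \<bar>s\<bar> ^ (2 * \<kappa> + 1)\<bar> \<le> C * w / \<bar>s\<bar>" .
    have "\<bar>s\<^sup>2 * w - 1 / \<bar>s\<bar> ^ (2 * \<kappa>)\<bar> = s\<^sup>2 * ?e" unfolding A
      using e(1) s0 by (subst right_diff_distrib[symmetric]) (simp add: abs_mult)
    also have "\<dots> \<le> s\<^sup>2 * (C * w / s\<^sup>2)" using e2 by (intro mult_left_mono) auto
    also have "\<dots> = C * w" using s0 by simp
    finally show ?thesis using 1 2 by (simp add: max_absorb1)
  qed
  then show "\<bar>\<bar>s\<bar> * w - 1 / max \<bar>s\<bar> 1 ^ (2 * \<kappa> + 1)\<bar> \<le> C * w / max \<bar>s\<bar> 1"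
    and "\<bar>s\<^sup>2 * w - 1 / max \<bar>s\<bar> 1 ^ (2 * \<kappa>)\<bar> \<le> C * w" by auto
qed

text \<open>Both moments reduce to Lebesgue integrals of the mass function up to a constant. The
  boundary term is left in the error of the first estimate, which will be applied to negligible
  measures, but stays a main term in the second, where it contributes to the limit.\<close>

lemma weighted_moment_bounds:
  fixes m :: "real measure" and \<kappa> :: nat
  defines "w \<equiv> \<lambda>s. 1 / (1 + s\<^sup>2) ^ (\<kappa> + 1)" and "C \<equiv> (real \<kappa> + 2) * 2 ^ (\<kappa> + 1)"
  assumes m: "locally_finite m" and int: "integrable m (\<lambda>s. 1 / (1 + s\<^sup>2) ^ (\<kappa> + 1))" and b: "b \<ge> 1"
  shows "\<bar>(LINT s:{-b<..<b}|m. \<bar>s\<bar> * w s) - (2 * \<kappa> + 1) * (LINT u:{1..b}|lborel. mass m u / u ^ (2 * \<kappa> + 2))\<bar>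
      \<le> C * (\<integral>s. w s \<partial>m) + mass m b / b ^ (2 * \<kappa> + 1)"
    and "\<bar>(LINT s:{-b<..<b}|m. s\<^sup>2 * w s) - 2 * \<kappa> * (LINT u:{1..b}|lborel. mass m u / u ^ (2 * \<kappa> + 1)) - mass m b / b ^ (2 * \<kappa>)\<bar>
      \<le> C * (\<integral>s. w s \<partial>m)"
proof -
  note mD = locally_finiteD[OF m]
  note [measurable_cong] = mD(1)
  have w: "0 \<le> w s" "w s \<le> 1" for s
    using weight_bounds[of s "\<kappa> + 1"] by (simp_all add: w_def)
  have [measurable]: "w \<in> borel_measurable borel" unfolding w_def by measurable
  have intw: "integrable m w" using int by (simp add: w_def)
  have C: "C \<ge> 0" by (simp add: C_def)
  have gen: "\<bar>(LINT s:{-b<..<b}|m. g s) - (LINT s:{-b<..<b}|m. h s)\<bar> \<le> C * (\<integral>s. w s \<partial>m)"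
    if i: "set_integrable m {-b<..<b} g" "set_integrable m {-b<..<b} h" and le: "\<And>s. \<bar>g s - h s\<bar> \<le> C * w s" for g h :: "real \<Rightarrow> real"
  proof -
    have d: "set_integrable m {-b<..<b} (\<lambda>s. g s - h s)" using set_integral_diff(1)[OF i] .
    have "(LINT s:{-b<..<b}|m. g s) - (LINT s:{-b<..<b}|m. h s) = (LINT s:{-b<..<b}|m. g s - h s)"
      using set_integral_diff(2)[OF i] by simp
    also have "norm \<dots> \<le> (\<integral>s. C * w s \<partial>m)" unfolding set_lebesgue_integral_def
    proof (rule Bochner_Integration.integral_norm_bound_integral)
      show "integrable m (\<lambda>s. indicat_real {-b<..<b} s *\<^sub>R (g s - h s))" using d by (simp add: set_integrable_def)
      show "integrable m (\<lambda>s. C * w s)" using intw by (rule integrable_mult_right)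
      show "norm (indicat_real {-b<..<b} s *\<^sub>R (g s - h s)) \<le> C * w s" for s
        using le[of s] w[of s] C by (auto simp: indicator_def intro: mult_nonneg_nonneg)
    qed
    finally show ?thesis by simp
  qed
  have mx: "\<bar>1 / max \<bar>s\<bar> 1 ^ n\<bar> \<le> 1" for s :: real and n
  proof -
    have "1 \<le> max \<bar>s\<bar> 1 ^ n" by (rule one_le_power) simp
    then show ?thesis by (subst abs_of_nonneg) (auto simp: divide_le_eq_1)
  qed
  have i1: "set_integrable m {-b<..<b} (\<lambda>s. 1 / max \<bar>s\<bar> 1 ^ n)" for n
    by (rule locally_finite_integrable[OF m _ mx]) measurable
  have i2: "set_integrable m {-b<..<b} (\<lambda>s. \<bar>s\<bar> * w s)"
  proof (rule locally_finite_integrable[OF m, where B = "b * 1"])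
    show "\<bar>\<bar>s\<bar> * w s\<bar> \<le> b * 1" if "\<bar>s\<bar> < b" for s
      unfolding abs_mult using w[of s] that by (intro mult_mono) auto
  qed measurable
  have i3: "set_integrable m {-b<..<b} (\<lambda>s. s\<^sup>2 * w s)"
  proof (rule locally_finite_integrable[OF m, where B = "b\<^sup>2 * 1"])
    show "\<bar>s\<^sup>2 * w s\<bar> \<le> b\<^sup>2 * 1" if "\<bar>s\<bar> < b" for s
      unfolding abs_mult using w[of s] that power_mono[of "\<bar>s\<bar>" b 2] by (intro mult_mono) auto
  qed measurable
  have le1: "\<bar>\<bar>s\<bar> * w s - 1 / max \<bar>s\<bar> 1 ^ (2 * \<kappa> + 1)\<bar> \<le> C * w s" for s
  proof -
    have "C * w s / max \<bar>s\<bar> 1 \<le> C * w s / 1" using C w[of s] by (intro divide_left_mono) auto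
    then show ?thesis using weight_comparison(1)[of s \<kappa>] unfolding w_def C_def by linarith
  qed
  have le2: "\<bar>s\<^sup>2 * w s - 1 / max \<bar>s\<bar> 1 ^ (2 * \<kappa>)\<bar> \<le> C * w s" for s
    using weight_comparison(2)[of s \<kappa>] by (simp only: w_def C_def)
  have M0: "mass m b / b ^ (2 * \<kappa> + 1) \<ge> 0" using b by simp
  have A1: "(2 * \<kappa> + 1) * (LINT u:{1..b}|lborel. mass m u / u ^ (2 * \<kappa> + 2)) = (LINT s:{-b<..<b}|m. 1 / max \<bar>s\<bar> 1 ^ (2 * \<kappa> + 1)) - mass m b / b ^ (2 * \<kappa> + 1)"
    using layer_bounded(2)[OF m b, of "2 * \<kappa> + 1"] by (simp add: numeral_2_eq_2)
  show "\<bar>(LINT s:{-b<..<b}|m. \<bar>s\<bar> * w s) - (2 * \<kappa> + 1) * (LINT u:{1..b}|lborel. mass m u / u ^ (2 * \<kappa> + 2))\<bar>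
      \<le> C * (\<integral>s. w s \<partial>m) + mass m b / b ^ (2 * \<kappa> + 1)"
    using gen[OF i2 i1 le1] M0 unfolding A1 by linarith
  have "real (2 * \<kappa>) * (LINT u:{1..b}|lborel. mass m u / u ^ (2 * \<kappa> + 1)) = (LINT s:{-b<..<b}|m. 1 / max \<bar>s\<bar> 1 ^ (2 * \<kappa>)) - mass m b / b ^ (2 * \<kappa>)"
    by (rule layer_bounded(2)[OF m b])
  then show "\<bar>(LINT s:{-b<..<b}|m. s\<^sup>2 * w s) - 2 * \<kappa> * (LINT u:{1..b}|lborel. mass m u / u ^ (2 * \<kappa> + 1)) - mass m b / b ^ (2 * \<kappa>)\<bar>
      \<le> C * (\<integral>s. w s \<partial>m)"
    using gen[OF i3 i1 le2] by (simp add: algebra_simps)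
qed

lemma layer_tail:
  fixes m :: "real measure"
  assumes m: "locally_finite m" and t: "t \<ge> 1" and n: "n \<ge> 1" and fin: "(\<integral>\<^sup>+ s. ennreal (1 / (1 + \<bar>s\<bar>) ^ n) \<partial>m) < \<infinity>"
  shows "set_integrable lborel {t..} (\<lambda>u. mass m u / u ^ (n + 1))"
    and "integrable m (\<lambda>s. 1 / max \<bar>s\<bar> t ^ n)"
    and "n * (LINT u:{t..}|lborel. mass m u / u ^ (n + 1)) = (\<integral>s. 1 / max \<bar>s\<bar> t ^ n \<partial>m)"
proof -
  note mD = locally_finiteD[OF m]
  note [measurable_cong] = mD(1)
  note measurable_mass[OF m, measurable]
  have le: "1 / max \<bar>s\<bar> t ^ n \<le> 2 ^ n * (1 / (1 + \<bar>s\<bar>) ^ n)" for s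
  proof -
    have "(1 + \<bar>s\<bar>) ^ n \<le> (2 * max \<bar>s\<bar> t) ^ n" using t by (intro power_mono) auto
    moreover have "0 < max \<bar>s\<bar> t" using t by linarith
    ultimately show ?thesis by (simp add: divide_simps power_mult_distrib add_pos_nonneg)
  qed
  have "(\<integral>\<^sup>+ s. ennreal (1 / max \<bar>s\<bar> t ^ n) \<partial>m) \<le> (\<integral>\<^sup>+ s. ennreal (2 ^ n) * ennreal (1 / (1 + \<bar>s\<bar>) ^ n) \<partial>m)"
  proof (rule nn_integral_mono)
    fix s :: real
    have "ennreal (2 ^ n) * ennreal (1 / (1 + \<bar>s\<bar>) ^ n) = ennreal (2 ^ n * (1 / (1 + \<bar>s\<bar>) ^ n))"
      by (rule ennreal_mult[symmetric]) auto
    then show "ennreal (1 / max \<bar>s\<bar> t ^ n) \<le> ennreal (2 ^ n) * ennreal (1 / (1 + \<bar>s\<bar>) ^ n)"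
      using ennreal_leI[OF le[of s]] by simp
  qed
  also have "\<dots> = ennreal (2 ^ n) * (\<integral>\<^sup>+ s. ennreal (1 / (1 + \<bar>s\<bar>) ^ n) \<partial>m)" by (rule nn_integral_cmult) measurable
  also have "\<dots> < \<infinity>" using fin by (simp add: ennreal_mult_less_top)
  finally have f: "(\<integral>\<^sup>+ s. ennreal (1 / max \<bar>s\<bar> t ^ n) \<partial>m) < \<infinity>" .
  have mp: "0 \<le> 1 / max \<bar>s\<bar> t ^ n" for s using t by (simp add: le_max_iff_disj)
  show I: "integrable m (\<lambda>s. 1 / max \<bar>s\<bar> t ^ n)"
    using f mp by (intro integrableI_bounded) auto
  have f2: "(\<integral>\<^sup>+ u. ennreal (n / u ^ (n + 1) * mass m u * indicator {t..} u) \<partial>lborel) < \<infinity>"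
    using f unfolding nn_layer_tail[OF m _ n, of t, symmetric, OF less_le_trans[OF zero_less_one t]]
    by (subst (asm) nn_integral_cong[where v = "\<lambda>u. ennreal (n / u ^ (n + 1) * mass m u * indicator {t..} u)"]) (auto simp: indicator_def)
  have nn: "0 \<le> n / u ^ (n + 1) * mass m u * indicator {t..} u" for u using t by (auto simp: indicator_def)
  have I2: "integrable lborel (\<lambda>u. n / u ^ (n + 1) * mass m u * indicator {t..} u)"
    using f2 nn by (intro integrableI_nonneg) auto
  have "(\<lambda>u. indicator {t..} u *\<^sub>R (mass m u / u ^ (n + 1))) = (\<lambda>u. 1 / n * (n / u ^ (n + 1) * mass m u * indicator {t..} u))"
    using n by (auto simp: indicator_def)
  then show "set_integrable lborel {t..} (\<lambda>u. mass m u / u ^ (n + 1))"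
    unfolding set_integrable_def using integrable_mult_right[OF I2] by presburger
  have "n * (LINT u:{t..}|lborel. mass m u / u ^ (n + 1)) = (\<integral>u. n / u ^ (n + 1) * mass m u * indicator {t..} u \<partial>lborel)"
    unfolding set_lebesgue_integral_def
    by (subst Bochner_Integration.integral_mult_right_zero[symmetric]) (auto intro!: Bochner_Integration.integral_cong)
  also have "\<dots> = enn2real (\<integral>\<^sup>+ u. ennreal (n / u ^ (n + 1) * mass m u) * indicator {t..} u \<partial>lborel)"
    using nn by (subst integral_eq_nn_integral) (auto simp: indicator_def intro!: arg_cong[where f = enn2real] nn_integral_cong)
  also have "\<dots> = (\<integral>s. 1 / max \<bar>s\<bar> t ^ n \<partial>m)"
    using t mp by (subst nn_layer_tail[OF m _ n]) (auto simp: integral_eq_nn_integral)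
  finally show "n * (LINT u:{t..}|lborel. mass m u / u ^ (n + 1)) = (\<integral>s. 1 / max \<bar>s\<bar> t ^ n \<partial>m)" .
qed

text \<open>Tails in place of truncations. The error improves to order 1/t because the comparison
  error carries an additional \<open>1 / |s|\<close> and |s| \<ge> t on the tail; a constant error
  would be too large here, since the slowly varying quotient may tend to 0.\<close>

lemma weighted_tail_bounds:
  fixes m :: "real measure" and \<kappa> :: nat
  defines "w \<equiv> \<lambda>s. 1 / (1 + s\<^sup>2) ^ (\<kappa> + 1)" and "C \<equiv> (real \<kappa> + 2) * 2 ^ (\<kappa> + 1)"
  assumes m: "locally_finite m" and int: "integrable m (\<lambda>s. 1 / (1 + s\<^sup>2) ^ (\<kappa> + 1))" and t: "t \<ge> 1"
    and fin: "(\<integral>\<^sup>+ s. ennreal (1 / (1 + \<bar>s\<bar>) ^ (2 * \<kappa> + 1)) \<partial>m) < \<infinity>"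
  shows "integrable m (\<lambda>s. \<bar>s\<bar> * w s)"
    and "\<bar>(LINT s:-{-t<..<t}|m. \<bar>s\<bar> * w s) - (2 * \<kappa> + 1) * (LINT u:{t..}|lborel. mass m u / u ^ (2 * \<kappa> + 2))\<bar>
      \<le> C * (\<integral>s. w s \<partial>m) / t + mass m t / t ^ (2 * \<kappa> + 1)"
proof -
  let ?n = "2 * \<kappa> + 1"
  note mD = locally_finiteD[OF m]
  note [measurable_cong] = mD(1)
  have w: "0 \<le> w s" "w s \<le> 1" for s
    using weight_bounds[of s "\<kappa> + 1"] by (simp_all add: w_def)
  have [measurable]: "w \<in> borel_measurable borel" unfolding w_def by measurable
  have intw: "integrable m w" using int by (simp add: w_def)
  have C: "C \<ge> 0" by (simp add: C_def)
  have n: "?n \<ge> 1" by simp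
  note lt = layer_tail[OF m t n fin]
  have i1: "integrable m (\<lambda>s. 1 / max \<bar>s\<bar> 1 ^ ?n)" by (rule layer_tail(2)[OF m _ n fin]) simp
  show iw: "integrable m (\<lambda>s. \<bar>s\<bar> * w s)"
  proof (rule integrable_bounded_by)
    show "integrable m (\<lambda>s. 1 / max \<bar>s\<bar> 1 ^ ?n + C * w s)"
      by (intro Bochner_Integration.integrable_add i1 integrable_mult_right intw)
    show "norm (\<bar>s\<bar> * w s) \<le> 1 / max \<bar>s\<bar> 1 ^ ?n + C * w s" for s
    proof -
      have "C * w s / max \<bar>s\<bar> 1 \<le> C * w s / 1" using C w[of s] by (intro divide_left_mono) auto
      then have "\<bar>\<bar>s\<bar> * w s - 1 / max \<bar>s\<bar> 1 ^ ?n\<bar> \<le> C * w s" using weight_comparison(1)[of s \<kappa>] unfolding w_def C_def by linarith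
      moreover have "0 \<le> \<bar>s\<bar> * w s" using w by simp
      ultimately show ?thesis unfolding real_norm_def by linarith
    qed
  qed measurable
  let ?h = "\<lambda>s. indicator (-{-t<..<t}) s * (\<bar>s\<bar> * w s)"
  have ih: "integrable m ?h" by (rule integrable_bounded_by[OF iw]) (auto simp: indicator_def w)
  have it: "integrable m (\<lambda>s. indicat_real {-t<..<t} s)" using mD(1) mD(2)[of t] by auto
  \<comment> \<open>Inside (-t, t) the truncated power is the constant \<open>1 / t ^ ?n\<close>; it
    is subtracted here and reappears as the boundary term.\<close>
  have "\<bar>?h s - (1 / max \<bar>s\<bar> t ^ ?n - indicator {-t<..<t} s / t ^ ?n)\<bar> \<le> C / t * w s" for s
  proof (cases "\<bar>s\<bar> < t")
    case True
    then show ?thesis using w[of s] C t by (auto simp: indicator_def abs_less_iff max_absorb2)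
  next
    case False
    have "C * w s / \<bar>s\<bar> \<le> C * w s / t" using False C w[of s] t by (intro divide_left_mono mult_nonneg_nonneg) auto
    moreover have "max \<bar>s\<bar> 1 = \<bar>s\<bar>" "max \<bar>s\<bar> t = \<bar>s\<bar>" "indicat_real (-{-t<..<t}) s = 1" "indicat_real {-t<..<t} s = 0"
      using False t by (auto simp: indicator_def)
    moreover have "\<bar>\<bar>s\<bar> * w s - 1 / max \<bar>s\<bar> 1 ^ ?n\<bar> \<le> C * w s / max \<bar>s\<bar> 1"
      using weight_comparison(1)[of s \<kappa>] by (simp only: w_def C_def)
    ultimately show ?thesis by (simp only: mult_1 div_0 diff_0_right times_divide_eq_left)
  qed
  note le = this
  have "\<bar>(\<integral>s. ?h s \<partial>m) - ((\<integral>s. 1 / max \<bar>s\<bar> t ^ ?n \<partial>m) - mass m t / t ^ ?n)\<bar>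
     = norm (\<integral>s. ?h s - (1 / max \<bar>s\<bar> t ^ ?n - indicator {-t<..<t} s / t ^ ?n) \<partial>m)"
    using ih lt(2) it mD(3) by (simp add: Bochner_Integration.integral_diff)
  also have "\<dots> \<le> (\<integral>s. C / t * w s \<partial>m)"
  proof (rule Bochner_Integration.integral_norm_bound_integral)
    show "integrable m (\<lambda>s. ?h s - (1 / max \<bar>s\<bar> t ^ ?n - indicator {-t<..<t} s / t ^ ?n))"
      using ih lt(2) it by (intro Bochner_Integration.integrable_diff) auto
    show "integrable m (\<lambda>s. C / t * w s)" by (rule integrable_mult_right[OF intw])
    show "norm (?h s - (1 / max \<bar>s\<bar> t ^ ?n - indicator {-t<..<t} s / t ^ ?n)) \<le> C / t * w s" for s using le[of s] by simp
  qed
  also have "\<dots> = C * (\<integral>s. w s \<partial>m) / t" by simp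
  finally have 1: "\<bar>(\<integral>s. ?h s \<partial>m) - ((\<integral>s. 1 / max \<bar>s\<bar> t ^ ?n \<partial>m) - mass m t / t ^ ?n)\<bar> \<le> C * (\<integral>s. w s \<partial>m) / t" .
  have 2: "(2 * \<kappa> + 1) * (LINT u:{t..}|lborel. mass m u / u ^ (2 * \<kappa> + 2)) = (\<integral>s. 1 / max \<bar>s\<bar> t ^ ?n \<partial>m)"
    using lt(3) by (simp add: numeral_2_eq_2)
  have 3: "(LINT s:-{-t<..<t}|m. \<bar>s\<bar> * w s) = (\<integral>s. ?h s \<partial>m)" by (simp add: set_lebesgue_integral_def)
  have "mass m t / t ^ ?n \<ge> 0" using t by simp
  then show "\<bar>(LINT s:-{-t<..<t}|m. \<bar>s\<bar> * w s) - (2 * \<kappa> + 1) * (LINT u:{t..}|lborel. mass m u / u ^ (2 * \<kappa> + 2))\<bar>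
      \<le> C * (\<integral>s. w s \<partial>m) / t + mass m t / t ^ (2 * \<kappa> + 1)"
    using 1 unfolding 2 3 by linarith
qed

lemma nn_tail_powr:
  assumes m: "locally_finite m" and t: "t > 0" and n: "n \<ge> 1" and \<gamma>: "\<gamma> < real n" and c: "c \<ge> 0"
    and le: "\<And>u. u \<ge> t \<Longrightarrow> mass m u \<le> c * u powr \<gamma>"
  shows "(\<integral>\<^sup>+ s. ennreal (1 / max \<bar>s\<bar> t ^ n) \<partial>m) \<le> ennreal (n * c / (n - \<gamma>) * t powr (\<gamma> - n))"
proof -
  define K where "K = n * c / (n - \<gamma>)"
  have D: "DERIV (\<lambda>u. - (K * u powr (\<gamma> - n))) u :> n * c * u powr (\<gamma> - n - 1)" if "u > 0" for u
  proof -
    have "DERIV (\<lambda>u. - (K * u powr (\<gamma> - n))) u :> - (K * ((\<gamma> - n) * u powr (\<gamma> - n - 1)))"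
      using that by (auto intro!: derivative_eq_intros)
    moreover have "- (K * ((\<gamma> - n) * u powr (\<gamma> - n - 1))) = n * c * u powr (\<gamma> - n - 1)"
      using \<gamma> by (simp add: K_def field_simps)
    ultimately show ?thesis by simp
  qed
  have lim: "((\<lambda>u. - (K * u powr (\<gamma> - n))) \<longlongrightarrow> - (K * 0)) at_top"
    using \<gamma> by (intro tendsto_intros tendsto_neg_powr filterlim_ident) auto
  have "(\<integral>\<^sup>+ s. ennreal (1 / max \<bar>s\<bar> t ^ n) \<partial>m) = (\<integral>\<^sup>+ u. ennreal (n / u ^ (n + 1) * mass m u) * indicator {t..} u \<partial>lborel)"
    by (rule nn_layer_tail[OF m t n, symmetric])
  also have "\<dots> \<le> (\<integral>\<^sup>+ u. ennreal (n * c * u powr (\<gamma> - n - 1)) * indicator {t..} u \<partial>lborel)"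
  proof (rule nn_integral_mono)
    fix u :: real
    show "ennreal (n / u ^ (n + 1) * mass m u) * indicator {t..} u \<le> ennreal (n * c * u powr (\<gamma> - n - 1)) * indicator {t..} u"
    proof (cases "u \<ge> t")
      case True
      have u: "u > 0" using True t by simp
      have "n / u ^ (n + 1) * mass m u \<le> n / u ^ (n + 1) * (c * u powr \<gamma>)" using le[OF True] u by (intro mult_left_mono) auto
      also have "\<dots> = n * c * u powr (\<gamma> - n - 1)"
      proof -
        have "\<gamma> - n - 1 = \<gamma> - real (n + 1)" by simp
        then have "u powr (\<gamma> - n - 1) = u powr \<gamma> / u ^ (n + 1)" using u by (simp only: powr_diff powr_realpow)
        then show ?thesis by simp
      qed
      finally show ?thesis using True by (simp add: ennreal_leI)
    qed simp
  qed
  also have "\<dots> = ennreal (- (K * 0) - (- (K * t powr (\<gamma> - n))))"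
    by (rule nn_integral_FTC_atLeast[OF _ _ _ lim]) (use t c D in auto)
  finally show ?thesis by (simp add: K_def)
qed

lemma mass_powr_bound:
  assumes m: "locally_finite m" and ev: "\<forall>\<^sub>F u in at_top. mass m u \<le> c * u powr \<gamma>" and "c \<ge> 0"
  shows "\<exists>K\<ge>0. \<forall>u\<ge>1. mass m u \<le> K * u powr \<gamma>"
proof -
  obtain X where X: "\<And>u. u \<ge> X \<Longrightarrow> mass m u \<le> c * u powr \<gamma>" using ev by (auto simp: eventually_at_top_linorder)
  define Y where "Y = max 1 X"
  \<comment> \<open>A positive lower bound for \<open>u powr \<gamma>\<close> on [1, Y], whatever
    the sign of \<gamma>; it absorbs the masses before the asymptotic regime.\<close>
  define d where "d = min 1 (Y powr \<gamma>)"
  have d: "d > 0" by (auto simp: d_def Y_def)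
  have "mass m u \<le> (c + mass m Y / d) * u powr \<gamma>" if u: "u \<ge> 1" for u
  proof (cases "u \<ge> X")
    case True
    have "c * u powr \<gamma> \<le> (c + mass m Y / d) * u powr \<gamma>" using d by (intro mult_right_mono) auto
    then show ?thesis using X[OF True] by linarith
  next
    case False
    have "d \<le> u powr \<gamma>"
    proof (cases "\<gamma> \<ge> 0")
      case True
      then show ?thesis using ge_one_powr_ge_zero[OF u True] by (simp add: d_def)
    next
      case neg: False
      have "Y powr \<gamma> \<le> u powr \<gamma>" using neg u False by (intro powr_mono2') (auto simp: Y_def)
      then show ?thesis by (simp add: d_def)
    qed
    have "mass m u \<le> mass m Y" using False by (intro mass_mono[OF m]) (auto simp: Y_def)
    also have "\<dots> = mass m Y / d * d" using d by simp
    also have "\<dots> \<le> mass m Y / d * u powr \<gamma>" using d \<open>d \<le> u powr \<gamma>\<close> by (intro mult_left_mono) auto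
    also have "\<dots> \<le> (c + mass m Y / d) * u powr \<gamma>" using assms(3) by (intro mult_right_mono) auto
    finally show ?thesis .
  qed
  moreover have "c + mass m Y / d \<ge> 0" using assms(3) d by simp
  ultimately show ?thesis by blast
qed

lemma shifted_weight_le:
  assumes m: "locally_finite m"
  shows "(\<integral>\<^sup>+ s. ennreal (1 / (1 + \<bar>s\<bar>) ^ n) \<partial>m) \<le> (\<integral>\<^sup>+ s. ennreal (1 / max \<bar>s\<bar> 1 ^ n) \<partial>m)"
proof (intro nn_integral_mono ennreal_leI divide_left_mono power_mono)
  show "0 < (1 + \<bar>s\<bar>) ^ n * max \<bar>s\<bar> 1 ^ n" for s :: real by (intro mult_pos_pos zero_less_power) auto
qed auto

section \<open>Growth of the mass function and Karamata's theorem\<close>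

text \<open>Slow variation, with slack 1/2, places the mass between multiples of the powers 2k + 1/2
  and 2k + 3/2 of t. The upper one makes the integral with exponent 2k + 2 converge, the lower one
  excludes every exponent up to 2k, and the exponents in \<open>kappa_index\<close> are
  even.\<close>

lemma kappa_index_regularly_varying:
  assumes m: "locally_finite m" and rv: "regularly_varying (mass m) (real (2 * k + 1))"
  shows "kappa_index m = enat k"
proof -
  let ?\<beta> = "2 * k + 1"
  note [measurable_cong] = locally_finiteD(1)[OF m]
  have mono: "mass m x \<le> mass m y" if "0 < x" "x \<le> y" for x y using mass_mono[OF m] that by blast
  obtain c where c: "c > 0" "\<forall>\<^sub>F t in at_top. sv (mass m) ?\<beta> t \<le> c * t powr (1/2)"
    using sv_lower_bound(2)[OF mono rv, of "1/2"] by auto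
  have "\<forall>\<^sub>F t in at_top. mass m t \<le> c * t powr (?\<beta> + 1/2)"
    using c(2) eventually_gt_at_top[of 0]
  proof eventually_elim
    case (elim t)
    have "mass m t = sv (mass m) ?\<beta> t * t powr real ?\<beta>" using elim by (simp only: powr_realpow) (simp add: sv_def)
    also have "\<dots> \<le> c * t powr (1/2) * t powr real ?\<beta>" using elim by (intro mult_right_mono) auto
    also have "\<dots> = c * t powr (?\<beta> + 1/2)" by (simp only: powr_add mult_ac)
    finally show ?case .
  qed
  then obtain K where K: "K \<ge> 0" "\<And>u. u \<ge> 1 \<Longrightarrow> mass m u \<le> K * u powr (?\<beta> + 1/2)"
    using mass_powr_bound[OF m _ less_imp_le[OF c(1)]] by blast
  have "(\<integral>\<^sup>+ s. ennreal (1 / (1 + \<bar>s\<bar>) ^ (2 * k + 2)) \<partial>m) \<le> (\<integral>\<^sup>+ s. ennreal (1 / max \<bar>s\<bar> 1 ^ (2 * k + 2)) \<partial>m)"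
    by (rule shifted_weight_le[OF m])
  also have "\<dots> \<le> ennreal ((2 * k + 2) * K / ((2 * k + 2) - (?\<beta> + 1/2)) * 1 powr ((?\<beta> + 1/2) - (2 * k + 2)))"
    using nn_tail_powr[OF m _ _ _ K(1), of 1 "2 * k + 2" "real ?\<beta> + 1/2"] K(2) by auto
  also have "\<dots> < \<infinity>" by simp
  finally have fin: "(\<integral>\<^sup>+ s. ennreal (1 / (1 + \<bar>s\<bar>) ^ (2 * k + 2)) \<partial>m) < \<infinity>" .
  have min: "k \<le> n" if n: "(\<integral>\<^sup>+ s. ennreal (1 / (1 + \<bar>s\<bar>) ^ (2 * n + 2)) \<partial>m) < \<infinity>" for n
  proof (rule ccontr)
    assume "\<not> k \<le> n"
    then have nk: "2 * n + 2 \<le> 2 * k" by simp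
    let ?e = "2 * n + 2"
    define B where "B = enn2real (\<integral>\<^sup>+ s. ennreal (1 / (1 + \<bar>s\<bar>) ^ ?e) \<partial>m)"
    \<comment> \<open>A finite integral with exponent \<open>?e\<close> forces polynomial growth of
      that order, because the integrand is at least \<open>1 / (1 + t) ^ ?e\<close> on (-t,
      t).\<close>
    have bd: "mass m t \<le> (1 + t) ^ ?e * B" if t: "t > 0" for t
    proof -
      have "ennreal (mass m t) = (\<integral>\<^sup>+ s. indicator {-t<..<t} s \<partial>m)"
        using locally_finiteD(1,4)[OF m] by (simp flip: locally_finiteD(4)[OF m])
      also have "\<dots> \<le> (\<integral>\<^sup>+ s. ennreal ((1 + t) ^ ?e) * ennreal (1 / (1 + \<bar>s\<bar>) ^ ?e) \<partial>m)"
      proof (rule nn_integral_mono)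
        fix s :: real
        show "indicator {-t<..<t} s \<le> ennreal ((1 + t) ^ ?e) * ennreal (1 / (1 + \<bar>s\<bar>) ^ ?e)"
        proof (cases "s \<in> {-t<..<t}")
          case True
          then have "(1 + \<bar>s\<bar>) ^ ?e \<le> (1 + t) ^ ?e" by (intro power_mono) auto
          moreover have "0 < (1 + \<bar>s\<bar>) ^ ?e" by (intro zero_less_power) auto
          ultimately have "1 \<le> (1 + t) ^ ?e * (1 / (1 + \<bar>s\<bar>) ^ ?e)" by simp
          then have "ennreal 1 \<le> ennreal ((1 + t) ^ ?e * (1 / (1 + \<bar>s\<bar>) ^ ?e))" by (rule ennreal_leI)
          also have "\<dots> = ennreal ((1 + t) ^ ?e) * ennreal (1 / (1 + \<bar>s\<bar>) ^ ?e)" using t by (intro ennreal_mult) auto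
          finally show ?thesis using True by simp
        qed simp
      qed
      also have "\<dots> = ennreal ((1 + t) ^ ?e) * (\<integral>\<^sup>+ s. ennreal (1 / (1 + \<bar>s\<bar>) ^ ?e) \<partial>m)" by (rule nn_integral_cmult) measurable
      also have "\<dots> = ennreal ((1 + t) ^ ?e) * ennreal B" unfolding B_def using n by (simp add: less_top)
      also have "\<dots> = ennreal ((1 + t) ^ ?e * B)" using t by (intro ennreal_mult[symmetric]) (auto simp: B_def)
      finally show ?thesis using t by (subst (asm) ennreal_le_iff) (auto simp: B_def)
    qed
    obtain d where d: "d > 0" "\<forall>\<^sub>F t in at_top. d * t powr (-(1/2)) \<le> sv (mass m) ?\<beta> t"
      using sv_lower_bound(1)[OF mono rv, of "1/2"] by auto
    have B0: "B \<ge> 0" by (simp add: B_def)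
    have "\<forall>\<^sub>F t in at_top. d * t powr (1/2) \<le> 2 ^ ?e * B"
      using d(2) eventually_ge_at_top[of 1]
    proof eventually_elim
      case (elim t)
      have t: "t > 0" using elim by simp
      have "mass m t \<le> (1 + t) ^ ?e * B" using bd[OF t] .
      also have "\<dots> \<le> (2 * t) ^ ?e * B" using elim B0 by (intro mult_right_mono power_mono) auto
      also have "\<dots> \<le> 2 ^ ?e * t ^ (2 * k) * B" unfolding power_mult_distrib
        using elim B0 nk by (intro mult_right_mono mult_left_mono power_increasing) auto
      finally have "mass m t / t ^ ?\<beta> \<le> 2 ^ ?e * t ^ (2 * k) * B / t ^ ?\<beta>" using t by (intro divide_right_mono) auto
      also have "\<dots> = 2 ^ ?e * B / t" using t by simp
      finally have "d * t powr (-(1/2)) \<le> 2 ^ ?e * B / t" using elim by (simp add: sv_def)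
      then have "d * t powr (-(1/2)) * t \<le> 2 ^ ?e * B" using t by (simp add: pos_le_divide_eq del: power_Suc)
      moreover have "t powr (-(1/2)) * t = t powr (1/2)"
        using t powr_add[of t "-(1/2)" 1] by simp
      ultimately show ?case by (simp add: mult.assoc del: power_Suc)
    qed
    moreover have "filterlim (\<lambda>t::real. d * sqrt t) at_top at_top"
      by (rule filterlim_tendsto_pos_mult_at_top[OF tendsto_const d(1) sqrt_at_top])
    then have "\<forall>\<^sub>F t in at_top. 2 ^ ?e * B < d * sqrt t" by (auto simp: filterlim_at_top_dense)
    ultimately have "\<forall>\<^sub>F t::real in at_top. False" using eventually_ge_at_top[of 0]
      by eventually_elim (auto simp: powr_half_sqrt)
    then show False by simp
  qed
  show ?thesis unfolding kappa_index_def
    by (rule antisym; (rule Inf_lower Inf_greatest)) (use fin min in auto)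
qed

text \<open>Karamata's theorem for the direct integral: after the substitution u = t v it is
  \<open>abel_limit\<close> with the indicator of (0, 1] as kernel.\<close>

lemma karamata_integral:
  assumes m: "locally_finite m" and rv: "regularly_varying (mass m) (real \<beta>)"
  shows "((\<lambda>t. (LINT u:{1..t}|lborel. mass m u / u ^ \<beta>) / (t * sv (mass m) \<beta> t)) \<longlongrightarrow> 1) at_top"
proof (rule tendsto_at_topI_sequentially)
  fix X :: "nat \<Rightarrow> real" assume X: "filterlim X at_top sequentially"
  let ?l = "sv (mass m) \<beta>"
  note measurable_mass[OF m, measurable]
  \<comment> \<open>The cut at 1 keeps \<Psi> bounded near 0, where
    \<open>mass m u / u ^ \<beta>\<close> may blow up, and matches the lower limit of the
    integral.\<close>
  define \<Psi> where "\<Psi> u = indicator {1..} u * ?l u" for u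
  have [measurable]: "\<Psi> \<in> borel_measurable borel" unfolding \<Psi>_def[abs_def] sv_def by measurable
  have mono: "mass m x \<le> mass m y" if "0 < x" "x \<le> y" for x y using mass_mono[OF m] that by blast
  have lpos: "\<forall>\<^sub>F r in at_top. ?l r > 0"
    using regularly_varying_eventually_pos[OF rv] eventually_gt_at_top[of 0] by eventually_elim (auto simp: sv_def)
  have lim: "((\<lambda>t. \<Psi> t / ?l t) \<longlongrightarrow> 1) at_top"
  proof (rule tendsto_eventually)
    show "\<forall>\<^sub>F t in at_top. \<Psi> t / ?l t = 1"
      using lpos eventually_ge_at_top[of 1] by eventually_elim (auto simp: \<Psi>_def)
  qed
  have bdd: "\<exists>B. \<forall>t. 0 < t \<longrightarrow> t \<le> x \<longrightarrow> \<bar>\<Psi> t\<bar> \<le> B" for x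
  proof (intro exI allI impI)
    fix t assume t: "0 < t" "t \<le> x"
    show "\<bar>\<Psi> t\<bar> \<le> mass m x"
    proof (cases "t \<ge> 1")
      case True
      have "mass m t / t ^ \<beta> \<le> mass m t / 1" using True by (intro divide_left_mono one_le_power) auto
      also have "\<dots> \<le> mass m x" using mono[OF t] by simp
      finally show ?thesis using True by (simp add: \<Psi>_def sv_def)
    qed (simp add: \<Psi>_def)
  qed
  have k: "norm (complex_of_real (indicator {..1} v)) \<le> 2 / (1 + v\<^sup>2)" if "v > 0" for v :: real
  proof (cases "v \<le> 1")
    case True
    then have "v\<^sup>2 \<le> 1" using that by (simp add: abs_square_le_1)
    then show ?thesis using True by (simp add: le_divide_eq add_pos_nonneg)
  qed simp
  have "(\<lambda>n. LBINT v:{0<..}. complex_of_real (indicator {..1} v) * of_real (\<Psi> (X n * v) / ?l (X n)))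
     \<longlonglongrightarrow> (LBINT v:{0<..}. complex_of_real (indicator {..1::real} v)) * of_real 1"
    by (rule abel_limit[where k = "\<lambda>_ v. complex_of_real (indicator {..1} v)" and k' = "\<lambda>v. complex_of_real (indicator {..1} v)" and r = X and C = 2 and M = "mass m" and \<Psi> = \<Psi>, OF mono rv lim bdd _ _ _ k _ X]) auto
  moreover have "(LBINT v:{0<..}. complex_of_real (indicator {..1::real} v)) = 1"
  proof -
    have "(LBINT v:{0<..}. complex_of_real (indicator {..1::real} v)) = (\<integral>v. complex_of_real (indicator {0<..1::real} v) \<partial>lborel)"
      unfolding set_lebesgue_integral_def by (intro Bochner_Integration.integral_cong) (auto simp: indicator_def)
    also have "\<dots> = 1" unfolding integral_complex_of_real by simp
    finally show ?thesis .
  qed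
  ultimately have "(\<lambda>n. LBINT v:{0<..}. complex_of_real (indicator {..1} v) * of_real (\<Psi> (X n * v) / ?l (X n))) \<longlonglongrightarrow> 1"
    by simp
  from tendsto_Re[OF this]
  have L: "(\<lambda>n. Re (LBINT v:{0<..}. complex_of_real (indicator {..1} v) * of_real (\<Psi> (X n * v) / ?l (X n)))) \<longlonglongrightarrow> 1"
    by simp
  have "\<forall>\<^sub>F n in sequentially. X n > 0 \<and> ?l (X n) > 0"
    using eventually_compose_filterlim[OF eventually_conj[OF eventually_gt_at_top[of 0] lpos] X] .
  then have "\<forall>\<^sub>F n in sequentially. Re (LBINT v:{0<..}. complex_of_real (indicator {..1} v) * of_real (\<Psi> (X n * v) / ?l (X n)))
      = (LINT u:{1..X n}|lborel. mass m u / u ^ \<beta>) / (X n * ?l (X n))"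
  proof eventually_elim
    case (elim n)
    have "(LBINT v:{0<..}. complex_of_real (indicator {..1} v) * of_real (\<Psi> (X n * v) / ?l (X n)))
      = of_real (\<integral>v. indicator {0<..1} v * (\<Psi> (X n * v) / ?l (X n)) \<partial>lborel)"
      unfolding set_lebesgue_integral_def integral_complex_of_real[symmetric]
      by (intro Bochner_Integration.integral_cong) (auto simp: indicator_def)
    moreover have "(LINT u:{1..X n}|lborel. mass m u / u ^ \<beta>) = X n * (\<integral>v. indicator {0<..1} v * \<Psi> (X n * v) \<partial>lborel)"
    proof -
      have "(LINT u:{1..X n}|lborel. mass m u / u ^ \<beta>) = \<bar>X n\<bar> *\<^sub>R (\<integral>v. indicator {1..X n} (0 + X n * v) *\<^sub>R (mass m (0 + X n * v) / (0 + X n * v) ^ \<beta>) \<partial>lborel)"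
        unfolding set_lebesgue_integral_def using elim by (intro lborel_integral_real_affine) auto
      also have "\<dots> = X n * (\<integral>v. indicator {0<..1} v * \<Psi> (X n * v) \<partial>lborel)"
      proof -
        have "(indicator {1..X n} (0 + X n * v) *\<^sub>R (mass m (0 + X n * v) / (0 + X n * v) ^ \<beta>)) = indicator {0<..1} v * \<Psi> (X n * v)" for v
        proof -
          have "X n * v \<le> X n \<longleftrightarrow> v \<le> 1" using elim by simp
          moreover have "0 < v" if "1 \<le> X n * v" using elim that zero_less_mult_pos[of "X n" v] by linarith
          ultimately show ?thesis by (auto simp: indicator_def \<Psi>_def sv_def)
        qed
        then show ?thesis using elim by simp
      qed
      finally show ?thesis .
    qed
    ultimately show ?case using elim by simp
  qed
  then show "(\<lambda>n. (LINT u:{1..X n}|lborel. mass m u / u ^ \<beta>) / (X n * ?l (X n))) \<longlonglongrightarrow> 1"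
    using L by (simp add: tendsto_cong)
qed

text \<open>The limit is 2\<kappa> from Karamata's theorem plus 1 from the boundary term. The
  constant error disappears because t times the slowly varying quotient tends to infinity.\<close>

lemma second_moment_asymptotics:
  fixes \<kappa> :: nat
  assumes m: "locally_finite m" and int: "integrable m (\<lambda>s. 1 / (1 + s\<^sup>2) ^ (\<kappa> + 1))"
    and rv: "regularly_varying (mass m) (real (2 * \<kappa> + 1))"
  shows "((\<lambda>t. (LINT s:{-t<..<t}|m. s\<^sup>2 * (1 / (1 + s\<^sup>2) ^ (\<kappa> + 1))) / t / sv (mass m) (2 * \<kappa> + 1) t) \<longlongrightarrow> real (2 * \<kappa> + 1)) at_top"
proof -
  let ?\<beta> = "2 * \<kappa> + 1" and ?l = "sv (mass m) (2 * \<kappa> + 1)"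
  let ?U = "\<lambda>t. LINT s:{-t<..<t}|m. s\<^sup>2 * (1 / (1 + s\<^sup>2) ^ (\<kappa> + 1))"
  let ?I = "\<lambda>t. LINT u:{1..t}|lborel. mass m u / u ^ ?\<beta>"
  define K where "K = (real \<kappa> + 2) * 2 ^ (\<kappa> + 1) * (\<integral>s. 1 / (1 + s\<^sup>2) ^ (\<kappa> + 1) \<partial>m)"
  have mono: "mass m x \<le> mass m y" if "0 < x" "x \<le> y" for x y using mass_mono[OF m] that by blast
  have lpos: "\<forall>\<^sub>F r in at_top. ?l r > 0"
    using regularly_varying_eventually_pos[OF rv] eventually_gt_at_top[of 0] by eventually_elim (auto simp: sv_def)
  have z: "((\<lambda>t. t powr (-1) / ?l t) \<longlongrightarrow> 0) at_top" using powr_over_sv_tendsto_0[OF mono rv, of 1] by simp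
  have "((\<lambda>t. ?U t / t / ?l t - 2 * \<kappa> * (?I t / (t * ?l t)) - 1) \<longlongrightarrow> 0) at_top"
  proof (rule tendsto_0_le)
    show "((\<lambda>t. t powr (-1) / ?l t) \<longlongrightarrow> 0) at_top" by (rule z)
    show "\<forall>\<^sub>F t in at_top. norm (?U t / t / ?l t - 2 * \<kappa> * (?I t / (t * ?l t)) - 1) \<le> norm (t powr (-1) / ?l t) * K"
      using lpos eventually_ge_at_top[of 1]
    proof eventually_elim
      case (elim t)
      have t: "t > 0" "t * ?l t > 0" using elim by auto
      have "mass m t / t ^ (2 * \<kappa>) = t * ?l t" using t by (simp add: sv_def)
      then have b: "\<bar>?U t - 2 * \<kappa> * ?I t - t * ?l t\<bar> \<le> K"
        using weighted_moment_bounds(2)[OF m int elim(2)] by (simp add: K_def)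
      have "?U t / t / ?l t - 2 * \<kappa> * (?I t / (t * ?l t)) - 1 = (?U t - 2 * \<kappa> * ?I t - t * ?l t) / (t * ?l t)"
        using t elim by (simp add: diff_divide_distrib)
      also have "norm \<dots> \<le> K / (t * ?l t)" using b t by (simp add: abs_divide divide_right_mono)
      also have "\<dots> = norm (t powr (-1) / ?l t) * K" using t elim by (simp add: powr_minus_divide)
      finally show ?case .
    qed
  qed
  from tendsto_add[OF tendsto_add[OF this tendsto_const[of 1]] tendsto_mult[OF tendsto_const[of "2 * real \<kappa>"] karamata_integral[OF m rv]]]
  show ?thesis by (simp add: add.commute)
qed

section \<open>Decomposition of the measure\<close>

text \<open>Induction over measurable functions. In the limit step the sum of two suprema is a
  supremum because both sequences increase.\<close>

lemma nn_integral_measure_sum: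
  assumes sets: "sets M = sets N" and f: "f \<in> borel_measurable M"
  shows "(\<integral>\<^sup>+ x. f x \<partial>measure_sum M N) = (\<integral>\<^sup>+ x. f x \<partial>M) + (\<integral>\<^sup>+ x. f x \<partial>N)"
  using f
proof (induction rule: borel_measurable_induct)
  case (cong f g)
  have "(\<integral>\<^sup>+ x. f x \<partial>K) = (\<integral>\<^sup>+ x. g x \<partial>K)" if "space K = space M" for K
    by (rule nn_integral_cong) (use cong(3) that in auto)
  from this[of M] this[of N] this[of "measure_sum M N"] show ?case
    using cong(4) sets_eq_imp_space_eq[OF sets] by simp
next
  case (set A)
  then show ?case using sets by (simp add: emeasure_measure_sum)
next
  case (mult u c)
  then have "u \<in> borel_measurable N" "u \<in> borel_measurable (measure_sum M N)"
    using sets by (simp_all cong: measurable_cong_sets)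
  then show ?case using mult by (simp add: nn_integral_cmult distrib_left)
next
  case (add u v)
  then have "u \<in> borel_measurable N" "u \<in> borel_measurable (measure_sum M N)" "v \<in> borel_measurable N" "v \<in> borel_measurable (measure_sum M N)"
    using sets by (simp_all cong: measurable_cong_sets)
  then show ?case using add by (simp add: nn_integral_add ac_simps)
next
  case (seq U)
  have m: "U i \<in> borel_measurable N" "U i \<in> borel_measurable (measure_sum M N)" for i
    using seq(1)[of i] sets by (simp_all cong: measurable_cong_sets)
  have inc: "incseq (\<lambda>i. \<integral>\<^sup>+ x. U i x \<partial>M)" "incseq (\<lambda>i. \<integral>\<^sup>+ x. U i x \<partial>N)"
    using seq(3) by (auto simp: incseq_def le_fun_def intro!: nn_integral_mono)
  have eq: "(\<integral>\<^sup>+ x. (SUP i. U i) x \<partial>K) = (SUP i. \<integral>\<^sup>+ x. U i x \<partial>K)" if "\<And>i. U i \<in> borel_measurable K" for K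
    using nn_integral_monotone_convergence_SUP[OF seq(3) that] by (simp add: image_comp)
  show ?case unfolding eq[OF m(2)] eq[OF m(1)] eq[OF seq(1)] using inc by (simp add: ennreal_SUP_add seq.IH)
qed

lemma
  fixes f :: "'a \<Rightarrow> real"
  assumes sets: "sets M = sets N" and f: "integrable M f" "integrable N f"
  shows integrable_measure_sum: "integrable (measure_sum M N) f"
    and integral_measure_sum: "(\<integral>x. f x \<partial>measure_sum M N) = (\<integral>x. f x \<partial>M) + (\<integral>x. f x \<partial>N)"
proof -
  have m: "f \<in> borel_measurable M" "f \<in> borel_measurable (measure_sum M N)"
    using f(1) sets by (auto cong: measurable_cong_sets dest: borel_measurable_integrable)
  have fin: "(\<integral>\<^sup>+ x. ennreal (f x) \<partial>M) < \<infinity>" "(\<integral>\<^sup>+ x. ennreal (- f x) \<partial>M) < \<infinity>"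
    "(\<integral>\<^sup>+ x. ennreal (f x) \<partial>N) < \<infinity>" "(\<integral>\<^sup>+ x. ennreal (- f x) \<partial>N) < \<infinity>"
    using f by (auto simp: real_integrable_def less_top)
  have e: "(\<integral>\<^sup>+ x. ennreal (f x) \<partial>measure_sum M N) = (\<integral>\<^sup>+ x. ennreal (f x) \<partial>M) + (\<integral>\<^sup>+ x. ennreal (f x) \<partial>N)"
    "(\<integral>\<^sup>+ x. ennreal (- f x) \<partial>measure_sum M N) = (\<integral>\<^sup>+ x. ennreal (- f x) \<partial>M) + (\<integral>\<^sup>+ x. ennreal (- f x) \<partial>N)"
    using m(1) by (intro nn_integral_measure_sum[OF sets]; measurable)+
  show I: "integrable (measure_sum M N) f"
    unfolding real_integrable_def e using m fin by (auto simp: less_top)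
  show "(\<integral>x. f x \<partial>measure_sum M N) = (\<integral>x. f x \<partial>M) + (\<integral>x. f x \<partial>N)"
    unfolding real_lebesgue_integral_def[OF I] real_lebesgue_integral_def[OF f(1)] real_lebesgue_integral_def[OF f(2)] e
    using fin by (simp add: enn2real_plus)
qed

lemma integrable_measure_sumD:
  fixes f :: "'a \<Rightarrow> real"
  assumes sets: "sets M = sets N" and f: "integrable (measure_sum M N) f"
  shows "integrable M f" "integrable N f"
proof -
  have m: "f \<in> borel_measurable M" "f \<in> borel_measurable N"
    using f sets by (auto cong: measurable_cong_sets dest!: borel_measurable_integrable)
  have e: "(\<integral>\<^sup>+ x. ennreal (norm (f x)) \<partial>measure_sum M N) = (\<integral>\<^sup>+ x. ennreal (norm (f x)) \<partial>M) + (\<integral>\<^sup>+ x. ennreal (norm (f x)) \<partial>N)"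
    using m(1) by (intro nn_integral_measure_sum[OF sets]) measurable
  have "(\<integral>\<^sup>+ x. ennreal (norm (f x)) \<partial>measure_sum M N) < \<infinity>" using f by (simp add: integrable_iff_bounded)
  then show "integrable M f" "integrable N f" using m unfolding e by (auto simp: integrable_iff_bounded)
qed

lemma locally_finite_measure_sumD:
  assumes "sets M = sets borel" "sets N = sets borel" "locally_finite (measure_sum M N)"
  shows "locally_finite M" "locally_finite N" "\<And>t. mass (measure_sum M N) t = mass M t + mass N t"
proof -
  have e: "emeasure (measure_sum M N) {-a<..<a} = emeasure M {-a<..<a} + emeasure N {-a<..<a}" for a
    using assms by (intro emeasure_measure_sum) auto
  have f: "emeasure M {-a<..<a} < \<infinity>" "emeasure N {-a<..<a} < \<infinity>" for a
    using locally_finiteD(2)[OF assms(3), of a] unfolding e by auto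
  then show "locally_finite M" "locally_finite N" using assms by (auto simp: locally_finite_def)
  show "mass (measure_sum M N) t = mass M t + mass N t" for t
    using f[of t] by (simp add: measure_def e enn2real_plus)
qed

text \<open>Reflection invariance equates the integral with its negative. Applied to truncations of
  \<open>s * w s\<close> it removes \<open>\<mu>\<^sub>0\<close> from the first moment.\<close>

lemma symmetric_measure_odd_integral:
  fixes g :: "real \<Rightarrow> real"
  assumes [measurable_cong]: "sets m = sets borel" and sym: "symmetric_measure m" and [measurable]: "g \<in> borel_measurable borel"
    and odd: "\<And>s. g (- s) = - g s"
  shows "(\<integral>s. g s \<partial>m) = 0"
proof -
  have sp: "space m = UNIV" using sets_eq_imp_space_eq[OF assms(1)] by simp
  have "distr m borel uminus = m"
  proof (rule measure_eqI)
    fix A assume "A \<in> sets (distr m borel uminus)"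
    then have A [measurable]: "A \<in> sets borel" by simp
    have "uminus -` A = uminus ` A" by (force simp: image_def)
    then show "emeasure (distr m borel uminus) A = emeasure m A"
      using sym A by (subst emeasure_distr) (auto simp: sp symmetric_measure_def)
  qed (use assms(1) in simp)
  then have "(\<integral>s. g s \<partial>m) = (\<integral>s. g s \<partial>distr m borel uminus)" by simp
  also have "\<dots> = (\<integral>s. g (- s) \<partial>m)" by (rule integral_distr) measurable
  also have "\<dots> = - (\<integral>s. g s \<partial>m)" by (simp add: odd)
  finally show ?thesis by simp
qed

lemma sets_pos_neg_part [simp, measurable_cong]: "sets (pos_part m) = sets m" "sets (neg_part m) = sets m"
  by (simp_all add: pos_part_def neg_part_def)

lemma nn_integral_pos_neg_part:
  assumes [measurable_cong]: "sets m = sets borel" and [measurable]: "f \<in> borel_measurable borel"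
  shows "(\<integral>\<^sup>+ s. f s \<partial>m) = (\<integral>\<^sup>+ s. f s \<partial>pos_part m) + (\<integral>\<^sup>+ s. f s \<partial>neg_part m)"
proof -
  have "(\<integral>\<^sup>+ s. f s \<partial>pos_part m) + (\<integral>\<^sup>+ s. f s \<partial>neg_part m) = (\<integral>\<^sup>+ s. indicator {0..} s * f s + indicator {..<0} s * f s \<partial>m)"
    unfolding pos_part_def neg_part_def by (subst (1 2) nn_integral_density) (auto simp: nn_integral_add)
  also have "\<dots> = (\<integral>\<^sup>+ s. f s \<partial>m)" by (intro nn_integral_cong) (auto simp: indicator_def)
  finally show ?thesis by simp
qed

lemma
  fixes f :: "real \<Rightarrow> real"
  assumes [measurable_cong]: "sets m = sets borel" and [measurable]: "f \<in> borel_measurable borel"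
  shows integral_pos_part: "(\<integral>s. f s \<partial>pos_part m) = (\<integral>s. indicator {0..} s * f s \<partial>m)"
    and integral_neg_part: "(\<integral>s. f s \<partial>neg_part m) = (\<integral>s. indicator {..<0} s * f s \<partial>m)"
    and integrable_pos_part: "integrable (pos_part m) f \<longleftrightarrow> integrable m (\<lambda>s. indicator {0..} s * f s)"
    and integrable_neg_part: "integrable (neg_part m) f \<longleftrightarrow> integrable m (\<lambda>s. indicator {..<0} s * f s)"
proof -
  \<comment> \<open>The definition uses an \<open>ennreal\<close>-valued indicator, whereas the
    density rules for Bochner integrals expect a real density.\<close>
  have e: "pos_part m = density m (\<lambda>s. ennreal (indicator {0..} s))" "neg_part m = density m (\<lambda>s. ennreal (indicator {..<0} s))"
    unfolding pos_part_def neg_part_def by (auto intro!: density_cong simp: indicator_def)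
  show "(\<integral>s. f s \<partial>pos_part m) = (\<integral>s. indicator {0..} s * f s \<partial>m)" "(\<integral>s. f s \<partial>neg_part m) = (\<integral>s. indicator {..<0} s * f s \<partial>m)"
    unfolding e by (subst integral_density; simp)+
  show "integrable (pos_part m) f \<longleftrightarrow> integrable m (\<lambda>s. indicator {0..} s * f s)" "integrable (neg_part m) f \<longleftrightarrow> integrable m (\<lambda>s. indicator {..<0} s * f s)"
    unfolding e by (subst integrable_density; simp)+
qed

lemma locally_finite_pos_neg_part:
  assumes m: "locally_finite m"
  shows "locally_finite (pos_part m)" "locally_finite (neg_part m)"
    "\<And>t. mass m t = mass (pos_part m) t + mass (neg_part m) t"
proof -
  note [measurable_cong] = locally_finiteD(1)[OF m]
  have e: "emeasure m {-a<..<a} = emeasure (pos_part m) {-a<..<a} + emeasure (neg_part m) {-a<..<a}" for a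
    using nn_integral_pos_neg_part[OF locally_finiteD(1)[OF m], of "indicator {-a<..<a}"] locally_finiteD(1)[OF m] by simp
  have f: "emeasure (pos_part m) {-a<..<a} < \<infinity>" "emeasure (neg_part m) {-a<..<a} < \<infinity>" for a
    using locally_finiteD(2)[OF m, of a] unfolding e by auto
  then show "locally_finite (pos_part m)" "locally_finite (neg_part m)"
    using locally_finiteD(1)[OF m] by (auto simp: locally_finite_def)
  show "mass m t = mass (pos_part m) t + mass (neg_part m) t" for t
    using f[of t] by (simp add: measure_def e enn2real_plus)
qed

section \<open>Consequences of the limits \<eta>\<close>

text \<open>Separated from \<open>eta_quotient\<close> because both branches are primitives of the
  same integrand: the sign in front of the tail makes it increasing too, so both branches have the
  same increments.\<close>

definition eta_numerator :: "nat \<Rightarrow> real measure \<Rightarrow> real measure \<Rightarrow> real \<Rightarrow> real" where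
  "eta_numerator \<beta> \<mu>\<^sub>1 \<nu> t = (if (\<integral>\<^sup>+ s. ennreal (1 / (1 + \<bar>s\<bar>) ^ \<beta>) \<partial>\<mu>\<^sub>1) = \<infinity>
     then (LINT s:{1..t}|lborel. mass \<nu> s / s ^ (\<beta> + 1)) else - (LINT s:{t..}|lborel. mass \<nu> s / s ^ (\<beta> + 1)))"

lemma eta_quotient_eq: "eta_quotient \<beta> \<mu>\<^sub>0 \<mu>\<^sub>1 \<nu> t = eta_numerator \<beta> \<mu>\<^sub>1 \<nu> t / sv (mass \<mu>\<^sub>0) \<beta> t"
  by (simp add: eta_quotient_def eta_numerator_def sv_def)

lemma eta_numerator_increment:
  assumes m: "locally_finite m" and t: "t \<ge> 1" and \<beta>: "\<beta> \<ge> 1"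
    and fin: "(\<integral>\<^sup>+ s. ennreal (1 / (1 + \<bar>s\<bar>) ^ \<beta>) \<partial>\<mu>\<^sub>1) < \<infinity> \<Longrightarrow> (\<integral>\<^sup>+ s. ennreal (1 / (1 + \<bar>s\<bar>) ^ \<beta>) \<partial>m) < \<infinity>"
  shows "eta_numerator \<beta> \<mu>\<^sub>1 m t + t * (mass m t / (2 * t) ^ (\<beta> + 1)) \<le> eta_numerator \<beta> \<mu>\<^sub>1 m (2 * t)"
proof -
  let ?g = "\<lambda>u. mass m u / u ^ (\<beta> + 1)"
  have ge: "mass m t / (2 * t) ^ (\<beta> + 1) \<le> ?g u" if "u \<in> {t..2 * t}" for u
    using that t mass_mono[OF m, of t u] by (intro frac_le zero_less_power power_mono) auto
  \<comment> \<open>The set \<open>B\<close> will be (t, 2t] in the divergent case and [t, 2t) in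
    the convergent one; only its length t matters.\<close>
  have step: "t * (mass m t / (2 * t) ^ (\<beta> + 1)) \<le> (LINT u:B|lborel. ?g u)"
    if i: "set_integrable lborel B ?g" and B: "B \<in> sets lborel" "B \<subseteq> {t..2 * t}" "emeasure lborel B = ennreal t" for B
  proof -
    have mB: "measure lborel B = t" using B(3) t by (simp add: measure_def)
    have "t * (mass m t / (2 * t) ^ (\<beta> + 1)) = (LINT u:B|lborel. mass m t / (2 * t) ^ (\<beta> + 1))"
      using B mB by (simp add: set_lebesgue_integral_def)
    also have "\<dots> \<le> (LINT u:B|lborel. ?g u)"
    proof (rule set_integral_mono[OF _ i])
      show "set_integrable lborel B (\<lambda>u. mass m t / (2 * t) ^ (\<beta> + 1))"
        unfolding set_integrable_def real_scaleR_def
        by (intro integrable_mult_left integrable_real_indicator) (use B in auto)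
      show "mass m t / (2 * t) ^ (\<beta> + 1) \<le> ?g u" if "u \<in> B" for u using ge that B by blast
    qed
    finally show ?thesis .
  qed
  show ?thesis
  proof (cases "(\<integral>\<^sup>+ s. ennreal (1 / (1 + \<bar>s\<bar>) ^ \<beta>) \<partial>\<mu>\<^sub>1) = \<infinity>")
    case True
    have i: "set_integrable lborel {1..2 * t} ?g" using layer_bounded(1)[OF m, of "2 * t" \<beta>] t by simp
    have i1: "set_integrable lborel {1..t} ?g" "set_integrable lborel {t<..2 * t} ?g"
      by (rule set_integrable_subset[OF i]; use t in force)+
    have eq: "{1..2 * t} = {1..t} \<union> {t<..2 * t}" and dj: "{1..t} \<inter> {t<..2 * t} = {}" using t by auto
    have "(LINT u:{1..2 * t}|lborel. ?g u) = (LINT u:{1..t}|lborel. ?g u) + (LINT u:{t<..2 * t}|lborel. ?g u)"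
      unfolding eq by (rule set_integral_Un[OF dj i1])
    moreover have "t * (mass m t / (2 * t) ^ (\<beta> + 1)) \<le> (LINT u:{t<..2 * t}|lborel. ?g u)"
      using t by (intro step i1) auto
    ultimately show ?thesis using True by (simp add: eta_numerator_def)
  next
    case False
    then have fin': "(\<integral>\<^sup>+ s. ennreal (1 / (1 + \<bar>s\<bar>) ^ \<beta>) \<partial>m) < \<infinity>" using fin by (simp add: less_top)
    have i: "set_integrable lborel {t..} ?g" by (rule layer_tail(1)[OF m t \<beta> fin'])
    have i1: "set_integrable lborel {t..<2 * t} ?g" "set_integrable lborel {2 * t..} ?g"
      by (rule set_integrable_subset[OF i]; use t in force)+
    have eq: "{t..} = {t..<2 * t} \<union> {2 * t..}" and dj: "{t..<2 * t} \<inter> {2 * t..} = {}" using t by auto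
    have "(LINT u:{t..}|lborel. ?g u) = (LINT u:{t..<2 * t}|lborel. ?g u) + (LINT u:{2 * t..}|lborel. ?g u)"
      unfolding eq by (rule set_integral_Un[OF dj i1])
    moreover have "t * (mass m t / (2 * t) ^ (\<beta> + 1)) \<le> (LINT u:{t..<2 * t}|lborel. ?g u)"
      using t by (intro step i1) auto
    ultimately show ?thesis using False by (simp add: eta_numerator_def)
  qed
qed

lemma eta_limit_imp_negligible:
  assumes m: "locally_finite m" and \<mu>\<^sub>0: "locally_finite \<mu>\<^sub>0" and rv: "regularly_varying (mass \<mu>\<^sub>0) (real \<beta>)" and \<beta>: "\<beta> \<ge> 1"
    and fin: "(\<integral>\<^sup>+ s. ennreal (1 / (1 + \<bar>s\<bar>) ^ \<beta>) \<partial>\<mu>\<^sub>1) < \<infinity> \<Longrightarrow> (\<integral>\<^sup>+ s. ennreal (1 / (1 + \<bar>s\<bar>) ^ \<beta>) \<partial>m) < \<infinity>"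
    and lim: "(eta_quotient \<beta> \<mu>\<^sub>0 \<mu>\<^sub>1 m \<longlongrightarrow> \<eta>) at_top"
  shows "((\<lambda>t. mass m t / mass \<mu>\<^sub>0 t) \<longlongrightarrow> 0) at_top"
proof -
  let ?l = "sv (mass \<mu>\<^sub>0) \<beta>" and ?J = "eta_numerator \<beta> \<mu>\<^sub>1 m"
  have lpos: "\<forall>\<^sub>F r in at_top. ?l r > 0"
    using regularly_varying_eventually_pos[OF rv] eventually_gt_at_top[of 0] by eventually_elim (auto simp: sv_def)
  have fl: "filterlim (\<lambda>t::real. 2 * t) at_top at_top"
    by (intro filterlim_tendsto_pos_mult_at_top[OF tendsto_const] filterlim_ident) simp
  have lim': "((\<lambda>t. ?J t / ?l t) \<longlongrightarrow> \<eta>) at_top" using lim by (simp add: eta_quotient_eq[abs_def])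
  have "((\<lambda>t. ?J (2 * t) / ?l (2 * t) * (?l (2 * t) / ?l t) - ?J t / ?l t) \<longlongrightarrow> \<eta> * 1 - \<eta>) at_top"
    by (intro tendsto_intros filterlim_compose[OF lim' fl] lim' regularly_varying_sv[OF rv]) simp
  \<comment> \<open>The factor \<open>2 ^ (\<beta> + 1)\<close> undoes the denominator
    \<open>(2 * t) ^ (\<beta> + 1)\<close> in the lower bound for the increment.\<close>
  then have L: "((\<lambda>t. 2 ^ (\<beta> + 1) * (?J (2 * t) / ?l (2 * t) * (?l (2 * t) / ?l t) - ?J t / ?l t)) \<longlongrightarrow> 2 ^ (\<beta> + 1) * 0) at_top"
    by (intro tendsto_mult tendsto_const) simp
  show ?thesis
  proof (rule tendsto_sandwich[OF _ _ tendsto_const])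
    show "\<forall>\<^sub>F t in at_top. 0 \<le> mass m t / mass \<mu>\<^sub>0 t" by simp
    show "((\<lambda>t. 2 ^ (\<beta> + 1) * (?J (2 * t) / ?l (2 * t) * (?l (2 * t) / ?l t) - ?J t / ?l t)) \<longlongrightarrow> 0) at_top" using L by simp
    show "\<forall>\<^sub>F t in at_top. mass m t / mass \<mu>\<^sub>0 t \<le> 2 ^ (\<beta> + 1) * (?J (2 * t) / ?l (2 * t) * (?l (2 * t) / ?l t) - ?J t / ?l t)"
      using lpos eventually_compose_filterlim[OF lpos fl] eventually_ge_at_top[of 1]
    proof eventually_elim
      case (elim t)
      have t: "t > 0" using elim by simp
      have "2 ^ (\<beta> + 1) * (t * (mass m t / (2 * t) ^ (\<beta> + 1))) \<le> 2 ^ (\<beta> + 1) * (?J (2 * t) - ?J t)"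
      proof (rule mult_left_mono)
        have "?J t + t * (mass m t / (2 * t) ^ (\<beta> + 1)) \<le> ?J (2 * t)"
          by (rule eta_numerator_increment[OF m elim(3) \<beta>]) (rule fin)
        then show "t * (mass m t / (2 * t) ^ (\<beta> + 1)) \<le> ?J (2 * t) - ?J t" by linarith
      qed simp
      moreover have "2 ^ (\<beta> + 1) * (t * (mass m t / (2 * t) ^ (\<beta> + 1))) = mass m t / t ^ \<beta>"
        using t by (simp add: power_mult_distrib)
      ultimately have "mass m t / t ^ \<beta> \<le> 2 ^ (\<beta> + 1) * (?J (2 * t) - ?J t)" by (simp only:)
      then have "mass m t / t ^ \<beta> / ?l t \<le> 2 ^ (\<beta> + 1) * (?J (2 * t) - ?J t) / ?l t"
        using elim(1) by (intro divide_right_mono) auto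
      moreover have "mass m t / t ^ \<beta> / ?l t = mass m t / mass \<mu>\<^sub>0 t" using t by (simp add: sv_def)
      moreover have "2 ^ (\<beta> + 1) * (?J (2 * t) - ?J t) / ?l t = 2 ^ (\<beta> + 1) * (?J (2 * t) / ?l (2 * t) * (?l (2 * t) / ?l t) - ?J t / ?l t)"
      proof -
        have "?J (2 * t) / ?l (2 * t) * (?l (2 * t) / ?l t) = ?J (2 * t) / ?l t" using elim by simp
        then show ?thesis by (simp only: diff_divide_distrib[symmetric] times_divide_eq_right)
      qed
      ultimately show ?case by (simp only:)
    qed
  qed
qed

text \<open>The numerator tends to infinity while its ratio to \<open>l\<close> stays bounded, so
  \<open>l\<close> must tend to infinity. In the divergent case this makes every bounded
  contribution to the first moment negligible.\<close>

lemma eta_divergent_sv: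
  assumes m: "locally_finite m" and \<beta>: "\<beta> \<ge> 1"
    and inf: "(\<integral>\<^sup>+ s. ennreal (1 / (1 + \<bar>s\<bar>) ^ \<beta>) \<partial>m) = \<infinity>"
    and lim: "((\<lambda>t. (LINT s:{1..t}|lborel. mass m s / s ^ (\<beta> + 1)) / l t) \<longlongrightarrow> \<eta>) at_top"
    and lpos: "\<forall>\<^sub>F t in at_top. l t > (0::real)"
  shows "filterlim l at_top at_top"
proof -
  let ?g = "\<lambda>u. mass m u / u ^ (\<beta> + 1)" and ?J = "\<lambda>t. LINT s:{1..t}|lborel. mass m s / s ^ (\<beta> + 1)"
  note [measurable_cong] = locally_finiteD(1)[OF m]
  note measurable_mass[OF m, measurable]
  have g0: "0 \<le> ?g u" if "u \<ge> 1" for u using that by simp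
  have Jmono: "?J s \<le> ?J t" if "s \<le> t" for s t
  proof (cases "s \<ge> 1")
    case True
    have i: "set_integrable lborel {1..s} ?g" "set_integrable lborel {1..t} ?g" using layer_bounded(1)[OF m] True that by auto
    show ?thesis unfolding set_lebesgue_integral_def
      using i that by (intro integral_mono) (auto simp: set_integrable_def indicator_def)
  next
    case False
    then have "?J s = 0" by (simp add: set_lebesgue_integral_def)
    moreover have "?J t \<ge> 0" unfolding set_lebesgue_integral_def
      by (intro Bochner_Integration.integral_nonneg) (auto simp: indicator_def)
    ultimately show ?thesis by simp
  qed
  have J: "filterlim ?J at_top at_top"
    unfolding filterlim_at_top
  proof
    fix Z
    show "\<forall>\<^sub>F t in at_top. Z \<le> ?J t"
    proof (rule ccontr)
      assume "\<not> (\<forall>\<^sub>F t in at_top. Z \<le> ?J t)"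
      then have "\<exists>t\<ge>T. ?J t < Z" for T by (auto simp: eventually_at_top_linorder not_le)
      \<comment> \<open>The integral is monotone in its upper limit, so not tending to infinity
        means being bounded; monotone convergence then bounds the integral over the measure,
        contrary to \<open>inf\<close>.\<close>
      then have bd: "?J T \<le> Z" for T using Jmono by (meson le_less_trans less_imp_le)
      let ?f = "\<lambda>n u. ennreal (\<beta> / u ^ (\<beta> + 1) * mass m u) * indicator {1..real n} u"
      have le: "(\<integral>\<^sup>+ u. ?f n u \<partial>lborel) \<le> ennreal (\<beta> * Z)" for n
      proof -
        have "(\<integral>\<^sup>+ u. ?f n u \<partial>lborel) = (\<integral>\<^sup>+ u. ennreal (\<beta> * (indicator {1..real n} u *\<^sub>R ?g u)) \<partial>lborel)"
          by (intro nn_integral_cong) (auto simp: indicator_def)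
        also have "\<dots> = ennreal (\<integral>u. \<beta> * (indicator {1..real n} u *\<^sub>R ?g u) \<partial>lborel)"
        proof (rule nn_integral_eq_integral)
          have "set_integrable lborel {1..real n} ?g"
            using layer_bounded(1)[OF m, of "real n" \<beta>] by (cases "n \<ge> 1") (auto simp: set_integrable_def)
          then show "integrable lborel (\<lambda>u. \<beta> * (indicator {1..real n} u *\<^sub>R ?g u))" unfolding set_integrable_def by (rule integrable_mult_right)
        qed (auto simp: indicator_def)
        also have "\<dots> = ennreal (\<beta> * ?J (real n))"
          unfolding set_lebesgue_integral_def by (simp only: Bochner_Integration.integral_mult_right_zero)
        also have "\<dots> \<le> ennreal (\<beta> * Z)" using bd by (intro ennreal_leI mult_left_mono) auto
        finally show ?thesis .
      qed
      have "(\<lambda>n. \<integral>\<^sup>+ u. ?f n u \<partial>lborel) \<longlonglongrightarrow> (\<integral>\<^sup>+ u. ennreal (\<beta> / u ^ (\<beta> + 1) * mass m u) * indicator {1..} u \<partial>lborel)"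
      proof (rule nn_integral_LIMSEQ)
        show "incseq ?f" by (auto simp: incseq_def le_fun_def indicator_def)
        show "?f n \<in> borel_measurable lborel" for n by measurable
        show "(\<lambda>n. ?f n u) \<longlonglongrightarrow> ennreal (\<beta> / u ^ (\<beta> + 1) * mass m u) * indicator {1..} u" for u
        proof (rule tendsto_eventually)
          show "\<forall>\<^sub>F n in sequentially. ?f n u = ennreal (\<beta> / u ^ (\<beta> + 1) * mass m u) * indicator {1..} u"
            using eventually_ge_at_top[of "nat \<lceil>u\<rceil>"] by eventually_elim (auto simp: indicator_def nat_le_iff ceiling_le_iff)
        qed
      qed
      then have "(\<integral>\<^sup>+ u. ennreal (\<beta> / u ^ (\<beta> + 1) * mass m u) * indicator {1..} u \<partial>lborel) \<le> ennreal (\<beta> * Z)"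
        using le by (intro LIMSEQ_le_const2) auto
      then have "(\<integral>\<^sup>+ s. ennreal (1 / max \<bar>s\<bar> 1 ^ \<beta>) \<partial>m) \<le> ennreal (\<beta> * Z)"
        using nn_layer_tail[OF m _ \<beta>, of 1] by simp
      then have "(\<integral>\<^sup>+ s. ennreal (1 / (1 + \<bar>s\<bar>) ^ \<beta>) \<partial>m) \<le> ennreal (\<beta> * Z)"
        using shifted_weight_le[OF m, of \<beta>] by (rule order_trans[rotated])
      then show False using inf by (simp add: top_unique)
    qed
  qed
  have "\<forall>\<^sub>F t in at_top. ?J t / l t < \<bar>\<eta>\<bar> + 1" using lim by (rule order_tendstoD) auto
  then have ev: "\<forall>\<^sub>F t in at_top. ?J t / (\<bar>\<eta>\<bar> + 1) \<le> l t"
    using lpos by eventually_elim (auto simp: divide_simps mult.commute split: if_splits)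
  have "filterlim (\<lambda>t. 1 / (\<bar>\<eta>\<bar> + 1) * ?J t) at_top at_top"
    by (rule filterlim_tendsto_pos_mult_at_top[OF tendsto_const _ J]) simp
  then show ?thesis by (rule filterlim_at_top_mono) (use ev in simp)
qed

lemma regularly_varying_asymp:
  assumes m: "locally_finite m" and rv: "regularly_varying g \<alpha>" and lim: "((\<lambda>t. mass m t / g t) \<longlongrightarrow> 1) at_top"
  shows "regularly_varying (mass m) \<alpha>"
proof -
  note measurable_mass[OF m, measurable]
  have gpos: "\<forall>\<^sub>F t in at_top. g t > 0" by (rule regularly_varying_eventually_pos[OF rv])
  have "\<forall>\<^sub>F t in at_top. mass m t / g t > 0" using lim by (rule order_tendstoD) simp
  then have pos: "\<forall>\<^sub>F t in at_top. mass m t > 0" using gpos by eventually_elim (auto simp: zero_less_divide_iff)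
  then obtain x where x: "\<And>t. t \<ge> x \<Longrightarrow> mass m t > 0" by (auto simp: eventually_at_top_linorder)
  have "\<exists>x\<^sub>0>0. mass m \<in> borel_measurable (restrict_space borel {x\<^sub>0..}) \<and> (\<forall>t\<ge>x\<^sub>0. mass m t > 0)"
    using x by (intro exI[of _ "max 1 x"]) (auto intro!: measurable_restrict_space1)
  moreover have "((\<lambda>r. mass m (c * r) / mass m r) \<longlongrightarrow> c powr \<alpha>) at_top" if c: "c > 0" for c
  proof -
    have fl: "filterlim (\<lambda>r. c * r) at_top at_top"
      using c by (intro filterlim_tendsto_pos_mult_at_top[OF tendsto_const] filterlim_ident)
    have "((\<lambda>r. g (c * r) / g r) \<longlongrightarrow> c powr \<alpha>) at_top" using rv c by (simp add: regularly_varying_def)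
    then have "((\<lambda>r. mass m (c * r) / g (c * r) * (g (c * r) / g r) / (mass m r / g r)) \<longlongrightarrow> 1 * c powr \<alpha> / 1) at_top"
      by (intro tendsto_intros filterlim_compose[OF lim fl] lim) auto
    moreover have "\<forall>\<^sub>F r in at_top. mass m (c * r) / g (c * r) * (g (c * r) / g r) / (mass m r / g r) = mass m (c * r) / mass m r"
      using gpos eventually_compose_filterlim[OF gpos fl] by eventually_elim simp
    ultimately show ?thesis using Lim_transform_eventually by force
  qed
  ultimately show ?thesis by (simp add: regularly_varying_def)
qed

text \<open>The gap between \<gamma> and \<beta> leaves a negative power of t, which beats every
  slowly varying factor.\<close>

lemma powr_mass_negligible:
  assumes \<mu>\<^sub>0: "locally_finite \<mu>\<^sub>0" and rv: "regularly_varying (mass \<mu>\<^sub>0) (real \<beta>)"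
    and g: "\<gamma> < real \<beta>" and ev: "\<forall>\<^sub>F t in at_top. mass m t \<le> c * t powr \<gamma>"
  shows "((\<lambda>t. mass m t / mass \<mu>\<^sub>0 t) \<longlongrightarrow> 0) at_top"
proof -
  have mono: "mass \<mu>\<^sub>0 x \<le> mass \<mu>\<^sub>0 y" if "0 < x" "x \<le> y" for x y using mass_mono[OF \<mu>\<^sub>0] that by blast
  have z: "((\<lambda>t. t powr (-(real \<beta> - \<gamma>)) / sv (mass \<mu>\<^sub>0) \<beta> t) \<longlongrightarrow> 0) at_top"
    using powr_over_sv_tendsto_0[where M = "mass \<mu>\<^sub>0", OF mono rv, of "real \<beta> - \<gamma>"] g by simp
  show ?thesis
  proof (rule tendsto_0_le[OF z, where K = "\<bar>c\<bar>"])
    show "\<forall>\<^sub>F t in at_top. norm (mass m t / mass \<mu>\<^sub>0 t) \<le> norm (t powr (-(real \<beta> - \<gamma>)) / sv (mass \<mu>\<^sub>0) \<beta> t) * \<bar>c\<bar>"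
      using ev eventually_gt_at_top[of 0] regularly_varying_eventually_pos[OF rv]
    proof eventually_elim
      case (elim t)
      have "t powr (-(real \<beta> - \<gamma>)) = t powr \<gamma> / t ^ \<beta>" using elim(2) powr_diff[of t \<gamma> "real \<beta>"] by (simp add: powr_realpow)
      then have e: "t powr (-(real \<beta> - \<gamma>)) / sv (mass \<mu>\<^sub>0) \<beta> t = t powr \<gamma> / mass \<mu>\<^sub>0 t" using elim(2) by (simp add: sv_def)
      have "c * t powr \<gamma> \<le> \<bar>c\<bar> * t powr \<gamma>" by (intro mult_right_mono) auto
      then have "mass m t \<le> \<bar>c\<bar> * t powr \<gamma>" using elim(1) by linarith
      then have "mass m t / mass \<mu>\<^sub>0 t \<le> \<bar>c\<bar> * t powr \<gamma> / mass \<mu>\<^sub>0 t" using elim(3) by (intro divide_right_mono) auto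
      then show ?case unfolding e using elim(3) by (simp add: mult.commute)
    qed
  qed
qed

text \<open>Divergent case: up to a constant and the boundary term, the truncated moment is \<beta>
  times the numerator of the eta quotient. The constant is negligible by \<open>inf\<close>, the
  boundary term by \<open>small\<close>.\<close>

lemma one_sided_moment_limit:
  fixes \<kappa> :: nat
  defines "w \<equiv> \<lambda>s. 1 / (1 + s\<^sup>2) ^ (\<kappa> + 1)" and "\<beta> \<equiv> 2 * \<kappa> + 1"
  assumes m: "locally_finite m" and int: "integrable m (\<lambda>s. 1 / (1 + s\<^sup>2) ^ (\<kappa> + 1))"
    and lpos: "\<forall>\<^sub>F t in at_top. sv (mass \<mu>\<^sub>0) \<beta> t > 0" and \<mu>\<^sub>1: "(\<integral>\<^sup>+ s. ennreal (1 / (1 + \<bar>s\<bar>) ^ \<beta>) \<partial>\<mu>\<^sub>1) = \<infinity>"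
    and lim: "(eta_quotient \<beta> \<mu>\<^sub>0 \<mu>\<^sub>1 m \<longlongrightarrow> \<eta>) at_top"
    and inf: "filterlim (sv (mass \<mu>\<^sub>0) \<beta>) at_top at_top"
    and small: "((\<lambda>t. mass m t / mass \<mu>\<^sub>0 t) \<longlongrightarrow> 0) at_top"
  shows "((\<lambda>t. (LINT s:{-t<..<t}|m. \<bar>s\<bar> * w s) / sv (mass \<mu>\<^sub>0) \<beta> t) \<longlongrightarrow> \<beta> * \<eta>) at_top"
proof -
  let ?l = "sv (mass \<mu>\<^sub>0) \<beta>" and ?J = "eta_numerator \<beta> \<mu>\<^sub>1 m" and ?A = "\<lambda>t. LINT s:{-t<..<t}|m. \<bar>s\<bar> * w s"
  define K where "K = (real \<kappa> + 2) * 2 ^ (\<kappa> + 1) * (\<integral>s. w s \<partial>m)"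
  have lim': "((\<lambda>t. ?J t / ?l t) \<longlongrightarrow> \<eta>) at_top" using lim by (simp add: eta_quotient_eq[abs_def])
  have i: "((\<lambda>t. 1 / ?l t) \<longlongrightarrow> 0) at_top" using tendsto_inverse_0_at_top[OF inf] by (simp add: inverse_eq_divide)
  have "((\<lambda>t. K * (1 / ?l t) + mass m t / mass \<mu>\<^sub>0 t) \<longlongrightarrow> K * 0 + 0) at_top" by (intro tendsto_intros i small)
  then have z: "((\<lambda>t. K * (1 / ?l t) + mass m t / mass \<mu>\<^sub>0 t) \<longlongrightarrow> 0) at_top" by simp
  have "((\<lambda>t. ?A t / ?l t - \<beta> * (?J t / ?l t)) \<longlongrightarrow> 0) at_top"
  proof (rule tendsto_0_le[OF z, where K = 1])
    show "\<forall>\<^sub>F t in at_top. norm (?A t / ?l t - \<beta> * (?J t / ?l t)) \<le> norm (K * (1 / ?l t) + mass m t / mass \<mu>\<^sub>0 t) * 1"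
      using lpos eventually_ge_at_top[of 1]
    proof eventually_elim
      case (elim t)
      have e: "2 * \<kappa> + 2 = \<beta> + 1" by (simp add: \<beta>_def)
      have b: "\<bar>?A t - \<beta> * ?J t\<bar> \<le> K + mass m t / t ^ \<beta>"
      proof -
        have J: "?J t = (LINT u:{1..t}|lborel. mass m u / u ^ (\<beta> + 1))" using \<mu>\<^sub>1 by (simp add: eta_numerator_def)
        show ?thesis
          using weighted_moment_bounds(1)[OF m int elim(2)] unfolding e J w_def K_def by (simp only: \<beta>_def)
      qed
      have "?A t / ?l t - \<beta> * (?J t / ?l t) = (?A t - \<beta> * ?J t) / ?l t" by (simp add: diff_divide_distrib)
      also have "norm \<dots> \<le> (K + mass m t / t ^ \<beta>) / ?l t" using b elim by (simp add: abs_divide divide_right_mono)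
      also have "\<dots> = K * (1 / ?l t) + mass m t / mass \<mu>\<^sub>0 t"
      proof -
        have p1: "K / ?l t = K * (1 / ?l t)" by simp
        have p2: "mass m t / t ^ \<beta> / ?l t = mass m t / mass \<mu>\<^sub>0 t" using elim(2) by (simp add: sv_def)
        show ?thesis by (simp only: add_divide_distrib p1 p2)
      qed
      finally show ?case by simp
    qed
  qed
  from tendsto_add[OF this tendsto_mult[OF tendsto_const[of "real \<beta>"] lim']] show ?thesis by simp
qed

text \<open>Convergent case: the tail moment is \<beta> times the tail integral, which
  \<open>eta_numerator\<close> carries with a minus sign, hence the sign of the limit. The error of
  order 1/t is negligible by \<open>inv\<close>, the boundary term by \<open>small\<close>.\<close>

lemma one_sided_tail_limit:
  fixes \<kappa> :: nat
  defines "w \<equiv> \<lambda>s. 1 / (1 + s\<^sup>2) ^ (\<kappa> + 1)" and "\<beta> \<equiv> 2 * \<kappa> + 1"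
  assumes m: "locally_finite m" and int: "integrable m (\<lambda>s. 1 / (1 + s\<^sup>2) ^ (\<kappa> + 1))"
    and lpos: "\<forall>\<^sub>F t in at_top. sv (mass \<mu>\<^sub>0) \<beta> t > 0" and \<mu>\<^sub>1: "(\<integral>\<^sup>+ s. ennreal (1 / (1 + \<bar>s\<bar>) ^ \<beta>) \<partial>\<mu>\<^sub>1) \<noteq> \<infinity>"
    and fin: "(\<integral>\<^sup>+ s. ennreal (1 / (1 + \<bar>s\<bar>) ^ \<beta>) \<partial>m) < \<infinity>"
    and lim: "(eta_quotient \<beta> \<mu>\<^sub>0 \<mu>\<^sub>1 m \<longlongrightarrow> \<eta>) at_top"
    and inv: "((\<lambda>t. t powr (-1) / sv (mass \<mu>\<^sub>0) \<beta> t) \<longlongrightarrow> 0) at_top"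
    and small: "((\<lambda>t. mass m t / mass \<mu>\<^sub>0 t) \<longlongrightarrow> 0) at_top"
  shows "((\<lambda>t. (LINT s:-{-t<..<t}|m. \<bar>s\<bar> * w s) / sv (mass \<mu>\<^sub>0) \<beta> t) \<longlongrightarrow> - (\<beta> * \<eta>)) at_top"
proof -
  let ?l = "sv (mass \<mu>\<^sub>0) \<beta>" and ?J = "eta_numerator \<beta> \<mu>\<^sub>1 m" and ?A = "\<lambda>t. LINT s:-{-t<..<t}|m. \<bar>s\<bar> * w s"
  define K where "K = (real \<kappa> + 2) * 2 ^ (\<kappa> + 1) * (\<integral>s. w s \<partial>m)"
  have lim': "((\<lambda>t. ?J t / ?l t) \<longlongrightarrow> \<eta>) at_top" using lim by (simp add: eta_quotient_eq[abs_def])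
  have "((\<lambda>t. K * (t powr (-1) / ?l t) + mass m t / mass \<mu>\<^sub>0 t) \<longlongrightarrow> K * 0 + 0) at_top" by (intro tendsto_intros inv small)
  then have z: "((\<lambda>t. K * (t powr (-1) / ?l t) + mass m t / mass \<mu>\<^sub>0 t) \<longlongrightarrow> 0) at_top" by simp
  have "((\<lambda>t. ?A t / ?l t + \<beta> * (?J t / ?l t)) \<longlongrightarrow> 0) at_top"
  proof (rule tendsto_0_le[OF z, where K = 1])
    show "\<forall>\<^sub>F t in at_top. norm (?A t / ?l t + \<beta> * (?J t / ?l t)) \<le> norm (K * (t powr (-1) / ?l t) + mass m t / mass \<mu>\<^sub>0 t) * 1"
      using lpos eventually_ge_at_top[of 1]
    proof eventually_elim
      case (elim t)
      let ?T = "LINT u:{t..}|lborel. mass m u / u ^ (\<beta> + 1)"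
      have e: "2 * \<kappa> + 2 = \<beta> + 1" by (simp add: \<beta>_def)
      have J: "?J t = - ?T" using \<mu>\<^sub>1 by (simp add: eta_numerator_def)
      have "\<bar>?A t - \<beta> * ?T\<bar> \<le> K / t + mass m t / t ^ \<beta>"
        using weighted_tail_bounds(2)[OF m int elim(2) fin[unfolded \<beta>_def]] unfolding e w_def K_def by (simp only: \<beta>_def)
      then have b: "\<bar>?A t + \<beta> * ?J t\<bar> \<le> K / t + mass m t / t ^ \<beta>" unfolding J by simp
      have "?A t / ?l t + \<beta> * (?J t / ?l t) = (?A t + \<beta> * ?J t) / ?l t" by (simp add: add_divide_distrib)
      also have "norm \<dots> \<le> (K / t + mass m t / t ^ \<beta>) / ?l t" using b elim by (simp add: abs_divide divide_right_mono)
      also have "\<dots> = K * (t powr (-1) / ?l t) + mass m t / mass \<mu>\<^sub>0 t"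
      proof -
        have p1: "K / t / ?l t = K * (t powr (-1) / ?l t)" using elim(2) by (simp add: powr_minus_divide)
        have p2: "mass m t / t ^ \<beta> / ?l t = mass m t / mass \<mu>\<^sub>0 t" using elim(2) by (simp add: sv_def)
        show ?thesis by (simp only: add_divide_distrib p1 p2)
      qed
      finally show ?case by simp
    qed
  qed
  from tendsto_diff[OF this tendsto_mult[OF tendsto_const[of "real \<beta>"] lim']] show ?thesis by simp
qed

text \<open>On each half s is plus or minus |s|; this reduces signed moments to the one-sided
  absolute moments that (e) controls.\<close>

lemma set_integral_pos_neg_part:
  fixes w :: "real \<Rightarrow> real"
  assumes [measurable_cong]: "sets m = sets borel" and [measurable]: "w \<in> borel_measurable borel" "A \<in> sets borel"
    and int: "integrable m (\<lambda>s. indicator A s * (\<bar>s\<bar> * w s))"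
  shows "(LINT s:A|m. s * w s) = (LINT s:A|pos_part m. \<bar>s\<bar> * w s) - (LINT s:A|neg_part m. \<bar>s\<bar> * w s)"
proof -
  let ?f = "\<lambda>s. indicator A s * (\<bar>s\<bar> * w s)"
  have i: "integrable m (\<lambda>s. indicator {0..} s * ?f s)" "integrable m (\<lambda>s. indicator {..<0} s * ?f s)"
    using int by (auto intro!: integrable_real_mult_indicator simp: mult.commute[of "indicator _ _" "?f _"])
  have "(LINT s:A|pos_part m. \<bar>s\<bar> * w s) - (LINT s:A|neg_part m. \<bar>s\<bar> * w s) = (\<integral>s. indicator {0..} s * ?f s \<partial>m) - (\<integral>s. indicator {..<0} s * ?f s \<partial>m)"
    unfolding set_lebesgue_integral_def by (subst integral_pos_part, simp_all add: assms(1), subst integral_neg_part, simp_all add: assms(1))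
  also have "\<dots> = (\<integral>s. indicator {0..} s * ?f s - indicator {..<0} s * ?f s \<partial>m)" using i by (rule Bochner_Integration.integral_diff[symmetric])
  also have "\<dots> = (LINT s:A|m. s * w s)" unfolding set_lebesgue_integral_def
    by (intro Bochner_Integration.integral_cong) (auto simp: indicator_def)
  finally show ?thesis by simp
qed

text \<open>As \<gamma> < \<beta>, the first absolute moment converges and its tail decays like a
  negative power of t, fast enough to vanish against any slowly varying quotient. On the tail the
  weighted integrand is bounded by a pure power.\<close>

lemma powr_mass_tail:
  fixes \<kappa> :: nat
  defines "w \<equiv> \<lambda>s. 1 / (1 + s\<^sup>2) ^ (\<kappa> + 1)" and "\<beta> \<equiv> 2 * \<kappa> + 1"
  assumes m: "locally_finite m" and int: "integrable m (\<lambda>s. 1 / (1 + s\<^sup>2) ^ (\<kappa> + 1))"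
    and g: "\<gamma> < real \<beta>" and ev: "\<forall>\<^sub>F t in at_top. mass m t \<le> c * t powr \<gamma>" and c: "c > 0"
  shows "integrable m (\<lambda>s. \<bar>s\<bar> * w s)"
    and "\<exists>K. \<forall>t\<ge>1. \<bar>LINT s:-{-t<..<t}|m. s * w s\<bar> \<le> K * t powr (\<gamma> - \<beta>)"
proof -
  note [measurable_cong] = locally_finiteD(1)[OF m]
  have [measurable]: "w \<in> borel_measurable borel" unfolding w_def by measurable
  obtain K where K: "K \<ge> 0" "\<And>u. u \<ge> 1 \<Longrightarrow> mass m u \<le> K * u powr \<gamma>"
    using mass_powr_bound[OF m ev] c by auto
  have \<beta>: "\<beta> \<ge> 1" by (simp add: \<beta>_def)
  have tail: "(\<integral>\<^sup>+ s. ennreal (1 / max \<bar>s\<bar> t ^ \<beta>) \<partial>m) \<le> ennreal (\<beta> * K / (\<beta> - \<gamma>) * t powr (\<gamma> - \<beta>))" if "t \<ge> 1" for t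
    using that K(2) by (intro nn_tail_powr[OF m _ \<beta> g K(1)]) auto
  have fin: "(\<integral>\<^sup>+ s. ennreal (1 / (1 + \<bar>s\<bar>) ^ \<beta>) \<partial>m) < \<infinity>"
    using order_trans[OF shifted_weight_le[OF m] tail[of 1]] by (auto simp: less_top[symmetric] top_unique)
  show iw: "integrable m (\<lambda>s. \<bar>s\<bar> * w s)"
    using weighted_tail_bounds(1)[OF m int order_refl fin[unfolded \<beta>_def]] by (simp add: w_def)
  have wle: "\<bar>s\<bar> * w s \<le> 1 / \<bar>s\<bar> ^ \<beta>" if "s \<noteq> 0" for s
  proof -
    have "(s\<^sup>2) ^ (\<kappa> + 1) \<le> (1 + s\<^sup>2) ^ (\<kappa> + 1)" by (intro power_mono) auto
    moreover have "(s\<^sup>2) ^ (\<kappa> + 1) = \<bar>s\<bar> * \<bar>s\<bar> ^ \<beta>"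
    proof -
      have "(s\<^sup>2) ^ (\<kappa> + 1) = \<bar>s\<bar> ^ (2 * (\<kappa> + 1))" unfolding power_mult by simp
      then show ?thesis by (simp add: \<beta>_def power2_eq_square)
    qed
    ultimately have "\<bar>s\<bar> * w s \<le> \<bar>s\<bar> * (1 / (\<bar>s\<bar> * \<bar>s\<bar> ^ \<beta>))" unfolding w_def using that
      by (intro mult_left_mono divide_left_mono mult_pos_pos zero_less_power) (auto simp: add_pos_nonneg)
    then show ?thesis using that by simp
  qed
  have w0: "w s \<ge> 0" for s using weight_bounds(1)[of s "\<kappa> + 1"] by (simp add: w_def)
  have "\<bar>LINT s:-{-t<..<t}|m. s * w s\<bar> \<le> \<beta> * K / (\<beta> - \<gamma>) * t powr (\<gamma> - \<beta>)" if t: "t \<ge> 1" for t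
  proof -
    have i: "integrable m (\<lambda>s. 1 / max \<bar>s\<bar> t ^ \<beta>)" by (rule layer_tail(2)[OF m t \<beta> fin])
    have nn: "0 \<le> 1 / max \<bar>s\<bar> t ^ \<beta>" for s using t by (simp add: le_max_iff_disj)
    have le: "norm (indicator (-{-t<..<t}) s *\<^sub>R (s * w s)) \<le> 1 / max \<bar>s\<bar> t ^ \<beta>" for s
    proof (cases "\<bar>s\<bar> < t")
      case True
      then show ?thesis using nn[of s] by (auto simp: indicator_def abs_less_iff)
    next
      case False
      then show ?thesis using wle[of s] t w0[of s] by (auto simp: indicator_def max_absorb1 abs_mult)
    qed
    have "norm (LINT s:-{-t<..<t}|m. s * w s) \<le> (\<integral>s. 1 / max \<bar>s\<bar> t ^ \<beta> \<partial>m)"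
      unfolding set_lebesgue_integral_def
    proof (rule Bochner_Integration.integral_norm_bound_integral[OF _ i le])
      show "integrable m (\<lambda>s. indicat_real (-{-t<..<t}) s *\<^sub>R (s * w s))" by (rule integrable_bounded_by[OF i _ le]) measurable
    qed
    also have "\<dots> \<le> \<beta> * K / (\<beta> - \<gamma>) * t powr (\<gamma> - \<beta>)"
    proof -
      have r: "0 \<le> \<beta> * K / (\<beta> - \<gamma>) * t powr (\<gamma> - \<beta>)" using K(1) g by simp
      have "ennreal (\<integral>s. 1 / max \<bar>s\<bar> t ^ \<beta> \<partial>m) = (\<integral>\<^sup>+ s. ennreal (1 / max \<bar>s\<bar> t ^ \<beta>) \<partial>m)"
        using nn by (intro nn_integral_eq_integral[symmetric] i) auto
      then show ?thesis using tail[OF t] r by (metis ennreal_le_iff)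
    qed
    finally show ?thesis by simp
  qed
  then show "\<exists>K. \<forall>t\<ge>1. \<bar>LINT s:-{-t<..<t}|m. s * w s\<bar> \<le> K * t powr (\<gamma> - \<beta>)" by blast
qed

text \<open>The symmetric part drops out. If the integral in (d) diverges, the quotient tends to
  infinity and swallows \<open>c2\<close> and the bounded moment of \<open>\<mu>\<^sub>2\<close>. If
  it converges, (d) identifies \<open>c2\<close> with the full first moment of
  \<open>\<mu>\<^sub>1\<close> and \<open>\<mu>\<^sub>2\<close>, so the difference is minus a tail.
  The two forms of (e) fit these cases and give the same limit.\<close>

lemma first_moment_asymptotics:
  fixes \<kappa> :: nat and c2 :: real and \<mu>\<^sub>0 \<mu>\<^sub>1 \<mu>\<^sub>2 :: "real measure"
  defines "w \<equiv> \<lambda>s. 1 / (1 + s\<^sup>2) ^ (\<kappa> + 1)" and "\<beta> \<equiv> 2 * \<kappa> + 1"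
  defines "\<mu> \<equiv> measure_sum (measure_sum \<mu>\<^sub>0 \<mu>\<^sub>1) \<mu>\<^sub>2"
  assumes lf: "locally_finite \<mu>\<^sub>0" "locally_finite \<mu>\<^sub>1" "locally_finite \<mu>\<^sub>2"
    and int: "integrable \<mu>\<^sub>0 w" "integrable \<mu>\<^sub>1 w" "integrable \<mu>\<^sub>2 w"
    and sym: "symmetric_measure \<mu>\<^sub>0" and rv: "regularly_varying (mass \<mu>\<^sub>0) (real \<beta>)"
    and g: "\<gamma> < real \<beta>" "\<forall>\<^sub>F t in at_top. mass \<mu>\<^sub>2 t \<le> c * t powr \<gamma>" "c > 0"
    and d: "(\<integral>\<^sup>+ t. ennreal (1 / (1 + \<bar>t\<bar>) ^ \<beta>) \<partial>\<mu>\<^sub>1) < \<infinity> \<Longrightarrow> c2 = (\<integral>t. t * w t \<partial>measure_sum \<mu>\<^sub>1 \<mu>\<^sub>2)"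
    and eta: "(eta_quotient \<beta> \<mu>\<^sub>0 \<mu>\<^sub>1 (pos_part \<mu>\<^sub>1) \<longlongrightarrow> \<eta>\<^sub>p) at_top" "(eta_quotient \<beta> \<mu>\<^sub>0 \<mu>\<^sub>1 (neg_part \<mu>\<^sub>1) \<longlongrightarrow> \<eta>\<^sub>m) at_top"
    and small: "((\<lambda>t. mass (pos_part \<mu>\<^sub>1) t / mass \<mu>\<^sub>0 t) \<longlongrightarrow> 0) at_top" "((\<lambda>t. mass (neg_part \<mu>\<^sub>1) t / mass \<mu>\<^sub>0 t) \<longlongrightarrow> 0) at_top"
  shows "((\<lambda>t. ((LINT s:{-t<..<t}|\<mu>. s * w s) - c2) / sv (mass \<mu>\<^sub>0) \<beta> t) \<longlongrightarrow> \<beta> * (\<eta>\<^sub>p - \<eta>\<^sub>m)) at_top"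
proof -
  let ?l = "sv (mass \<mu>\<^sub>0) \<beta>" and ?p = "pos_part \<mu>\<^sub>1" and ?n = "neg_part \<mu>\<^sub>1"
  note s0 = locally_finiteD(1)[OF lf(1)] and s1 = locally_finiteD(1)[OF lf(2)] and s2 = locally_finiteD(1)[OF lf(3)]
  note [measurable_cong] = s0 s1 s2
  have [measurable]: "w \<in> borel_measurable borel" unfolding w_def by measurable
  have w: "0 \<le> w s" "w s \<le> 1" for s using weight_bounds[of s "\<kappa> + 1"] by (simp_all add: w_def)
  note lfp = locally_finite_pos_neg_part[OF lf(2)]
  have intp: "integrable ?p w" "integrable ?n w"
    using int(2) s1 by (auto simp: integrable_pos_part integrable_neg_part intro!: integrable_bounded_by[OF int(2)] simp: indicator_def w)
  note intw = int(3)[unfolded w_def] intp[unfolded w_def]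
  have mono: "mass \<mu>\<^sub>0 x \<le> mass \<mu>\<^sub>0 y" if "0 < x" "x \<le> y" for x y using mass_mono[OF lf(1)] that by blast
  have lpos: "\<forall>\<^sub>F r in at_top. ?l r > 0"
    using regularly_varying_eventually_pos[OF rv] eventually_gt_at_top[of 0] by eventually_elim (auto simp: sv_def)
  have si: "set_integrable m {-t<..<t} (\<lambda>s. s * w s)" "set_integrable m {-t<..<t} (\<lambda>s. \<bar>s\<bar> * w s)" if "locally_finite m" for m t
  proof -
    have "\<bar>s * w s\<bar> \<le> t * 1" "\<bar>\<bar>s\<bar> * w s\<bar> \<le> t * 1" if "\<bar>s\<bar> < t" for s
    proof -
      have "\<bar>s\<bar> * w s \<le> t * 1" using w[of s] that by (intro mult_mono) auto
      then show "\<bar>s * w s\<bar> \<le> t * 1" "\<bar>\<bar>s\<bar> * w s\<bar> \<le> t * 1" using w[of s] by (simp_all add: abs_mult)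
    qed
    then show "set_integrable m {-t<..<t} (\<lambda>s. s * w s)" "set_integrable m {-t<..<t} (\<lambda>s. \<bar>s\<bar> * w s)"
      by (auto intro!: locally_finite_integrable[OF that, where B = "t * 1"])
  qed
  have V0: "(LINT s:{-t<..<t}|\<mu>\<^sub>0. s * w s) = 0" for t unfolding set_lebesgue_integral_def
    by (rule symmetric_measure_odd_integral[OF s0 sym]) (auto simp: indicator_def w_def)
  have V1: "(LINT s:{-t<..<t}|\<mu>\<^sub>1. s * w s) = (LINT s:{-t<..<t}|?p. \<bar>s\<bar> * w s) - (LINT s:{-t<..<t}|?n. \<bar>s\<bar> * w s)" for t
    using si(2)[OF lf(2), of t] s1 by (intro set_integral_pos_neg_part) (auto simp: set_integrable_def)
  have V: "(LINT s:{-t<..<t}|\<mu>. s * w s) = (LINT s:{-t<..<t}|\<mu>\<^sub>1. s * w s) + (LINT s:{-t<..<t}|\<mu>\<^sub>2. s * w s)" for t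
  proof -
    let ?f = "\<lambda>s. indicator {-t<..<t} s *\<^sub>R (s * w s)"
    have i: "integrable \<mu>\<^sub>0 ?f" "integrable \<mu>\<^sub>1 ?f" "integrable \<mu>\<^sub>2 ?f"
      using si(1)[OF lf(1)] si(1)[OF lf(2)] si(1)[OF lf(3)] by (auto simp: set_integrable_def)
    have e: "sets \<mu>\<^sub>0 = sets \<mu>\<^sub>1" "sets (measure_sum \<mu>\<^sub>0 \<mu>\<^sub>1) = sets \<mu>\<^sub>2" using s0 s1 s2 by auto
    have "integral\<^sup>L \<mu> ?f = integral\<^sup>L \<mu>\<^sub>0 ?f + integral\<^sup>L \<mu>\<^sub>1 ?f + integral\<^sup>L \<mu>\<^sub>2 ?f"
      unfolding \<mu>_def integral_measure_sum[OF e(2) integrable_measure_sum[OF e(1) i(1,2)] i(3)] integral_measure_sum[OF e(1) i(1,2)] ..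
    then show ?thesis using V0[of t] by (simp add: set_lebesgue_integral_def)
  qed
  have pm: "integrable \<mu>\<^sub>2 (\<lambda>s. \<bar>s\<bar> * w s)" "\<exists>K. \<forall>t\<ge>1. \<bar>LINT s:-{-t<..<t}|\<mu>\<^sub>2. s * w s\<bar> \<le> K * t powr (\<gamma> - \<beta>)"
    unfolding w_def \<beta>_def
    by (rule powr_mass_tail[OF lf(3) intw(1) g(1)[unfolded \<beta>_def] g(2,3)])+
  show ?thesis
  proof (cases "(\<integral>\<^sup>+ s. ennreal (1 / (1 + \<bar>s\<bar>) ^ \<beta>) \<partial>\<mu>\<^sub>1) = \<infinity>")
    case True
    have "(\<integral>\<^sup>+ s. ennreal (1 / (1 + \<bar>s\<bar>) ^ \<beta>) \<partial>?p) + (\<integral>\<^sup>+ s. ennreal (1 / (1 + \<bar>s\<bar>) ^ \<beta>) \<partial>?n) = \<infinity>"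
      using True nn_integral_pos_neg_part[OF s1, of "\<lambda>s. ennreal (1 / (1 + \<bar>s\<bar>) ^ \<beta>)"] by simp
    \<comment> \<open>Divergence passes to at least one half of \<open>\<mu>\<^sub>1\<close>, and
      one is enough to force the quotient to infinity.\<close>
    then consider "(\<integral>\<^sup>+ s. ennreal (1 / (1 + \<bar>s\<bar>) ^ \<beta>) \<partial>?p) = \<infinity>" | "(\<integral>\<^sup>+ s. ennreal (1 / (1 + \<bar>s\<bar>) ^ \<beta>) \<partial>?n) = \<infinity>"
      by (auto simp: ennreal_add_eq_top)
    then have inf: "filterlim ?l at_top at_top"
    proof cases
      case 1
      then show ?thesis
        using eta(1) True by (intro eta_divergent_sv[OF lfp(1) _ 1 _ lpos]) (auto simp: eta_quotient_eq[abs_def] eta_numerator_def[abs_def] \<beta>_def)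
    next
      case 2
      then show ?thesis
        using eta(2) True by (intro eta_divergent_sv[OF lfp(2) _ 2 _ lpos]) (auto simp: eta_quotient_eq[abs_def] eta_numerator_def[abs_def] \<beta>_def)
    qed
    have i: "((\<lambda>t. 1 / ?l t) \<longlongrightarrow> 0) at_top" using tendsto_inverse_0_at_top[OF inf] by (simp add: inverse_eq_divide)
    have P: "((\<lambda>t. (LINT s:{-t<..<t}|?p. \<bar>s\<bar> * w s) / ?l t) \<longlongrightarrow> \<beta> * \<eta>\<^sub>p) at_top"
      unfolding w_def \<beta>_def
      by (rule one_sided_moment_limit[OF lfp(1) intw(2) lpos[unfolded \<beta>_def] True[unfolded \<beta>_def] eta(1)[unfolded \<beta>_def] inf[unfolded \<beta>_def] small(1)])
    have Ng: "((\<lambda>t. (LINT s:{-t<..<t}|?n. \<bar>s\<bar> * w s) / ?l t) \<longlongrightarrow> \<beta> * \<eta>\<^sub>m) at_top"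
      unfolding w_def \<beta>_def
      by (rule one_sided_moment_limit[OF lfp(2) intw(3) lpos[unfolded \<beta>_def] True[unfolded \<beta>_def] eta(2)[unfolded \<beta>_def] inf[unfolded \<beta>_def] small(2)])
    define B where "B = (\<integral>s. \<bar>s\<bar> * w s \<partial>\<mu>\<^sub>2)"
    have b: "\<bar>LINT s:{-t<..<t}|\<mu>\<^sub>2. s * w s\<bar> \<le> B" for t
    proof -
      have "norm (LINT s:{-t<..<t}|\<mu>\<^sub>2. s * w s) \<le> B" unfolding set_lebesgue_integral_def B_def
        using si(1)[OF lf(3), of t] pm(1) w
        by (intro Bochner_Integration.integral_norm_bound_integral) (auto simp: set_integrable_def indicator_def abs_mult)
      then show ?thesis by simp
    qed
    have Z: "((\<lambda>t. ((LINT s:{-t<..<t}|\<mu>\<^sub>2. s * w s) - c2) / ?l t) \<longlongrightarrow> 0) at_top"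
    proof (rule tendsto_0_le[OF i, where K = "B + \<bar>c2\<bar>"])
      show "\<forall>\<^sub>F t in at_top. norm (((LINT s:{-t<..<t}|\<mu>\<^sub>2. s * w s) - c2) / ?l t) \<le> norm (1 / ?l t) * (B + \<bar>c2\<bar>)"
        using lpos
      proof eventually_elim
        case (elim t)
        have "\<bar>(LINT s:{-t<..<t}|\<mu>\<^sub>2. s * w s) - c2\<bar> \<le> B + \<bar>c2\<bar>" using b[of t] by linarith
        then have "\<bar>(LINT s:{-t<..<t}|\<mu>\<^sub>2. s * w s) - c2\<bar> / ?l t \<le> (B + \<bar>c2\<bar>) / ?l t" using elim by (intro divide_right_mono) auto
        then show ?case using elim by (simp add: abs_divide)
      qed
    qed
    have "((\<lambda>t. (LINT s:{-t<..<t}|?p. \<bar>s\<bar> * w s) / ?l t - (LINT s:{-t<..<t}|?n. \<bar>s\<bar> * w s) / ?l t + ((LINT s:{-t<..<t}|\<mu>\<^sub>2. s * w s) - c2) / ?l t)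
        \<longlongrightarrow> \<beta> * \<eta>\<^sub>p - \<beta> * \<eta>\<^sub>m + 0) at_top" by (intro tendsto_intros P Ng Z)
    then show ?thesis unfolding V V1 by (simp add: add_divide_distrib diff_divide_distrib right_diff_distrib algebra_simps)
  next
    case False
    then have fin: "(\<integral>\<^sup>+ s. ennreal (1 / (1 + \<bar>s\<bar>) ^ \<beta>) \<partial>\<mu>\<^sub>1) < \<infinity>" by (simp add: less_top)
    have finp: "(\<integral>\<^sup>+ s. ennreal (1 / (1 + \<bar>s\<bar>) ^ \<beta>) \<partial>?p) < \<infinity>" "(\<integral>\<^sup>+ s. ennreal (1 / (1 + \<bar>s\<bar>) ^ \<beta>) \<partial>?n) < \<infinity>"
      using fin nn_integral_pos_neg_part[OF s1, of "\<lambda>s. ennreal (1 / (1 + \<bar>s\<bar>) ^ \<beta>)"] by auto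
    have inv: "((\<lambda>t. t powr (-1) / ?l t) \<longlongrightarrow> 0) at_top"
      using powr_over_sv_tendsto_0[where M = "mass \<mu>\<^sub>0", OF mono rv, of 1] by simp
    have P: "((\<lambda>t. (LINT s:-{-t<..<t}|?p. \<bar>s\<bar> * w s) / ?l t) \<longlongrightarrow> - (\<beta> * \<eta>\<^sub>p)) at_top"
      unfolding w_def \<beta>_def
      by (rule one_sided_tail_limit[OF lfp(1) intw(2) lpos[unfolded \<beta>_def] False[unfolded \<beta>_def] finp(1)[unfolded \<beta>_def] eta(1)[unfolded \<beta>_def] inv[unfolded \<beta>_def] small(1)])
    have Ng: "((\<lambda>t. (LINT s:-{-t<..<t}|?n. \<bar>s\<bar> * w s) / ?l t) \<longlongrightarrow> - (\<beta> * \<eta>\<^sub>m)) at_top"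
      unfolding w_def \<beta>_def
      by (rule one_sided_tail_limit[OF lfp(2) intw(3) lpos[unfolded \<beta>_def] False[unfolded \<beta>_def] finp(2)[unfolded \<beta>_def] eta(2)[unfolded \<beta>_def] inv[unfolded \<beta>_def] small(2)])
    obtain K where K: "\<And>t. t \<ge> 1 \<Longrightarrow> \<bar>LINT s:-{-t<..<t}|\<mu>\<^sub>2. s * w s\<bar> \<le> K * t powr (\<gamma> - \<beta>)" using pm(2) by blast
    have inv2: "((\<lambda>t. t powr (-(real \<beta> - \<gamma>)) / ?l t) \<longlongrightarrow> 0) at_top"
      using powr_over_sv_tendsto_0[where M = "mass \<mu>\<^sub>0", OF mono rv, of "real \<beta> - \<gamma>"] g(1) by simp
    have Z: "((\<lambda>t. (LINT s:-{-t<..<t}|\<mu>\<^sub>2. s * w s) / ?l t) \<longlongrightarrow> 0) at_top"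
    proof (rule tendsto_0_le[OF inv2, where K = K])
      show "\<forall>\<^sub>F t in at_top. norm ((LINT s:-{-t<..<t}|\<mu>\<^sub>2. s * w s) / ?l t) \<le> norm (t powr (-(real \<beta> - \<gamma>)) / ?l t) * K"
        using lpos eventually_ge_at_top[of 1]
      proof eventually_elim
        case (elim t)
        have "\<bar>LINT s:-{-t<..<t}|\<mu>\<^sub>2. s * w s\<bar> / ?l t \<le> K * t powr (\<gamma> - \<beta>) / ?l t" using K[OF elim(2)] elim by (intro divide_right_mono) auto
        then show ?case using elim by (simp add: abs_divide mult.commute)
      qed
    qed
    have iw1: "integrable \<mu>\<^sub>1 (\<lambda>s. \<bar>s\<bar> * w s)"
      using weighted_tail_bounds(1)[OF lf(2) int(2)[unfolded w_def] order_refl fin[unfolded \<beta>_def]] by (simp add: w_def)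
    have iw: "integrable m (\<lambda>s. s * w s)" if "sets m = sets borel" "integrable m (\<lambda>s. \<bar>s\<bar> * w s)" for m
    proof (rule integrable_bounded_by[OF that(2)])
      show "(\<lambda>s. s * w s) \<in> borel_measurable m" using that(1) by (simp cong: measurable_cong_sets)
      show "norm (s * w s) \<le> \<bar>s\<bar> * w s" for s using w[of s] by (simp add: abs_mult)
    qed
    have i1: "integrable \<mu>\<^sub>1 (\<lambda>s. s * w s)" by (rule iw[OF s1 iw1])
    have i2: "integrable \<mu>\<^sub>2 (\<lambda>s. s * w s)" by (rule iw[OF s2 pm(1)])
    have c2: "c2 = (\<integral>s. s * w s \<partial>\<mu>\<^sub>1) + (\<integral>s. s * w s \<partial>\<mu>\<^sub>2)"
      unfolding d[OF fin] by (rule integral_measure_sum[OF _ i1 i2]) (simp add: s1 s2)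
    have compl: "(\<integral>s. s * w s \<partial>m) = (LINT s:{-t<..<t}|m. s * w s) + (LINT s:-{-t<..<t}|m. s * w s)"
      if i: "integrable m (\<lambda>s. s * w s)" and m: "sets m = sets borel" for m t
    proof -
      have "set_integrable m {-t<..<t} (\<lambda>s. s * w s)" "set_integrable m (-{-t<..<t}) (\<lambda>s. s * w s)"
        unfolding set_integrable_def by (rule integrable_mult_indicator[OF _ i]; simp add: m)+
      from set_integral_Un[OF _ this] show ?thesis by (simp add: set_lebesgue_integral_def)
    qed
    have T1: "(LINT s:-{-t<..<t}|\<mu>\<^sub>1. s * w s) = (LINT s:-{-t<..<t}|?p. \<bar>s\<bar> * w s) - (LINT s:-{-t<..<t}|?n. \<bar>s\<bar> * w s)" for t
    proof (rule set_integral_pos_neg_part[OF s1])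
      show "integrable \<mu>\<^sub>1 (\<lambda>s. indicat_real (-{-t<..<t}) s * (\<bar>s\<bar> * w s))"
        by (rule integrable_bounded_by[OF iw1]) (auto simp: indicator_def w)
    qed measurable
    \<comment> \<open>Subtracting the full moment turns each truncated moment into minus its
      tail.\<close>
    have eq: "(LINT s:{-t<..<t}|\<mu>. s * w s) - c2 = - ((LINT s:-{-t<..<t}|?p. \<bar>s\<bar> * w s) - (LINT s:-{-t<..<t}|?n. \<bar>s\<bar> * w s)) - (LINT s:-{-t<..<t}|\<mu>\<^sub>2. s * w s)" for t
      unfolding V c2 T1[symmetric] compl[OF i1 s1, of t] compl[OF i2 s2, of t] by simp
    have "((\<lambda>t. - ((LINT s:-{-t<..<t}|?p. \<bar>s\<bar> * w s) / ?l t) + (LINT s:-{-t<..<t}|?n. \<bar>s\<bar> * w s) / ?l t - (LINT s:-{-t<..<t}|\<mu>\<^sub>2. s * w s) / ?l t)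
        \<longlongrightarrow> - (- (\<beta> * \<eta>\<^sub>p)) + - (\<beta> * \<eta>\<^sub>m) - 0) at_top" by (intro tendsto_intros P Ng Z)
    then show ?thesis unfolding eq by (simp add: add_divide_distrib diff_divide_distrib right_diff_distrib)
  qed
qed

section \<open>Locally uniform rescaling limits\<close>

text \<open>For signed \<open>h\<close> the truncated moment need not be monotone in u, so
  measurability comes from the product space instead.\<close>

lemma measurable_layer_moment:
  fixes h :: "real \<Rightarrow> real"
  assumes m: "locally_finite m" and [measurable]: "h \<in> borel_measurable borel"
  shows "(\<lambda>u. LINT s:{-u<..<u}|m. h s) \<in> borel_measurable borel"
proof -
  note [measurable_cong] = locally_finiteD(1)[OF m]
  interpret m: sigma_finite_measure m by (rule sigma_finite_locally_finite[OF locally_finiteD(1,2)[OF m]])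
  let ?S = "{p :: real \<times> real. \<bar>snd p\<bar> < fst p}"
  have "{p \<in> space (borel \<Otimes>\<^sub>M borel). \<bar>snd p\<bar> < (fst p :: real)} \<in> sets (borel \<Otimes>\<^sub>M borel)" by measurable
  then have Sm: "?S \<in> sets (borel \<Otimes>\<^sub>M (borel :: real measure))" by (simp add: space_pair_measure)
  have "sets (borel \<Otimes>\<^sub>M m) = sets (borel \<Otimes>\<^sub>M (borel :: real measure))"
    by (intro sets_pair_measure_cong locally_finiteD(1)[OF m]) simp
  then have [measurable]: "?S \<in> sets (borel \<Otimes>\<^sub>M m)" using Sm by simp
  have "(\<lambda>u. \<integral>s. indicator ?S (u, s) * h s \<partial>m) \<in> borel_measurable borel"
    by (rule m.borel_measurable_lebesgue_integral) measurable
  moreover have "(\<lambda>u. \<integral>s. indicator ?S (u, s) * h s \<partial>m) = (\<lambda>u. LINT s:{-u<..<u}|m. h s)"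
    unfolding set_lebesgue_integral_def
    by (intro ext Bochner_Integration.integral_cong) (auto simp: indicator_def abs_less_iff)
  ultimately show ?thesis by simp
qed

section \<open>Layer representation of the transform\<close>

text \<open>The tails of \<open>layer_kernel z\<close> decay like \<open>1 / (1 + s^2)\<close>,
  which exactly compensates the growth that \<open>hw\<close> grants to \<open>h\<close> relative to
  the integrable \<open>w\<close>. Both \<open>s^2 * w s\<close> and \<open>s * w s\<close> are
  covered.\<close>

lemma layer_representation:
  fixes h w :: "real \<Rightarrow> real"
  assumes m: "locally_finite m" and [measurable]: "h \<in> borel_measurable borel" and z: "Im z > 0"
    and w: "integrable m w" and hw: "\<And>s. \<bar>h s\<bar> \<le> (1 + s\<^sup>2) * w s"
  shows "integrable m (\<lambda>s. of_real (h s) / ((of_real s)\<^sup>2 - z\<^sup>2))"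
    and "set_integrable lborel {0<..} (\<lambda>u. layer_kernel z u * of_real (LINT s:{-u<..<u}|m. h s))"
    and "(\<integral>s. of_real (h s) / ((of_real s)\<^sup>2 - z\<^sup>2) \<partial>m) = (LBINT u:{0<..}. layer_kernel z u * of_real (LINT s:{-u<..<u}|m. h s))"
proof -
  note mD = locally_finiteD[OF m]
  note [measurable_cong] = mD(1)
  obtain c where c: "c > 0" "\<And>u. u \<ge> 0 \<Longrightarrow> norm ((complex_of_real u)\<^sup>2 - z\<^sup>2) \<ge> c * (1 + u\<^sup>2)"
    using square_diff_lower_bound[of "Im z" "norm z"] z by auto
  have kt: "set_integrable lborel {\<bar>s\<bar><..} (layer_kernel z)"
    "(LBINT u:{\<bar>s\<bar><..}. norm (layer_kernel z u)) \<le> 1 / c\<^sup>2 * (1 / (1 + \<bar>s\<bar>\<^sup>2))"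
    "(LBINT u:{\<bar>s\<bar><..}. layer_kernel z u) = 1 / ((of_real \<bar>s\<bar>)\<^sup>2 - z\<^sup>2)" for s :: real
    by (rule layer_kernel_tail[OF z abs_ge_zero c(1)]; rule c(2); assumption)+
  have w0: "w s \<ge> 0" for s
  proof -
    have "0 \<le> (1 + s\<^sup>2) * w s" using hw[of s] by linarith
    moreover have "0 < 1 + s\<^sup>2" using zero_le_power2[of s] by linarith
    ultimately show ?thesis by (simp add: zero_le_mult_iff)
  qed
  have hB: "integrable m (\<lambda>s. \<bar>h s\<bar> * (1 / c\<^sup>2 * (1 / (1 + \<bar>s\<bar>\<^sup>2))))"
  proof (rule integrable_bounded_by)
    show "integrable m (\<lambda>s. 1 / c\<^sup>2 * w s)" by (rule integrable_mult_right[OF w])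
    show "norm (\<bar>h s\<bar> * (1 / c\<^sup>2 * (1 / (1 + \<bar>s\<bar>\<^sup>2)))) \<le> 1 / c\<^sup>2 * w s" for s
    proof -
      have p: "0 < 1 + s\<^sup>2" using zero_le_power2[of s] by linarith
      have "\<bar>h s\<bar> * (1 / (1 + s\<^sup>2)) \<le> (1 + s\<^sup>2) * w s * (1 / (1 + s\<^sup>2))" using hw[of s] p by (intro mult_right_mono) auto
      also have "\<dots> = w s" using p by simp
      finally have "1 / c\<^sup>2 * (\<bar>h s\<bar> * (1 / (1 + s\<^sup>2))) \<le> 1 / c\<^sup>2 * w s" by (intro mult_left_mono) auto
      then show ?thesis using p by (simp add: abs_mult mult_ac)
    qed
  qed measurable
  note L = layer_integral[OF mD(1,2) measurable_layer_kernel _ kt(1) kt(2) hB]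
  have eq: "of_real (h s) * (LBINT u:{\<bar>s\<bar><..}. layer_kernel z u) = of_real (h s) / ((of_real s)\<^sup>2 - z\<^sup>2)" for s
    unfolding kt(3) by (simp add: abs_mult_self_eq power2_eq_square flip: of_real_mult)
  \<comment> \<open>For u \<le> 0 the interval (-u, u) is empty and the moment is 0, so the integral
    over the line is already one over u > 0.\<close>
  have eq2: "layer_kernel z u * of_real (LINT s:{-u<..<u}|m. h s) = indicator {0<..} u *\<^sub>R (layer_kernel z u * of_real (LINT s:{-u<..<u}|m. h s))" for u
    by (cases "u > 0") (auto simp: set_lebesgue_integral_def)
  show "integrable m (\<lambda>s. of_real (h s) / ((of_real s)\<^sup>2 - z\<^sup>2))" using L(1) unfolding eq by simp
  show "set_integrable lborel {0<..} (\<lambda>u. layer_kernel z u * of_real (LINT s:{-u<..<u}|m. h s))"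
    unfolding set_integrable_def eq2[symmetric] by (rule L(2)) simp
  show "(\<integral>s. of_real (h s) / ((of_real s)\<^sup>2 - z\<^sup>2) \<partial>m) = (LBINT u:{0<..}. layer_kernel z u * of_real (LINT s:{-u<..<u}|m. h s))"
    unfolding set_lebesgue_integral_def[of lborel] eq2[symmetric] using L(3) unfolding eq by simp
qed

text \<open>The constant \<open>c2\<close> is free: the layer kernel has total integral
  \<open>- 1 / z^2\<close>, so subtracting \<open>c2\<close> inside costs the explicit term with
  \<open>z^2\<close> in the denominator. This term and the one with the total weight are those
  against which the two leading coefficients of \<open>p\<close> cancel.\<close>

lemma C_transform_layers:
  fixes \<kappa> :: nat and p :: "real poly"
  defines "w \<equiv> \<lambda>s. 1 / (1 + s\<^sup>2) ^ (\<kappa> + 1)" and "N \<equiv> \<kappa> + 1"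
  assumes m: "locally_finite m" and int: "integrable m (\<lambda>s. 1 / (1 + s\<^sup>2) ^ (\<kappa> + 1))" and z: "Im z > 0"
  shows "C_transform \<kappa> m p z =
     poly (map_poly complex_of_real p) z - of_real (\<integral>s. w s \<partial>m) * (1 + z\<^sup>2) ^ N / z - of_real c2 * (1 + z\<^sup>2) ^ N / z\<^sup>2
     + (1 + z\<^sup>2) ^ N / z * (LBINT u:{0<..}. layer_kernel z u * of_real (LINT s:{-u<..<u}|m. s\<^sup>2 * w s))
     + (1 + z\<^sup>2) ^ N * (LBINT u:{0<..}. layer_kernel z u * of_real ((LINT s:{-u<..<u}|m. s * w s) - c2))"
proof -
  note mD = locally_finiteD[OF m]
  note [measurable_cong] = mD(1)
  have [measurable]: "w \<in> borel_measurable borel" unfolding w_def by measurable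
  have w0: "0 \<le> w s" for s using weight_bounds(1)[of s "\<kappa> + 1"] by (simp add: w_def)
  have intw: "integrable m w" using int by (simp add: w_def)
  have z0: "z \<noteq> 0" using z by auto
  let ?E = "\<lambda>s. complex_of_real (s\<^sup>2 * w s) / ((of_real s)\<^sup>2 - z\<^sup>2)" and ?O = "\<lambda>s. complex_of_real (s * w s) / ((of_real s)\<^sup>2 - z\<^sup>2)"
  have hE: "\<bar>s\<^sup>2 * w s\<bar> \<le> (1 + s\<^sup>2) * w s" for s using w0[of s] by (simp add: abs_mult mult_right_mono)
  have hO: "\<bar>s * w s\<bar> \<le> (1 + s\<^sup>2) * w s" for s
  proof -
    have "0 \<le> (\<bar>s\<bar> - 1)\<^sup>2" by simp
    then have "2 * \<bar>s\<bar> \<le> 1 + s\<^sup>2" by (simp add: power2_diff)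
    then have "\<bar>s\<bar> \<le> 1 + s\<^sup>2" by linarith
    then show ?thesis using w0[of s] by (simp add: abs_mult mult_right_mono)
  qed
  note LE = layer_representation[where h = "\<lambda>s. s\<^sup>2 * w s", OF m _ z intw hE]
  note LO = layer_representation[where h = "\<lambda>s. s * w s", OF m _ z intw hO]
  have iE: "integrable m ?E" by (rule LE(1)) measurable
  have iO: "integrable m ?O" by (rule LO(1)) measurable
  have pt: "1 / (complex_of_real s - z) * complex_of_real (w s) = - (1 / z) * of_real (w s) + (1 / z) * ?E s + ?O s" for s
  proof -
    have n1: "complex_of_real s - z \<noteq> 0" "complex_of_real s + z \<noteq> 0" using z by (auto simp: complex_eq_iff)
    have n2: "(complex_of_real s)\<^sup>2 - z\<^sup>2 = (of_real s - z) * (of_real s + z)" by (simp add: power2_eq_square algebra_simps)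
    have "1 / (complex_of_real s - z) = - (1 / z) + (1 / z) * ((of_real s)\<^sup>2 / ((of_real s)\<^sup>2 - z\<^sup>2)) + of_real s / ((of_real s)\<^sup>2 - z\<^sup>2)"
      unfolding n2 using n1 z0 by (simp add: divide_simps) (simp add: power2_eq_square algebra_simps)
    then have "1 / (complex_of_real s - z) * complex_of_real (w s) = (- (1 / z) + (1 / z) * ((of_real s)\<^sup>2 / ((of_real s)\<^sup>2 - z\<^sup>2)) + of_real s / ((of_real s)\<^sup>2 - z\<^sup>2)) * complex_of_real (w s)"
      by (rule arg_cong)
    moreover have "?E s = (of_real s)\<^sup>2 / ((of_real s)\<^sup>2 - z\<^sup>2) * complex_of_real (w s)" "?O s = of_real s / ((of_real s)\<^sup>2 - z\<^sup>2) * complex_of_real (w s)"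
      by simp_all
    ultimately show ?thesis by (simp only: distrib_right mult.assoc)
  qed
  have I: "(\<integral>s. 1 / (complex_of_real s - z) * complex_of_real (w s) \<partial>m) = - (1 / z) * of_real (\<integral>s. w s \<partial>m) + (1 / z) * (\<integral>s. ?E s \<partial>m) + (\<integral>s. ?O s \<partial>m)"
  proof -
    have i0: "integrable m (\<lambda>s. - (1 / z) * complex_of_real (w s))" using intw by (intro integrable_mult_right) auto
    have i1: "integrable m (\<lambda>s. (1 / z) * ?E s)" by (rule integrable_mult_right[OF iE])
    show ?thesis unfolding pt Bochner_Integration.integral_add[OF Bochner_Integration.integrable_add[OF i0 i1] iO]
        Bochner_Integration.integral_add[OF i0 i1] Bochner_Integration.integral_mult_right_zero integral_complex_of_real ..
  qed
  obtain c where c: "c > 0" "\<And>u. u \<ge> 0 \<Longrightarrow> norm ((complex_of_real u)\<^sup>2 - z\<^sup>2) \<ge> c * (1 + u\<^sup>2)"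
    using square_diff_lower_bound[of "Im z" "norm z"] z by auto
  have k0: "(LBINT u:{0<..}. layer_kernel z u) = - 1 / z\<^sup>2" "set_integrable lborel {0<..} (layer_kernel z)"
    using layer_kernel_tail[OF z order_refl c] by (simp_all add: divide_minus_right)
  have "(LBINT u:{0<..}. layer_kernel z u * of_real ((LINT s:{-u<..<u}|m. s * w s) - c2))
     = (LBINT u:{0<..}. layer_kernel z u * of_real (LINT s:{-u<..<u}|m. s * w s)) - (LBINT u:{0<..}. of_real c2 * layer_kernel z u)"
  proof (subst set_integral_diff(2)[symmetric])
    show "set_integrable lborel {0<..} (\<lambda>u. layer_kernel z u * of_real (LINT s:{-u<..<u}|m. s * w s))" by (rule LO(2)) measurable
    show "set_integrable lborel {0<..} (\<lambda>u. of_real c2 * layer_kernel z u)" using k0(2) by simp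
  qed (simp add: algebra_simps)
  also have "(LBINT u:{0<..}. of_real c2 * layer_kernel z u) = of_real c2 * (- 1 / z\<^sup>2)" using k0(1) by simp
  finally have "(LBINT u:{0<..}. layer_kernel z u * of_real (LINT s:{-u<..<u}|m. s * w s))
     = (LBINT u:{0<..}. layer_kernel z u * of_real ((LINT s:{-u<..<u}|m. s * w s) - c2)) - of_real c2 / z\<^sup>2" by simp
  then have O: "(\<integral>s. ?O s \<partial>m) = (LBINT u:{0<..}. layer_kernel z u * of_real ((LINT s:{-u<..<u}|m. s * w s) - c2)) - of_real c2 / z\<^sup>2"
    by (subst LO(3)) measurable
  have E: "(\<integral>s. ?E s \<partial>m) = (LBINT u:{0<..}. layer_kernel z u * of_real (LINT s:{-u<..<u}|m. s\<^sup>2 * w s))"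
    by (rule LE(3)) measurable
  have "C_transform \<kappa> m p z = poly (map_poly complex_of_real p) z + (1 + z\<^sup>2) ^ N * (\<integral>s. 1 / (complex_of_real s - z) * complex_of_real (w s) \<partial>m)"
    by (simp add: C_transform_def w_def N_def)
  also have "\<dots> = poly (map_poly complex_of_real p) z - of_real (\<integral>s. w s \<partial>m) * (1 + z\<^sup>2) ^ N / z - of_real c2 * (1 + z\<^sup>2) ^ N / z\<^sup>2
     + (1 + z\<^sup>2) ^ N / z * (LBINT u:{0<..}. layer_kernel z u * of_real (LINT s:{-u<..<u}|m. s\<^sup>2 * w s))
     + (1 + z\<^sup>2) ^ N * (LBINT u:{0<..}. layer_kernel z u * of_real ((LINT s:{-u<..<u}|m. s * w s) - c2))"
    unfolding I E O by (simp add: distrib_left right_diff_distrib mult_ac)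
  finally show ?thesis .
qed

lemma one_plus_square_power_remainder:
  "\<exists>C\<ge>0. \<forall>\<zeta>::complex. norm \<zeta> \<ge> 1 \<longrightarrow> norm ((1 + \<zeta>\<^sup>2) ^ (n + 1) - (\<zeta>\<^sup>2) ^ (n + 1)) \<le> C * norm \<zeta> ^ (2 * n)"
proof (induction n)
  case 0
  show ?case by (intro exI[of _ 1]) auto
next
  case (Suc n)
  then obtain C where C: "C \<ge> 0" "\<And>\<zeta>::complex. norm \<zeta> \<ge> 1 \<Longrightarrow> norm ((1 + \<zeta>\<^sup>2) ^ (n + 1) - (\<zeta>\<^sup>2) ^ (n + 1)) \<le> C * norm \<zeta> ^ (2 * n)" by blast
  have "norm ((1 + \<zeta>\<^sup>2) ^ (Suc n + 1) - (\<zeta>\<^sup>2) ^ (Suc n + 1)) \<le> (2 * C + 1) * norm \<zeta> ^ (2 * Suc n)" if z: "norm \<zeta> \<ge> 1" for \<zeta> :: complex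
  proof -
    have "(1 + \<zeta>\<^sup>2) ^ (Suc n + 1) - (\<zeta>\<^sup>2) ^ (Suc n + 1) = (1 + \<zeta>\<^sup>2) * ((1 + \<zeta>\<^sup>2) ^ (n + 1) - (\<zeta>\<^sup>2) ^ (n + 1)) + (\<zeta>\<^sup>2) ^ (n + 1)"
      by (simp add: algebra_simps)
    also have "norm \<dots> \<le> norm (1 + \<zeta>\<^sup>2) * norm ((1 + \<zeta>\<^sup>2) ^ (n + 1) - (\<zeta>\<^sup>2) ^ (n + 1)) + norm ((\<zeta>\<^sup>2) ^ (n + 1))"
      by (rule order_trans[OF norm_triangle_ineq]) (simp add: norm_mult del: power_Suc)
    also have "\<dots> \<le> (2 * (norm \<zeta>)\<^sup>2) * (C * norm \<zeta> ^ (2 * n)) + norm \<zeta> ^ (2 * (n + 1))"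
    proof (intro add_mono mult_mono C(2) z)
      have "norm (1 + \<zeta>\<^sup>2) \<le> 1 + (norm \<zeta>)\<^sup>2" using norm_triangle_ineq[of 1 "\<zeta>\<^sup>2"] by (simp add: norm_power)
      moreover have "1 \<le> (norm \<zeta>)\<^sup>2" using z by (rule one_le_power)
      ultimately show "norm (1 + \<zeta>\<^sup>2) \<le> 2 * (norm \<zeta>)\<^sup>2" by linarith
      show "norm ((\<zeta>\<^sup>2) ^ (n + 1)) \<le> norm \<zeta> ^ (2 * (n + 1))" unfolding norm_power power_mult ..
    qed auto
    also have "\<dots> = (2 * C + 1) * norm \<zeta> ^ (2 * Suc n)" by (simp add: algebra_simps power2_eq_square)
    finally show ?thesis .
  qed
  then show ?case using C(1) by (intro exI[of _ "2 * C + 1"]) auto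
qed

text \<open>The two subtracted terms have top powers 2\<kappa> + 1 and 2\<kappa> and remove the two
  highest coefficients, leaving order 2\<kappa> - 1. Multiplying by \<open>norm \<zeta>\<close>
  avoids the negative exponent at \<kappa> = 0.\<close>

lemma polynomial_remainder_bound:
  fixes p :: "real poly" and \<kappa> :: nat
  assumes p: "degree p \<le> 2 * \<kappa> + 1"
  shows "\<exists>C\<ge>0. \<forall>\<zeta>. norm \<zeta> \<ge> 1 \<longrightarrow>
    norm (poly (map_poly complex_of_real p) \<zeta> - of_real (coeff p (2 * \<kappa> + 1)) * (1 + \<zeta>\<^sup>2) ^ (\<kappa> + 1) / \<zeta>
      - of_real (coeff p (2 * \<kappa>)) * (1 + \<zeta>\<^sup>2) ^ (\<kappa> + 1) / \<zeta>\<^sup>2) * norm \<zeta> \<le> C * norm \<zeta> ^ (2 * \<kappa>)"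
proof -
  let ?a = "coeff p"
  obtain C where C: "C \<ge> 0" "\<And>\<zeta>::complex. norm \<zeta> \<ge> 1 \<Longrightarrow> norm ((1 + \<zeta>\<^sup>2) ^ (\<kappa> + 1) - (\<zeta>\<^sup>2) ^ (\<kappa> + 1)) \<le> C * norm \<zeta> ^ (2 * \<kappa>)"
    using one_plus_square_power_remainder[of \<kappa>] by blast
  define D where "D = (\<Sum>j<2 * \<kappa>. \<bar>?a j\<bar>) + \<bar>?a (2 * \<kappa> + 1)\<bar> * C + \<bar>?a (2 * \<kappa>)\<bar> * C"
  have "norm (poly (map_poly complex_of_real p) \<zeta> - of_real (?a (2 * \<kappa> + 1)) * (1 + \<zeta>\<^sup>2) ^ (\<kappa> + 1) / \<zeta>
      - of_real (?a (2 * \<kappa>)) * (1 + \<zeta>\<^sup>2) ^ (\<kappa> + 1) / \<zeta>\<^sup>2) * norm \<zeta> \<le> D * norm \<zeta> ^ (2 * \<kappa>)" if z: "norm \<zeta> \<ge> 1" for \<zeta> :: complex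
  proof -
    have z0: "\<zeta> \<noteq> 0" "norm \<zeta> > 0" using z by auto
    define E where "E = (1 + \<zeta>\<^sup>2) ^ (\<kappa> + 1) - (\<zeta>\<^sup>2) ^ (\<kappa> + 1)"
    have E: "norm E \<le> C * norm \<zeta> ^ (2 * \<kappa>)" using C(2)[OF z] by (simp add: E_def)
    have P: "poly (map_poly complex_of_real p) \<zeta> = (\<Sum>j<2 * \<kappa>. of_real (?a j) * \<zeta> ^ j) + of_real (?a (2 * \<kappa>)) * \<zeta> ^ (2 * \<kappa>) + of_real (?a (2 * \<kappa> + 1)) * \<zeta> ^ (2 * \<kappa> + 1)"
    proof -
      have "poly (map_poly complex_of_real p) \<zeta> = (\<Sum>j\<le>2 * \<kappa> + 1. coeff (map_poly complex_of_real p) j * \<zeta> ^ j)"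
        unfolding poly_altdef using p
        by (intro sum.mono_neutral_left) (auto simp: degree_map_poly coeff_map_poly coeff_eq_0 not_le)
      also have "\<dots> = (\<Sum>j<2 * \<kappa> + 2. of_real (?a j) * \<zeta> ^ j)" by (simp add: coeff_map_poly lessThan_Suc_atMost)
      finally show ?thesis by simp
    qed
    have S: "(1 + \<zeta>\<^sup>2) ^ (\<kappa> + 1) = \<zeta> ^ (2 * \<kappa> + 1) * \<zeta> + E" "(1 + \<zeta>\<^sup>2) ^ (\<kappa> + 1) = \<zeta> ^ (2 * \<kappa>) * \<zeta>\<^sup>2 + E"
      by (simp_all add: E_def power_mult power2_eq_square power_mult_distrib)
    have "poly (map_poly complex_of_real p) \<zeta> - of_real (?a (2 * \<kappa> + 1)) * (1 + \<zeta>\<^sup>2) ^ (\<kappa> + 1) / \<zeta> - of_real (?a (2 * \<kappa>)) * (1 + \<zeta>\<^sup>2) ^ (\<kappa> + 1) / \<zeta>\<^sup>2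
      = (\<Sum>j<2 * \<kappa>. of_real (?a j) * \<zeta> ^ j) - of_real (?a (2 * \<kappa> + 1)) * E / \<zeta> - of_real (?a (2 * \<kappa>)) * E / \<zeta>\<^sup>2"
    proof -
      have "of_real (?a (2 * \<kappa> + 1)) * (1 + \<zeta>\<^sup>2) ^ (\<kappa> + 1) / \<zeta> = of_real (?a (2 * \<kappa> + 1)) * \<zeta> ^ (2 * \<kappa> + 1) + of_real (?a (2 * \<kappa> + 1)) * E / \<zeta>"
        unfolding S(1) using z0 by (simp add: distrib_left add_divide_distrib)
      moreover have "of_real (?a (2 * \<kappa>)) * (1 + \<zeta>\<^sup>2) ^ (\<kappa> + 1) / \<zeta>\<^sup>2 = of_real (?a (2 * \<kappa>)) * \<zeta> ^ (2 * \<kappa>) + of_real (?a (2 * \<kappa>)) * E / \<zeta>\<^sup>2"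
        unfolding S(2) using z0 by (simp add: distrib_left add_divide_distrib)
      ultimately show ?thesis unfolding P by simp
    qed
    also have "norm \<dots> \<le> norm (\<Sum>j<2 * \<kappa>. of_real (?a j) * \<zeta> ^ j) + norm (of_real (?a (2 * \<kappa> + 1)) * E / \<zeta>) + norm (of_real (?a (2 * \<kappa>)) * E / \<zeta>\<^sup>2)"
      by (rule order_trans[OF norm_triangle_ineq4 add_right_mono[OF norm_triangle_ineq4]])
    finally have "norm (poly (map_poly complex_of_real p) \<zeta> - of_real (?a (2 * \<kappa> + 1)) * (1 + \<zeta>\<^sup>2) ^ (\<kappa> + 1) / \<zeta> - of_real (?a (2 * \<kappa>)) * (1 + \<zeta>\<^sup>2) ^ (\<kappa> + 1) / \<zeta>\<^sup>2) * norm \<zeta>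
      \<le> (norm (\<Sum>j<2 * \<kappa>. of_real (?a j) * \<zeta> ^ j) + norm (of_real (?a (2 * \<kappa> + 1)) * E / \<zeta>) + norm (of_real (?a (2 * \<kappa>)) * E / \<zeta>\<^sup>2)) * norm \<zeta>"
      by (intro mult_right_mono) auto
    also have "\<dots> = norm (\<Sum>j<2 * \<kappa>. of_real (?a j) * \<zeta> ^ j) * norm \<zeta> + norm (of_real (?a (2 * \<kappa> + 1)) * E / \<zeta>) * norm \<zeta> + norm (of_real (?a (2 * \<kappa>)) * E / \<zeta>\<^sup>2) * norm \<zeta>"
      by (simp add: distrib_right)
    also have "\<dots> \<le> (\<Sum>j<2 * \<kappa>. \<bar>?a j\<bar>) * norm \<zeta> ^ (2 * \<kappa>) + \<bar>?a (2 * \<kappa> + 1)\<bar> * (C * norm \<zeta> ^ (2 * \<kappa>)) + \<bar>?a (2 * \<kappa>)\<bar> * (C * norm \<zeta> ^ (2 * \<kappa>))"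
    proof (intro add_mono)
      have "norm (\<Sum>j<2 * \<kappa>. of_real (?a j) * \<zeta> ^ j) * norm \<zeta> \<le> (\<Sum>j<2 * \<kappa>. norm (of_real (?a j) * \<zeta> ^ j)) * norm \<zeta>"
        by (intro mult_right_mono norm_sum) auto
      also have "\<dots> = (\<Sum>j<2 * \<kappa>. \<bar>?a j\<bar> * norm \<zeta> ^ (j + 1))"
        unfolding sum_distrib_right by (intro sum.cong refl) (simp add: norm_mult norm_power)
      also have "\<dots> \<le> (\<Sum>j<2 * \<kappa>. \<bar>?a j\<bar> * norm \<zeta> ^ (2 * \<kappa>))" using z by (intro sum_mono mult_left_mono power_increasing) auto
      finally show "norm (\<Sum>j<2 * \<kappa>. of_real (?a j) * \<zeta> ^ j) * norm \<zeta> \<le> (\<Sum>j<2 * \<kappa>. \<bar>?a j\<bar>) * norm \<zeta> ^ (2 * \<kappa>)" by (simp add: sum_distrib_right)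
      have "norm (of_real (?a (2 * \<kappa> + 1)) * E / \<zeta>) * norm \<zeta> = \<bar>?a (2 * \<kappa> + 1)\<bar> * norm E" using z0 by (simp add: norm_mult norm_divide)
      also have "\<dots> \<le> \<bar>?a (2 * \<kappa> + 1)\<bar> * (C * norm \<zeta> ^ (2 * \<kappa>))" using E by (intro mult_left_mono) auto
      finally show "norm (of_real (?a (2 * \<kappa> + 1)) * E / \<zeta>) * norm \<zeta> \<le> \<bar>?a (2 * \<kappa> + 1)\<bar> * (C * norm \<zeta> ^ (2 * \<kappa>))" .
      have "norm (of_real (?a (2 * \<kappa>)) * E / \<zeta>\<^sup>2) * norm \<zeta> = \<bar>?a (2 * \<kappa>)\<bar> * norm E / norm \<zeta>" using z0 by (simp add: norm_mult norm_divide norm_power power2_eq_square)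
      also have "\<dots> \<le> \<bar>?a (2 * \<kappa>)\<bar> * norm E / 1" using z by (intro divide_left_mono) auto
      also have "\<dots> \<le> \<bar>?a (2 * \<kappa>)\<bar> * (C * norm \<zeta> ^ (2 * \<kappa>))" using E by (simp add: mult_left_mono)
      finally show "norm (of_real (?a (2 * \<kappa>)) * E / \<zeta>\<^sup>2) * norm \<zeta> \<le> \<bar>?a (2 * \<kappa>)\<bar> * (C * norm \<zeta> ^ (2 * \<kappa>))" .
    qed
    also have "\<dots> = D * norm \<zeta> ^ (2 * \<kappa>)" by (simp add: D_def algebra_simps)
    finally show ?thesis .
  qed
  moreover have "D \<ge> 0" using C(1) by (auto simp: D_def intro!: add_nonneg_nonneg sum_nonneg)
  ultimately show ?thesis by blast
qed

text \<open>If uniformity fails on a compact ball, there are scales tending to infinity and points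
  of the ball where the error stays large; a convergent subsequence of these points contradicts
  \<open>lim\<close>. The radius \<open>Im z / 2\<close> provides the common \<delta> and
  \<open>R\<close>.\<close>

lemma locally_uniform_limit_sequentially:
  fixes F :: "real \<Rightarrow> complex \<Rightarrow> complex"
  assumes cont: "continuous_on upper_half_plane l"
    and lim: "\<And>X Z z \<delta> R. \<lbrakk>filterlim X at_top sequentially; \<And>n. X n > 0; \<delta> > 0; R \<ge> 0; \<And>n. Im (Z n) \<ge> \<delta>; \<And>n. norm (Z n) \<le> R;
        Z \<longlonglongrightarrow> z; Im z > 0\<rbrakk> \<Longrightarrow> (\<lambda>n. F (X n) (Z n)) \<longlonglongrightarrow> l z"
  shows "locally_uniform_limit upper_half_plane F l at_top"
  unfolding locally_uniform_limit_def
proof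
  fix z assume "z \<in> upper_half_plane"
  then have z: "Im z > 0" by (simp add: upper_half_plane_def)
  define d where "d = Im z / 2"
  have d: "d > 0" using z by (simp add: d_def)
  have im: "Im x \<ge> d" and nm: "norm x \<le> norm z + d" if "x \<in> cball z d" for x
  proof -
    have "norm (z - x) \<le> d" using that by (simp add: dist_norm)
    then show "Im x \<ge> d" "norm x \<le> norm z + d"
      using abs_Im_le_cmod[of "z - x"] norm_triangle_ineq2[of x z] by (auto simp: d_def norm_minus_commute field_simps)
  qed
  have sub: "cball z d \<subseteq> upper_half_plane" using im d by (force simp: upper_half_plane_def)
  have "uniform_limit (cball z d) F l at_top"
  proof (rule ccontr)
    assume "\<not> uniform_limit (cball z d) F l at_top"
    then obtain e where e: "e > 0" "\<not> (\<forall>\<^sub>F r in at_top. \<forall>x\<in>cball z d. dist (F r x) (l x) < e)"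
      by (auto simp: uniform_limit_iff)
    have "\<exists>r x. r \<ge> real n + 1 \<and> x \<in> cball z d \<and> dist (F r x) (l x) \<ge> e" for n :: nat
      using e(2) unfolding eventually_at_top_linorder by (metis linorder_not_less)
    then obtain X Z where XZ: "\<And>n. X n \<ge> real n + 1" "\<And>n. Z n \<in> cball z d" "\<And>n. dist (F (X n) (Z n)) (l (Z n)) \<ge> e" by metis
    obtain y \<phi> where y: "y \<in> cball z d" "strict_mono (\<phi> :: nat \<Rightarrow> nat)" "(Z \<circ> \<phi>) \<longlonglongrightarrow> y"
      using compact_cball[of z d] XZ(2) unfolding compact_def by metis
    have X: "filterlim (\<lambda>n. X (\<phi> n)) at_top sequentially"
    proof (rule filterlim_at_top_mono[OF filterlim_real_sequentially])
      show "\<forall>\<^sub>F n in sequentially. real n \<le> X (\<phi> n)"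
        using XZ(1) seq_suble[OF y(2)] by (intro always_eventually allI) (metis add_increasing2 le_trans of_nat_le_iff order_trans zero_le_one add.commute le_add_same_cancel1 linear)
    qed
    have Xp: "X n > 0" for n using XZ(1)[of n] by linarith
    have "(\<lambda>n. F (X (\<phi> n)) (Z (\<phi> n))) \<longlonglongrightarrow> l y"
      by (rule lim[OF X _ d, where R = "norm z + d"]) (use Xp XZ(2) im nm y d less_le_trans[OF d im[OF y(1)]] in \<open>auto simp: comp_def\<close>)
    moreover have "(\<lambda>n. l (Z (\<phi> n))) \<longlonglongrightarrow> l y"
      using continuous_on_tendsto_compose[OF cont, of "Z \<circ> \<phi>" y] y sub XZ(2) by (auto simp: comp_def subset_iff)
    ultimately have "(\<lambda>n. dist (F (X (\<phi> n)) (Z (\<phi> n))) (l (Z (\<phi> n)))) \<longlonglongrightarrow> dist (l y) (l y)" by (rule tendsto_dist)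
    then have "\<forall>\<^sub>F n in sequentially. dist (F (X (\<phi> n)) (Z (\<phi> n))) (l (Z (\<phi> n))) < e" using e(1) by (intro order_tendstoD) auto
    from eventually_happens'[OF sequentially_bot this] show False using XZ(3) by (metis not_less)
  qed
  then show "\<exists>d>0. cball z d \<subseteq> upper_half_plane \<and> uniform_limit (cball z d) F l at_top" using d sub by blast
qed

lemma odd_part_power:
  fixes z :: complex
  shows "(z / \<i>) ^ (2 * \<kappa>) = (-1) ^ \<kappa> * z ^ (2 * \<kappa>)"
proof -
  have "(z / \<i>) ^ (2 * \<kappa>) = ((z / \<i>)\<^sup>2) ^ \<kappa>" by (simp add: power_mult)
  also have "(z / \<i>)\<^sup>2 = - (z\<^sup>2)" unfolding power_divide power2_i by simp
  finally show ?thesis unfolding power_minus[of "z\<^sup>2" \<kappa>] power_mult[of z 2 \<kappa>] .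
qed

text \<open>\<open>layer_kernel\<close> is homogeneous of degree -3 in z and u jointly, and the
  substitution u = r v contributes one factor r.\<close>

lemma layer_rescale:
  fixes G :: "real \<Rightarrow> real"
  assumes r: "r > 0"
  shows "(LBINT u:{0<..}. layer_kernel (of_real r * z) u * of_real (G u)) = (LBINT v:{0<..}. layer_kernel z v * of_real (G (r * v))) / (of_real r)\<^sup>2"
proof -
  have k: "layer_kernel (of_real r * z) (r * v) = layer_kernel z v / (of_real r) ^ 3" for v
  proof -
    have "(complex_of_real (r * v))\<^sup>2 - (of_real r * z)\<^sup>2 = (of_real r)\<^sup>2 * ((of_real v)\<^sup>2 - z\<^sup>2)"
      by (simp add: power_mult_distrib algebra_simps)
    then show ?thesis using r unfolding layer_kernel_def by (simp add: power_mult_distrib power2_eq_square power3_eq_cube)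
  qed
  have "(LBINT u:{0<..}. layer_kernel (of_real r * z) u * of_real (G u))
    = \<bar>r\<bar> *\<^sub>R (\<integral>v. indicator {0<..} (0 + r * v) *\<^sub>R (layer_kernel (of_real r * z) (0 + r * v) * of_real (G (0 + r * v))) \<partial>lborel)"
    unfolding set_lebesgue_integral_def using r by (intro lborel_integral_real_affine) auto
  also have "(\<lambda>v. indicator {0<..} (0 + r * v) *\<^sub>R (layer_kernel (of_real r * z) (0 + r * v) * of_real (G (0 + r * v))))
     = (\<lambda>v. 1 / (of_real r) ^ 3 * (indicator {0<..} v *\<^sub>R (layer_kernel z v * of_real (G (r * v)))))"
    using r by (auto simp: k indicator_def zero_less_mult_iff)
  finally have "(LBINT u:{0<..}. layer_kernel (of_real r * z) u * of_real (G u))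
    = of_real r * (1 / (of_real r) ^ 3 * (LBINT v:{0<..}. layer_kernel z v * of_real (G (r * v))))"
    unfolding Bochner_Integration.integral_mult_right_zero set_lebesgue_integral_def using r by (simp add: scaleR_conv_of_real)
  then show ?thesis using r by (simp add: power2_eq_square power3_eq_cube)
qed

text \<open>In units of \<open>\<beta> r ^ (2 \<kappa>)\<close> times the slowly varying quotient,
  the even layers tend to \<open>i pi / (2 z^2)\<close>, the odd ones to
  \<open>- \<eta> / z^2\<close>, and the prefactor contributes \<open>z ^ (2 \<kappa> + 2)\<close>.
  The sum is \<open>z ^ (2 \<kappa>) (i pi / 2 - \<eta>)\<close>; the sign in \<omega> compensates
  that of \<open>(z / i) ^ (2 \<kappa>)\<close>.\<close>

lemma abelian_rescaling:
  fixes \<kappa> :: nat and p :: "real poly" and c2 \<eta> :: real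
  defines "w \<equiv> \<lambda>s. 1 / (1 + s\<^sup>2) ^ (\<kappa> + 1)" and "\<beta> \<equiv> 2 * \<kappa> + 1"
  assumes m: "locally_finite m" and int: "integrable m (\<lambda>s. 1 / (1 + s\<^sup>2) ^ (\<kappa> + 1))"
    and rv: "regularly_varying (mass m) (real \<beta>)" and p: "degree p \<le> 2 * \<kappa> + 1"
    and lead: "coeff p (2 * \<kappa> + 1) = (\<integral>s. w s \<partial>m)"
    and \<Phi>: "((\<lambda>t. ((LINT s:{-t<..<t}|m. s * w s) - coeff p (2 * \<kappa>)) / sv (mass m) \<beta> t) \<longlongrightarrow> \<beta> * \<eta>) at_top"
    and X: "filterlim X at_top sequentially" "\<And>n. X n > 0" and \<delta>: "\<delta> > 0" and R: "R \<ge> 0"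
    and Z: "\<And>n. Im (Z n) \<ge> \<delta>" "\<And>n. norm (Z n) \<le> R" "Z \<longlonglongrightarrow> z" and z: "Im z > 0"
  shows "(\<lambda>n. C_transform \<kappa> m p (of_real (X n) * Z n) / of_real (\<beta> * (mass m (X n) / X n)))
    \<longlonglongrightarrow> \<i> * ((-1) ^ \<kappa> * (of_real (pi / 2) + \<i> * of_real \<eta>)) * (z / \<i>) ^ (\<beta> - 1)"
proof -
  note mD = locally_finiteD[OF m]
  note [measurable_cong] = mD(1)
  let ?l = "sv (mass m) \<beta>" and ?N = "\<kappa> + 1"
  have [measurable]: "w \<in> borel_measurable borel" unfolding w_def by measurable
  have w0: "0 \<le> w s" for s using weight_bounds(1)[of s "\<kappa> + 1"] by (simp add: w_def)
  have intw: "integrable m w" using int by (simp add: w_def)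
  define c2 where "c2 = coeff p (2 * \<kappa>)"
  define U where "U t = (LINT s:{-t<..<t}|m. s\<^sup>2 * w s)" for t
  \<comment> \<open>The second moment grows like t times a slowly varying function; the factor t
    moves into the kernel, which becomes \<open>of_real v * layer_kernel z v\<close>.\<close>
  define \<Psi> where "\<Psi> t = U t / t" for t
  define F where "F t = (LINT s:{-t<..<t}|m. s * w s) - c2" for t
  have Um [measurable]: "U \<in> borel_measurable borel" unfolding U_def[abs_def] by (rule measurable_layer_moment[OF m]) measurable
  have \<Psi>m [measurable]: "\<Psi> \<in> borel_measurable borel" unfolding \<Psi>_def[abs_def] by measurable
  have "(\<lambda>t. LINT s:{-t<..<t}|m. s * w s) \<in> borel_measurable borel" by (rule measurable_layer_moment[OF m]) measurable
  then have Fm [measurable]: "F \<in> borel_measurable borel" unfolding F_def[abs_def] by measurable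
  have mono: "mass m x \<le> mass m y" if "0 < x" "x \<le> y" for x y using mass_mono[OF m] that by blast
  have lpos: "\<forall>\<^sub>F r in at_top. ?l r > 0"
    using regularly_varying_eventually_pos[OF rv] eventually_gt_at_top[of 0] by eventually_elim (auto simp: sv_def)
  define B where "B = (\<integral>s. w s \<partial>m)"
  have mom: "\<bar>LINT s:{-t<..<t}|m. g s * w s\<bar> \<le> K * B"
    if [measurable]: "g \<in> borel_measurable borel" and g: "\<And>s. \<bar>s\<bar> < t \<Longrightarrow> \<bar>g s\<bar> \<le> K" and K: "K \<ge> 0" for g :: "real \<Rightarrow> real" and t K
  proof -
    have le: "norm (indicator {-t<..<t} s *\<^sub>R (g s * w s)) \<le> K * w s" for s
    proof (cases "\<bar>s\<bar> < t")
      case True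
      then show ?thesis using mult_right_mono[OF g[OF True] w0[of s]] w0[of s] by (auto simp: indicator_def abs_mult abs_less_iff)
    next
      case False
      then show ?thesis using K w0[of s] by (auto simp: indicator_def abs_less_iff)
    qed
    have iK: "integrable m (\<lambda>s. K * w s)" by (rule integrable_mult_right[OF intw])
    have "norm (LINT s:{-t<..<t}|m. g s * w s) \<le> (\<integral>s. K * w s \<partial>m)" unfolding set_lebesgue_integral_def
      by (rule Bochner_Integration.integral_norm_bound_integral[OF integrable_bounded_by[OF iK _ le] iK le]) measurable
    then show ?thesis by (simp add: B_def)
  qed
  have B0: "B \<ge> 0" unfolding B_def using w0 by (intro Bochner_Integration.integral_nonneg) auto
  have bdd\<Psi>: "\<exists>K. \<forall>t. 0 < t \<longrightarrow> t \<le> x \<longrightarrow> \<bar>\<Psi> t\<bar> \<le> K" for x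
  proof (intro exI allI impI)
    fix t assume t: "0 < t" "t \<le> x"
    have "\<bar>U t\<bar> \<le> t\<^sup>2 * B" unfolding U_def
      by (rule mom) (use t power_mono[of "\<bar>_\<bar>" t 2] in \<open>auto simp: abs_le_square_iff[symmetric]\<close>)
    then have "\<bar>\<Psi> t\<bar> \<le> t\<^sup>2 * B / t" using t by (simp add: \<Psi>_def abs_divide divide_right_mono)
    also have "\<dots> = t * B" using t by (simp add: power2_eq_square)
    also have "\<dots> \<le> x * B" using t B0 by (intro mult_right_mono) auto
    finally show "\<bar>\<Psi> t\<bar> \<le> x * B" .
  qed
  have bddF: "\<exists>K. \<forall>t. 0 < t \<longrightarrow> t \<le> x \<longrightarrow> \<bar>F t\<bar> \<le> K" for x
  proof (intro exI allI impI)
    fix t assume t: "0 < t" "t \<le> x"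
    have "\<bar>LINT s:{-t<..<t}|m. s * w s\<bar> \<le> t * B" by (rule mom) (use t in auto)
    also have "\<dots> \<le> x * B" using t B0 by (intro mult_right_mono) auto
    finally show "\<bar>F t\<bar> \<le> x * B + \<bar>c2\<bar>" unfolding F_def by linarith
  qed
  have lim\<Psi>: "((\<lambda>t. \<Psi> t / ?l t) \<longlongrightarrow> real \<beta>) at_top"
    using second_moment_asymptotics[OF m int rv[unfolded \<beta>_def]] unfolding \<Psi>_def U_def w_def \<beta>_def .
  have limF: "((\<lambda>t. F t / ?l t) \<longlongrightarrow> real \<beta> * \<eta>) at_top" using \<Phi> unfolding F_def c2_def .
  obtain c where c: "c > 0" "\<And>z u. Im z \<ge> \<delta> \<Longrightarrow> norm z \<le> R \<Longrightarrow> u \<ge> 0 \<Longrightarrow> norm ((complex_of_real u)\<^sup>2 - z\<^sup>2) \<ge> c * (1 + u\<^sup>2)"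
    using square_diff_lower_bound[OF \<delta> R] by blast
  \<comment> \<open>Bounds independent of n, thanks to the common \<delta> and \<open>R\<close> of
    the moving points.\<close>
  have kb: "norm (layer_kernel (Z n) v) \<le> 2 / c\<^sup>2 / (1 + v\<^sup>2)" "norm (of_real v * layer_kernel (Z n) v) \<le> 2 / c\<^sup>2 / (1 + v\<^sup>2)" if v: "v > 0" for n v
  proof -
    have p: "0 < 1 + v\<^sup>2" using zero_le_power2[of v] by linarith
    have b: "norm (layer_kernel (Z n) v) \<le> 2 / c\<^sup>2 * (v / (1 + v\<^sup>2)\<^sup>2)"
      using v by (intro norm_layer_kernel_le[OF c(1)] c(2) Z) auto
    have "0 \<le> (v - 1)\<^sup>2" by simp
    then have "2 * v \<le> 1 + v\<^sup>2" by (simp add: power2_diff)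
    then have "v \<le> 1 + v\<^sup>2" using v by linarith
    then have "v / (1 + v\<^sup>2)\<^sup>2 \<le> (1 + v\<^sup>2) / (1 + v\<^sup>2)\<^sup>2" by (intro divide_right_mono) auto
    also have "\<dots> = 1 / (1 + v\<^sup>2)" using p by (simp add: power2_eq_square)
    finally have "2 / c\<^sup>2 * (v / (1 + v\<^sup>2)\<^sup>2) \<le> 2 / c\<^sup>2 * (1 / (1 + v\<^sup>2))" by (intro mult_left_mono) auto
    then show "norm (layer_kernel (Z n) v) \<le> 2 / c\<^sup>2 / (1 + v\<^sup>2)" using b by simp
    have "v\<^sup>2 / (1 + v\<^sup>2)\<^sup>2 \<le> (1 + v\<^sup>2) / (1 + v\<^sup>2)\<^sup>2" by (intro divide_right_mono) auto
    also have "\<dots> = 1 / (1 + v\<^sup>2)" using p by (simp add: power2_eq_square)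
    finally have 2: "2 / c\<^sup>2 * (v\<^sup>2 / (1 + v\<^sup>2)\<^sup>2) \<le> 2 / c\<^sup>2 * (1 / (1 + v\<^sup>2))" by (intro mult_left_mono) auto
    have "norm (of_real v * layer_kernel (Z n) v) \<le> v * (2 / c\<^sup>2 * (v / (1 + v\<^sup>2)\<^sup>2))"
      unfolding norm_mult using b v by (intro mult_mono) auto
    also have "\<dots> = 2 / c\<^sup>2 * (v\<^sup>2 / (1 + v\<^sup>2)\<^sup>2)" by (simp add: power2_eq_square)
    finally show "norm (of_real v * layer_kernel (Z n) v) \<le> 2 / c\<^sup>2 / (1 + v\<^sup>2)" using 2 by simp
  qed
  have kl: "(\<lambda>n. layer_kernel (Z n) v) \<longlonglongrightarrow> layer_kernel z v" for v
    unfolding layer_kernel_def using square_diff_nonzero[OF z, of v] by (intro tendsto_intros Z(3)) auto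
  have z0: "z \<noteq> 0" using z by auto
  have Zn0: "Z n \<noteq> 0" "Im (Z n) > 0" for n using Z(1)[of n] \<delta> by auto
  obtain c' where c': "c' > 0" "\<And>u. u \<ge> 0 \<Longrightarrow> norm ((complex_of_real u)\<^sup>2 - z\<^sup>2) \<ge> c' * (1 + u\<^sup>2)"
    using square_diff_lower_bound[of "Im z" "norm z"] z by auto
  have k0: "(LBINT v:{0<..}. layer_kernel z v) = - 1 / z\<^sup>2"
    using layer_kernel_tail(3)[OF z order_refl c'] by (simp add: divide_minus_right)
  let ?IE = "\<lambda>n. LBINT v:{0<..}. of_real v * layer_kernel (Z n) v * of_real (\<Psi> (X n * v) / ?l (X n))"
  let ?IO = "\<lambda>n. LBINT v:{0<..}. layer_kernel (Z n) v * of_real (F (X n * v) / ?l (X n))"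
  have LE: "?IE \<longlonglongrightarrow> (LBINT v:{0<..}. of_real v * layer_kernel z v) * of_real (real \<beta>)"
    by (rule abel_limit[where k = "\<lambda>n v. of_real v * layer_kernel (Z n) v" and k' = "\<lambda>v. of_real v * layer_kernel z v" and r = X
        and C = "2 / c\<^sup>2" and M = "mass m" and \<Psi> = \<Psi>, OF mono rv lim\<Psi> bdd\<Psi> \<Psi>m _ _ kb(2) tendsto_mult[OF tendsto_const kl] X(1)]) measurable
  have LO: "?IO \<longlonglongrightarrow> (LBINT v:{0<..}. layer_kernel z v) * of_real (real \<beta> * \<eta>)"
    by (rule abel_limit[where k = "\<lambda>n v. layer_kernel (Z n) v" and k' = "\<lambda>v. layer_kernel z v" and r = X
        and C = "2 / c\<^sup>2" and M = "mass m" and \<Psi> = F, OF mono rv limF bddF Fm _ _ kb(1) kl X(1)]) measurable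
  let ?Rem = "\<lambda>\<zeta>. poly (map_poly complex_of_real p) \<zeta> - of_real (coeff p (2 * \<kappa> + 1)) * (1 + \<zeta>\<^sup>2) ^ ?N / \<zeta> - of_real (coeff p (2 * \<kappa>)) * (1 + \<zeta>\<^sup>2) ^ ?N / \<zeta>\<^sup>2"
  let ?rem = "\<lambda>n. ?Rem (of_real (X n) * Z n) / of_real (\<beta> * (X n ^ (2 * \<kappa>) * ?l (X n)))"
  let ?h = "\<lambda>n. 1 / (of_real (X n))\<^sup>2 + (Z n)\<^sup>2"
  have lX: "\<forall>\<^sub>F n in sequentially. ?l (X n) > 0" using eventually_compose_filterlim[OF lpos X(1)] .
  \<comment> \<open>The remainder is one power of r below \<open>r ^ (2 \<kappa>)\<close>, and this
    power outweighs the slowly varying quotient in the denominator.\<close>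
  have REM: "?rem \<longlonglongrightarrow> 0"
  proof -
    obtain C where C: "C \<ge> 0" "\<And>\<zeta>. norm \<zeta> \<ge> 1 \<Longrightarrow> norm (?Rem \<zeta>) * norm \<zeta> \<le> C * norm \<zeta> ^ (2 * \<kappa>)"
      using polynomial_remainder_bound[OF p] by blast
    have "((\<lambda>t. t powr (-1) / ?l t) \<longlongrightarrow> 0) at_top" using powr_over_sv_tendsto_0[where M = "mass m", OF mono rv, of 1] by simp
    from filterlim_compose[OF this X(1)] have T: "(\<lambda>n. X n powr (-1) / ?l (X n)) \<longlonglongrightarrow> 0" .
    have nZ: "\<delta> \<le> norm (Z n)" for n using Z(1)[of n] abs_Im_le_cmod[of "Z n"] by linarith
    have big: "\<forall>\<^sub>F n in sequentially. X n \<ge> 1 / \<delta>" using X(1) by (auto simp: filterlim_at_top)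
    show ?thesis
    proof (rule tendsto_0_le[OF T, where K = "C * R ^ (2 * \<kappa>) / (\<beta> * \<delta>)"])
      show "\<forall>\<^sub>F n in sequentially. norm (?rem n) \<le> norm (X n powr (-1) / ?l (X n)) * (C * R ^ (2 * \<kappa>) / (\<beta> * \<delta>))"
        using big lX
      proof eventually_elim
        case (elim n)
        let ?\<zeta> = "of_real (X n) * Z n"
        have n\<zeta>: "norm ?\<zeta> = X n * norm (Z n)" using X(2)[of n] by (simp add: norm_mult)
        have "1 / \<delta> * \<delta> \<le> X n * norm (Z n)" using elim(1) nZ[of n] \<delta> X(2)[of n] by (intro mult_mono) auto
        then have g1: "norm ?\<zeta> \<ge> 1" unfolding n\<zeta> using \<delta> by simp
        have "norm (?Rem ?\<zeta>) * (X n * \<delta>) \<le> norm (?Rem ?\<zeta>) * norm ?\<zeta>" unfolding n\<zeta> using nZ[of n] X(2)[of n] by (intro mult_left_mono) auto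
        also have "\<dots> \<le> C * norm ?\<zeta> ^ (2 * \<kappa>)" by (rule C(2)[OF g1])
        also have "\<dots> \<le> C * (X n ^ (2 * \<kappa>) * R ^ (2 * \<kappa>))" unfolding n\<zeta> power_mult_distrib
          using C(1) Z(2)[of n] X(2)[of n] by (intro mult_left_mono power_mono) auto
        finally have b: "norm (?Rem ?\<zeta>) \<le> C * (X n ^ (2 * \<kappa>) * R ^ (2 * \<kappa>)) / (X n * \<delta>)" using X(2)[of n] \<delta> by (simp add: pos_le_divide_eq)
        have \<beta>0: "real \<beta> > 0" by (simp add: \<beta>_def)
        have "norm (?rem n) = norm (?Rem ?\<zeta>) / (\<beta> * (X n ^ (2 * \<kappa>) * ?l (X n)))"
          unfolding norm_divide norm_of_real using X(2)[of n] elim(2) \<beta>0 by (simp add: abs_mult)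
        also have "\<dots> \<le> C * (X n ^ (2 * \<kappa>) * R ^ (2 * \<kappa>)) / (X n * \<delta>) / (\<beta> * (X n ^ (2 * \<kappa>) * ?l (X n)))"
          using b X(2)[of n] elim(2) \<beta>0 by (intro divide_right_mono) auto
        also have "\<dots> = X n powr (-1) / ?l (X n) * (C * R ^ (2 * \<kappa>) / (\<beta> * \<delta>))"
          using X(2)[of n] elim(2) \<beta>0 \<delta> by (simp add: powr_minus_divide divide_simps)
        finally show ?case using X(2)[of n] elim(2) by simp
      qed
    qed
  qed
  have iX: "(\<lambda>n. 1 / (complex_of_real (X n))\<^sup>2) \<longlonglongrightarrow> 0"
  proof -
    have "(\<lambda>n. 1 / X n) \<longlonglongrightarrow> 0" using tendsto_inverse_0_at_top[OF X(1)] by (simp add: inverse_eq_divide)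
    from tendsto_power[OF tendsto_of_real[OF this, where ?'a = complex], of 2]
    have "(\<lambda>n. (complex_of_real (1 / X n))\<^sup>2) \<longlonglongrightarrow> 0" by simp
    then show ?thesis by (simp add: power_divide of_real_divide del: of_real_power)
  qed
  \<comment> \<open>An exact identity for large n, not an estimate: \<open>?h n\<close> is
    \<open>1 + \<zeta>^2\<close> with the square of \<open>X n\<close> taken out.\<close>
  have key: "\<forall>\<^sub>F n in sequentially. ?rem n + ?h n ^ ?N * (1 / (of_real (real \<beta>) * Z n) * ?IE n + 1 / of_real (real \<beta>) * ?IO n)
     = C_transform \<kappa> m p (of_real (X n) * Z n) / of_real (\<beta> * (mass m (X n) / X n))"
    using lX
  proof eventually_elim
    case (elim n)
    let ?r = "X n" and ?z = "Z n" and ?\<zeta> = "of_real (X n) * Z n"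
    have r: "?r > 0" by (rule X(2))
    have \<beta>0: "real \<beta> > 0" by (simp add: \<beta>_def)
    have f: "\<beta> * (mass m ?r / ?r) = \<beta> * (?r ^ (2 * \<kappa>) * ?l ?r)" using r by (simp add: sv_def \<beta>_def)
    have im: "Im ?\<zeta> > 0" using r Zn0(2)[of n] by simp
    have e1: "(LBINT u:{0<..}. layer_kernel ?\<zeta> u * of_real (U u)) = of_real (?l ?r) * ?IE n / of_real ?r"
    proof -
      have "(LBINT v:{0<..}. layer_kernel ?z v * of_real (U (?r * v))) = (LBINT v:{0<..}. of_real (?r * ?l ?r) * (of_real v * layer_kernel ?z v * of_real (\<Psi> (?r * v) / ?l ?r)))"
        using r elim by (intro set_lebesgue_integral_cong) (auto simp: \<Psi>_def)
      then have L: "(LBINT v:{0<..}. layer_kernel ?z v * of_real (U (?r * v))) = (of_real ?r * of_real (?l ?r)) * ?IE n"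
        by (simp only: set_integral_mult_right of_real_mult)
      have A: "(a * l) * E / a\<^sup>2 = l * E / a" if "a \<noteq> 0" for a l E :: complex
        using that by (simp add: power2_eq_square)
      show ?thesis unfolding layer_rescale[OF r] L by (rule A) (use r in simp)
    qed
    have e2: "(LBINT u:{0<..}. layer_kernel ?\<zeta> u * of_real (F u)) = of_real (?l ?r) * ?IO n / (of_real ?r)\<^sup>2"
    proof -
      have "(LBINT v:{0<..}. layer_kernel ?z v * of_real (F (?r * v))) = (LBINT v:{0<..}. of_real (?l ?r) * (layer_kernel ?z v * of_real (F (?r * v) / ?l ?r)))"
        using elim by (intro set_lebesgue_integral_cong) auto
      then show ?thesis unfolding layer_rescale[OF r] by (simp only: set_integral_mult_right)
    qed
    have C: "C_transform \<kappa> m p ?\<zeta> = ?Rem ?\<zeta> + (1 + ?\<zeta>\<^sup>2) ^ ?N / ?\<zeta> * (of_real (?l ?r) * ?IE n / of_real ?r) + (1 + ?\<zeta>\<^sup>2) ^ ?N * (of_real (?l ?r) * ?IO n / (of_real ?r)\<^sup>2)"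
      using C_transform_layers[OF m int im, of p c2] unfolding e1[symmetric] e2[symmetric] unfolding U_def F_def lead w_def c2_def .
    have h: "(1 + ?\<zeta>\<^sup>2) ^ ?N = ?h n ^ ?N * (of_real ?r)\<^sup>2 * of_real (?r ^ (2 * \<kappa>))"
    proof -
      have "1 + ?\<zeta>\<^sup>2 = ?h n * (of_real ?r)\<^sup>2" using r by (simp add: power_mult_distrib distrib_right)
      then have "(1 + ?\<zeta>\<^sup>2) ^ ?N = ?h n ^ ?N * ((of_real ?r)\<^sup>2) ^ ?N" by (simp only: power_mult_distrib)
      also have "((complex_of_real ?r)\<^sup>2) ^ ?N = (of_real ?r)\<^sup>2 * of_real (?r ^ (2 * \<kappa>))" by (simp add: power_mult)
      finally show ?thesis by (simp add: mult.assoc)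
    qed
    have nz: "complex_of_real ?r \<noteq> 0" "complex_of_real (?l ?r) \<noteq> 0" "complex_of_real (real \<beta>) \<noteq> 0" "?z \<noteq> 0" "complex_of_real (?r ^ (2 * \<kappa>)) \<noteq> 0"
      using r elim \<beta>0 Zn0[of n] by auto
    have alg: "(A + H * a\<^sup>2 * b / (a * y) * (l * E / a) + H * a\<^sup>2 * b * (l * Q / a\<^sup>2)) / (d * (b * l)) = A / (d * (b * l)) + H * (1 / (d * y) * E + 1 / d * Q)"
      if "a \<noteq> 0" "l \<noteq> 0" "d \<noteq> 0" "y \<noteq> 0" "b \<noteq> 0" for A H a b y l E Q d :: complex
    proof -
      have "H * a\<^sup>2 * b / (a * y) * (l * E / a) / (d * (b * l)) = H * (1 / (d * y) * E)" using that by (simp add: power2_eq_square)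
      moreover have "H * a\<^sup>2 * b * (l * Q / a\<^sup>2) / (d * (b * l)) = H * (1 / d * Q)" using that by simp
      ultimately show ?thesis by (simp only: add_divide_distrib distrib_left add.assoc)
    qed
    show ?case unfolding f C h of_real_mult by (rule alg[OF nz, symmetric])
  qed
  have nzb: "complex_of_real (real \<beta>) \<noteq> 0" by (simp only: of_real_eq_0_iff of_nat_eq_0_iff \<beta>_def)
  have "(\<lambda>n. ?rem n + ?h n ^ ?N * (1 / (of_real (real \<beta>) * Z n) * ?IE n + 1 / of_real (real \<beta>) * ?IO n))
    \<longlonglongrightarrow> 0 + (0 + z\<^sup>2) ^ ?N * (1 / (of_real (real \<beta>) * z) * ((LBINT v:{0<..}. of_real v * layer_kernel z v) * of_real (real \<beta>))
        + 1 / of_real (real \<beta>) * ((LBINT v:{0<..}. layer_kernel z v) * of_real (real \<beta> * \<eta>)))"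
    by (intro tendsto_add REM tendsto_mult tendsto_power iX Z(3) LE LO tendsto_divide tendsto_const) (use z0 nzb in \<open>simp_all only: mult_eq_0_iff simp_thms not_False_eq_True\<close>)
  also have "0 + (0 + z\<^sup>2) ^ ?N * (1 / (of_real (real \<beta>) * z) * ((LBINT v:{0<..}. of_real v * layer_kernel z v) * of_real (real \<beta>))
        + 1 / of_real (real \<beta>) * ((LBINT v:{0<..}. layer_kernel z v) * of_real (real \<beta> * \<eta>)))
     = \<i> * ((-1) ^ \<kappa> * (of_real (pi / 2) + \<i> * of_real \<eta>)) * (z / \<i>) ^ (\<beta> - 1)"
  proof -
    have s1: "(-1) ^ \<kappa> * (-1) ^ \<kappa> = (1::complex)" by (simp flip: power_mult_distrib)
    have a1: "1 / (d * z) * (\<i> * of_real pi / (2 * z) * d) + 1 / d * (- 1 / z\<^sup>2 * (d * e)) = (\<i> * of_real pi / 2 - e) / z\<^sup>2"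
      if "d \<noteq> 0" for d e :: complex
      using that z0 by (simp add: field_simps power2_eq_square)
    have a2: "(0 + z\<^sup>2) ^ ?N * (x / z\<^sup>2) = z ^ (2 * \<kappa>) * x" for x using z0 by (simp add: power_mult)
    have e: "\<beta> - 1 = 2 * \<kappa>" by (simp add: \<beta>_def)
    have "\<i> * ((-1) ^ \<kappa> * (of_real (pi / 2) + \<i> * of_real \<eta>)) * (z / \<i>) ^ (\<beta> - 1) = ((-1) ^ \<kappa> * (-1) ^ \<kappa>) * (z ^ (2 * \<kappa>) * (\<i> * of_real pi / 2 - of_real \<eta>))"
      unfolding e odd_part_power by (simp add: algebra_simps)
    then show ?thesis unfolding layer_kernel_first_moment[OF z] k0 of_real_mult a1[OF nzb] a2 s1 by simp
  qed
  finally show ?thesis using key by (rule Lim_transform_eventually)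
qed

lemma continuous_on_rescaling_target:
  "continuous_on S (\<lambda>z. \<i> * \<omega> * (z / \<i>) ^ n)"
  by (intro continuous_intros) auto

lemma rescaling_limit_pointwise:
  assumes "rescaling_limit \<beta> q f \<omega>" "Im z > 0"
  shows "((\<lambda>r. q (of_real r * z) / of_real (f r)) \<longlongrightarrow> \<i> * \<omega> * (z / \<i>) ^ (\<beta> - 1)) at_top"
proof -
  obtain d where "d > 0" "uniform_limit (cball z d) (\<lambda>r z. q (of_real r * z) / of_real (f r)) (\<lambda>z. \<i> * \<omega> * (z / \<i>) ^ (\<beta> - 1)) at_top"
    using assms unfolding rescaling_limit_def locally_uniform_limit_def upper_half_plane_def by blast
  then show ?thesis by (auto intro: tendsto_uniform_limitI)
qed

text \<open>Multiplication by a convergent scalar preserves local uniformity because the limit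
  function is bounded on closed balls.\<close>

lemma rescaling_limit_change_scale:
  assumes lim: "rescaling_limit \<beta> q f \<omega>" and f: "\<forall>\<^sub>F r in at_top. f r > 0" and g: "((\<lambda>r. f r / g r) \<longlongrightarrow> a) at_top"
  shows "rescaling_limit \<beta> q g (of_real a * \<omega>)"
  unfolding rescaling_limit_def locally_uniform_limit_def
proof
  fix z assume "z \<in> upper_half_plane"
  then obtain d where d: "d > 0" "cball z d \<subseteq> upper_half_plane"
    and u: "uniform_limit (cball z d) (\<lambda>r z. q (of_real r * z) / of_real (f r)) (\<lambda>z. \<i> * \<omega> * (z / \<i>) ^ (\<beta> - 1)) at_top"
    using lim unfolding rescaling_limit_def locally_uniform_limit_def by blast
  have c: "uniform_limit (cball z d) (\<lambda>r z. complex_of_real (f r / g r)) (\<lambda>z. of_real a) at_top"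
    using tendsto_of_real[OF g, where ?'a = complex] by (auto simp: uniform_limit_iff dest: tendstoD)
  have "bounded ((\<lambda>z. \<i> * \<omega> * (z / \<i>) ^ (\<beta> - 1)) ` cball z d)"
    by (intro compact_imp_bounded compact_continuous_image continuous_on_rescaling_target compact_cball)
  from uniform_lim_mult[OF u c this]
  have "uniform_limit (cball z d) (\<lambda>r z. q (of_real r * z) / of_real (f r) * of_real (f r / g r)) (\<lambda>z. \<i> * \<omega> * (z / \<i>) ^ (\<beta> - 1) * of_real a) at_top"
    by (simp add: image_constant_conv)
  moreover have "\<forall>\<^sub>F r in at_top. \<forall>x\<in>cball z d. q (of_real r * x) / of_real (f r) * of_real (f r / g r) = q (of_real r * x) / of_real (g r)"
    using f by eventually_elim auto
  ultimately have "uniform_limit (cball z d) (\<lambda>r z. q (of_real r * z) / of_real (g r)) (\<lambda>z. \<i> * \<omega> * (z / \<i>) ^ (\<beta> - 1) * of_real a) at_top"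
    by (rule uniform_limit_cong[THEN iffD1, rotated 2]) auto
  then have "uniform_limit (cball z d) (\<lambda>r z. q (of_real r * z) / of_real (g r)) (\<lambda>z. \<i> * (of_real a * \<omega>) * (z / \<i>) ^ (\<beta> - 1)) at_top"
    by (simp add: mult_ac)
  then show "\<exists>d>0. cball z d \<subseteq> upper_half_plane \<and> uniform_limit (cball z d) (\<lambda>r z. q (of_real r * z) / of_real (g r)) (\<lambda>z. \<i> * (of_real a * \<omega>) * (z / \<i>) ^ (\<beta> - 1)) at_top"
    using d by blast
qed

text \<open>Evaluation at z = i, where every power of \<open>z / i\<close> is 1.\<close>

lemma rescaling_limit_unique:
  assumes "rescaling_limit \<beta> q f \<omega>" "rescaling_limit \<beta> q f \<omega>'"
  shows "\<omega> = \<omega>'"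
proof -
  have "\<i> * \<omega> * (\<i> / \<i>) ^ (\<beta> - 1) = \<i> * \<omega>' * (\<i> / \<i>) ^ (\<beta> - 1)"
    using rescaling_limit_pointwise[OF assms(1), of \<i>] rescaling_limit_pointwise[OF assms(2), of \<i>]
    by (intro tendsto_unique[OF trivial_limit_at_top_linorder]) auto
  then show ?thesis by simp
qed

text \<open>The weight is bounded below on bounded intervals, so its integrability forces finite
  mass there.\<close>

lemma E_le_locally_finite:
  assumes "(\<mu>, p) \<in> E_le \<kappa>"
  shows "locally_finite \<mu>" "integrable \<mu> (\<lambda>s. 1 / (1 + s\<^sup>2) ^ (\<kappa> + 1))"
proof -
  have sets: "sets \<mu> = sets borel" and fin: "(\<integral>\<^sup>+ t. ennreal (1 / (1 + t\<^sup>2) ^ (\<kappa> + 1)) \<partial>\<mu>) < \<infinity>"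
    using assms by (auto simp: E_le_def borel_measure_def)
  note [measurable_cong] = sets
  show "integrable \<mu> (\<lambda>s. 1 / (1 + s\<^sup>2) ^ (\<kappa> + 1))"
    using fin by (intro integrableI_nonneg) (auto intro!: AE_I2)
  have "emeasure \<mu> {-a<..<a} < \<infinity>" for a
  proof -
    let ?c = "(1 + a\<^sup>2) ^ (\<kappa> + 1)"
    have "emeasure \<mu> {-a<..<a} = (\<integral>\<^sup>+ s. indicator {-a<..<a} s \<partial>\<mu>)" by (simp add: sets)
    also have "\<dots> \<le> (\<integral>\<^sup>+ s. ennreal ?c * ennreal (1 / (1 + s\<^sup>2) ^ (\<kappa> + 1)) \<partial>\<mu>)"
    proof (rule nn_integral_mono)
      fix s :: real
      show "indicator {-a<..<a} s \<le> ennreal ?c * ennreal (1 / (1 + s\<^sup>2) ^ (\<kappa> + 1))"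
      proof (cases "s \<in> {-a<..<a}")
        case True
        then have "\<bar>s\<bar> \<le> \<bar>a\<bar>" by auto
        then have "s\<^sup>2 \<le> a\<^sup>2" by (simp add: abs_le_square_iff)
        then have "(1 + s\<^sup>2) ^ (\<kappa> + 1) \<le> ?c" by (intro power_mono) auto
        moreover have p: "0 < (1 + s\<^sup>2) ^ (\<kappa> + 1)" by (intro zero_less_power add_pos_nonneg) auto
        ultimately have "1 \<le> ?c * (1 / (1 + s\<^sup>2) ^ (\<kappa> + 1))" by (simp add: le_divide_eq del: power_Suc)
        then have "ennreal 1 \<le> ennreal (?c * (1 / (1 + s\<^sup>2) ^ (\<kappa> + 1)))" by (rule ennreal_leI)
        also have "\<dots> = ennreal ?c * ennreal (1 / (1 + s\<^sup>2) ^ (\<kappa> + 1))" by (rule ennreal_mult) auto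
        finally show ?thesis using True by simp
      qed simp
    qed
    also have "\<dots> = ennreal ?c * (\<integral>\<^sup>+ s. ennreal (1 / (1 + s\<^sup>2) ^ (\<kappa> + 1)) \<partial>\<mu>)" by (rule nn_integral_cmult) measurable
    also have "\<dots> < \<infinity>" using fin by (simp add: ennreal_mult_less_top del: power_Suc)
    finally show ?thesis .
  qed
  then show "locally_finite \<mu>" using sets by (simp add: locally_finite_def)
qed

theorem theorem5p5:
  fixes \<mu> :: "real measure" and \<kappa> \<beta> :: nat and p :: "real poly" and q :: "complex \<Rightarrow> complex"
  assumes "borel_measure \<mu>"
    and "p_index \<mu> < \<infinity>"
    and "enat \<kappa> = kappa_index \<mu>"
    and "(\<mu>, p) \<in> E_le \<kappa>"
    and "coeff p (2 * \<kappa> + 1) = (\<integral>t. 1 / (1 + t\<^sup>2) ^ (\<kappa> + 1) \<partial>\<mu>)"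
    and "q = C_transform \<kappa> \<mu> p"
    and "odd \<beta>"
  shows
    "(\<forall>\<mu>\<^sub>0 \<mu>\<^sub>1 \<mu>\<^sub>2 \<eta>\<^sub>p \<eta>\<^sub>m.
        borel_measure \<mu>\<^sub>0 \<and> borel_measure \<mu>\<^sub>1 \<and> borel_measure \<mu>\<^sub>2
        \<and> \<mu> = measure_sum (measure_sum \<mu>\<^sub>0 \<mu>\<^sub>1) \<mu>\<^sub>2
        \<and> symmetric_measure \<mu>\<^sub>0
        \<and> regularly_varying (\<lambda>t. measure \<mu>\<^sub>0 {-t<..<t}) (real \<beta>)
        \<and> (emeasure \<mu>\<^sub>1 {0..} = 0 \<or> regularly_varying (\<lambda>t. measure \<mu>\<^sub>1 {0..<t}) (real \<beta>))
        \<and> (emeasure \<mu>\<^sub>1 {..<0} = 0 \<or> regularly_varying (\<lambda>t. measure \<mu>\<^sub>1 {-t<..<0}) (real \<beta>))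
        \<and> (\<exists>\<gamma>::real. \<gamma> < real \<beta> \<and>
             (\<exists>c>0. \<forall>\<^sub>F t in at_top. measure \<mu>\<^sub>2 {-t<..<t} \<le> c * t powr \<gamma>))
        \<and> ((\<integral>\<^sup>+ t. ennreal (1 / (1 + \<bar>t\<bar>) ^ \<beta>) \<partial>\<mu>\<^sub>1) < \<infinity> \<longrightarrow>
             coeff p (2 * \<kappa>) = (\<integral>t. t / (1 + t\<^sup>2) ^ (\<kappa> + 1) \<partial>(measure_sum \<mu>\<^sub>1 \<mu>\<^sub>2)))
        \<and> (eta_quotient \<beta> \<mu>\<^sub>0 \<mu>\<^sub>1 (pos_part \<mu>\<^sub>1) \<longlongrightarrow> \<eta>\<^sub>p) at_top
        \<and> (eta_quotient \<beta> \<mu>\<^sub>0 \<mu>\<^sub>1 (neg_part \<mu>\<^sub>1) \<longlongrightarrow> \<eta>\<^sub>m) at_top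
        \<longrightarrow>
        (\<lambda>t. measure \<mu> {-t<..<t}) \<sim>[at_top] (\<lambda>t. measure \<mu>\<^sub>0 {-t<..<t})
        \<and> \<beta> = 2 * \<kappa> + 1
        \<and> rescaling_limit \<beta> q (\<lambda>r. real \<beta> * (measure \<mu> {-r<..<r} / r))
             ((-1) ^ \<kappa> * (complex_of_real (pi / 2) + \<i> * complex_of_real (\<eta>\<^sub>p - \<eta>\<^sub>m))))
     \<and>
     ((\<exists>f \<alpha> \<omega>. regularly_varying f \<alpha> \<and> Re \<omega> \<noteq> 0 \<and> rescaling_limit \<beta> q f \<omega>)
      \<longrightarrow>
        regularly_varying (\<lambda>t. measure \<mu> {-t<..<t}) (real \<beta>)
        \<and> ((\<lambda>t. measure \<mu> {-t<..<0} / measure \<mu> {0..<t}) \<longlongrightarrow> 1) at_top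
        \<and> (\<exists>\<omega>. rescaling_limit \<beta> q (\<lambda>r. real \<beta> * (measure \<mu> {-r<..<r} / r)) \<omega>)
        \<and> (\<forall>\<omega>. rescaling_limit \<beta> q (\<lambda>r. real \<beta> * (measure \<mu> {-r<..<r} / r)) \<omega>
               \<longrightarrow> Re \<omega> = (-1) ^ \<kappa> * (pi / 2)))"
proof (intro conjI allI impI)
  note lfm = E_le_locally_finite[OF assms(4)]
  have deg: "degree p \<le> 2 * \<kappa> + 1" using assms(4) by (simp add: E_le_def)
  obtain n where n: "\<beta> = 2 * n + 1" using assms(7) by (auto elim: oddE)
  {
    fix \<mu>\<^sub>0 \<mu>\<^sub>1 \<mu>\<^sub>2 \<eta>\<^sub>p \<eta>\<^sub>m
    assume H: "borel_measure \<mu>\<^sub>0 \<and> borel_measure \<mu>\<^sub>1 \<and> borel_measure \<mu>\<^sub>2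
        \<and> \<mu> = measure_sum (measure_sum \<mu>\<^sub>0 \<mu>\<^sub>1) \<mu>\<^sub>2
        \<and> symmetric_measure \<mu>\<^sub>0
        \<and> regularly_varying (mass \<mu>\<^sub>0) (real \<beta>)
        \<and> (emeasure \<mu>\<^sub>1 {0..} = 0 \<or> regularly_varying (\<lambda>t. measure \<mu>\<^sub>1 {0..<t}) (real \<beta>))
        \<and> (emeasure \<mu>\<^sub>1 {..<0} = 0 \<or> regularly_varying (\<lambda>t. measure \<mu>\<^sub>1 {-t<..<0}) (real \<beta>))
        \<and> (\<exists>\<gamma>::real. \<gamma> < real \<beta> \<and>
             (\<exists>c>0. \<forall>\<^sub>F t in at_top. mass \<mu>\<^sub>2 t \<le> c * t powr \<gamma>))
        \<and> ((\<integral>\<^sup>+ t. ennreal (1 / (1 + \<bar>t\<bar>) ^ \<beta>) \<partial>\<mu>\<^sub>1) < \<infinity> \<longrightarrow>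
             coeff p (2 * \<kappa>) = (\<integral>t. t / (1 + t\<^sup>2) ^ (\<kappa> + 1) \<partial>(measure_sum \<mu>\<^sub>1 \<mu>\<^sub>2)))
        \<and> (eta_quotient \<beta> \<mu>\<^sub>0 \<mu>\<^sub>1 (pos_part \<mu>\<^sub>1) \<longlongrightarrow> \<eta>\<^sub>p) at_top
        \<and> (eta_quotient \<beta> \<mu>\<^sub>0 \<mu>\<^sub>1 (neg_part \<mu>\<^sub>1) \<longlongrightarrow> \<eta>\<^sub>m) at_top"
    have sets: "sets \<mu>\<^sub>0 = sets borel" "sets \<mu>\<^sub>1 = sets borel" "sets \<mu>\<^sub>2 = sets borel" and \<mu>: "\<mu> = measure_sum (measure_sum \<mu>\<^sub>0 \<mu>\<^sub>1) \<mu>\<^sub>2"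
      and sym: "symmetric_measure \<mu>\<^sub>0" and rv: "regularly_varying (mass \<mu>\<^sub>0) (real \<beta>)"
      and eta: "(eta_quotient \<beta> \<mu>\<^sub>0 \<mu>\<^sub>1 (pos_part \<mu>\<^sub>1) \<longlongrightarrow> \<eta>\<^sub>p) at_top" "(eta_quotient \<beta> \<mu>\<^sub>0 \<mu>\<^sub>1 (neg_part \<mu>\<^sub>1) \<longlongrightarrow> \<eta>\<^sub>m) at_top"
      using H unfolding borel_measure_def by blast+
    have d: "coeff p (2 * \<kappa>) = (\<integral>t. t / (1 + t\<^sup>2) ^ (\<kappa> + 1) \<partial>(measure_sum \<mu>\<^sub>1 \<mu>\<^sub>2))"
      if "(\<integral>\<^sup>+ t. ennreal (1 / (1 + \<bar>t\<bar>) ^ \<beta>) \<partial>\<mu>\<^sub>1) < \<infinity>" using H that by blast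
    obtain \<gamma> c where g: "\<gamma> < real \<beta>" "c > 0" "\<forall>\<^sub>F t in at_top. mass \<mu>\<^sub>2 t \<le> c * t powr \<gamma>" using H by blast
    have s01: "sets (measure_sum \<mu>\<^sub>0 \<mu>\<^sub>1) = sets borel" using sets by simp
    note lf2 = locally_finite_measure_sumD[OF s01 sets(3) lfm(1)[unfolded \<mu>]]
    note lf1 = locally_finite_measure_sumD[OF sets(1,2) lf2(1)]
    note lfp = locally_finite_pos_neg_part[OF lf1(2)]
    let ?w = "\<lambda>s::real. 1 / (1 + s\<^sup>2) ^ (\<kappa> + 1)"
    have eq: "sets (measure_sum \<mu>\<^sub>0 \<mu>\<^sub>1) = sets \<mu>\<^sub>2" "sets \<mu>\<^sub>0 = sets \<mu>\<^sub>1" using sets by simp_all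
    note i2 = integrable_measure_sumD[OF eq(1) lfm(2)[unfolded \<mu>]]
    note i1 = integrable_measure_sumD[OF eq(2) i2(1)]
    have fin: "(\<integral>\<^sup>+ s. ennreal (1 / (1 + \<bar>s\<bar>) ^ \<beta>) \<partial>pos_part \<mu>\<^sub>1) < \<infinity>" "(\<integral>\<^sup>+ s. ennreal (1 / (1 + \<bar>s\<bar>) ^ \<beta>) \<partial>neg_part \<mu>\<^sub>1) < \<infinity>"
      if "(\<integral>\<^sup>+ s. ennreal (1 / (1 + \<bar>s\<bar>) ^ \<beta>) \<partial>\<mu>\<^sub>1) < \<infinity>"
      using that nn_integral_pos_neg_part[OF sets(2), of "\<lambda>s. ennreal (1 / (1 + \<bar>s\<bar>) ^ \<beta>)"] by auto
    have \<beta>1: "\<beta> \<ge> 1" using n by simp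
    have small: "((\<lambda>t. mass (pos_part \<mu>\<^sub>1) t / mass \<mu>\<^sub>0 t) \<longlongrightarrow> 0) at_top" "((\<lambda>t. mass (neg_part \<mu>\<^sub>1) t / mass \<mu>\<^sub>0 t) \<longlongrightarrow> 0) at_top"
      by (rule eta_limit_imp_negligible[OF lfp(1) lf1(1) rv \<beta>1 _ eta(1)], rule fin(1), assumption)
         (rule eta_limit_imp_negligible[OF lfp(2) lf1(1) rv \<beta>1 _ eta(2)], rule fin(2), assumption)
    have small2: "((\<lambda>t. mass \<mu>\<^sub>2 t / mass \<mu>\<^sub>0 t) \<longlongrightarrow> 0) at_top" by (rule powr_mass_negligible[OF lf1(1) rv g(1,3)])
    have pos0: "\<forall>\<^sub>F t in at_top. mass \<mu>\<^sub>0 t > 0" by (rule regularly_varying_eventually_pos[OF rv])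
    have ratio: "((\<lambda>t. mass \<mu> t / mass \<mu>\<^sub>0 t) \<longlongrightarrow> 1) at_top"
    proof -
      have "((\<lambda>t. 1 + (mass (pos_part \<mu>\<^sub>1) t / mass \<mu>\<^sub>0 t + mass (neg_part \<mu>\<^sub>1) t / mass \<mu>\<^sub>0 t) + mass \<mu>\<^sub>2 t / mass \<mu>\<^sub>0 t) \<longlongrightarrow> 1 + (0 + 0) + 0) at_top"
        by (intro tendsto_intros small small2)
      moreover have "\<forall>\<^sub>F t in at_top. 1 + (mass (pos_part \<mu>\<^sub>1) t / mass \<mu>\<^sub>0 t + mass (neg_part \<mu>\<^sub>1) t / mass \<mu>\<^sub>0 t) + mass \<mu>\<^sub>2 t / mass \<mu>\<^sub>0 t = mass \<mu> t / mass \<mu>\<^sub>0 t"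
        using pos0
      proof eventually_elim
        case (elim t)
        have "mass \<mu> t = mass \<mu>\<^sub>0 t + (mass (pos_part \<mu>\<^sub>1) t + mass (neg_part \<mu>\<^sub>1) t) + mass \<mu>\<^sub>2 t"
          unfolding \<mu> lf2(3) lf1(3) lfp(3) ..
        then show ?case using elim by (simp add: add_divide_distrib)
      qed
      ultimately show ?thesis using Lim_transform_eventually by force
    qed
    have rvm: "regularly_varying (mass \<mu>) (real \<beta>)" by (rule regularly_varying_asymp[OF lfm(1) rv ratio])
    \<comment> \<open>\<beta> is tied to \<kappa> through growth: \<open>n\<close> is the value that
      regular variation of the mass dictates for \<open>kappa_index\<close>.\<close>
    have nk: "n = \<kappa>" using kappa_index_regularly_varying[OF lfm(1) rvm[unfolded n]] assms(3) by simp
    have \<beta>: "\<beta> = 2 * \<kappa> + 1" using n nk by simp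
    show "\<beta> = 2 * \<kappa> + 1" by (rule \<beta>)
    show "mass \<mu> \<sim>[at_top] mass \<mu>\<^sub>0"
      using ratio pos0 by (intro asymp_equivI') auto
    have \<Phi>: "((\<lambda>t. ((LINT s:{-t<..<t}|\<mu>. s * ?w s) - coeff p (2 * \<kappa>)) / sv (mass \<mu>\<^sub>0) \<beta> t) \<longlongrightarrow> \<beta> * (\<eta>\<^sub>p - \<eta>\<^sub>m)) at_top"
      unfolding \<mu> \<beta>
    proof (rule first_moment_asymptotics[OF lf1(1,2) lf2(2) i1 i2(2) sym rv[unfolded \<beta>] g(1)[unfolded \<beta>] g(3,2) _ eta[unfolded \<beta>] small])
      assume "(\<integral>\<^sup>+ t. ennreal (1 / (1 + \<bar>t\<bar>) ^ (2 * \<kappa> + 1)) \<partial>\<mu>\<^sub>1) < \<infinity>"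
      then show "coeff p (2 * \<kappa>) = (\<integral>t. t * ?w t \<partial>measure_sum \<mu>\<^sub>1 \<mu>\<^sub>2)" using d[unfolded \<beta>] by simp
    qed
    \<comment> \<open>The limits in (e) are normalised by \<open>\<mu>\<^sub>0\<close>, the
      rescaling by \<mu>; the asymptotic equality of the masses allows the exchange.\<close>
    have \<Phi>': "((\<lambda>t. ((LINT s:{-t<..<t}|\<mu>. s * ?w s) - coeff p (2 * \<kappa>)) / sv (mass \<mu>) \<beta> t) \<longlongrightarrow> \<beta> * (\<eta>\<^sub>p - \<eta>\<^sub>m)) at_top"
    proof -
      have "((\<lambda>t. ((LINT s:{-t<..<t}|\<mu>. s * ?w s) - coeff p (2 * \<kappa>)) / sv (mass \<mu>\<^sub>0) \<beta> t / (mass \<mu> t / mass \<mu>\<^sub>0 t)) \<longlongrightarrow> \<beta> * (\<eta>\<^sub>p - \<eta>\<^sub>m) / 1) at_top"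
        by (rule tendsto_divide[OF \<Phi> ratio]) simp
      moreover have "\<forall>\<^sub>F t in at_top. ((LINT s:{-t<..<t}|\<mu>. s * ?w s) - coeff p (2 * \<kappa>)) / sv (mass \<mu>\<^sub>0) \<beta> t / (mass \<mu> t / mass \<mu>\<^sub>0 t)
          = ((LINT s:{-t<..<t}|\<mu>. s * ?w s) - coeff p (2 * \<kappa>)) / sv (mass \<mu>) \<beta> t"
        using pos0
      proof eventually_elim
        case (elim t)
        have e: "x / (a / y) / (b / a) = x / (b / y)" if "a \<noteq> 0" for x a b y :: real using that by simp
        show ?case unfolding sv_def by (rule e) (use elim in simp)
      qed
      ultimately show ?thesis using Lim_transform_eventually by force
    qed
    show "rescaling_limit \<beta> q (\<lambda>r. real \<beta> * (mass \<mu> r / r)) ((-1) ^ \<kappa> * (complex_of_real (pi / 2) + \<i> * complex_of_real (\<eta>\<^sub>p - \<eta>\<^sub>m)))"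
      unfolding rescaling_limit_def assms(6)
    proof (rule locally_uniform_limit_sequentially[OF continuous_on_rescaling_target])
      fix X :: "nat \<Rightarrow> real" and Z z \<delta> R
      assume *: "filterlim X at_top sequentially" "\<And>n. X n > 0" "\<delta> > 0" "R \<ge> 0" "\<And>n. Im (Z n) \<ge> \<delta>" "\<And>n. norm (Z n) \<le> R" "Z \<longlonglongrightarrow> z" "Im z > 0"
      show "(\<lambda>n. C_transform \<kappa> \<mu> p (complex_of_real (X n) * Z n) / complex_of_real (real \<beta> * (mass \<mu> (X n) / X n)))
         \<longlonglongrightarrow> \<i> * ((-1) ^ \<kappa> * (complex_of_real (pi / 2) + \<i> * complex_of_real (\<eta>\<^sub>p - \<eta>\<^sub>m))) * (z / \<i>) ^ (\<beta> - 1)"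
        using \<Phi>' rvm unfolding \<beta>
        by (intro abelian_rescaling[OF lfm _ deg assms(5) _ *]) auto
    qed
  }
  {
    assume "\<exists>f \<alpha> \<omega>. regularly_varying f \<alpha> \<and> Re \<omega> \<noteq> 0 \<and> rescaling_limit \<beta> q f \<omega>"
    then obtain f \<alpha> \<omega> where f: "regularly_varying f \<alpha>" and \<omega>: "Re \<omega> \<noteq> 0" and lim: "rescaling_limit \<beta> q f \<omega>" by blast
    have fpos: "\<forall>\<^sub>F r in at_top. f r > 0" by (rule regularly_varying_eventually_pos[OF f])
    \<comment> \<open>Restriction to z = i sqrt v, where \<open>(z / i) ^ (\<beta> - 1)\<close> is
      \<open>sqrt v ^ (2 * n)\<close>.\<close>
    have lim': "((\<lambda>r. C_transform \<kappa> \<mu> p (\<i> * of_real (r * sqrt v)) / of_real (f r)) \<longlongrightarrow> \<i> * \<omega> * of_real (sqrt v) ^ (2 * n)) at_top" if "v > 0" for v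
      using rescaling_limit_pointwise[OF lim, of "\<i> * of_real (sqrt v)"] that unfolding assms(6) n by (simp add: mult_ac)
    define C where "C = (-1) ^ n * Re \<omega> / pi"
    note T = tauberian_rescaling[OF locally_finiteD(1)[OF lfm(1)] lfm(2) deg fpos \<omega> lim', folded C_def]
    let ?N = "\<lambda>r. mass \<mu> r / (r * f r)"
    define L where "L = 2 * C / \<beta>"
    have C: "C > 0" by (rule T(1))
    have L: "L > 0" using C n by (simp add: L_def)
    \<comment> \<open>A power law in the dilation: in ratios the unknown scale
      \<open>r * f r\<close> cancels, and regular variation of the mass follows.\<close>
    have M: "((\<lambda>r. mass \<mu> (\<delta> * r) / (r * f r)) \<longlongrightarrow> L * \<delta> ^ \<beta>) at_top" if "\<delta> > 0" for \<delta>
      using T(2)[of \<delta>] that by (simp add: L_def n)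
    have M1: "(?N \<longlongrightarrow> L) at_top" using M[of 1] by simp
    have rf: "\<forall>\<^sub>F r in at_top. r > 0 \<and> f r > 0" using fpos eventually_gt_at_top[of 0] by eventually_elim auto
    have "\<forall>\<^sub>F r in at_top. ?N r > 0" using M1 L by (rule order_tendstoD)
    then have mpos: "\<forall>\<^sub>F r in at_top. mass \<mu> r > 0" using rf by eventually_elim (auto simp: zero_less_divide_iff zero_less_mult_iff)
    show rvm: "regularly_varying (mass \<mu>) (real \<beta>)"
      unfolding regularly_varying_def
    proof (intro conjI allI impI)
      note measurable_mass[OF lfm(1), measurable]
      obtain x where x: "\<And>r. r \<ge> x \<Longrightarrow> mass \<mu> r > 0" using mpos by (auto simp: eventually_at_top_linorder)
      then show "\<exists>x\<^sub>0>0. mass \<mu> \<in> borel_measurable (restrict_space borel {x\<^sub>0..}) \<and> (\<forall>r\<ge>x\<^sub>0. mass \<mu> r > 0)"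
        by (intro exI[of _ "max 1 x"]) (auto intro!: measurable_restrict_space1)
      fix c :: real assume c: "c > 0"
      have "((\<lambda>r. mass \<mu> (c * r) / (r * f r) / ?N r) \<longlongrightarrow> L * c ^ \<beta> / L) at_top" using L by (intro tendsto_divide M c M1) auto
      moreover have "\<forall>\<^sub>F r in at_top. mass \<mu> (c * r) / (r * f r) / ?N r = mass \<mu> (c * r) / mass \<mu> r"
        using rf by eventually_elim auto
      ultimately have "((\<lambda>r. mass \<mu> (c * r) / mass \<mu> r) \<longlongrightarrow> L * c ^ \<beta> / L) at_top"
        by (rule Lim_transform_eventually)
      then show "((\<lambda>r. mass \<mu> (c * r) / mass \<mu> r) \<longlongrightarrow> c powr real \<beta>) at_top"
        using L c by (simp add: powr_realpow)
    qed
    have nk: "n = \<kappa>" using kappa_index_regularly_varying[OF lfm(1) rvm[unfolded n]] assms(3) by simp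
    show "((\<lambda>t. measure \<mu> {-t<..<0} / measure \<mu> {0..<t}) \<longlongrightarrow> 1) at_top"
    proof -
      let ?a = "\<lambda>t. measure \<mu> {-t<..<0} / (t * f t)" and ?b = "\<lambda>t. measure \<mu> {0..<t} / (t * f t)"
      note lD = locally_finiteD[OF lfm(1)]
      have sum: "mass \<mu> t = measure \<mu> {-t<..<0} + measure \<mu> {0..<t}" if "t > 0" for t
      proof -
        have s: "{-t<..<t} = {-t<..<0} \<union> {0..<t}" using that by auto
        have f: "emeasure \<mu> A \<noteq> \<infinity>" if "A \<subseteq> {-t<..<t}" for A
          using lD(2)[of t] emeasure_mono[OF that, of \<mu>] lD(1) by (auto simp: top_unique less_top[symmetric])
        have f1: "emeasure \<mu> {-t<..<0} \<noteq> \<infinity>" "emeasure \<mu> {0..<t} \<noteq> \<infinity>"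
          by (rule f; use that in auto)+
        show ?thesis unfolding s by (rule measure_Union) (use f1 lD(1) in auto)
      qed
      \<comment> \<open>Sum and difference of the two normalised sides converge to \<open>L\<close>
        and 0, hence each side to \<open>L / 2\<close>.\<close>
      have D: "((\<lambda>t. ?b t - ?a t) \<longlongrightarrow> 0) at_top" using T(3) by (simp add: diff_divide_distrib)
      have "\<forall>\<^sub>F t in at_top. ?N t = ?a t + ?b t" using rf by eventually_elim (simp add: sum add_divide_distrib)
      then have S: "((\<lambda>t. ?a t + ?b t) \<longlongrightarrow> L) at_top" using M1 by (simp add: tendsto_cong)
      have A: "((\<lambda>t. ((?a t + ?b t) - (?b t - ?a t)) / 2) \<longlongrightarrow> (L - 0) / 2) at_top" by (intro tendsto_intros S D) auto
      have B: "((\<lambda>t. ((?a t + ?b t) + (?b t - ?a t)) / 2) \<longlongrightarrow> (L + 0) / 2) at_top" by (intro tendsto_intros S D) auto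
      have AB: "(?a \<longlongrightarrow> L / 2) at_top" "(?b \<longlongrightarrow> L / 2) at_top" using A B by simp_all
      have "((\<lambda>t. ?a t / ?b t) \<longlongrightarrow> (L / 2) / (L / 2)) at_top" by (rule tendsto_divide[OF AB]) (use L in simp)
      moreover have "\<forall>\<^sub>F t in at_top. ?a t / ?b t = measure \<mu> {-t<..<0} / measure \<mu> {0..<t}" using rf by eventually_elim auto
      ultimately have "((\<lambda>t. measure \<mu> {-t<..<0} / measure \<mu> {0..<t}) \<longlongrightarrow> (L / 2) / (L / 2)) at_top"
        by (rule Lim_transform_eventually)
      then show ?thesis using L by simp
    qed
    \<comment> \<open>The canonical scale is asymptotically a positive multiple of \<open>f\<close>,
      so passing to it multiplies \<omega> by a real constant only.\<close>
    have sc: "((\<lambda>r. f r / (real \<beta> * (mass \<mu> r / r))) \<longlongrightarrow> 1 / (real \<beta> * L)) at_top"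
    proof -
      have "((\<lambda>r. 1 / (real \<beta> * ?N r)) \<longlongrightarrow> 1 / (real \<beta> * L)) at_top" by (rule tendsto_divide[OF tendsto_const tendsto_mult[OF tendsto_const M1]]) (use L n in simp)
      moreover have "\<forall>\<^sub>F r in at_top. 1 / (real \<beta> * ?N r) = f r / (real \<beta> * (mass \<mu> r / r))" using rf by eventually_elim auto
      ultimately show ?thesis using Lim_transform_eventually by force
    qed
    note R = rescaling_limit_change_scale[OF lim fpos sc]
    show "\<exists>\<omega>. rescaling_limit \<beta> q (\<lambda>r. real \<beta> * (mass \<mu> r / r)) \<omega>" using R by blast
    fix \<omega>' assume "rescaling_limit \<beta> q (\<lambda>r. real \<beta> * (mass \<mu> r / r)) \<omega>'"
    then have "\<omega>' = of_real (1 / (real \<beta> * L)) * \<omega>" using rescaling_limit_unique R by blast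
    moreover have "real \<beta> * L = 2 * C" using n by (simp add: L_def)
    ultimately have "Re \<omega>' = Re \<omega> / (2 * C)" by simp
    \<comment> \<open>\<open>C\<close> is \<open>Re \<omega>\<close> times
      \<open>(-1) ^ n / pi\<close>, so \<open>Re \<omega>\<close> cancels and a universal constant
      remains.\<close>
    also have "\<dots> = (-1) ^ \<kappa> * (pi / 2)" using \<omega> unfolding C_def nk by (cases "even \<kappa>") auto
    finally show "Re \<omega>' = (-1) ^ \<kappa> * (pi / 2)" .
  }
qed

end
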